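(* Let $\gamma_1,\gamma_2$ be real parameters. For any given $a\in\mathbb{R}^d$ and $T\ge 0$, let $\bar S_T$ be the estimator $$\bar S_T=a^\top\Big(\Phi^\top(0;T)m_0+\Psi^\top(0;T)(\bar X_0-m_0)+\int_0^T\Phi^\top(t;T)\mathsf{K}_t\,dZ_t+\gamma_1\int_0^T\Psi^\top(t;T)\,d\bar B_t+\gamma_2\int_0^T\Psi^\top(t;T)\mathsf{K}_t\,d\bar W_t\Big),$$ with $\bar X_0\sim\mathcal{N}(m_0,\Sigma_0)$. Then $\bar S_T=a^\top\bar X_T$, where $\bar X_T$ is the strong solution (at time $T$) of the following mean-field stochastic differential equation: $$d\bar X_t=A_t\bar X_t\,dt+\gamma_1\,d\bar B_t+\frac{1-\gamma_1^2}{2}Q_t\Sigma_t^{-1}(\bar X_t-\bar m_t)\,dt+\mathsf{K}_t\Big(dZ_t-C_t\Big(\frac{(1+\gamma_2^2)\bar X_t+(1-\gamma_2^2)\bar m_t}{2}\Big)dt+\gamma_2\,d\bar W_t\Big),$$ where $\bar m_t=\mathsf{E}[\bar X_t|\mathcal{Z}_t]$ and the initial condition $\bar X_0\sim\mathcal{N}(m_0,\Sigma_0)$.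
   Context: Model: the hidden state $X_t\in\mathbb{R}^d$ and the observation $Z_t\in\mathbb{R}^m$ satisfy $dX_t=A_tX_t\,dt+dB_t$, $X_0\sim\mathcal{N}(m_0,\Sigma_0)$, and $dZ_t=C_tX_t\,dt+dW_t$. $A_t$ and $C_t$ are matrices of appropriate dimension ($d\times d$ and $m\times d$) whose elements are continuous in $t$. $\{B_t\}$ and $\{W_t\}$ are Wiener processes taking values in $\mathbb{R}^d$ and $\mathbb{R}^m$, with associated covariances $Q_t$ and $R_t$ respectively. The covariance matrices $Q_t$, $R_t$ and $\Sigma_0$ are strictly positive definite for all $t$; $m_0\in\mathbb{R}^d$. The noise processes $\{B_t\}$, $\{W_t\}$ and the initial conditions $X_0$, $\bar X_0$ are all mutually independent. $\{\bar B_t\}$ and $\{\bar W_t\}$ are independent copies of the process noise $\{B_t\}$ (with covariance $Q_t$) and the measurement noise $\{W_t\}$ (with covariance $R_t$), respectively; they are also independent of $\{B_t\}$, $\{W_t\}$, $X_0$, $\bar X_0$. $\mathcal{Z}_t:=\sigma(Z_s;s\in[0,t])$ is the filtration generated by the observations. Notation: $\Sigma_t$ is the solution of the dynamic Riccati equation $$\frac{d\Sigma_t}{dt}=A_t\Sigma_t+\Sigma_tA_t^\top+Q_t-\Sigma_tC_t^\top R_t^{-1}C_t\Sigma_t$$ with initial condition $\Sigma_0$, and $\mathsf{K}_t:=\Sigma_tC_t^\top R_t^{-1}$ is the Kalman gain. The state transition matrices $\Phi(t;\tau)$ and $\Psi(t;\tau)$ are defined by $$\frac{d\Phi}{dt}(t;\tau)=\big(-A_t^\top+C_t^\top\mathsf{K}_t^\top\big)\Phi(t;\tau),$$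 $$\frac{d\Psi}{dt}(t;\tau)=\Big(-A_t^\top+\frac{1+\gamma_2^2}{2}C_t^\top\mathsf{K}_t^\top-\frac{1-\gamma_1^2}{2}\Sigma_t^{-1}Q_t\Big)\Psi(t;\tau),$$ with $\Phi(\tau;\tau)=\Psi(\tau;\tau)=I$, the identity matrix. $\Phi^\top(t;\tau)$ and $\Psi^\top(t;\tau)$ denote the transposes of $\Phi(t;\tau)$ and $\Psi(t;\tau)$. *)

theory Defs
  imports "HOL-Probability.Probability"
begin

definition pos_def :: "real^'n^'n \<Rightarrow> bool" where
  "pos_def S \<longleftrightarrow> transpose S = S \<and> (\<forall>x. x \<noteq> 0 \<longrightarrow> 0 < x \<bullet> (S *v x))"

text \<open>Multivariate normal law: every linear functional is univariate normal, where a normal law of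
  variance zero is a point mass (needed for increments over an interval of length zero).\<close>

definition gaussian ::
    "'w measure \<Rightarrow> ('w \<Rightarrow> real^'n) \<Rightarrow> real^'n \<Rightarrow> real^'n^'n \<Rightarrow> bool" where
  "gaussian M X m S \<longleftrightarrow>
     X \<in> borel_measurable M \<and>
     (\<forall>a. 0 \<le> a \<bullet> (S *v a) \<and>
        (if a \<bullet> (S *v a) = 0 then AE \<omega> in M. a \<bullet> X \<omega> = a \<bullet> m
         else distributed M lborel (\<lambda>\<omega>. a \<bullet> X \<omega>)
                (normal_density (a \<bullet> m) (sqrt (a \<bullet> (S *v a))))))"

definition generated_sigma ::
    "'w measure \<Rightarrow> 'i set \<Rightarrow> ('i \<Rightarrow> 'w \<Rightarrow> real^'n) \<Rightarrow> 'w measure" where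
  "generated_sigma M I Y =
     sigma (space M) {Y i -` U \<inter> space M | i U. i \<in> I \<and> U \<in> sets borel}"

text \<open>Wiener process with time-varying covariance (intensity) \<open>Q\<close>, started at zero.  Local integrability
  of \<open>Q\<close> is part of the notion: the increment over \<open>[s, t]\<close> has covariance \<open>\<integral>\<^sub>s\<^sup>t Q\<^sub>u du\<close>.\<close>

definition wiener_process ::
    "'w measure \<Rightarrow> (real \<Rightarrow> real^'n^'n) \<Rightarrow> (real \<Rightarrow> 'w \<Rightarrow> real^'n) \<Rightarrow> bool" where
  "wiener_process M Q B \<longleftrightarrow>
     (\<forall>t\<ge>0. B t \<in> borel_measurable M) \<and>
     (AE \<omega> in M. B 0 \<omega> = 0) \<and>
     (AE \<omega> in M. continuous_on {0..} (\<lambda>t. B t \<omega>)) \<and>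
     (\<forall>t\<ge>0. set_integrable lborel {0..t} Q) \<and>
     (\<forall>s t. 0 \<le> s \<longrightarrow> s \<le> t \<longrightarrow>
        gaussian M (\<lambda>\<omega>. B t \<omega> - B s \<omega>) 0 (LINT u:{s..t}|lborel. Q u) \<and>
        prob_space.indep_set M
          (sets (generated_sigma M {0..s} B))
          (sets (generated_sigma M {()} (\<lambda>_ \<omega>. B t \<omega> - B s \<omega>))))"

text \<open>Stochastic integral of a deterministic integrand.  A list of triples \<open>(c, a, b)\<close> encodes the step
  function \<open>\<Sum> c 1\<^bsub>(a,b]\<^esub>\<close>, whose integral is \<open>\<Sum> c (W\<^sub>b - W\<^sub>a)\<close>; the general integral is the
  mean-square limit of these along step functions converging to the integrand in the
  seminorm \<open>\<integral> tr (f R f\<^sup>T)\<close> of the Ito isometry.\<close>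

definition step_function ::
    "((real^'m^'k) \<times> real \<times> real) list \<Rightarrow> real \<Rightarrow> real^'m^'k" where
  "step_function g s = (\<Sum>(c, a, b)\<leftarrow>g. indicat_real {a<..b} s *\<^sub>R c)"

definition step_integral ::
    "(real \<Rightarrow> 'w \<Rightarrow> real^'m) \<Rightarrow> ((real^'m^'k) \<times> real \<times> real) list \<Rightarrow> 'w \<Rightarrow> real^'k" where
  "step_integral W g \<omega> = (\<Sum>(c, a, b)\<leftarrow>g. c *v (W b \<omega> - W a \<omega>))"

definition has_wiener_integral ::
    "'w measure \<Rightarrow> (real \<Rightarrow> real^'m^'m) \<Rightarrow> (real \<Rightarrow> 'w \<Rightarrow> real^'m) \<Rightarrow> real \<Rightarrow>
     (real \<Rightarrow> real^'m^'k) \<Rightarrow> ('w \<Rightarrow> real^'k) \<Rightarrow> bool" where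
  "has_wiener_integral M R W T f J \<longleftrightarrow>
     set_borel_measurable borel {0..T} f \<and>
     J \<in> borel_measurable M \<and>
     (\<exists>g :: nat \<Rightarrow> ((real^'m^'k) \<times> real \<times> real) list.
        (\<forall>n. \<forall>(c, a, b)\<in>set (g n). 0 \<le> a \<and> a \<le> b \<and> b \<le> T) \<and>
        ((\<lambda>n. \<integral>\<^sup>+s\<in>{0..T}. ennreal (trace ((step_function (g n) s - f s) ** R s **
                 transpose (step_function (g n) s - f s))) \<partial>lborel) \<longlonglongrightarrow> 0) \<and>
        ((\<lambda>n. \<integral>\<^sup>+\<omega>. ennreal ((norm (step_integral W (g n) \<omega> - J \<omega>))\<^sup>2) \<partial>M) \<longlonglongrightarrow> 0))"

text \<open>A version of \<open>\<integral>\<^sub>0\<^sup>T f\<^sub>t dW\<^sub>t\<close>, determined only up to null sets for each \<open>T\<close>; it is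
  unspecified if the integral does not exist.\<close>

definition wiener_integral ::
    "'w measure \<Rightarrow> (real \<Rightarrow> real^'m^'m) \<Rightarrow> (real \<Rightarrow> 'w \<Rightarrow> real^'m) \<Rightarrow> real \<Rightarrow>
     (real \<Rightarrow> real^'m^'k) \<Rightarrow> 'w \<Rightarrow> real^'k" where
  "wiener_integral M R W T f = (SOME J. has_wiener_integral M R W T f J)"

text \<open>\<open>\<integral>\<^sub>0\<^sup>T f\<^sub>t dY\<^sub>t\<close> for the Ito process \<open>dY\<^sub>t = u\<^sub>t dt + dW\<^sub>t\<close>.\<close>

definition ito_process_integral ::
    "'w measure \<Rightarrow> (real \<Rightarrow> real^'m^'m) \<Rightarrow> (real \<Rightarrow> 'w \<Rightarrow> real^'m) \<Rightarrow> (real \<Rightarrow> 'w \<Rightarrow> real^'m) \<Rightarrow>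
     real \<Rightarrow> (real \<Rightarrow> real^'m^'k) \<Rightarrow> 'w \<Rightarrow> real^'k" where
  "ito_process_integral M R u W T f \<omega> =
     (LINT t:{0..T}|lborel. f t *v u t \<omega>) + wiener_integral M R W T f \<omega>"

definition vector_cond_exp ::
    "'w measure \<Rightarrow> 'w measure \<Rightarrow> ('w \<Rightarrow> real^'n) \<Rightarrow> 'w \<Rightarrow> real^'n" where
  "vector_cond_exp M F X \<omega> = (\<chi> i. real_cond_exp M F (\<lambda>\<omega>. X \<omega> $ i) \<omega>)"

definition kalman_gain ::
    "(real \<Rightarrow> real^'d^'m) \<Rightarrow> (real \<Rightarrow> real^'m^'m) \<Rightarrow> (real \<Rightarrow> real^'d^'d) \<Rightarrow> real \<Rightarrow> real^'m^'d" where
  "kalman_gain C R S t = S t ** transpose (C t) ** matrix_inv (R t)"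

text \<open>The filtration of the data driving the mean-field equation (initial condition, observations
  and the two copies of the noise), augmented by the null sets.\<close>

definition driving_sigma ::
    "'w measure \<Rightarrow> ('w \<Rightarrow> real^'d) \<Rightarrow> (real \<Rightarrow> 'w \<Rightarrow> real^'m) \<Rightarrow> (real \<Rightarrow> 'w \<Rightarrow> real^'d) \<Rightarrow>
     (real \<Rightarrow> 'w \<Rightarrow> real^'m) \<Rightarrow> real \<Rightarrow> 'w measure" where
  "driving_sigma M Xb0 Z Bb Wb t =
     sigma (space M)
       (sets (generated_sigma M {()} (\<lambda>_. Xb0)) \<union> sets (generated_sigma M {0..t} Z) \<union>
        sets (generated_sigma M {0..t} Bb) \<union> sets (generated_sigma M {0..t} Wb) \<union> null_sets M)"

definition mean_field_drift ::
    "(real \<Rightarrow> real^'d^'d) \<Rightarrow> (real \<Rightarrow> real^'d^'m) \<Rightarrow> (real \<Rightarrow> real^'d^'d) \<Rightarrow> (real \<Rightarrow> real^'m^'m) \<Rightarrow>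
     (real \<Rightarrow> real^'d^'d) \<Rightarrow> real \<Rightarrow> real \<Rightarrow> real \<Rightarrow> real^'d \<Rightarrow> real^'d \<Rightarrow> real^'d" where
  "mean_field_drift A C Q R S \<gamma>1 \<gamma>2 t x m =
     A t *v x
     + ((1 - \<gamma>1\<^sup>2) / 2) *\<^sub>R ((Q t ** matrix_inv (S t)) *v (x - m))
     - kalman_gain C R S t *v
         (C t *v ((1 / 2) *\<^sub>R ((1 + \<gamma>2\<^sup>2) *\<^sub>R x + (1 - \<gamma>2\<^sup>2) *\<^sub>R m)))"

text \<open>Strong solution of the mean-field equation, with \<open>dZ\<^sub>t = C\<^sub>t X\<^sub>t dt + dW\<^sub>t\<close>.
  The mean \<open>mb\<close> is a jointly measurable version of \<open>t \<mapsto> E[Xb\<^sub>t | \<Z>\<^sub>t]\<close>: choosing a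
  version separately at each time would leave its time integral undetermined.  The integral
  equation is required almost surely at each time because \<^const>\<open>wiener_integral\<close> is only
  determined up to a null set for each time; the paths of \<open>Xb\<close> are continuous.\<close>

definition mean_field_strong_solution ::
    "'w measure \<Rightarrow> (real \<Rightarrow> real^'d^'d) \<Rightarrow> (real \<Rightarrow> real^'d^'m) \<Rightarrow>
     (real \<Rightarrow> real^'d^'d) \<Rightarrow> (real \<Rightarrow> real^'m^'m) \<Rightarrow> (real \<Rightarrow> real^'d^'d) \<Rightarrow> real \<Rightarrow> real \<Rightarrow>
     (real \<Rightarrow> 'w \<Rightarrow> real^'d) \<Rightarrow> (real \<Rightarrow> 'w \<Rightarrow> real^'m) \<Rightarrow> (real \<Rightarrow> 'w \<Rightarrow> real^'m) \<Rightarrow>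
     ('w \<Rightarrow> real^'d) \<Rightarrow> (real \<Rightarrow> 'w \<Rightarrow> real^'d) \<Rightarrow> (real \<Rightarrow> 'w \<Rightarrow> real^'m) \<Rightarrow>
     (real \<Rightarrow> 'w \<Rightarrow> real^'d) \<Rightarrow> bool" where
  "mean_field_strong_solution M A C Q R S \<gamma>1 \<gamma>2 X W Z Xb0 Bb Wb Xb \<longleftrightarrow>
     (\<forall>t\<ge>0. Xb t \<in> borel_measurable (driving_sigma M Xb0 Z Bb Wb t)) \<and>
     (\<forall>t\<ge>0. integrable M (Xb t)) \<and>
     (AE \<omega> in M. continuous_on {0..} (\<lambda>t. Xb t \<omega>)) \<and>
     (AE \<omega> in M. Xb 0 \<omega> = Xb0 \<omega>) \<and>
     (\<exists>mb :: real \<Rightarrow> 'w \<Rightarrow> real^'d.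
        (\<lambda>(t, \<omega>). mb t \<omega>) \<in> borel_measurable (restrict_space borel {0..} \<Otimes>\<^sub>M M) \<and>
        (\<forall>t\<ge>0. AE \<omega> in M. mb t \<omega> = vector_cond_exp M (generated_sigma M {0..t} Z) (Xb t) \<omega>) \<and>
        (AE \<omega> in M. \<forall>t\<ge>0. set_integrable lborel {0..t}
           (\<lambda>s. mean_field_drift A C Q R S \<gamma>1 \<gamma>2 s (Xb s \<omega>) (mb s \<omega>))) \<and>
        (\<forall>t\<ge>0. AE \<omega> in M.
           Xb t \<omega> = Xb0 \<omega>
             + (LINT s:{0..t}|lborel. mean_field_drift A C Q R S \<gamma>1 \<gamma>2 s (Xb s \<omega>) (mb s \<omega>))
             + \<gamma>1 *\<^sub>R Bb t \<omega>
             + ito_process_integral M R (\<lambda>s \<omega>. C s *v X s \<omega>) W t (kalman_gain C R S) \<omega>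
             + \<gamma>2 *\<^sub>R wiener_integral M R Wb t (kalman_gain C R S) \<omega>))"

end

theory Submission
  imports Defs
begin

text \<open>The mean-field equation is linear, and splitting its solution into conditional mean and deviation
decouples it.  With \<open>L = A - K C\<close> and \<open>F = A + (1 - \<gamma>\<^sub>1\<^sup>2)/2 Q \<Sigma>\<^sup>-\<^sup>1 - (1 + \<gamma>\<^sub>2\<^sup>2)/2 K C\<close> the drift
at the state \<open>x\<close> and the mean \<open>m\<close> is \<open>L m + F (x - m)\<close> (lemma \<open>drift_eq\<close>).  So the mean has to follow
the Kalman filter \<open>dm = L m dt + K dZ\<close> and the deviation \<open>\<xi>\<close> the autonomous equation
\<open>d\<xi> = F \<xi> dt + \<gamma>\<^sub>1 dBb + \<gamma>\<^sub>2 K dWb\<close>.  The matrices \<open>U\<^sub>t = \<Phi>(0; t)\<^sup>T\<close> and \<open>V\<^sub>t = \<Psi>(0; t)\<^sup>T\<close> are fundamental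
solutions of \<open>U' = L U\<close> and \<open>V' = F V\<close>, and \<open>\<Phi>(t; T)\<^sup>T = U\<^sub>T U\<^sub>t\<^sup>-\<^sup>1\<close>, \<open>\<Psi>(t; T)\<^sup>T = V\<^sub>T V\<^sub>t\<^sup>-\<^sup>1\<close>.  Therefore the
estimator is the sum of two variation of constants formulas, one for \<open>m\<close> and one for \<open>\<xi>\<close>.

The candidate solution is \<open>Xs = m + \<xi>\<close> with
\<open>m\<^sub>t = U\<^sub>t (m\<^sub>0 + \<integral>\<^sub>0\<^sup>t U\<^sup>-\<^sup>1 K dZ)\<close> and \<open>\<xi>\<^sub>t = V\<^sub>t (Xb\<^sub>0 - m\<^sub>0 + \<gamma>\<^sub>1 \<integral>\<^sub>0\<^sup>t V\<^sup>-\<^sup>1 dBb + \<gamma>\<^sub>2 \<integral>\<^sub>0\<^sup>t V\<^sup>-\<^sup>1 K dWb)\<close>, for versions of the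
integrals with continuous paths (\<open>wiener_integral_process\<close>).  Integration by parts
(\<open>wiener_integral_by_parts\<close>) turns these formulas into the integral equation (\<open>Xs_equation\<close>).  The
process \<open>m\<close> is the conditional mean of \<open>Xs\<close>: it is a functional of the observations, because the
integral against \<open>dZ\<close> is a limit of step integrals of \<open>Z\<close> (\<open>Pr_adapted\<close>), while \<open>\<xi>\<close> is built from
sources of mean zero that are independent of the observations (\<open>observation_orthogonal\<close>).

For uniqueness, let \<open>e\<close> be the difference of two solutions and \<open>w\<close> the difference of their conditional
means.  All noise cancels, so that \<open>e\<close> solves \<open>e' = L w + F (e - w)\<close> path by path, and variation of
constants gives \<open>e\<^sub>t = V\<^sub>t \<integral>\<^sub>0\<^sup>t V\<^sup>-\<^sup>1 (L - F) w ds\<close>.  The right-hand side is measurable with respect to the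
observations up to time \<open>t\<close> (\<open>time_integral_adapted\<close>); hence \<open>w\<^sub>t = E[e\<^sub>t | \<Z>\<^sub>t] = e\<^sub>t\<close>, the equation becomes
\<open>e' = L e\<close> with \<open>e\<^sub>0 = 0\<close>, and \<open>e\<close> vanishes (\<open>solution_unique\<close>).  Since a solution
is only required to be integrable at each fixed time, the measurability of the time integral rests on a
truncation of the integrand and not on moments of its path.

The covariances \<open>Q\<close> and \<open>R\<close> are merely integrable in time, and \<open>R\<^sup>-\<^sup>1\<close> may be unbounded,
so integrability of \<open>H = C\<^sup>T R\<^sup>-\<^sup>1 C\<close>, of \<open>K C = \<Sigma> H\<close> and of the kernel \<open>K\<close> has to be extracted from the
Riccati equation itself: \<open>\<Sigma>\<close> stays positive (\<open>Sig_positive\<close>), and \<open>H\<close> is the derivative of \<open>\<Sigma>\<^sup>-\<^sup>1\<close> plus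
integrable terms (\<open>H_integrable\<close>).  Ordinary differential equations are used in integrated form
throughout, with an estimate of Gronwall type for integrable coefficients (\<open>gronwall_zero\<close>).\<close>

section \<open>Matrices\<close>

lemma bounded_bilinear_matmul:
  "bounded_bilinear ((**) :: real^'n^'m \<Rightarrow> real^'p^'n \<Rightarrow> real^'p^'m)"
  unfolding bilinear_conv_bounded_bilinear [symmetric] bilinear_def linear_iff vec_eq_iff
  by (simp add: matrix_matrix_mult_def sum.distrib ring_distribs sum_distrib_left mult.assoc mult.left_commute)

lemma bounded_bilinear_matvec:
  "bounded_bilinear ((*v) :: real^'n^'m \<Rightarrow> real^'n \<Rightarrow> real^'m)"
  unfolding bilinear_conv_bounded_bilinear [symmetric] bilinear_def linear_iff vec_eq_iff
  by (simp add: matrix_vector_mult_def sum.distrib ring_distribs sum_distrib_left mult.assoc mult.left_commute)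

lemma bounded_linear_transpose: "bounded_linear (transpose :: real^'n^'m \<Rightarrow> real^'m^'n)"
  unfolding linear_conv_bounded_linear [symmetric] linear_iff
  by (simp add: transpose_def vec_eq_iff)

lemmas continuous_on_matmul [continuous_intros] =
  bounded_bilinear.continuous_on [OF bounded_bilinear_matmul]
lemmas continuous_on_matvec [continuous_intros] =
  bounded_bilinear.continuous_on [OF bounded_bilinear_matvec]
lemmas continuous_on_transpose [continuous_intros] =
  bounded_linear.continuous_on [OF bounded_linear_transpose]
lemmas tendsto_matmul [tendsto_intros] =
  bounded_bilinear.tendsto [OF bounded_bilinear_matmul]

lemma borel_measurable_bilinear:
  fixes h :: "'a::euclidean_space \<Rightarrow> 'b::euclidean_space \<Rightarrow> 'c::euclidean_space"
  assumes "bounded_bilinear h" "f \<in> borel_measurable N" "g \<in> borel_measurable N"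
  shows "(\<lambda>x. h (f x) (g x)) \<in> borel_measurable N"
  by (rule borel_measurable_continuous_Pair [OF assms(2,3)])
    (intro bounded_bilinear.continuous_on [OF assms(1)] continuous_intros)

lemmas borel_measurable_matmul [measurable (raw)] = borel_measurable_bilinear [OF bounded_bilinear_matmul]
lemmas borel_measurable_matvec [measurable (raw)] = borel_measurable_bilinear [OF bounded_bilinear_matvec]

lemma borel_measurable_transpose [measurable (raw)]:
  "f \<in> borel_measurable N \<Longrightarrow> (\<lambda>x. transpose (f x :: real^'n^'m)) \<in> borel_measurable N"
  by (rule measurable_compose [OF _ borel_measurable_continuous_onI])
    (auto intro: continuous_on_transpose continuous_on_id)

lemma norm_matmul_le: "norm (A ** B) \<le> norm A * norm (B :: real^'p^'n)" for A :: "real^'n^'m"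
proof -
  have row: "norm ((A ** B) $ i) \<le> norm (A $ i) * norm B" for i
  proof -
    have "(A ** B) $ i = (\<Sum>k\<in>UNIV. (A $ i $ k) *\<^sub>R (B $ k))"
      by (simp add: matrix_matrix_mult_def vec_eq_iff)
    then have "norm ((A ** B) $ i) \<le> (\<Sum>k\<in>UNIV. \<bar>norm (A $ i $ k)\<bar> * \<bar>norm (B $ k)\<bar>)"
      by (simp add: order_trans [OF norm_sum])
    also have "\<dots> \<le> norm (A $ i) * norm B"
      unfolding norm_vec_def [of "A $ i"] norm_vec_def [of B] by (rule L2_set_mult_ineq)
    finally show ?thesis .
  qed
  have "norm (A ** B) \<le> L2_set (\<lambda>i. norm (A $ i) * norm B) UNIV"
    unfolding norm_vec_def [of "A ** B"] by (rule L2_set_mono) (auto intro: row)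
  also have "\<dots> = norm A * norm B"
    by (simp add: L2_set_left_distrib [symmetric] norm_vec_def [of A])
  finally show ?thesis .
qed

lemma norm_matvec_le: "norm (A *v x) \<le> norm A * norm x" for A :: "real^'n^'m"
proof -
  have row: "norm ((A *v x) $ i) \<le> norm (A $ i) * norm x" for i
    using Cauchy_Schwarz_ineq2 [of "A $ i" x] by (simp add: matrix_vector_mul_component)
  have "norm (A *v x) \<le> L2_set (\<lambda>i. norm (A $ i) * norm x) UNIV"
    unfolding norm_vec_def [of "A *v x"] using row by (intro L2_set_mono) auto
  also have "\<dots> = norm A * norm x"
    by (simp add: L2_set_left_distrib [symmetric] norm_vec_def [of A])
  finally show ?thesis .
qed

lemma norm_transpose [simp]: "norm (transpose A) = norm (A :: real^'n^'m)"
  unfolding norm_eq_sqrt_inner inner_vec_def transpose_def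
  by (simp add: sum.swap [of "\<lambda>i j. A $ i $ j * A $ i $ j"])

lemma inner_matvec_transpose: "(transpose A *v x) \<bullet> y = x \<bullet> (A *v y)" for A :: "real^'n^'m"
  by (simp add: dot_lmul_matrix)

text \<open>Row by row the trace form is a sum of scalar quadratic forms; positivity and the inequalities below
  are inherited from these.\<close>

lemma trace_form: "trace (c ** S ** transpose d) = (\<Sum>k\<in>UNIV. c $ k \<bullet> (S *v (d $ k)))"
  for c :: "real^'n^'m" and d :: "real^'p^'m"
proof -
  have "(c ** S ** transpose d) $ k $ k = c $ k \<bullet> (S *v (d $ k))" for k
  proof -
    have "(c ** S ** transpose d) $ k $ k = (\<Sum>j\<in>UNIV. (\<Sum>i\<in>UNIV. c $ k $ i * S $ i $ j * d $ k $ j))"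
      by (simp add: matrix_matrix_mult_def transpose_def sum_distrib_right)
    also have "\<dots> = (\<Sum>i\<in>UNIV. (\<Sum>j\<in>UNIV. c $ k $ i * S $ i $ j * d $ k $ j))"
      by (rule sum.swap)
    also have "\<dots> = c $ k \<bullet> (S *v (d $ k))"
      by (simp add: inner_vec_def matrix_vector_mult_def sum_distrib_left mult.assoc)
    finally show ?thesis .
  qed
  then show ?thesis by (simp add: trace_def)
qed

lemma trace_form_nonneg:
  fixes c :: "real^'n^'m"
  assumes "\<And>x. 0 \<le> x \<bullet> (S *v x)"
  shows "0 \<le> trace (c ** S ** transpose c)"
  unfolding trace_form using assms by (intro sum_nonneg) auto

lemma trace_form_scaleR: "trace ((r *\<^sub>R c) ** S ** transpose (r *\<^sub>R c)) = r\<^sup>2 * trace (c ** S ** transpose c)"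
  for c :: "real^'n^'m"
  unfolding trace_form
  by (simp add: sum_distrib_left power2_eq_square mult.assoc matrix_vector_mult_scaleR)

lemma trace_form_add_le:
  fixes c d :: "real^'n^'m"
  assumes "\<And>x. 0 \<le> x \<bullet> (S *v x)"
  shows "trace ((c + d) ** S ** transpose (c + d))
    \<le> 2 * trace (c ** S ** transpose c) + 2 * trace (d ** S ** transpose d)"
proof -
  have "trace ((c + d) ** S ** transpose (c + d)) + trace ((c - d) ** S ** transpose (c - d))
      = 2 * trace (c ** S ** transpose c) + 2 * trace (d ** S ** transpose d)"
    unfolding trace_form sum_distrib_left sum.distrib [symmetric]
    by (rule sum.cong) (auto simp: matrix_vector_right_distrib bounded_bilinear.diff_right [OF bounded_bilinear_matvec] inner_simps)
  moreover have "0 \<le> trace ((c - d) ** S ** transpose (c - d))"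
    by (rule trace_form_nonneg [OF assms])
  ultimately show ?thesis by linarith
qed

lemma trace_form_le_norm: "trace (c ** S ** transpose c) \<le> (norm c)\<^sup>2 * norm S" for c :: "real^'n^'m"
proof -
  have "trace (c ** S ** transpose c) \<le> (\<Sum>k\<in>UNIV. (norm (c $ k))\<^sup>2 * norm S)"
    unfolding trace_form
  proof (rule sum_mono)
    fix k
    have "c $ k \<bullet> (S *v c $ k) \<le> norm (c $ k) * norm (S *v c $ k)"
      by (rule norm_cauchy_schwarz)
    also have "\<dots> \<le> norm (c $ k) * (norm S * norm (c $ k))"
      by (intro mult_left_mono norm_matvec_le) auto
    finally show "c $ k \<bullet> (S *v c $ k) \<le> (norm (c $ k))\<^sup>2 * norm S"
      by (simp add: power2_eq_square mult_ac)
  qed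
  also have "\<dots> = (norm c)\<^sup>2 * norm S"
    by (simp add: norm_vec_def [of c] L2_set_def sum_nonneg sum_distrib_right)
  finally show ?thesis .
qed

lemma matrix_inv_inverse:
  assumes "invertible A"
  shows "A ** matrix_inv A = mat 1" and "matrix_inv A ** A = mat 1"
  using someI_ex [OF assms [unfolded invertible_def]] unfolding matrix_inv_def by auto

lemma matrix_inv_unique: "B = matrix_inv A" if "A ** B = mat 1" for A :: "real^'n^'n"
proof -
  have inv: "invertible A"
    using that matrix_left_right_inverse invertible_def by blast
  have "matrix_inv A = matrix_inv A ** (A ** B)" by (simp add: that)
  also have "\<dots> = B" by (simp add: matrix_mul_assoc matrix_inv_inverse [OF inv])
  finally show ?thesis by simp
qed

text \<open>A kernel vector \<open>x\<close> would give \<open>x \<bullet> R x = 0\<close>.\<close>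

lemma invertible_if_positive:
  assumes "\<And>x::real^'n. x \<noteq> 0 \<Longrightarrow> 0 < x \<bullet> (R *v x)"
  shows "invertible R"
proof -
  have "\<forall>x. R *v x = 0 \<longrightarrow> x = 0"
    using assms by force
  then obtain B where "B ** R = mat 1"
    using matrix_left_invertible_ker by blast
  then show ?thesis
    unfolding invertible_def using matrix_left_right_inverse by blast
qed

lemma pos_def_imp_invertible: "pos_def R \<Longrightarrow> invertible R"
  by (rule invertible_if_positive) (auto simp: pos_def_def)

lemma pos_def_nonneg: "pos_def R \<Longrightarrow> 0 \<le> x \<bullet> (R *v x)"
  unfolding pos_def_def by (cases "x = 0") (auto intro: less_imp_le)

lemma pos_def_symmetric: "pos_def R \<Longrightarrow> transpose R = R"
  by (simp add: pos_def_def)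

lemma matrix_inv_transpose:
  fixes A :: "real^'n^'n"
  assumes "invertible A" shows "transpose (matrix_inv A) = matrix_inv (transpose A)"
proof (rule matrix_inv_unique)
  show "transpose A ** transpose (matrix_inv A) = mat 1"
    unfolding matrix_transpose_mul [symmetric] matrix_inv_inverse(2) [OF assms] by (rule transpose_mat)
qed

lemma pos_def_matrix_inv:
  assumes "pos_def R" shows "pos_def (matrix_inv R)"
  unfolding pos_def_def
proof (intro conjI allI impI)
  have inv: "invertible R" by (rule pos_def_imp_invertible [OF assms])
  show "transpose (matrix_inv R) = matrix_inv R"
    using assms by (simp add: matrix_inv_transpose [OF inv] pos_def_def)
  fix x :: "real^'a" assume "x \<noteq> 0"
  define y where "y = matrix_inv R *v x"
  have x: "x = R *v y"
    by (simp add: y_def matrix_vector_mul_assoc matrix_inv_inverse [OF inv])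
  then have "y \<noteq> 0" using \<open>x \<noteq> 0\<close> by auto
  then have "0 < y \<bullet> (R *v y)" using assms by (auto simp: pos_def_def)
  then show "0 < x \<bullet> (matrix_inv R *v x)"
    by (fold y_def) (simp add: x inner_commute)
qed

lemma pos_def_Cauchy_Schwarz:
  assumes "pos_def R" shows "(g \<bullet> (R *v w))\<^sup>2 \<le> (g \<bullet> (R *v g)) * (w \<bullet> (R *v w))"
proof (cases "w = 0")
  case False
  define p where "p = w \<bullet> (R *v w)"
  have p: "0 < p" using assms False by (auto simp: pos_def_def p_def)
  have sym: "w \<bullet> (R *v g) = g \<bullet> (R *v w)"
    using inner_matvec_transpose [of R w g] unfolding pos_def_symmetric [OF assms] by (simp only: inner_commute)
  define l where "l = (g \<bullet> (R *v w)) / p"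
  have "0 \<le> (g - l *\<^sub>R w) \<bullet> (R *v (g - l *\<^sub>R w))" by (rule pos_def_nonneg [OF assms])
  also have "\<dots> = g \<bullet> (R *v g) - 2 * l * (g \<bullet> (R *v w)) + l\<^sup>2 * p"
    by (simp add: bounded_bilinear.diff_right [OF bounded_bilinear_matvec] inner_simps matrix_vector_mult_scaleR sym
        power2_eq_square algebra_simps p_def)
  also have "\<dots> = g \<bullet> (R *v g) - (g \<bullet> (R *v w))\<^sup>2 / p"
    using p by (simp add: l_def power2_eq_square field_simps)
  finally show ?thesis
    using p unfolding p_def [symmetric] by (simp add: field_simps)
qed simp

text \<open>The Cauchy--Schwarz inequality pairing the seminorm of the Ito isometry with its dual: it
  controls the drift part of an integral against \<open>dZ\<close> by the same seminorm that controls
  its martingale part, without a lower bound on \<open>R\<close>.\<close>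

lemma norm_matvec_le_trace_form:
  fixes c :: "real^'n^'m"
  assumes "pos_def R"
  shows "(norm (c *v v))\<^sup>2 \<le> trace (c ** R ** transpose c) * (v \<bullet> (matrix_inv R *v v))"
proof -
  have inv: "invertible R" by (rule pos_def_imp_invertible [OF assms])
  define w where "w = matrix_inv R *v v"
  have v: "v = R *v w"
    by (simp add: w_def matrix_vector_mul_assoc matrix_inv_inverse [OF inv])
  have "(norm (c *v v))\<^sup>2 = (\<Sum>k\<in>UNIV. (c $ k \<bullet> v)\<^sup>2)"
    by (simp add: norm_vec_def L2_set_def sum_nonneg matrix_vector_mul_component)
  also have "\<dots> \<le> (\<Sum>k\<in>UNIV. (c $ k \<bullet> (R *v (c $ k))) * (w \<bullet> (R *v w)))"
    unfolding v by (rule sum_mono) (rule pos_def_Cauchy_Schwarz [OF assms])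
  also have "\<dots> = trace (c ** R ** transpose c) * (v \<bullet> w)"
    unfolding trace_form sum_distrib_right v by (simp only: inner_commute)
  finally show ?thesis unfolding w_def .
qed

lemma continuous_on_det: "continuous_on S f \<Longrightarrow> continuous_on S (\<lambda>x. det (f x :: real^'n^'n))"
  unfolding det_def by (intro continuous_intros)

text \<open>Cramer's rule: the entries of the inverse are quotients of polynomials in the entries, which yields
  continuity and measurability of the inverse.\<close>

lemma matrix_inv_component:
  assumes "invertible A"
  shows "matrix_inv A $ k $ j = det (\<chi> i l. if l = k then axis j 1 $ i else A $ i $ l) / det (A :: real^'n^'n)"
proof -
  have "A *v (matrix_inv A *v axis j 1) = axis j 1"
    by (simp add: matrix_vector_mul_assoc matrix_inv_inverse [OF assms])
  then have "matrix_inv A *v axis j 1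
      = (\<chi> k. det (\<chi> i l. if l = k then axis j 1 $ i else A $ i $ l) / det A)"
    using assms by (subst (asm) cramer) (auto simp: invertible_det_nz)
  moreover have "matrix_inv A $ k $ j = (matrix_inv A *v axis j 1) $ k"
    by (simp add: matrix_vector_mult_basis column_def)
  ultimately show ?thesis by simp
qed

lemma continuous_on_matrix_inv:
  assumes "continuous_on S f" "\<And>x. x \<in> S \<Longrightarrow> invertible (f x :: real^'n^'n)"
  shows "continuous_on S (\<lambda>x. matrix_inv (f x))"
proof -
  have entry: "continuous_on S (\<lambda>x. if l = k then axis j 1 $ i else f x $ i $ l)" for k l :: 'n and i j :: 'n
    using assms(1) by (cases "l = k") (auto intro!: continuous_intros)
  have "continuous_on S (\<lambda>x. \<chi> k j. det (\<chi> i l. if l = k then axis j 1 $ i else f x $ i $ l) / det (f x))"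
    using assms
    by (intro continuous_on_vec_lambda continuous_on_divide continuous_on_det entry)
      (auto simp: invertible_det_nz)
  moreover have "matrix_inv (f x) = (\<chi> k j. det (\<chi> i l. if l = k then axis j 1 $ i else f x $ i $ l) / det (f x))"
    if "x \<in> S" for x
    using matrix_inv_component [OF assms(2) [OF that]] by (simp add: vec_eq_iff)
  ultimately show ?thesis by (simp cong: continuous_on_cong)
qed

lemma open_invertible: "open {A :: real^'n^'n. invertible A}"
  unfolding invertible_det_nz
  by (intro open_Collect_neq continuous_on_det continuous_intros)

lemma borel_measurable_matrix_inv [measurable]:
  "(matrix_inv :: real^'n^'n \<Rightarrow> real^'n^'n) \<in> borel_measurable borel"
proof -
  let ?I = "{A :: real^'n^'n. invertible A}"
  (* off the invertible matrices matrix_inv is one fixed, unspecified matrix *)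
  have "matrix_inv A = (SOME B. False)" if "A \<notin> ?I" for A :: "real^'n^'n"
    using that unfolding matrix_inv_def invertible_def by (auto intro: arg_cong [where f = Eps])
  then have "matrix_inv = (\<lambda>A. if A \<in> ?I then matrix_inv A else (SOME B. False) :: real^'n^'n)"
    by auto
  moreover have "(\<lambda>A. if A \<in> ?I then matrix_inv A else (SOME B. False) :: real^'n^'n) \<in> borel_measurable borel"
    by (intro borel_measurable_continuous_on_if continuous_on_matrix_inv continuous_intros borel_open open_invertible) auto
  ultimately show ?thesis by metis
qed

section \<open>Integral equations with integrable coefficients\<close>

lemma set_integrable_imp_integrable_on:
  fixes f :: "real \<Rightarrow> 'a::euclidean_space"
  assumes "set_integrable lborel {a..b} f"
  shows "f integrable_on {a..b}" "(LINT s:{a..b}|lborel. f s) = integral {a..b} f"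
  using set_borel_integral_eq_integral [OF assms] by auto

lemma set_integrable_imp_norm_integrable_on:
  fixes f :: "real \<Rightarrow> 'a::euclidean_space"
  assumes "set_integrable lborel {a..b} f"
  shows "(\<lambda>s. norm (f s)) integrable_on {a..b}"
  using set_integrable_imp_integrable_on(1) [OF set_integrable_norm [OF assms]] .

lemma set_integrable_bilinear:
  fixes h :: "'a::euclidean_space \<Rightarrow> 'b::euclidean_space \<Rightarrow> 'c::euclidean_space"
  assumes h: "bounded_bilinear h" and F: "continuous_on {a..b} F" and g: "set_integrable lborel {a..b} g"
  shows "set_integrable lborel {a..b::real} (\<lambda>s. h (F s) (g s))"
proof -
  interpret h: bounded_bilinear h by fact
  obtain K where K: "\<And>x y. norm (h x y) \<le> norm x * norm y * K" "K > 0"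
    using h.pos_bounded by blast
  have "compact (F ` {a..b})" by (intro compact_continuous_image F compact_Icc)
  then obtain B where B: "\<And>s. s \<in> {a..b} \<Longrightarrow> norm (F s) \<le> B"
    by (meson bounded_iff compact_imp_bounded image_eqI)
  have eq: "indicator {a..b} s *\<^sub>R h (F s) (g s) = h (indicator {a..b} s *\<^sub>R F s) (indicator {a..b} s *\<^sub>R g s)" for s
    by (auto simp: indicator_def h.zero_left)
  have mF: "(\<lambda>s. indicator {a..b} s *\<^sub>R F s) \<in> borel_measurable borel"
    using borel_measurable_continuous_on_indicator [OF _ F] by simp
  have mg: "(\<lambda>s. indicator {a..b} s *\<^sub>R g s) \<in> borel_measurable borel"
    using g unfolding set_integrable_def by (simp add: borel_measurable_integrable)
  show ?thesis
    unfolding set_integrable_def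
  proof (rule Bochner_Integration.integrable_bound)
    show "integrable lborel (\<lambda>s. (B * K) *\<^sub>R (indicator {a..b} s *\<^sub>R g s))"
      using g unfolding set_integrable_def by (rule integrable_scaleR_right)
    show "(\<lambda>s. indicator {a..b} s *\<^sub>R h (F s) (g s)) \<in> borel_measurable lborel"
      unfolding eq using borel_measurable_bilinear [OF h mF mg] by simp
    show "AE s in lborel. norm (indicator {a..b} s *\<^sub>R h (F s) (g s)) \<le> norm ((B * K) *\<^sub>R (indicator {a..b} s *\<^sub>R g s))"
    proof (rule AE_I2)
      fix s
      show "norm (indicator {a..b} s *\<^sub>R h (F s) (g s)) \<le> norm ((B * K) *\<^sub>R (indicator {a..b} s *\<^sub>R g s))"
      proof (cases "s \<in> {a..b}")
        case True
        have "norm (h (F s) (g s)) \<le> norm (F s) * norm (g s) * K" by (rule K)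
        also have "\<dots> \<le> B * norm (g s) * K"
          by (intro mult_right_mono B True) (use K in auto)
        also have "\<dots> \<le> \<bar>B * K\<bar> * norm (g s)"
          by (simp add: mult.assoc mult.commute [of "norm (g s)"]) (simp add: mult.assoc [symmetric] mult_right_mono)
        finally show ?thesis using True by simp
      qed simp
    qed
  qed
qed

lemma set_integrable_bilinear_flip:
  fixes h :: "'a::euclidean_space \<Rightarrow> 'b::euclidean_space \<Rightarrow> 'c::euclidean_space"
  assumes h: "bounded_bilinear h" and F: "continuous_on {a..b} F" and g: "set_integrable lborel {a..b} g"
  shows "set_integrable lborel {a..b::real} (\<lambda>s. h (g s) (F s))"
  using set_integrable_bilinear [OF bounded_bilinear.flip [OF h] F g] .

lemma set_integrable_linear:
  fixes l :: "'a::euclidean_space \<Rightarrow> 'c::euclidean_space"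
  assumes "bounded_linear l" "set_integrable lborel {a..b} g"
  shows "set_integrable lborel {a..b::real} (\<lambda>s. l (g s))"
  using integrable_bounded_linear [OF assms(1) assms(2)[unfolded set_integrable_def]]
  unfolding set_integrable_def by (simp add: linear_cmul [OF bounded_linear.linear [OF assms(1)]])

abbreviation grid :: "real \<Rightarrow> nat \<Rightarrow> nat \<Rightarrow> real" where
  "grid T n i \<equiv> real i * T / real n"

lemma grid_mono: "0 \<le> T \<Longrightarrow> i \<le> j \<Longrightarrow> grid T n i \<le> grid T n j"
  by (intro divide_right_mono mult_right_mono) auto

lemma grid_bounds: "0 \<le> T \<Longrightarrow> i \<le> n \<Longrightarrow> 0 \<le> grid T n i \<and> grid T n i \<le> T"
  using mult_right_mono [of "real i" "real n" T] by (cases "n = 0") (auto simp: divide_le_eq mult.commute)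

lemma grid_cell:
  assumes "0 < T" "0 < n" "0 < s" "s \<le> T"
  obtains i where "i < n" "grid T n i < s" "s \<le> grid T n (Suc i)"
proof -
  define i where "i = nat (\<lceil>s * n / T\<rceil> - 1)"
  have pos: "0 < s * n / T" using assms by auto
  then have c: "1 \<le> \<lceil>s * n / T\<rceil>" by linarith
  have "s * n / T \<le> n" using assms by (simp add: field_simps)
  then have "\<lceil>s * n / T\<rceil> \<le> int n" by (simp add: ceiling_le_iff)
  then have "i < n" using c by (simp add: i_def) linarith
  moreover have i: "real i = real_of_int \<lceil>s * n / T\<rceil> - 1" using c by (simp add: i_def)
  have "real i < s * n / T" unfolding i by linarith
  then have "grid T n i < s" using assms by (simp add: field_simps)
  moreover have "s * n / T \<le> real (Suc i)" unfolding of_nat_Suc i by linarith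
  then have "s \<le> grid T n (Suc i)" using assms by (simp add: field_simps)
  ultimately show ?thesis using that by blast
qed

lemma sum_grid_indicator:
  assumes "0 \<le> T" "i < n" "grid T n i < s" "s \<le> grid T n (Suc i)"
  shows "(\<Sum>j<n. indicat_real {grid T n j<..grid T n (Suc j)} s *\<^sub>R c j) = (c i :: 'a::real_vector)"
proof -
  have "indicat_real {grid T n j<..grid T n (Suc j)} s = (if j = i then 1 else 0)" for j
  proof (cases j i rule: linorder_cases)
    case less
    then show ?thesis using grid_mono [of T "Suc j" i n] assms by (auto simp: indicator_def)
  next
    case greater
    then show ?thesis using grid_mono [of T "Suc i" j n] assms by (auto simp: indicator_def)
  qed (use assms in auto)
  then show ?thesis using assms(2) by (simp add: if_distrib [of "\<lambda>x. x *\<^sub>R _"] cong: if_cong)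
qed

lemma grid_fine:
  assumes "0 \<le> T" "0 < d" shows "\<forall>\<^sub>F n in sequentially. T / real n < d"
  using order_tendstoD(2) [OF lim_const_over_n [of T] assms(2)] by simp

text \<open>No differentiability of \<open>\<integral> k\<close> is available for a merely integrable \<open>k\<close>, so the
  classical exponential argument is replaced by a contraction on cells on which \<open>k\<close> has
  integral at most one half.\<close>

lemma gronwall_zero:
  fixes e :: "real \<Rightarrow> 'a::real_normed_vector"
  assumes T: "0 \<le> T" and e: "continuous_on {0..T} e" and k: "k integrable_on {0..T}"
    and ke: "(\<lambda>s. k s * norm (e s)) integrable_on {0..T}"
    and k0: "\<And>s. s \<in> {0..T} \<Longrightarrow> 0 \<le> k s"
    and le: "\<And>t. t \<in> {0..T} \<Longrightarrow> norm (e t) \<le> integral {0..t} (\<lambda>s. k s * norm (e s))"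
    and t: "t \<in> {0..T}"
  shows "e t = 0"
proof -
  let ?K = "\<lambda>t. integral {0..t} k"
  have "uniformly_continuous_on {0..T} ?K"
    by (intro compact_uniformly_continuous indefinite_integral_continuous_1 k) auto
  then obtain d where d: "d > 0"
    "\<And>s t. s \<in> {0..T} \<Longrightarrow> t \<in> {0..T} \<Longrightarrow> dist t s < d \<Longrightarrow> dist (?K t) (?K s) < 1/2"
    unfolding uniformly_continuous_on_def by (metis zero_less_divide_1_iff zero_less_numeral)
  (* on a cell of length below d the maximum of norm e is at most half of itself *)
  have cell: "e t = 0" if u: "0 \<le> u" "\<And>s. s \<in> {0..u} \<Longrightarrow> e s = 0" and v: "v \<le> T" "v - u < d" and t: "t \<in> {u..v}" for u v t
  proof -
    have "u \<le> v" using t by auto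
    have "continuous_on {u..v} (\<lambda>s. norm (e s))"
      using u v by (intro continuous_on_norm continuous_on_subset [OF e]) auto
    then obtain x where x: "x \<in> {u..v}" and mx: "\<And>s. s \<in> {u..v} \<Longrightarrow> norm (e s) \<le> norm (e x)"
      using continuous_attains_sup [of "{u..v}"] \<open>u \<le> v\<close> by (metis atLeastatMost_empty_iff2 compact_Icc not_le)
    have sub: "{u..x} \<subseteq> {0..T}" "{0..x} \<subseteq> {0..T}" "{0..u} \<subseteq> {0..T}" using x u v by auto
    have "norm (e x) \<le> integral {0..x} (\<lambda>s. k s * norm (e s))"
      using x u v by (intro le) auto
    also have "\<dots> = integral {0..u} (\<lambda>s. k s * norm (e s)) + integral {u..x} (\<lambda>s. k s * norm (e s))"
      using Henstock_Kurzweil_Integration.integral_combine [of 0 u x "\<lambda>s. k s * norm (e s)"] x u(1)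
        integrable_subinterval_real [OF ke sub(2)] by auto
    also have "integral {0..u} (\<lambda>s. k s * norm (e s)) = integral {0..u} (\<lambda>s. 0)"
      by (rule integral_cong) (simp add: u)
    also have "integral {u..x} (\<lambda>s. k s * norm (e s)) \<le> integral {u..x} (\<lambda>s. norm (e x) * k s)"
    proof (rule integral_le)
      show "(\<lambda>s. k s * norm (e s)) integrable_on {u..x}"
        by (rule integrable_subinterval_real [OF ke sub(1)])
      show "(\<lambda>s. norm (e x) * k s) integrable_on {u..x}"
        by (intro integrable_on_mult_right integrable_subinterval_real [OF k sub(1)])
      show "k s * norm (e s) \<le> norm (e x) * k s" if "s \<in> {u..x}" for s
        using mx [of s] k0 [of s] that x sub by (simp add: mult.commute mult_left_mono)
    qed
    also have "integral {u..x} (\<lambda>s. norm (e x) * k s) = norm (e x) * integral {u..x} k" by simp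
    also have "integral {u..x} k = ?K x - ?K u"
      using Henstock_Kurzweil_Integration.integral_combine [of 0 u x k] x u integrable_subinterval_real [OF k sub(2)] by auto
    also have "norm (e x) * (?K x - ?K u) \<le> norm (e x) * (1/2)"
    proof (rule mult_left_mono)
      have "dist (?K x) (?K u) < 1/2" using x u v by (intro d) (auto simp: dist_real_def)
      then show "?K x - ?K u \<le> 1/2" unfolding dist_real_def by linarith
    qed auto
    finally have "norm (e x) = 0" by simp
    then show ?thesis using mx [OF t] by simp
  qed
  obtain n :: nat where "T < real n * d"
    using reals_Archimedean3 [OF d(1)] by blast
  then have n: "T / real (Suc n) < d"
    using d(1) by (simp add: divide_less_eq algebra_simps)
  have "\<forall>s\<in>{0..real i * T / real (Suc n)}. e s = 0" if "i \<le> Suc n" for i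
    using that
  proof (induction i)
    case 0
    show ?case using le [of 0] T by auto
  next
    case (Suc i)
    have "real (Suc i) * T / real (Suc n) \<le> T"
      using grid_bounds [OF T Suc.prems] by simp
    moreover have "real (Suc i) * T / real (Suc n) - real i * T / real (Suc n) < d"
      using n by (simp add: diff_divide_distrib [symmetric] ring_distribs)
    ultimately show ?case
      using Suc.IH Suc.prems T cell [of "real i * T / real (Suc n)" "real (Suc i) * T / real (Suc n)"]
      by (metis Suc_leD atLeastAtMost_iff divide_nonneg_nonneg linear mult_nonneg_nonneg of_nat_0_le_iff)
  qed
  from this [of "Suc n"] t show ?thesis by simp
qed

lemma linear_ode_zero:
  fixes e :: "real \<Rightarrow> 'a::euclidean_space"
  assumes de: "\<And>t. 0 \<le> t \<Longrightarrow> (e has_vector_derivative e' t) (at t within {0..})"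
    and le: "\<And>t. 0 \<le> t \<Longrightarrow> norm (e' t) \<le> k t * norm (e t)"
    and k0: "\<And>t. 0 \<le> t \<Longrightarrow> 0 \<le> k t"
    and k: "\<And>t. set_integrable lborel {0..t} k" and e0: "e 0 = 0" and t: "0 \<le> t"
  shows "e t = 0"
proof -
  have ce: "continuous_on {0..} e"
    unfolding continuous_on_eq_continuous_within by (auto intro: has_vector_derivative_continuous [OF de])
  have ce': "continuous_on {0..t} e" for t by (rule continuous_on_subset [OF ce]) auto
  have "set_integrable lborel {0..t} (\<lambda>s. k s * norm (e s))" for t
    by (rule set_integrable_bilinear_flip [OF bounded_bilinear_mult continuous_on_norm [OF ce'] k])
  then have ke: "(\<lambda>s. k s * norm (e s)) integrable_on {0..t}" for t
    by (rule set_integrable_imp_integrable_on)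
  show ?thesis
  proof (rule gronwall_zero [OF t ce' set_integrable_imp_integrable_on(1)[OF k] ke])
    fix r assume "r \<in> {0..t}"
    then have "(e' has_integral (e r - e 0)) {0..r}"
      by (intro fundamental_theorem_of_calculus)
        (auto intro: has_vector_derivative_within_subset [OF de])
    then have "e r = integral {0..r} e'" "e' integrable_on {0..r}"
      using e0 by (auto simp: integral_unique has_integral_integrable)
    then have "norm (integral {0..r} e') \<le> integral {0..r} (\<lambda>s. k s * norm (e s))"
      by (intro integral_norm_bound_integral [OF _ ke] le) auto
    then show "norm (e r) \<le> integral {0..r} (\<lambda>s. k s * norm (e s))"
      using \<open>e r = _\<close> by simp
  qed (use k0 t in auto)
qed

lemma integral_grid:
  fixes f :: "real \<Rightarrow> 'a::euclidean_space"
  assumes T: "0 \<le> T" and f: "f integrable_on {0..T}" and m: "m \<le> n"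
  shows "integral {0..grid T n m} f = (\<Sum>i<m. integral {grid T n i..grid T n (Suc i)} f)"
  using m
proof (induction m)
  case (Suc m)
  have b: "0 \<le> grid T n m" "grid T n m \<le> grid T n (Suc m)" "grid T n (Suc m) \<le> T"
    using grid_bounds [OF T, of m n] grid_bounds [OF T Suc.prems] grid_mono [OF T, of m "Suc m" n] Suc.prems by auto
  have "integral {0..grid T n m} f + integral {grid T n m..grid T n (Suc m)} f = integral {0..grid T n (Suc m)} f"
    by (intro Henstock_Kurzweil_Integration.integral_combine b integrable_subinterval_real [OF f]) (use b in auto)
  with Suc show ?case by simp
qed simp

text \<open>The tags are arbitrary in their cells, and the weights \<open>\<integral> g\<close> of the cells replace their lengths: by
  uniform continuity of \<open>c\<close> the error is small relative to \<open>\<integral> |g|\<close>.\<close>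

lemma riemann_sum_weighted:
  fixes h :: "'a::euclidean_space \<Rightarrow> 'b::euclidean_space \<Rightarrow> 'c::euclidean_space"
  assumes h: "bounded_bilinear h" and T: "0 \<le> T"
    and c: "continuous_on {0..T} c" and g: "set_integrable lborel {0..T} g"
    and tag: "\<And>n i. i < n \<Longrightarrow> tag n i \<in> {grid T n i..grid T n (Suc i)}"
  shows "(\<lambda>n. \<Sum>i<n. h (c (tag n i)) (integral {grid T n i..grid T n (Suc i)} g))
    \<longlonglongrightarrow> integral {0..T} (\<lambda>s. h (c s) (g s))"
proof (rule LIMSEQ_I)
  interpret h: bounded_bilinear h by fact
  fix r :: real assume r: "0 < r"
  obtain K where K: "\<And>x y. norm (h x y) \<le> norm x * norm y * K" "K > 0"
    using h.pos_bounded by blast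
  have gi: "g integrable_on {0..T}" and ng: "(\<lambda>s. norm (g s)) integrable_on {0..T}"
    and hi: "(\<lambda>s. h (c s) (g s)) integrable_on {0..T}"
    using set_integrable_imp_integrable_on(1) [OF g] set_integrable_imp_norm_integrable_on [OF g]
      set_integrable_imp_integrable_on(1) [OF set_integrable_bilinear [OF h c g]] by auto
  define G where "G = integral {0..T} (\<lambda>s. norm (g s))"
  have G0: "0 \<le> G" unfolding G_def by (intro integral_nonneg ng) auto
  define d where "d = r / (2 * K * (G + 1))"
  have "d * K * G = r * (G / (2 * (G + 1)))" using K(2) by (simp add: d_def)
  moreover have "G / (2 * (G + 1)) < 1" using G0 by (simp add: divide_less_eq)
  ultimately have "d * K * G < r * 1" using r by (simp only: mult_strict_left_mono)
  moreover have "0 < d" using r K(2) G0 by (simp add: d_def)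
  ultimately have d: "0 < d" "d * K * G < r" by auto
  have "uniformly_continuous_on {0..T} c" by (intro compact_uniformly_continuous c) auto
  then obtain e where e: "e > 0"
    "\<And>s t. s \<in> {0..T} \<Longrightarrow> t \<in> {0..T} \<Longrightarrow> dist t s < e \<Longrightarrow> dist (c t) (c s) < d"
    unfolding uniformly_continuous_on_def using d(1) by metis
  obtain n0 where n0: "\<And>n. n \<ge> n0 \<Longrightarrow> T / real n < e"
    using grid_fine [OF T e(1)] unfolding eventually_sequentially by blast
  show "\<exists>no. \<forall>n\<ge>no. norm ((\<Sum>i<n. h (c (tag n i)) (integral {grid T n i..grid T n (Suc i)} g))
      - integral {0..T} (\<lambda>s. h (c s) (g s))) < r"
  proof (intro exI allI impI)
    fix n assume "max n0 1 \<le> n"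
    then have n: "n0 \<le> n" "0 < n" by auto
    have gT: "grid T n n = T" using n by simp
    let ?I = "\<lambda>i. {grid T n i..grid T n (Suc i)}"
    have cell: "norm (h (c (tag n i)) (integral (?I i) g) - integral (?I i) (\<lambda>s. h (c s) (g s)))
        \<le> integral (?I i) (\<lambda>s. d * K * norm (g s))" if i: "i < n" for i
    proof -
      have sub: "?I i \<subseteq> {0..T}"
        using grid_bounds [OF T, of i n] grid_bounds [OF T, of "Suc i" n] i by auto
      note I = integrable_subinterval_real [OF _ sub]
      have "h (c (tag n i)) (integral (?I i) g) = integral (?I i) (\<lambda>s. h (c (tag n i)) (g s))"
        using integral_linear [OF I [OF gi] h.bounded_linear_right, of "c (tag n i)"] by (simp add: o_def)
      moreover have lin: "(\<lambda>s. h (c (tag n i)) (g s)) integrable_on ?I i"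
        using integrable_linear [OF I [OF gi] h.bounded_linear_right, of "c (tag n i)"] by (simp add: o_def)
      ultimately have "h (c (tag n i)) (integral (?I i) g) - integral (?I i) (\<lambda>s. h (c s) (g s))
          = integral (?I i) (\<lambda>s. h (c (tag n i)) (g s) - h (c s) (g s))"
        using Henstock_Kurzweil_Integration.integral_diff [OF lin I [OF hi]] by simp
      also have "norm \<dots> \<le> integral (?I i) (\<lambda>s. d * K * norm (g s))"
      proof (rule integral_norm_bound_integral)
        show "(\<lambda>s. h (c (tag n i)) (g s) - h (c s) (g s)) integrable_on ?I i"
          by (intro Henstock_Kurzweil_Integration.integrable_diff lin I hi)
        show "(\<lambda>s. d * K * norm (g s)) integrable_on ?I i"
          by (intro integrable_on_mult_right I ng)
        fix s assume s: "s \<in> ?I i"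
        have "\<bar>tag n i - s\<bar> \<le> grid T n (Suc i) - grid T n i" using tag [OF i] s by auto
        also have "\<dots> = T / n" by (simp add: add_divide_distrib ring_distribs)
        also have "\<dots> < e" by (rule n0 [OF n(1)])
        finally have "dist (c (tag n i)) (c s) < d"
          using s tag [OF i] sub by (intro e) (auto simp: dist_real_def)
        then have "norm (c (tag n i) - c s) \<le> d" by (simp add: dist_norm)
        then have "norm (c (tag n i) - c s) * norm (g s) * K \<le> d * norm (g s) * K"
          using K by (intro mult_right_mono) auto
        then show "norm (h (c (tag n i)) (g s) - h (c s) (g s)) \<le> d * K * norm (g s)"
          using K(1) [of "c (tag n i) - c s" "g s"] by (simp add: h.diff_left mult_ac)
      qed
      finally show ?thesis .
    qed
    have "norm ((\<Sum>i<n. h (c (tag n i)) (integral (?I i) g)) - integral {0..T} (\<lambda>s. h (c s) (g s)))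
        = norm (\<Sum>i<n. h (c (tag n i)) (integral (?I i) g) - integral (?I i) (\<lambda>s. h (c s) (g s)))"
      using integral_grid [OF T hi, of n n] by (simp add: gT sum_subtractf)
    also have "\<dots> \<le> (\<Sum>i<n. integral (?I i) (\<lambda>s. d * K * norm (g s)))"
      by (rule sum_norm_le) (use cell in auto)
    also have "\<dots> = d * K * G"
      using integral_grid [OF T integrable_on_mult_right [OF ng, of "d * K"], of n n] by (simp add: gT G_def)
    also have "\<dots> < r" by (rule d)
    finally show "norm ((\<Sum>i<n. h (c (tag n i)) (integral (?I i) g)) - integral {0..T} (\<lambda>s. h (c s) (g s))) < r" .
  qed
qed

text \<open>Only the integrator \<open>u\<close> has a derivative here; \<open>N\<close> is merely continuous and will be the path
  of a stochastic integral.  Summation by parts moves the increments from \<open>N\<close> to \<open>u\<close>.\<close>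

lemma stieltjes_sum_limit:
  fixes h :: "'a::euclidean_space \<Rightarrow> 'b::euclidean_space \<Rightarrow> 'c::euclidean_space"
  assumes h: "bounded_bilinear h" and T: "0 \<le> T"
    and N: "continuous_on {0..T} N" and u': "set_integrable lborel {0..T} u'"
    and u: "\<And>s t. 0 \<le> s \<Longrightarrow> s \<le> t \<Longrightarrow> t \<le> T \<Longrightarrow> u t - u s = integral {s..t} u'"
  shows "(\<lambda>n. \<Sum>i<n. h (u (grid T n i)) (N (grid T n (Suc i)) - N (grid T n i)))
    \<longlonglongrightarrow> h (u T) (N T) - h (u 0) (N 0) - integral {0..T} (\<lambda>s. h (u' s) (N s))"
proof -
  interpret h: bounded_bilinear h by fact
  have "(\<lambda>n. \<Sum>i<n. h (integral {grid T n i..grid T n (Suc i)} u') (N (grid T n (Suc i))))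
      \<longlonglongrightarrow> integral {0..T} (\<lambda>s. h (u' s) (N s))"
    by (rule riemann_sum_weighted [OF bounded_bilinear.flip [OF h] T N u', of "\<lambda>n i. grid T n (Suc i)"])
      (auto intro!: grid_mono T simp del: of_nat_Suc)
  then have "(\<lambda>n. h (u T) (N T) - h (u 0) (N 0) - (\<Sum>i<n. h (integral {grid T n i..grid T n (Suc i)} u') (N (grid T n (Suc i)))))
      \<longlonglongrightarrow> h (u T) (N T) - h (u 0) (N 0) - integral {0..T} (\<lambda>s. h (u' s) (N s))"
    by (intro tendsto_intros)
  moreover have "\<forall>\<^sub>F n in sequentially.
      h (u T) (N T) - h (u 0) (N 0) - (\<Sum>i<n. h (integral {grid T n i..grid T n (Suc i)} u') (N (grid T n (Suc i))))
      = (\<Sum>i<n. h (u (grid T n i)) (N (grid T n (Suc i)) - N (grid T n i)))"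
    using eventually_gt_at_top [of 0]
  proof eventually_elim
    case (elim n)
    have "(\<Sum>i<n. h (integral {grid T n i..grid T n (Suc i)} u') (N (grid T n (Suc i))))
        = (\<Sum>i<n. h (u (grid T n (Suc i)) - u (grid T n i)) (N (grid T n (Suc i))))"
    proof (rule sum.cong [OF refl])
      fix i assume "i \<in> {..<n}"
      then show "h (integral {grid T n i..grid T n (Suc i)} u') (N (grid T n (Suc i)))
          = h (u (grid T n (Suc i)) - u (grid T n i)) (N (grid T n (Suc i)))"
        using u [of "grid T n i" "grid T n (Suc i)"] grid_bounds [OF T, of i n]
          grid_bounds [OF T, of "Suc i" n] grid_mono [OF T, of i "Suc i" n] by simp
    qed
    moreover have "(\<Sum>i<n. h (u (grid T n i)) (N (grid T n (Suc i)) - N (grid T n i)))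
        + (\<Sum>i<n. h (u (grid T n (Suc i)) - u (grid T n i)) (N (grid T n (Suc i))))
        = (\<Sum>i<n. h (u (grid T n (Suc i))) (N (grid T n (Suc i))) - h (u (grid T n i)) (N (grid T n i)))"
      unfolding sum.distrib [symmetric] by (rule sum.cong) (auto simp: h.diff_left h.diff_right)
    moreover have "\<dots> = h (u T) (N T) - h (u 0) (N 0)"
      using elim by (subst sum_lessThan_telescope) simp
    ultimately show ?case by (simp add: algebra_simps)
  qed
  ultimately show ?thesis by (rule Lim_transform_eventually)
qed

text \<open>Both functions are indefinite integrals; the formula is the limit of summation by parts over the
  grid, with \<open>stieltjes_sum_limit\<close> for one side and Riemann sums for the other.\<close>

lemma integration_by_parts_ac:
  fixes h :: "'a::euclidean_space \<Rightarrow> 'b::euclidean_space \<Rightarrow> 'c::euclidean_space"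
  assumes h: "bounded_bilinear h" and T: "0 \<le> (T::real)"
    and g: "set_integrable lborel {0..T} g" and u': "set_integrable lborel {0..T} u'"
    and u: "\<And>s t. 0 \<le> s \<Longrightarrow> s \<le> t \<Longrightarrow> t \<le> T \<Longrightarrow> u t - u s = integral {s..t} u'"
  shows "h (u T) (integral {0..T} g) = integral {0..T} (\<lambda>s. h (u s) (g s))
    + integral {0..T} (\<lambda>s. h (u' s) (integral {0..s} g))"
proof -
  interpret h: bounded_bilinear h by fact
  let ?y = "\<lambda>t. integral {0..t} g"
  note gi = set_integrable_imp_integrable_on(1) [OF g]
  have y: "continuous_on {0..T} ?y" by (rule indefinite_integral_continuous_1 [OF gi])
  have "continuous_on {0..T} (\<lambda>t. u 0 + integral {0..t} u')"
    by (intro continuous_intros indefinite_integral_continuous_1 set_integrable_imp_integrable_on u')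
  moreover have "u t = u 0 + integral {0..t} u'" if "t \<in> {0..T}" for t
    using u [of 0 t] that by (simp add: algebra_simps)
  ultimately have cu: "continuous_on {0..T} u" by (metis (no_types, lifting) continuous_on_eq)
  have 1: "(\<lambda>n. \<Sum>i<n. h (u (grid T n i)) (?y (grid T n (Suc i)) - ?y (grid T n i)))
    \<longlonglongrightarrow> h (u T) (?y T) - h (u 0) (?y 0) - integral {0..T} (\<lambda>s. h (u' s) (?y s))"
    by (rule stieltjes_sum_limit [OF h T y u' u])
  have 2: "(\<Sum>i<n. h (u (grid T n i)) (integral {grid T n i..grid T n (Suc i)} g))
      = (\<Sum>i<n. h (u (grid T n i)) (?y (grid T n (Suc i)) - ?y (grid T n i)))" for n
  proof (rule sum.cong [OF refl])
    fix i assume "i \<in> {..<n}"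
    then have b: "0 \<le> grid T n i" "grid T n i \<le> grid T n (Suc i)" "grid T n (Suc i) \<le> T"
      using grid_bounds [OF T, of i n] grid_bounds [OF T, of "Suc i" n] grid_mono [OF T, of i "Suc i" n] by auto
    then have "?y (grid T n i) + integral {grid T n i..grid T n (Suc i)} g = ?y (grid T n (Suc i))"
      by (intro Henstock_Kurzweil_Integration.integral_combine integrable_subinterval_real [OF gi]) auto
    then have "integral {grid T n i..grid T n (Suc i)} g + ?y (grid T n i) = ?y (grid T n (Suc i))"
      by (simp only: add.commute)
    then have "integral {grid T n i..grid T n (Suc i)} g = ?y (grid T n (Suc i)) - ?y (grid T n i)"
      by (rule add_implies_diff)
    then show "h (u (grid T n i)) (integral {grid T n i..grid T n (Suc i)} g)
      = h (u (grid T n i)) (?y (grid T n (Suc i)) - ?y (grid T n i))"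
      by (simp only:)
  qed
  have "(\<lambda>n. \<Sum>i<n. h (u (grid T n i)) (integral {grid T n i..grid T n (Suc i)} g))
    \<longlonglongrightarrow> integral {0..T} (\<lambda>s. h (u s) (g s))"
    by (rule riemann_sum_weighted [OF h T cu g, of "\<lambda>n i. grid T n i"])
      (auto intro!: grid_mono T simp del: of_nat_Suc)
  then have "integral {0..T} (\<lambda>s. h (u s) (g s))
      = h (u T) (?y T) - h (u 0) (?y 0) - integral {0..T} (\<lambda>s. h (u' s) (?y s))"
    unfolding 2 by (rule LIMSEQ_unique [OF _ 1])
  then show ?thesis by (simp add: algebra_simps h.zero_right)
qed

lemma cont_Icc_of_atLeast: "continuous_on {0..} f \<Longrightarrow> continuous_on {0..t::real} f"
  by (erule continuous_on_subset) auto

lemma continuous_on_atLeast0I: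
  fixes f :: "real \<Rightarrow> 'b::topological_space"
  assumes "\<And>n::nat. continuous_on {0..real n} f" shows "continuous_on {0..} f"
  unfolding continuous_on_eq_continuous_within
proof
  fix x :: real assume x: "x \<in> {0..}"
  obtain n :: nat where n: "x < real n" using reals_Archimedean2 by blast
  have "continuous (at x within {0..real n}) f"
    using assms [of n] x n unfolding continuous_on_eq_continuous_within by auto
  moreover have "at x within {0..real n} = at x within {0..}"
    by (rule at_within_nhd [of x "{..<real n}"]) (use x n in auto)
  ultimately show "continuous (at x within {0..}) f" by simp
qed

lemma continuous_LINT:
  fixes f :: "real \<Rightarrow> 'a::euclidean_space"
  assumes "\<And>t. set_integrable lborel {0..t} f"
  shows "continuous_on {0..} (\<lambda>t. LINT s:{0..t}|lborel. f s)"
proof (rule continuous_on_atLeast0I)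
  fix n :: nat
  have "continuous_on {0..real n} (\<lambda>t. integral {0..t} f)"
    by (intro indefinite_integral_continuous_1 set_integrable_imp_integrable_on assms)
  then show "continuous_on {0..real n} (\<lambda>t. LINT s:{0..t}|lborel. f s)"
    by (simp add: set_integrable_imp_integrable_on(2) [OF assms])
qed

lemma linear_integral_equation_zero:
  fixes e :: "real \<Rightarrow> real^'n" and G :: "real \<Rightarrow> real^'n^'n"
  assumes G: "\<And>t. set_integrable lborel {0..t} G" and e: "continuous_on {0..} e"
    and eq: "\<And>t. 0 \<le> t \<Longrightarrow> e t = (LINT s:{0..t}|lborel. G s *v e s)" and t: "0 \<le> t"
  shows "e t = 0"
proof (rule gronwall_zero [OF t cont_Icc_of_atLeast [OF e]])
  have k: "set_integrable lborel {0..r} (\<lambda>s. norm (G s) * norm (e s))" for r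
    by (rule set_integrable_bilinear_flip [OF bounded_bilinear_mult cont_Icc_of_atLeast [OF continuous_on_norm [OF e]] set_integrable_norm [OF G]])
  show "(\<lambda>s. norm (G s)) integrable_on {0..t}" by (rule set_integrable_imp_norm_integrable_on [OF G])
  show "(\<lambda>s. norm (G s) * norm (e s)) integrable_on {0..t}" by (rule set_integrable_imp_integrable_on(1) [OF k])
  fix r assume "r \<in> {0..t}"
  then have r: "0 \<le> r" by simp
  have i: "set_integrable lborel {0..r} (\<lambda>s. G s *v e s)"
    by (rule set_integrable_bilinear_flip [OF bounded_bilinear_matvec cont_Icc_of_atLeast [OF e] G])
  show "norm (e r) \<le> integral {0..r} (\<lambda>s. norm (G s) * norm (e s))"
    unfolding eq [OF r] set_integrable_imp_integrable_on(2) [OF i]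
    by (rule integral_norm_bound_integral [OF set_integrable_imp_integrable_on(1) [OF i] set_integrable_imp_integrable_on(1) [OF k] norm_matvec_le])
qed (use t in auto)

text \<open>A countable set of times that approximates every time, used to pass from almost sure statements at
  fixed times to statements about whole paths.\<close>

lemma floor_grid_tendsto:
  fixes s :: real
  assumes s: "0 \<le> s"
  shows "(\<lambda>n. real (nat \<lfloor>s * (real n + 1)\<rfloor>) / (real n + 1)) \<longlonglongrightarrow> s"
proof -
  let ?k = "\<lambda>n. nat \<lfloor>s * (real n + 1)\<rfloor>"
  have bd: "\<bar>real (?k n) / (real n + 1) - s\<bar> \<le> 1 / (real n + 1)" for n
  proof -
    have "0 \<le> s * (real n + 1)" using s by simp
    then have "real (?k n) = real_of_int \<lfloor>s * (real n + 1)\<rfloor>" by simp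
    then have "\<bar>real (?k n) - s * (real n + 1)\<bar> \<le> 1" by linarith
    then have "\<bar>real (?k n) - s * (real n + 1)\<bar> / (real n + 1) \<le> 1 / (real n + 1)"
      by (intro divide_right_mono) auto
    moreover have "real (?k n) / (real n + 1) - s = (real (?k n) - s * (real n + 1)) / (real n + 1)"
      by (simp add: diff_divide_distrib)
    ultimately show ?thesis by (simp add: abs_divide)
  qed
  have "(\<lambda>n. 1 / (real n + 1)) \<longlonglongrightarrow> 0"
    using LIMSEQ_inverse_real_of_nat by (simp add: inverse_eq_divide add.commute)
  then have "(\<lambda>n. real (?k n) / (real n + 1) - s) \<longlonglongrightarrow> 0"
    by (rule Lim_null_comparison [rotated]) (use bd in simp)
  then show ?thesis by (simp add: LIM_zero_iff)
qed

lemma continuous_eq_from_rationals: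
  fixes f g :: "real \<Rightarrow> 'b::real_normed_vector"
  assumes f: "continuous_on {0..} f" and g: "continuous_on {0..} g"
    and eq: "\<And>k n :: nat. f (real k / (real n + 1)) = g (real k / (real n + 1))" and t: "0 \<le> t"
  shows "f t = g t"
proof -
  let ?s = "\<lambda>n. real (nat \<lfloor>t * (real n + 1)\<rfloor>) / (real n + 1)"
  have lim: "(\<lambda>n. f (?s n)) \<longlonglongrightarrow> f t" if "continuous_on {0..} f" for f :: "real \<Rightarrow> 'b"
    by (rule continuous_on_tendsto_compose [OF that floor_grid_tendsto [OF t]]) (use t in auto)
  show ?thesis
    by (rule LIMSEQ_unique [OF lim [OF f]]) (use lim [OF g] eq in simp)
qed

section \<open>The seminorm of the Ito isometry and density of step functions\<close>

text \<open>Extended real valued, so that finiteness is the condition for a Wiener integral to exist.\<close>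

definition ito_sq :: "(real \<Rightarrow> real^'m^'m) \<Rightarrow> real \<Rightarrow> (real \<Rightarrow> real^'m^'k) \<Rightarrow> ennreal" where
  "ito_sq R T f = (\<integral>\<^sup>+s\<in>{0..T}. ennreal (trace (f s ** R s ** transpose (f s))) \<partial>lborel)"

definition step_list :: "real \<Rightarrow> ('c \<times> real \<times> real) list \<Rightarrow> bool" where
  "step_list T g \<longleftrightarrow> (\<forall>(c, a, b)\<in>set g. 0 \<le> a \<and> a \<le> b \<and> b \<le> T)"

lemma borel_measurable_trace [measurable (raw)]:
  "f \<in> borel_measurable N \<Longrightarrow> (\<lambda>x. trace (f x :: real^'n^'n)) \<in> borel_measurable N"
  by (rule measurable_compose [OF _ borel_measurable_continuous_onI])
    (auto simp: trace_def intro!: continuous_intros)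

lemma borel_measurable_step_function [measurable]:
  "step_function g \<in> borel_measurable borel"
proof (induction g)
  case Nil
  then show ?case by (simp add: step_function_def [abs_def])
next
  case (Cons x g)
  obtain c a b where x: "x = (c, a, b)" by (cases x)
  have "step_function (x # g) = (\<lambda>s. indicat_real {a<..b} s *\<^sub>R c + step_function g s)"
    by (simp add: step_function_def fun_eq_iff x)
  then show ?case using Cons by simp
qed

lemma set_borel_measurable_step_function: "set_borel_measurable borel {0..T} (step_function g)"
  unfolding set_borel_measurable_def by measurable

lemma set_borel_measurable_bilinear:
  fixes h :: "'a::euclidean_space \<Rightarrow> 'b::euclidean_space \<Rightarrow> 'c::euclidean_space"
  assumes h: "bounded_bilinear h" and "set_borel_measurable borel A f" "set_borel_measurable borel A g"
  shows "set_borel_measurable borel A (\<lambda>s. h (f s) (g s))"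
proof -
  interpret h: bounded_bilinear h by fact
  have eq: "indicator A s *\<^sub>R h (f s) (g s) = h (indicator A s *\<^sub>R f s) (indicator A s *\<^sub>R g s)" for s
    by (auto simp: indicator_def h.zero_left)
  show ?thesis
    unfolding set_borel_measurable_def eq
    by (rule borel_measurable_bilinear [OF h assms(2,3) [unfolded set_borel_measurable_def]])
qed

lemma set_borel_measurable_diff:
  fixes f g :: "'a \<Rightarrow> 'b::euclidean_space"
  assumes "set_borel_measurable N A f" "set_borel_measurable N A g"
  shows "set_borel_measurable N A (\<lambda>s. f s - g s)"
  using borel_measurable_diff [OF assms [unfolded set_borel_measurable_def]]
  unfolding set_borel_measurable_def by (simp add: scaleR_diff_right)

lemma set_borel_measurable_add:
  fixes f g :: "'a \<Rightarrow> 'b::euclidean_space"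
  assumes "set_borel_measurable N A f" "set_borel_measurable N A g"
  shows "set_borel_measurable N A (\<lambda>s. f s + g s)"
  using borel_measurable_add [OF assms [unfolded set_borel_measurable_def]]
  unfolding set_borel_measurable_def by (simp add: scaleR_add_right)

lemma set_borel_measurable_continuous_on:
  fixes f :: "real \<Rightarrow> 'b::euclidean_space"
  assumes "continuous_on {0..T} f" shows "set_borel_measurable borel {0..T} f"
  using borel_measurable_continuous_on_indicator [OF _ assms] by (simp add: set_borel_measurable_def)

lemma nn_set_integral_to_LINT:
  fixes f :: "real \<Rightarrow> real"
  assumes "set_integrable lborel A f" "\<And>s. s \<in> A \<Longrightarrow> 0 \<le> f s"
  shows "(\<integral>\<^sup>+s\<in>A. ennreal (f s) \<partial>lborel) = ennreal (LINT s:A|lborel. f s)"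
proof -
  have "(\<integral>\<^sup>+s\<in>A. ennreal (f s) \<partial>lborel) = (\<integral>\<^sup>+s. ennreal (indicator A s *\<^sub>R f s) \<partial>lborel)"
    by (intro nn_integral_cong) (auto simp: indicator_def)
  also have "\<dots> = ennreal (LINT s:A|lborel. f s)"
    unfolding set_lebesgue_integral_def
    using assms by (intro nn_integral_eq_integral) (auto simp: set_integrable_def indicator_def)
  finally show ?thesis .
qed

locale intensity =
  fixes R :: "real \<Rightarrow> real^'m^'m"
  assumes R_int: "\<And>t. set_integrable lborel {0..t} R"
    and R_pos: "\<And>t. 0 \<le> t \<Longrightarrow> pos_def (R t)"
begin

lemma R_measurable: "set_borel_measurable borel {0..t} R"
  using R_int [of t] unfolding set_integrable_def set_borel_measurable_def
  by (simp add: borel_measurable_integrable)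

lemma R_nonneg: "0 \<le> t \<Longrightarrow> 0 \<le> x \<bullet> (R t *v x)"
  by (rule pos_def_nonneg [OF R_pos])

lemma ito_integrand_nonneg: "0 \<le> s \<Longrightarrow> 0 \<le> trace (c ** R s ** transpose c)" for c :: "real^'m^'k"
  by (rule trace_form_nonneg) (rule R_nonneg)

lemma ito_integrand_measurable:
  fixes f :: "real \<Rightarrow> real^'m^'k"
  assumes "set_borel_measurable borel {0..T} f"
  shows "(\<lambda>s. ennreal (trace (f s ** R s ** transpose (f s))) * indicator {0..T} s) \<in> borel_measurable borel"
proof -
  let ?i = "indicat_real {0..T}"
  have "(\<lambda>s. ennreal (trace (f s ** R s ** transpose (f s))) * indicator {0..T} s)
     = (\<lambda>s. ennreal (trace ((?i s *\<^sub>R f s) ** (?i s *\<^sub>R R s) ** transpose (?i s *\<^sub>R f s))))"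
    by (auto simp: fun_eq_iff indicator_def matrix_matrix_mult_def trace_def zero_vec_def)
  moreover have [measurable]: "(\<lambda>s. ?i s *\<^sub>R f s) \<in> borel_measurable borel" "(\<lambda>s. ?i s *\<^sub>R R s) \<in> borel_measurable borel"
    using assms R_measurable by (auto simp: set_borel_measurable_def)
  ultimately show ?thesis by simp
qed

lemma ito_sq_add:
  fixes f g :: "real \<Rightarrow> real^'m^'k"
  assumes "set_borel_measurable borel {0..T} f" "set_borel_measurable borel {0..T} g"
  shows "ito_sq R T (\<lambda>s. f s + g s) \<le> 2 * ito_sq R T f + 2 * ito_sq R T g"
proof -
  let ?q = "\<lambda>f s. ennreal (trace (f s ** R s ** transpose (f s))) * indicator {0..T} s"
  have "ito_sq R T (\<lambda>s. f s + g s) \<le> (\<integral>\<^sup>+s. 2 * ?q f s + 2 * ?q g s \<partial>lborel)"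
    unfolding ito_sq_def
  proof (rule nn_integral_mono)
    fix s
    show "ennreal (trace ((f s + g s) ** R s ** transpose (f s + g s))) * indicator {0..T} s
        \<le> 2 * ?q f s + 2 * ?q g s"
    proof (cases "s \<in> {0..T}")
      case True
      have "ennreal (trace ((f s + g s) ** R s ** transpose (f s + g s)))
        \<le> ennreal (2 * trace (f s ** R s ** transpose (f s)) + 2 * trace (g s ** R s ** transpose (g s)))"
        using True by (intro ennreal_leI trace_form_add_le R_nonneg) auto
      also have "\<dots> = 2 * ennreal (trace (f s ** R s ** transpose (f s))) + 2 * ennreal (trace (g s ** R s ** transpose (g s)))"
        using True ito_integrand_nonneg [of s "f s"] ito_integrand_nonneg [of s "g s"]
        by (simp add: ennreal_plus ennreal_mult)
      finally show ?thesis using True by simp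
    qed simp
  qed
  also have "\<dots> = 2 * ito_sq R T f + 2 * ito_sq R T g"
    unfolding ito_sq_def
    using ito_integrand_measurable [OF assms(1)] ito_integrand_measurable [OF assms(2)]
    by (simp add: nn_integral_add nn_integral_cmult)
  finally show ?thesis .
qed

lemma ito_sq_cong:
  assumes "\<And>s. 0 < s \<Longrightarrow> s \<le> T \<Longrightarrow> f s = g s"
  shows "ito_sq R T f = ito_sq R T g"
  unfolding ito_sq_def
proof (rule nn_integral_cong_AE, rule AE_mp [OF AE_lborel_singleton [of 0]], rule AE_I2, rule impI)
  fix s :: real assume "s \<noteq> 0"
  then show "ennreal (trace (f s ** R s ** transpose (f s))) * indicator {0..T} s
      = ennreal (trace (g s ** R s ** transpose (g s))) * indicator {0..T} s"
    using assms [of s] by (cases "s \<in> {0..T}") auto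
qed

lemma ito_sq_minus_commute: "ito_sq R T (\<lambda>s. f s - g s) = ito_sq R T (\<lambda>s. g s - f s)"
proof -
  have "trace ((f s - g s) ** R s ** transpose (f s - g s)) = trace ((g s - f s) ** R s ** transpose (g s - f s))" for s
    using trace_form_scaleR [of "-1" "f s - g s" "R s"] by simp
  then show ?thesis unfolding ito_sq_def by simp
qed

lemma ito_sq_triangle:
  fixes f g h :: "real \<Rightarrow> real^'m^'k"
  assumes "set_borel_measurable borel {0..T} f" "set_borel_measurable borel {0..T} g" "set_borel_measurable borel {0..T} h"
  shows "ito_sq R T (\<lambda>s. f s - h s) \<le> 2 * ito_sq R T (\<lambda>s. f s - g s) + 2 * ito_sq R T (\<lambda>s. g s - h s)"
  using ito_sq_add [OF set_borel_measurable_diff [OF assms(1,2)] set_borel_measurable_diff [OF assms(2,3)]] by simp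

lemma ito_sq_subinterval: "u \<le> T \<Longrightarrow> ito_sq R u f \<le> ito_sq R T f"
  unfolding ito_sq_def by (intro nn_integral_mono) (auto simp: indicator_def)

lemma ito_sq_le_bound:
  fixes f :: "real \<Rightarrow> real^'m^'k"
  assumes "\<And>s. 0 < s \<Longrightarrow> s \<le> T \<Longrightarrow> norm (f s) \<le> B"
  shows "ito_sq R T f \<le> ennreal (B\<^sup>2 * (LINT s:{0..T}|lborel. norm (R s)))"
proof -
  have "ito_sq R T f \<le> (\<integral>\<^sup>+s\<in>{0..T}. ennreal (B\<^sup>2 * norm (R s)) \<partial>lborel)"
    unfolding ito_sq_def
  proof (rule nn_integral_mono_AE, rule AE_mp [OF AE_lborel_singleton [of 0]], rule AE_I2, rule impI)
    fix s :: real assume "s \<noteq> 0"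
    have "trace (f s ** R s ** transpose (f s)) \<le> B\<^sup>2 * norm (R s)" if "s \<in> {0..T}"
    proof -
      have "(norm (f s))\<^sup>2 \<le> B\<^sup>2" using assms [of s] that \<open>s \<noteq> 0\<close> by (intro power_mono) auto
      then have "(norm (f s))\<^sup>2 * norm (R s) \<le> B\<^sup>2 * norm (R s)" by (intro mult_right_mono) auto
      then show ?thesis using trace_form_le_norm [of "f s" "R s"] by linarith
    qed
    then show "ennreal (trace (f s ** R s ** transpose (f s))) * indicator {0..T} s
        \<le> ennreal (B\<^sup>2 * norm (R s)) * indicator {0..T} s"
      by (auto simp: indicator_def intro!: ennreal_leI)
  qed
  also have "\<dots> = ennreal (LINT s:{0..T}|lborel. B\<^sup>2 * norm (R s))"
    by (rule nn_set_integral_to_LINT) (auto intro: set_integrable_norm [OF R_int])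
  finally show ?thesis by simp
qed

lemma ito_sq_tendsto_0:
  fixes f :: "nat \<Rightarrow> real \<Rightarrow> real^'m^'k"
  assumes meas: "\<And>n. set_borel_measurable borel {0..T} (f n)"
    and lim: "AE s in lborel. s \<in> {0..T} \<longrightarrow> (\<lambda>n. f n s) \<longlonglongrightarrow> 0"
    and w: "w \<in> borel_measurable borel" "(\<integral>\<^sup>+s. w s \<partial>lborel) < \<infinity>"
    and dom: "\<And>n s. s \<in> {0..T} \<Longrightarrow> ennreal (trace (f n s ** R s ** transpose (f n s))) \<le> w s"
  shows "(\<lambda>n. ito_sq R T (f n)) \<longlonglongrightarrow> 0"
proof -
  have "(\<lambda>n. ito_sq R T (f n)) \<longlonglongrightarrow> (\<integral>\<^sup>+s. 0 \<partial>(lborel :: real measure))"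
    unfolding ito_sq_def
  proof (rule nn_integral_dominated_convergence [of _ _ _ w])
    show "(\<lambda>s. ennreal (trace (f n s ** R s ** transpose (f n s))) * indicator {0..T} s) \<in> borel_measurable lborel" for n
      using ito_integrand_measurable [OF meas] by simp
    show "AE s in lborel. ennreal (trace (f n s ** R s ** transpose (f n s))) * indicator {0..T} s \<le> w s" for n
      using dom by (intro AE_I2) (auto simp: indicator_def)
    show "AE s in lborel. (\<lambda>n. ennreal (trace (f n s ** R s ** transpose (f n s))) * indicator {0..T} s) \<longlonglongrightarrow> 0"
      using lim
    proof eventually_elim
      case (elim s)
      show ?case
      proof (cases "s \<in> {0..T}")
        case True
        then have l: "(\<lambda>n. f n s) \<longlonglongrightarrow> 0" using elim by simp
        have "(\<lambda>n. ennreal ((norm (f n s))\<^sup>2 * norm (R s))) \<longlonglongrightarrow> ennreal (0\<^sup>2 * norm (R s))"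
          by (intro tendsto_ennrealI tendsto_intros tendsto_norm_zero l)
        then have "(\<lambda>n. ennreal ((norm (f n s))\<^sup>2 * norm (R s))) \<longlonglongrightarrow> 0" by simp
        then have "(\<lambda>n. ennreal (trace (f n s ** R s ** transpose (f n s)))) \<longlonglongrightarrow> 0"
          by (rule tendsto_sandwich [OF _ _ tendsto_const, rotated 2])
            (auto intro!: always_eventually ennreal_leI trace_form_le_norm)
        then show ?thesis using True by simp
      qed simp
    qed
  qed (use w in auto)
  then show ?thesis by simp
qed

lemma step_approx_continuous:
  fixes c :: "real \<Rightarrow> real^'m^'k"
  assumes c: "continuous_on UNIV c" and T: "0 \<le> T" and e: "0 < e"
  shows "\<exists>g. step_list T g \<and> ito_sq R T (\<lambda>s. step_function g s - c s) \<le> ennreal e"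
proof (cases "T = 0")
  case True
  have "ito_sq R T (\<lambda>s. step_function [] s - c s) = ito_sq R T (\<lambda>s. 0 :: real^'m^'k)"
    by (rule ito_sq_cong) (use True in auto)
  then show ?thesis
    by (intro exI [of _ "[]"]) (simp add: step_list_def ito_sq_def bounded_bilinear.zero_left [OF bounded_bilinear_matmul] trace_def)
next
  case False
  then have T: "0 < T" using T by simp
  define \<rho> where "\<rho> = (LINT s:{0..T}|lborel. norm (R s))"
  have \<rho>: "0 \<le> \<rho>" unfolding \<rho>_def set_lebesgue_integral_def by (intro Bochner_Integration.integral_nonneg) auto
  define d where "d = sqrt (e / (\<rho> + 1))"
  have d: "0 < d" "d\<^sup>2 * \<rho> \<le> e"
    using e \<rho> by (auto simp: d_def field_simps)
  have "uniformly_continuous_on {0..T} c"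
    by (intro compact_uniformly_continuous continuous_on_subset [OF c]) auto
  then obtain r where r: "r > 0" "\<And>s t. s \<in> {0..T} \<Longrightarrow> t \<in> {0..T} \<Longrightarrow> dist t s < r \<Longrightarrow> dist (c t) (c s) < d"
    unfolding uniformly_continuous_on_def using d(1) by metis
  have "\<forall>\<^sub>F n in sequentially. T / real n < r \<and> 0 < n"
    using grid_fine [of T r] r(1) T by (intro eventually_conj eventually_gt_at_top) auto
  then obtain n where n: "T / real n < r" "0 < n"
    using eventually_happens' [OF sequentially_bot] by blast
  define g where "g = map (\<lambda>i. (c (grid T n i), grid T n i, grid T n (Suc i))) [0..<n]"
  have step: "step_function g s = (\<Sum>i<n. indicat_real {grid T n i<..grid T n (Suc i)} s *\<^sub>R c (grid T n i))" for s
    by (simp add: step_function_def g_def o_def interv_sum_list_conv_sum_set_nat atLeast0LessThan)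
  have "ito_sq R T (\<lambda>s. step_function g s - c s) \<le> ennreal (d\<^sup>2 * (LINT s:{0..T}|lborel. norm (R s)))"
  proof (rule ito_sq_le_bound)
    fix s assume s: "0 < s" "s \<le> T"
    obtain i where i: "i < n" "grid T n i < s" "s \<le> grid T n (Suc i)"
      using grid_cell [OF T n(2) s] by blast
    have "step_function g s = c (grid T n i)"
      unfolding step by (rule sum_grid_indicator [OF _ i]) (use T in auto)
    moreover have "grid T n (Suc i) - grid T n i = T / n" by (simp add: add_divide_distrib ring_distribs)
    then have "dist (grid T n i) s < r" using i n by (auto simp: dist_real_def)
    then have "dist (c (grid T n i)) (c s) < d"
      using s grid_bounds [of T i n] i T by (intro r) auto
    ultimately show "norm (step_function g s - c s) \<le> d" by (simp add: dist_norm)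
  qed
  also have "\<dots> \<le> ennreal e" using d(2) unfolding \<rho>_def by (rule ennreal_leI)
  finally show ?thesis
    using T grid_bounds [of T _ n] grid_mono [of T _ _ n]
    by (intro exI [of _ g]) (auto simp: step_list_def g_def simp del: of_nat_Suc)
qed

text \<open>Measurable functions are almost everywhere limits of continuous ones; after truncation these are
  dominated by an integrable multiple of \<open>R\<close>.\<close>

lemma continuous_approx_bounded:
  fixes f :: "real \<Rightarrow> real^'m^'k"
  assumes f: "set_borel_measurable borel {0..T} f" and N: "0 < N" "\<And>s. norm (f s) \<le> N" and e: "0 < e"
  shows "\<exists>c. continuous_on UNIV c \<and> ito_sq R T (\<lambda>s. c s - f s) \<le> ennreal e"
proof -
  let ?F = "\<lambda>s. indicat_real {0..T} s *\<^sub>R f s"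
  have "?F \<in> borel_measurable lebesgue"
    using f unfolding set_borel_measurable_def by (simp add: measurable_completion)
  then have "?F measurable_on UNIV"
    by (simp add: measurable_on_iff_borel_measurable lebesgue_on_UNIV_eq)
  then obtain Z g where Z: "negligible Z" and g: "\<And>n. continuous_on UNIV (g n)"
    and lim: "\<And>s. s \<notin> Z \<Longrightarrow> (\<lambda>n. g n s) \<longlonglongrightarrow> ?F s"
    unfolding measurable_on_def by auto
  (* radial truncation bounds the approximants by N and keeps the limit, which is bounded by N *)
  define clip where "clip = (\<lambda>x :: real^'m^'k. (N / max N (norm x)) *\<^sub>R x)"
  have clip_cont: "continuous_on UNIV clip"
    unfolding clip_def using N(1) by (intro continuous_intros) (auto simp: max_def)
  have clip_bound: "norm (clip x) \<le> N" for x
    using N(1) by (auto simp: clip_def max_def)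
  have clip_id: "clip x = x" if "norm x \<le> N" for x
    using that N(1) by (simp add: clip_def max_def)
  define c where "c n = (\<lambda>s. clip (g n s))" for n
  have c: "continuous_on UNIV (c n)" for n
    unfolding c_def by (rule continuous_on_compose2 [OF clip_cont g]) auto
  have "AE s in lebesgue. s \<notin> Z"
    using Z by (intro AE_not_in) (simp add: negligible_iff_null_sets)
  then have Z': "AE s in lborel. s \<notin> Z" by (simp add: AE_completion_iff)
  have "(\<lambda>n. ito_sq R T (\<lambda>s. c n s - f s)) \<longlonglongrightarrow> 0"
  proof (rule ito_sq_tendsto_0)
    show "set_borel_measurable borel {0..T} (\<lambda>s. c n s - f s)" for n
      by (intro set_borel_measurable_diff f set_borel_measurable_continuous_on continuous_on_subset [OF c]) auto
    show "AE s in lborel. s \<in> {0..T} \<longrightarrow> (\<lambda>n. c n s - f s) \<longlonglongrightarrow> 0"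
      using Z'
    proof eventually_elim
      case (elim s)
      have "(\<lambda>n. clip (g n s)) \<longlonglongrightarrow> clip (?F s)"
        by (rule continuous_on_tendsto_compose [OF clip_cont lim [OF elim]]) auto
      then show ?case
        using clip_id [OF N(2) [of s]] by (auto simp: c_def intro: LIM_zero)
    qed
    let ?w = "\<lambda>s. ennreal ((2 * N)\<^sup>2 * norm (R s)) * indicator {0..T} s"
    have "(\<lambda>s. norm (indicat_real {0..T} s *\<^sub>R R s)) \<in> borel_measurable borel"
      by (rule measurable_compose [OF R_measurable [unfolded set_borel_measurable_def] borel_measurable_norm])
    then have "(\<lambda>s. ennreal ((2 * N)\<^sup>2 * norm (indicat_real {0..T} s *\<^sub>R R s))) \<in> borel_measurable borel" by simp
    moreover have "(\<lambda>s. ennreal ((2 * N)\<^sup>2 * norm (indicat_real {0..T} s *\<^sub>R R s))) = ?w"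
      by (auto simp: indicator_def fun_eq_iff)
    ultimately show "?w \<in> borel_measurable borel" by (simp only:)
    have "(\<integral>\<^sup>+s. ?w s \<partial>lborel) = ennreal (LINT s:{0..T}|lborel. (2 * N)\<^sup>2 * norm (R s))"
      by (rule nn_set_integral_to_LINT) (auto intro: set_integrable_norm [OF R_int])
    then show "(\<integral>\<^sup>+s. ?w s \<partial>lborel) < \<infinity>" by simp
    fix n s assume s: "s \<in> {0..T}"
    have "norm (c n s - f s) \<le> 2 * N"
      using norm_triangle_ineq4 [of "c n s" "f s"] clip_bound [of "g n s"] N(2) [of s] by (simp add: c_def)
    then have "(norm (c n s - f s))\<^sup>2 * norm (R s) \<le> (2 * N)\<^sup>2 * norm (R s)"
      by (intro mult_right_mono power_mono) auto
    then have "trace ((c n s - f s) ** R s ** transpose (c n s - f s)) \<le> (2 * N)\<^sup>2 * norm (R s)"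
      using trace_form_le_norm [of "c n s - f s" "R s"] by linarith
    then show "ennreal (trace ((c n s - f s) ** R s ** transpose (c n s - f s))) \<le> ?w s"
      using s by (auto intro: ennreal_leI)
  qed
  then have "\<forall>\<^sub>F n in sequentially. ito_sq R T (\<lambda>s. c n s - f s) < ennreal e"
    using e by (intro order_tendstoD) auto
  then obtain n where "ito_sq R T (\<lambda>s. c n s - f s) < ennreal e"
    using eventually_happens' [OF sequentially_bot] by blast
  then show ?thesis using c by (intro exI [of _ "c n"]) auto
qed

lemma bounded_approx:
  fixes f :: "real \<Rightarrow> real^'m^'k"
  assumes f: "set_borel_measurable borel {0..T} f" and fin: "ito_sq R T f < \<infinity>" and e: "0 < e"
  shows "\<exists>f' N. set_borel_measurable borel {0..T} f' \<and> 0 < N \<and> (\<forall>s. norm (f' s) \<le> N) \<and>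
    ito_sq R T (\<lambda>s. f' s - f s) \<le> ennreal e"
proof -
  define b where "b n = (\<lambda>s. if norm (f s) \<le> real n then f s else 0)" for n :: nat
  have b: "set_borel_measurable borel {0..T} (b n)" for n
  proof -
    have [measurable]: "(\<lambda>s. indicat_real {0..T} s *\<^sub>R f s) \<in> borel_measurable borel"
      using f by (simp add: set_borel_measurable_def)
    have "(\<lambda>s. indicat_real {0..T} s *\<^sub>R b n s)
        = (\<lambda>s. if norm (indicat_real {0..T} s *\<^sub>R f s) \<le> real n then indicat_real {0..T} s *\<^sub>R f s else 0)"
      by (auto simp: fun_eq_iff b_def indicator_def)
    also have "\<dots> \<in> borel_measurable borel" by measurable
    finally show ?thesis by (simp add: set_borel_measurable_def)
  qed
  have "(\<lambda>n. ito_sq R T (\<lambda>s. b n s - f s)) \<longlonglongrightarrow> 0"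
  proof (rule ito_sq_tendsto_0)
    show "set_borel_measurable borel {0..T} (\<lambda>s. b n s - f s)" for n
      by (intro set_borel_measurable_diff f b)
    show "AE s in lborel. s \<in> {0..T} \<longrightarrow> (\<lambda>n. b n s - f s) \<longlonglongrightarrow> 0"
    proof (intro AE_I2 impI)
      fix s
      obtain k :: nat where k: "norm (f s) \<le> real k" using real_arch_simple by blast
      have "\<forall>\<^sub>F n in sequentially. b n s - f s = 0"
        using eventually_ge_at_top [of k] by eventually_elim (use k in \<open>auto simp: b_def\<close>)
      then show "(\<lambda>n. b n s - f s) \<longlonglongrightarrow> 0" by (rule tendsto_eventually)
    qed
    let ?w = "\<lambda>s. ennreal (trace (f s ** R s ** transpose (f s))) * indicator {0..T} s"
    show "?w \<in> borel_measurable borel" by (rule ito_integrand_measurable [OF f])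
    show "(\<integral>\<^sup>+s. ?w s \<partial>lborel) < \<infinity>" using fin by (simp add: ito_sq_def)
    fix n s assume s: "s \<in> {0..T}"
    have "trace ((b n s - f s) ** R s ** transpose (b n s - f s)) \<le> trace (f s ** R s ** transpose (f s))"
    proof (cases "norm (f s) \<le> real n")
      case True
      then show ?thesis using ito_integrand_nonneg [of s "f s"] ito_integrand_nonneg [of s "0 :: real^'m^'k"] s
        trace_form_scaleR [of 0 "f s" "R s"] by (simp add: b_def)
    next
      case False
      then show ?thesis using trace_form_scaleR [of "-1" "f s" "R s"] by (simp add: b_def)
    qed
    then show "ennreal (trace ((b n s - f s) ** R s ** transpose (b n s - f s))) \<le> ?w s"
      using s by (auto intro: ennreal_leI)
  qed
  then have "\<forall>\<^sub>F n in sequentially. ito_sq R T (\<lambda>s. b n s - f s) < ennreal e"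
    using e by (intro order_tendstoD) auto
  then obtain n where "ito_sq R T (\<lambda>s. b n s - f s) < ennreal e"
    using eventually_happens' [OF sequentially_bot] by blast
  then show ?thesis using b by (intro exI [of _ "b n"] exI [of _ "real n + 1"]) (auto simp: b_def)
qed

text \<open>Truncation, approximation almost everywhere by continuous functions, and sampling on a grid.\<close>

lemma step_function_dense:
  fixes f :: "real \<Rightarrow> real^'m^'k"
  assumes f: "set_borel_measurable borel {0..T} f" and fin: "ito_sq R T f < \<infinity>" and T: "0 \<le> T" and e: "0 < e"
  shows "\<exists>g. step_list T g \<and> ito_sq R T (\<lambda>s. step_function g s - f s) \<le> ennreal e"
proof -
  have e8: "0 < e / 16" using e by simp
  obtain b N where b: "set_borel_measurable borel {0..T} b" "0 < N" "\<And>s. norm (b s) \<le> N"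
    "ito_sq R T (\<lambda>s. b s - f s) \<le> ennreal (e / 16)"
    using bounded_approx [OF f fin e8] by blast
  obtain c where c: "continuous_on UNIV c" "ito_sq R T (\<lambda>s. c s - b s) \<le> ennreal (e / 16)"
    using continuous_approx_bounded [OF b(1-3) e8] by blast
  obtain g where g: "step_list T g" "ito_sq R T (\<lambda>s. step_function g s - c s) \<le> ennreal (e / 16)"
    using step_approx_continuous [OF c(1) T e8] by blast
  have mc: "set_borel_measurable borel {0..T} c"
    by (intro set_borel_measurable_continuous_on continuous_on_subset [OF c(1)]) auto
  note ms = set_borel_measurable_step_function
  have "ito_sq R T (\<lambda>s. step_function g s - b s) \<le> 2 * ennreal (e / 16) + 2 * ennreal (e / 16)"
    by (rule order_trans [OF ito_sq_triangle [OF ms mc b(1)]]) (intro add_mono mult_left_mono g c; simp)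
  also have "\<dots> = ennreal (e / 4)"
    using e by (simp add: ennreal_plus [symmetric] ennreal_mult' [symmetric] flip: ennreal_numeral)
  finally have gb: "ito_sq R T (\<lambda>s. step_function g s - b s) \<le> ennreal (e / 4)" .
  show ?thesis
  proof (intro exI [of _ g] conjI g(1))
    have "ito_sq R T (\<lambda>s. step_function g s - f s) \<le> 2 * ito_sq R T (\<lambda>s. step_function g s - b s) + 2 * ito_sq R T (\<lambda>s. b s - f s)"
      by (rule ito_sq_triangle [OF ms b(1) f])
    also have "\<dots> \<le> 2 * ennreal (e / 4) + 2 * ennreal (e / 4)"
    proof (intro add_mono mult_left_mono)
      show "ito_sq R T (\<lambda>s. step_function g s - b s) \<le> ennreal (e / 4)" by (rule gb)
      show "ito_sq R T (\<lambda>s. b s - f s) \<le> ennreal (e / 4)"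
        by (rule order_trans [OF b(4)]) (use e in \<open>auto intro: ennreal_leI\<close>)
    qed auto
    also have "\<dots> = ennreal e"
      using e by (simp add: ennreal_plus [symmetric] ennreal_mult' [symmetric] flip: ennreal_numeral)
    finally show "ito_sq R T (\<lambda>s. step_function g s - f s) \<le> ennreal e" .
  qed
qed

end

section \<open>Wiener processes: covariance and the Ito isometry\<close>

lemma space_generated_sigma [simp]: "space (generated_sigma M I Y) = space M"
  by (simp add: generated_sigma_def space_measure_of_conv)

lemma sets_generated_sigma:
  "sets (generated_sigma M I Y) = sigma_sets (space M) {Y i -` U \<inter> space M | i U. i \<in> I \<and> U \<in> sets borel}"
  unfolding generated_sigma_def by (rule sets_measure_of) auto

lemma generated_sigma_measurable [intro]:
  "i \<in> I \<Longrightarrow> Y i \<in> borel_measurable (generated_sigma M I Y)"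
  by (rule measurableI) (auto simp: sets_generated_sigma intro!: sigma_sets.Basic)

lemma sets_generated_sigma_subset:
  assumes "\<And>i. i \<in> I \<Longrightarrow> Y i \<in> borel_measurable N" "space N = space M"
  shows "sets (generated_sigma M I Y) \<subseteq> sets N"
proof -
  have "Y i -` U \<inter> space M \<in> sets N" if "i \<in> I" "U \<in> sets borel" for i U
    using measurable_sets [OF assms(1) that(2)] that assms(2) by simp
  then have "sigma_sets (space N) {Y i -` U \<inter> space M | i U. i \<in> I \<and> U \<in> sets borel} \<subseteq> sets N"
    by (intro sets.sigma_sets_subset) auto
  then show ?thesis by (simp add: sets_generated_sigma assms(2))
qed

lemma measurable_finer:
  assumes "f \<in> measurable F N" "space F = space G" "sets F \<subseteq> sets G"
  shows "f \<in> measurable G N"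
  using assms unfolding measurable_def by auto

lemma measurable_generated_sigma_mono:
  assumes "f \<in> borel_measurable (generated_sigma M I Y)" "I \<subseteq> J"
  shows "f \<in> borel_measurable (generated_sigma M J Y)"
proof (rule measurable_finer [OF assms(1)])
  show "sets (generated_sigma M I Y) \<subseteq> sets (generated_sigma M J Y)"
    using assms(2) by (intro sets_generated_sigma_subset generated_sigma_measurable) auto
qed simp

lemma borel_measurable_component [measurable (raw)]:
  "f \<in> borel_measurable N \<Longrightarrow> (\<lambda>x. f x $ i :: real) \<in> borel_measurable N"
  by (rule measurable_compose [OF _ borel_measurable_continuous_onI]) (auto intro!: continuous_intros)

lemma borel_measurable_vecI:
  fixes f :: "'a \<Rightarrow> real^'n"
  assumes "\<And>i. (\<lambda>x. f x $ i) \<in> borel_measurable N"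
  shows "f \<in> borel_measurable N"
  unfolding borel_measurable_euclidean_space [of f]
  using assms by (auto simp: Basis_vec_def inner_axis)

lemma (in prob_space) indep_set_subset:
  "indep_set A B \<Longrightarrow> A' \<subseteq> A \<Longrightarrow> B' \<subseteq> B \<Longrightarrow> indep_set A' B'"
  unfolding indep_set_def by (rule indep_sets_mono_sets) (auto split: bool.split)

lemma (in prob_space) indep_var_of_sets:
  assumes ind: "indep_set (sets F) (sets G)" and F: "space F = space M" and G: "space G = space M"
    and Y: "Y \<in> borel_measurable F" and Z: "Z \<in> borel_measurable G"
  shows "indep_var borel Y borel Z"
proof -
  have sub: "sets F \<subseteq> events" "sets G \<subseteq> events"
    using ind unfolding indep_set_def indep_sets_def UNIV_bool by auto
  have "sigma_sets (space M) {Y -` A \<inter> space M | A. A \<in> sets borel} \<subseteq> sets F"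
    unfolding F [symmetric] by (intro sets.sigma_sets_subset) (use Y in \<open>auto intro: measurable_sets\<close>)
  moreover have "sigma_sets (space M) {Z -` A \<inter> space M | A. A \<in> sets borel} \<subseteq> sets G"
    unfolding G [symmetric] by (intro sets.sigma_sets_subset) (use Z in \<open>auto intro: measurable_sets\<close>)
  ultimately have "indep_set (sigma_sets (space M) {Y -` A \<inter> space M | A. A \<in> sets borel})
      (sigma_sets (space M) {Z -` A \<inter> space M | A. A \<in> sets borel})"
    by (rule indep_set_subset [OF ind])
  moreover have "random_variable borel Y" "random_variable borel Z"
    by (rule measurable_finer [OF Y F sub(1)], rule measurable_finer [OF Z G sub(2)])
  ultimately show ?thesis unfolding indep_var_eq by simp
qed

lemma gaussian_measurable: "gaussian M X m S \<Longrightarrow> X \<in> borel_measurable M"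
  by (simp add: gaussian_def)

lemma (in prob_space) gaussian_moments:
  assumes G: "gaussian M X m S"
  shows "integrable M (\<lambda>\<omega>. a \<bullet> X \<omega>)" "(\<integral>\<omega>. a \<bullet> X \<omega> \<partial>M) = a \<bullet> m"
    "integrable M (\<lambda>\<omega>. (a \<bullet> X \<omega> - a \<bullet> m)\<^sup>2)" "(\<integral>\<omega>. (a \<bullet> X \<omega> - a \<bullet> m)\<^sup>2 \<partial>M) = a \<bullet> (S *v a)"
proof -
  have [measurable]: "X \<in> borel_measurable M" using G by (rule gaussian_measurable)
  have all: "integrable M (\<lambda>\<omega>. a \<bullet> X \<omega>) \<and> (\<integral>\<omega>. a \<bullet> X \<omega> \<partial>M) = a \<bullet> m \<and>
    integrable M (\<lambda>\<omega>. (a \<bullet> X \<omega> - a \<bullet> m)\<^sup>2) \<and> (\<integral>\<omega>. (a \<bullet> X \<omega> - a \<bullet> m)\<^sup>2 \<partial>M) = a \<bullet> (S *v a)"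
  proof (cases "a \<bullet> (S *v a) = 0")
    case True
    then have ae: "AE \<omega> in M. a \<bullet> X \<omega> = a \<bullet> m" using G by (auto simp: gaussian_def)
    then have ae2: "AE \<omega> in M. (a \<bullet> X \<omega> - a \<bullet> m)\<^sup>2 = 0" by eventually_elim simp
    have "integrable M (\<lambda>\<omega>. a \<bullet> X \<omega>)" "integrable M (\<lambda>\<omega>. (a \<bullet> X \<omega> - a \<bullet> m)\<^sup>2)"
      using integrable_cong_AE [OF _ _ ae] integrable_cong_AE [OF _ _ ae2] by simp_all
    moreover have "(\<integral>\<omega>. a \<bullet> X \<omega> \<partial>M) = a \<bullet> m" "(\<integral>\<omega>. (a \<bullet> X \<omega> - a \<bullet> m)\<^sup>2 \<partial>M) = 0"
      using integral_cong_AE [OF _ _ ae] integral_cong_AE [OF _ _ ae2] by (simp_all add: prob_space)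
    ultimately show ?thesis using True by simp
  next
    case False
    define \<sigma> where "\<sigma> = sqrt (a \<bullet> (S *v a))"
    have s0: "0 < \<sigma>" "\<sigma>\<^sup>2 = a \<bullet> (S *v a)"
      using G False by (auto simp: gaussian_def \<sigma>_def less_le)
    have D: "distributed M lborel (\<lambda>\<omega>. a \<bullet> X \<omega>) (\<lambda>x. ennreal (normal_density (a \<bullet> m) \<sigma> x))"
      using G False by (auto simp: gaussian_def \<sigma>_def)
    have "integrable M (\<lambda>\<omega>. a \<bullet> X \<omega>)"
      using distributed_integrable [OF D, of "\<lambda>x. x"] integrable_normal_moment_nz_1 [OF s0(1)] by simp
    moreover have "integrable M (\<lambda>\<omega>. (a \<bullet> X \<omega> - a \<bullet> m)\<^sup>2)"
      using distributed_integrable [OF D, of "\<lambda>x. (x - a \<bullet> m)\<^sup>2"] integrable_normal_moment [OF s0(1), of _ 2] by simp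
    moreover have "(\<integral>\<omega>. a \<bullet> X \<omega> \<partial>M) = a \<bullet> m"
      using distributed_integral [OF D, of "\<lambda>x. x"] integral_normal_moment_nz_1 [OF s0(1)] by simp
    moreover have "(\<integral>\<omega>. (a \<bullet> X \<omega> - a \<bullet> m)\<^sup>2 \<partial>M) = \<sigma>\<^sup>2"
      using distributed_integral [OF D, of "\<lambda>x. (x - a \<bullet> m)\<^sup>2"] integral_normal_moment_even [OF s0(1), of "a \<bullet> m" 1]
      by (simp add: fact_numeral)
    ultimately show ?thesis by (simp add: s0)
  qed
  from all show "integrable M (\<lambda>\<omega>. a \<bullet> X \<omega>)" "(\<integral>\<omega>. a \<bullet> X \<omega> \<partial>M) = a \<bullet> m"
    "integrable M (\<lambda>\<omega>. (a \<bullet> X \<omega> - a \<bullet> m)\<^sup>2)" "(\<integral>\<omega>. (a \<bullet> X \<omega> - a \<bullet> m)\<^sup>2 \<partial>M) = a \<bullet> (S *v a)"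
    by auto
qed

lemma (in prob_space) gaussian_integrable:
  fixes Y :: "'a \<Rightarrow> real^'n"
  assumes "gaussian M Y \<mu> S" shows "integrable M Y"
proof (rule Bochner_Integration.integrable_bound)
  have "integrable M (\<lambda>\<omega>. Y \<omega> $ i)" for i
    using gaussian_moments(1) [OF assms, of "axis i 1"] by (simp add: inner_axis')
  then show "integrable M (\<lambda>\<omega>. \<Sum>i\<in>UNIV. \<bar>Y \<omega> $ i\<bar>)" by simp
  show "Y \<in> borel_measurable M" by (rule gaussian_measurable [OF assms])
  show "AE \<omega> in M. norm (Y \<omega>) \<le> norm (\<Sum>i\<in>UNIV. \<bar>Y \<omega> $ i\<bar>)"
    using norm_le_l1_cart by (intro AE_I2) (auto simp: sum_nonneg)
qed

lemma step_integral_simps [simp]: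
  "step_integral W [] \<omega> = 0"
  "step_integral W ((c, a, b) # g) \<omega> = c *v (W b \<omega> - W a \<omega>) + step_integral W g \<omega>"
  "step_integral W (g @ g') \<omega> = step_integral W g \<omega> + step_integral W g' \<omega>"
  by (auto simp: step_integral_def)

lemma step_function_simps [simp]:
  "step_function [] s = 0"
  "step_function ((c, a, b) # g) s = indicat_real {a<..b} s *\<^sub>R c + step_function g s"
  "step_function (g @ g') s = step_function g s + step_function g' s"
  by (auto simp: step_function_def)

lemma step_list_simps [simp]:
  "step_list T []"
  "step_list T ((c, a, b) # g) \<longleftrightarrow> 0 \<le> a \<and> a \<le> b \<and> b \<le> T \<and> step_list T g"
  "step_list T (g @ g') \<longleftrightarrow> step_list T g \<and> step_list T g'"
  by (simp_all add: step_list_def ball_Un)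

locale wiener = prob_space M + intensity R
  for M :: "'w measure" and R :: "real \<Rightarrow> real^'m^'m" +
  fixes W :: "real \<Rightarrow> 'w \<Rightarrow> real^'m"
  assumes W: "wiener_process M R W"
begin

lemma W_measurable [measurable]: "0 \<le> t \<Longrightarrow> W t \<in> borel_measurable M"
  using W by (simp add: wiener_process_def)

lemma W_0: "AE \<omega> in M. W 0 \<omega> = 0"
  using W by (simp add: wiener_process_def)

lemma W_continuous: "AE \<omega> in M. continuous_on {0..} (\<lambda>t. W t \<omega>)"
  using W by (simp add: wiener_process_def)

lemma W_gaussian: "0 \<le> s \<Longrightarrow> s \<le> t \<Longrightarrow> gaussian M (\<lambda>\<omega>. W t \<omega> - W s \<omega>) 0 (LINT u:{s..t}|lborel. R u)"
  using W by (simp add: wiener_process_def)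

lemma R_int_sub: "0 \<le> s \<Longrightarrow> set_integrable lborel {s..t} R"
  by (rule set_integrable_subset [OF R_int [of t]]) auto

lemma inner_LINT_R:
  assumes "0 \<le> s"
  shows "set_integrable lborel {s..t} (\<lambda>u. x \<bullet> (R u *v y))"
    "x \<bullet> ((LINT u:{s..t}|lborel. R u) *v y) = (LINT u:{s..t}|lborel. x \<bullet> (R u *v y))"
proof -
  have l: "bounded_linear (\<lambda>A :: real^'m^'m. x \<bullet> (A *v y))"
    by (intro bounded_linear_intros bounded_bilinear.bounded_linear_left [OF bounded_bilinear_matvec]
        bounded_linear_compose [OF bounded_linear_inner_right])
  show "set_integrable lborel {s..t} (\<lambda>u. x \<bullet> (R u *v y))"
    by (rule set_integrable_linear [OF l R_int_sub [OF assms]])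
  show "x \<bullet> ((LINT u:{s..t}|lborel. R u) *v y) = (LINT u:{s..t}|lborel. x \<bullet> (R u *v y))"
    using integral_bounded_linear [OF l R_int_sub [OF assms, of t, unfolded set_integrable_def]]
    unfolding set_lebesgue_integral_def
    by (simp add: bounded_bilinear.scaleR_left [OF bounded_bilinear_matvec])
qed

lemma R_symmetric: "0 \<le> u \<Longrightarrow> y \<bullet> (R u *v x) = x \<bullet> (R u *v y)"
  using inner_matvec_transpose [of "R u" y x] pos_def_symmetric [OF R_pos, of u] by (simp only: inner_commute)

lemma increment_integrable:
  assumes "0 \<le> s" "s \<le> t"
  shows "integrable M (\<lambda>\<omega>. x \<bullet> (W t \<omega> - W s \<omega>))" "(\<integral>\<omega>. x \<bullet> (W t \<omega> - W s \<omega>) \<partial>M) = 0"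
    "integrable M (\<lambda>\<omega>. (x \<bullet> (W t \<omega> - W s \<omega>))\<^sup>2)"
    "(\<integral>\<omega>. (x \<bullet> (W t \<omega> - W s \<omega>))\<^sup>2 \<partial>M) = (LINT u:{s..t}|lborel. x \<bullet> (R u *v x))"
  using gaussian_moments [OF W_gaussian [OF assms], of x] inner_LINT_R(2) [OF assms(1), of x t x] by auto

lemma increment_variance:
  assumes "0 \<le> s" "s \<le> t"
  shows "has_bochner_integral M (\<lambda>\<omega>. (x \<bullet> (W t \<omega> - W s \<omega>)) * (y \<bullet> (W t \<omega> - W s \<omega>)))
    (LINT u:{s..t}|lborel. x \<bullet> (R u *v y))"
proof -
  let ?D = "\<lambda>\<omega>. W t \<omega> - W s \<omega>"
  have [measurable]: "?D \<in> borel_measurable M" using assms by simp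
  have hb: "has_bochner_integral M (\<lambda>\<omega>. (z \<bullet> ?D \<omega>)\<^sup>2) (LINT u:{s..t}|lborel. z \<bullet> (R u *v z))" for z
    using increment_integrable [OF assms, of z] by (simp add: has_bochner_integral_iff)
  have hl: "has_bochner_integral lborel (\<lambda>u. indicator {s..t} u *\<^sub>R (z \<bullet> (R u *v z'))) (LINT u:{s..t}|lborel. z \<bullet> (R u *v z'))" for z z'
    using inner_LINT_R(1) [OF assms(1), of t z z'] unfolding set_integrable_def set_lebesgue_integral_def
    by (simp add: has_bochner_integral_iff)
  have "has_bochner_integral M (\<lambda>\<omega>. ((x + y) \<bullet> ?D \<omega>)\<^sup>2 - (x \<bullet> ?D \<omega>)\<^sup>2 - (y \<bullet> ?D \<omega>)\<^sup>2)
    ((LINT u:{s..t}|lborel. (x + y) \<bullet> (R u *v (x + y))) - (LINT u:{s..t}|lborel. x \<bullet> (R u *v x)) - (LINT u:{s..t}|lborel. y \<bullet> (R u *v y)))"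
    by (intro has_bochner_integral_diff hb)
  moreover have "has_bochner_integral lborel (\<lambda>u. indicator {s..t} u *\<^sub>R ((x + y) \<bullet> (R u *v (x + y)))
      - indicator {s..t} u *\<^sub>R (x \<bullet> (R u *v x)) - indicator {s..t} u *\<^sub>R (y \<bullet> (R u *v y)))
    ((LINT u:{s..t}|lborel. (x + y) \<bullet> (R u *v (x + y))) - (LINT u:{s..t}|lborel. x \<bullet> (R u *v x)) - (LINT u:{s..t}|lborel. y \<bullet> (R u *v y)))"
    by (intro has_bochner_integral_diff hl)
  moreover have "(\<lambda>u. indicator {s..t} u *\<^sub>R ((x + y) \<bullet> (R u *v (x + y)))
      - indicator {s..t} u *\<^sub>R (x \<bullet> (R u *v x)) - indicator {s..t} u *\<^sub>R (y \<bullet> (R u *v y)))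
      = (\<lambda>u. 2 * (indicator {s..t} u *\<^sub>R (x \<bullet> (R u *v y))))"
    using assms R_symmetric [of _ y x]
    by (auto simp: fun_eq_iff indicator_def matrix_vector_right_distrib inner_simps)
  ultimately have "(LINT u:{s..t}|lborel. (x + y) \<bullet> (R u *v (x + y))) - (LINT u:{s..t}|lborel. x \<bullet> (R u *v x)) - (LINT u:{s..t}|lborel. y \<bullet> (R u *v y))
      = 2 * (LINT u:{s..t}|lborel. x \<bullet> (R u *v y))"
    using has_bochner_integral_mult_right [OF hl [of x y], of 2] has_bochner_integral_eq by (metis (lifting))
  moreover have "((x + y) \<bullet> ?D \<omega>)\<^sup>2 - (x \<bullet> ?D \<omega>)\<^sup>2 - (y \<bullet> ?D \<omega>)\<^sup>2 = 2 * ((x \<bullet> ?D \<omega>) * (y \<bullet> ?D \<omega>))" for \<omega>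
    by (simp add: inner_add_left power2_eq_square algebra_simps)
  ultimately have "has_bochner_integral M (\<lambda>\<omega>. 2 * ((x \<bullet> ?D \<omega>) * (y \<bullet> ?D \<omega>))) (2 * (LINT u:{s..t}|lborel. x \<bullet> (R u *v y)))"
    using \<open>has_bochner_integral M (\<lambda>\<omega>. ((x + y) \<bullet> ?D \<omega>)\<^sup>2 - (x \<bullet> ?D \<omega>)\<^sup>2 - (y \<bullet> ?D \<omega>)\<^sup>2) _\<close> by simp
  from has_bochner_integral_mult_right [OF this, of "1/2"] show ?thesis by simp
qed

lemma increment_indep:
  assumes "0 \<le> s" "s \<le> t" and Y: "Y \<in> borel_measurable (generated_sigma M {0..s} W)" "integrable M Y"
  shows "has_bochner_integral M (\<lambda>\<omega>. Y \<omega> * (x \<bullet> (W t \<omega> - W s \<omega>))) 0"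
proof -
  let ?G = "generated_sigma M {()} (\<lambda>_ \<omega>. W t \<omega> - W s \<omega>)"
  have ind: "indep_set (sets (generated_sigma M {0..s} W)) (sets ?G)"
    using W assms by (simp add: wiener_process_def)
  have "(\<lambda>_ \<omega>. W t \<omega> - W s \<omega>) () \<in> borel_measurable ?G" by (rule generated_sigma_measurable) simp
  then have [measurable]: "(\<lambda>\<omega>. W t \<omega> - W s \<omega>) \<in> borel_measurable ?G" by simp
  have "(\<lambda>\<omega>. x \<bullet> (W t \<omega> - W s \<omega>)) \<in> borel_measurable ?G" by measurable
  then have iv: "indep_var borel Y borel (\<lambda>\<omega>. x \<bullet> (W t \<omega> - W s \<omega>))"
    by (intro indep_var_of_sets [OF ind _ _ Y(1)]) auto
  show ?thesis
    using indep_var_integrable [OF iv Y(2) increment_integrable(1) [OF assms(1,2), of x]]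
      indep_var_lebesgue_integral [OF iv Y(2) increment_integrable(1) [OF assms(1,2), of x]]
      increment_integrable(2) [OF assms(1,2), of x]
    by (simp add: has_bochner_integral_iff)
qed

text \<open>The relation \<open>E F = \<integral>\<^sub>0\<^sup>T f\<close> is isolated because it is closed under linear combinations: the isometry
  for step functions then follows from the covariance of \<open>W\<close> by bilinearity.\<close>

definition isometric :: "real \<Rightarrow> ('w \<Rightarrow> real) \<Rightarrow> (real \<Rightarrow> real) \<Rightarrow> bool" where
  "isometric T F f \<longleftrightarrow> (\<exists>v. has_bochner_integral M F v \<and>
     has_bochner_integral lborel (\<lambda>s. indicat_real {0..T} s * f s) v)"

lemma isometric_add: "isometric T F f \<Longrightarrow> isometric T G g \<Longrightarrow> isometric T (\<lambda>\<omega>. F \<omega> + G \<omega>) (\<lambda>s. f s + g s)"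
  unfolding isometric_def distrib_left by (elim exE conjE) (rule exI, rule conjI; erule (1) has_bochner_integral_add)

lemma isometric_diff: "isometric T F f \<Longrightarrow> isometric T G g \<Longrightarrow> isometric T (\<lambda>\<omega>. F \<omega> - G \<omega>) (\<lambda>s. f s - g s)"
  unfolding isometric_def right_diff_distrib by (elim exE conjE) (rule exI, rule conjI; erule (1) has_bochner_integral_diff)

lemma isometric_0: "isometric T (\<lambda>\<omega>. 0) (\<lambda>s. 0)"
  unfolding isometric_def by (auto intro!: exI [of _ 0])

lemma isometric_sum: "finite K \<Longrightarrow> (\<And>k. k \<in> K \<Longrightarrow> isometric T (F k) (f k)) \<Longrightarrow>
    isometric T (\<lambda>\<omega>. \<Sum>k\<in>K. F k \<omega>) (\<lambda>s. \<Sum>k\<in>K. f k s)"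
  by (induction K rule: finite_induct) (auto intro: isometric_0 isometric_add)

text \<open>Write \<open>W\<^sub>t - W\<^sub>0 = (W\<^sub>s - W\<^sub>0) + (W\<^sub>t - W\<^sub>s)\<close>; the last increment is orthogonal to the past.\<close>

lemma covariance:
  assumes "0 \<le> s" "s \<le> t" "t \<le> T"
  shows "isometric T (\<lambda>\<omega>. (x \<bullet> (W s \<omega> - W 0 \<omega>)) * (y \<bullet> (W t \<omega> - W 0 \<omega>)))
    (\<lambda>u. indicat_real {0<..s} u * indicat_real {0<..t} u * (x \<bullet> (R u *v y)))"
proof -
  let ?v = "LINT u:{0..s}|lborel. x \<bullet> (R u *v y)"
  have Y: "(\<lambda>\<omega>. x \<bullet> (W s \<omega> - W 0 \<omega>)) \<in> borel_measurable (generated_sigma M {0..s} W)"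
    using assms generated_sigma_measurable [of s "{0..s}" W M] generated_sigma_measurable [of 0 "{0..s}" W M] by simp
  have "has_bochner_integral M (\<lambda>\<omega>. (x \<bullet> (W s \<omega> - W 0 \<omega>)) * (y \<bullet> (W s \<omega> - W 0 \<omega>))
      + (x \<bullet> (W s \<omega> - W 0 \<omega>)) * (y \<bullet> (W t \<omega> - W s \<omega>))) (?v + 0)"
    by (intro has_bochner_integral_add increment_variance increment_indep Y increment_integrable)
      (use assms in auto)
  moreover have "(x \<bullet> (W s \<omega> - W 0 \<omega>)) * (y \<bullet> (W s \<omega> - W 0 \<omega>))
      + (x \<bullet> (W s \<omega> - W 0 \<omega>)) * (y \<bullet> (W t \<omega> - W s \<omega>)) = (x \<bullet> (W s \<omega> - W 0 \<omega>)) * (y \<bullet> (W t \<omega> - W 0 \<omega>))" for \<omega>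
    by (simp add: distrib_left [symmetric] inner_add_right [symmetric])
  ultimately have 1: "has_bochner_integral M (\<lambda>\<omega>. (x \<bullet> (W s \<omega> - W 0 \<omega>)) * (y \<bullet> (W t \<omega> - W 0 \<omega>))) ?v"
    by simp
  have m: "(\<lambda>u. indicator {0..t} u *\<^sub>R (x \<bullet> (R u *v y))) \<in> borel_measurable lborel" for t
    using inner_LINT_R(1) [of 0 t x y] unfolding set_integrable_def by (intro borel_measurable_integrable) simp
  have "has_bochner_integral lborel (\<lambda>u. indicator {0..s} u *\<^sub>R (x \<bullet> (R u *v y))) ?v"
    using inner_LINT_R(1) [of 0 s x y] unfolding set_integrable_def set_lebesgue_integral_def
    by (simp add: has_bochner_integral_iff)
  then have 2: "has_bochner_integral lborel
      (\<lambda>u. indicat_real {0..T} u * (indicat_real {0<..s} u * indicat_real {0<..t} u * (x \<bullet> (R u *v y)))) ?v"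
  proof (rule has_bochner_integralI_AE)
    have "(\<lambda>u. indicat_real {0..T} u * (indicat_real {0<..s} u * indicat_real {0<..t} u * (x \<bullet> (R u *v y))))
        = (\<lambda>u. indicat_real {0<..s} u * (indicator {0..s} u *\<^sub>R (x \<bullet> (R u *v y))))"
      using assms by (auto simp: fun_eq_iff indicator_def)
    then show "(\<lambda>u. indicat_real {0..T} u * (indicat_real {0<..s} u * indicat_real {0<..t} u * (x \<bullet> (R u *v y)))) \<in> borel_measurable lborel"
      using m [of s] by simp
    show "AE u in lborel. indicator {0..s} u *\<^sub>R (x \<bullet> (R u *v y)) = indicat_real {0..T} u * (indicat_real {0<..s} u * indicat_real {0<..t} u * (x \<bullet> (R u *v y)))"
      by (rule AE_mp [OF AE_lborel_singleton [of 0]], rule AE_I2) (use assms in \<open>auto simp: indicator_def\<close>)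
  qed
  show ?thesis unfolding isometric_def using 1 2 by blast
qed

lemma covariance':
  assumes "0 \<le> s" "0 \<le> t" "s \<le> T" "t \<le> T"
  shows "isometric T (\<lambda>\<omega>. (x \<bullet> (W s \<omega> - W 0 \<omega>)) * (y \<bullet> (W t \<omega> - W 0 \<omega>)))
    (\<lambda>u. indicat_real {0<..s} u * indicat_real {0<..t} u * (x \<bullet> (R u *v y)))"
proof (cases "s \<le> t")
  case True
  then show ?thesis using covariance assms by blast
next
  case False
  have 1: "isometric T (\<lambda>\<omega>. (y \<bullet> (W t \<omega> - W 0 \<omega>)) * (x \<bullet> (W s \<omega> - W 0 \<omega>)))
    (\<lambda>u. indicat_real {0<..t} u * indicat_real {0<..s} u * (y \<bullet> (R u *v x)))"
    using False by (intro covariance) (use assms in auto)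
  have 2: "indicat_real {0<..t} u * indicat_real {0<..s} u * (y \<bullet> (R u *v x))
      = indicat_real {0<..s} u * indicat_real {0<..t} u * (x \<bullet> (R u *v y))" for u
    using R_symmetric [of u y x] by (auto simp: indicator_def)
  have 3: "(y \<bullet> (W t \<omega> - W 0 \<omega>)) * (x \<bullet> (W s \<omega> - W 0 \<omega>)) = (x \<bullet> (W s \<omega> - W 0 \<omega>)) * (y \<bullet> (W t \<omega> - W 0 \<omega>))" for \<omega>
    by (rule mult.commute)
  show ?thesis using 1 unfolding 2 3 .
qed

lemma increment_covariance:
  assumes "0 \<le> a" "a \<le> b" "b \<le> T" "0 \<le> a'" "a' \<le> b'" "b' \<le> T"
  shows "isometric T (\<lambda>\<omega>. (x \<bullet> (W b \<omega> - W a \<omega>)) * (y \<bullet> (W b' \<omega> - W a' \<omega>)))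
    (\<lambda>u. indicat_real {a<..b} u * indicat_real {a'<..b'} u * (x \<bullet> (R u *v y)))"
proof -
  let ?X = "\<lambda>s \<omega>. x \<bullet> (W s \<omega> - W 0 \<omega>)" and ?Y = "\<lambda>s \<omega>. y \<bullet> (W s \<omega> - W 0 \<omega>)"
  let ?i = "\<lambda>s. indicat_real {0<..s}" and ?r = "\<lambda>u. x \<bullet> (R u *v y)"
  have "isometric T (\<lambda>\<omega>. (?X b \<omega> * ?Y b' \<omega> - ?X b \<omega> * ?Y a' \<omega>) - (?X a \<omega> * ?Y b' \<omega> - ?X a \<omega> * ?Y a' \<omega>))
    (\<lambda>u. (?i b u * ?i b' u * ?r u - ?i b u * ?i a' u * ?r u) - (?i a u * ?i b' u * ?r u - ?i a u * ?i a' u * ?r u))"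
    by (intro isometric_diff covariance') (use assms in auto)
  moreover have "(\<lambda>\<omega>. (?X b \<omega> * ?Y b' \<omega> - ?X b \<omega> * ?Y a' \<omega>) - (?X a \<omega> * ?Y b' \<omega> - ?X a \<omega> * ?Y a' \<omega>))
    = (\<lambda>\<omega>. (x \<bullet> (W b \<omega> - W a \<omega>)) * (y \<bullet> (W b' \<omega> - W a' \<omega>)))"
    by (simp add: fun_eq_iff inner_diff_right algebra_simps)
  moreover have ind: "indicat_real {p<..q} u = ?i q u - ?i p u" if "0 \<le> p" "p \<le> q" for p q u :: real
    using that by (auto simp: indicator_def)
  have "(\<lambda>u. (?i b u * ?i b' u * ?r u - ?i b u * ?i a' u * ?r u) - (?i a u * ?i b' u * ?r u - ?i a u * ?i a' u * ?r u))
    = (\<lambda>u. indicat_real {a<..b} u * indicat_real {a'<..b'} u * (x \<bullet> (R u *v y)))"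
    unfolding ind [OF assms(1,2)] ind [OF assms(4,5)] by (simp add: fun_eq_iff algebra_simps)
  ultimately show ?thesis by simp
qed

lemma step_isometric:
  fixes g h :: "((real^'m^'k) \<times> real \<times> real) list"
  assumes "step_list T g" "step_list T h"
  shows "isometric T (\<lambda>\<omega>. step_integral W g \<omega> \<bullet> step_integral W h \<omega>)
    (\<lambda>s. trace (step_function g s ** R s ** transpose (step_function h s)))"
proof -
  let ?t = "\<lambda>c d s. \<Sum>k\<in>UNIV. c $ k \<bullet> (R s *v (d $ k))"
  have one: "isometric T (\<lambda>\<omega>. (c *v (W b \<omega> - W a \<omega>)) \<bullet> (d *v (W b' \<omega> - W a' \<omega>)))
      (\<lambda>s. ?t (indicat_real {a<..b} s *\<^sub>R c) (indicat_real {a'<..b'} s *\<^sub>R d) s)"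
    if "0 \<le> a" "a \<le> b" "b \<le> T" "0 \<le> a'" "a' \<le> b'" "b' \<le> T" for a b a' b' and c d :: "real^'m^'k"
  proof -
    have "isometric T (\<lambda>\<omega>. \<Sum>k\<in>UNIV. (c $ k \<bullet> (W b \<omega> - W a \<omega>)) * (d $ k \<bullet> (W b' \<omega> - W a' \<omega>)))
      (\<lambda>s. \<Sum>k\<in>UNIV. indicat_real {a<..b} s * indicat_real {a'<..b'} s * (c $ k \<bullet> (R s *v (d $ k))))"
      by (intro isometric_sum increment_covariance that) auto
    moreover have "?t (i *\<^sub>R c) (j *\<^sub>R d) s = (\<Sum>k\<in>UNIV. i * j * (c $ k \<bullet> (R s *v (d $ k))))" for i j s :: real
      by (simp add: matrix_vector_mult_scaleR mult.assoc mult.left_commute)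
    moreover have "(c *v p) \<bullet> (d *v q) = (\<Sum>k\<in>UNIV. (c $ k \<bullet> p) * (d $ k \<bullet> q))" for p q
      by (simp add: inner_vec_def [of "_ *v _"] matrix_vector_mul_component)
    ultimately show ?thesis by (simp only:)
  qed
  have row: "isometric T (\<lambda>\<omega>. (c *v (W b \<omega> - W a \<omega>)) \<bullet> step_integral W h \<omega>)
      (\<lambda>s. ?t (indicat_real {a<..b} s *\<^sub>R c) (step_function h s) s)"
    if "0 \<le> a" "a \<le> b" "b \<le> T" for a b and c :: "real^'m^'k"
    using assms(2)
  proof (induction h)
    case Nil
    then show ?case by (simp add: isometric_0)
  next
    case (Cons p h)
    obtain d a' b' where p: "p = (d, a', b')" by (cases p)
    have 1: "isometric T (\<lambda>\<omega>. (c *v (W b \<omega> - W a \<omega>)) \<bullet> (d *v (W b' \<omega> - W a' \<omega>)) + (c *v (W b \<omega> - W a \<omega>)) \<bullet> step_integral W h \<omega>)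
      (\<lambda>s. ?t (indicat_real {a<..b} s *\<^sub>R c) (indicat_real {a'<..b'} s *\<^sub>R d) s + ?t (indicat_real {a<..b} s *\<^sub>R c) (step_function h s) s)"
      by (rule isometric_add [OF one Cons.IH]) (use that Cons.prems p in auto)
    have 2: "?t c' (d1 + d2) s = ?t c' d1 s + ?t c' d2 s" for c' d1 d2 :: "real^'m^'k" and s
      by (simp add: matrix_vector_right_distrib inner_add_right sum.distrib)
    show ?case using 1 unfolding p step_integral_simps step_function_simps inner_add_right 2 .
  qed
  show ?thesis
    unfolding trace_form using assms(1)
  proof (induction g)
    case Nil
    then show ?case by (simp add: isometric_0)
  next
    case (Cons p g)
    obtain c a b where p: "p = (c, a, b)" by (cases p)
    have 1: "isometric T (\<lambda>\<omega>. (c *v (W b \<omega> - W a \<omega>)) \<bullet> step_integral W h \<omega> + step_integral W g \<omega> \<bullet> step_integral W h \<omega>)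
      (\<lambda>s. ?t (indicat_real {a<..b} s *\<^sub>R c) (step_function h s) s + ?t (step_function g s) (step_function h s) s)"
      by (rule isometric_add [OF row Cons.IH]) (use Cons.prems p in auto)
    have 2: "?t (c1 + c2) d s = ?t c1 d s + ?t c2 d s" for c1 c2 d :: "real^'m^'k" and s
      by (simp add: inner_add_left sum.distrib)
    show ?case using 1 unfolding p step_integral_simps step_function_simps inner_add_left 2 .
  qed
qed

lemma step_integral_measurable [measurable]:
  "step_list T g \<Longrightarrow> step_integral W g \<in> borel_measurable M"
proof (induction g)
  case Nil
  then show ?case by (simp add: step_integral_def [abs_def])
next
  case (Cons p g)
  obtain c a b where p: "p = (c, a, b)" by (cases p)
  have "step_integral W (p # g) = (\<lambda>\<omega>. c *v (W b \<omega> - W a \<omega>) + step_integral W g \<omega>)"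
    by (auto simp: p)
  then show ?case using Cons p by simp
qed

lemma step_ito_isometry:
  assumes g: "step_list T g"
  shows "integrable M (\<lambda>\<omega>. (norm (step_integral W g \<omega>))\<^sup>2)"
    "ito_sq R T (step_function g) = ennreal (\<integral>\<omega>. (norm (step_integral W g \<omega>))\<^sup>2 \<partial>M)"
    "(\<integral>\<^sup>+\<omega>. ennreal ((norm (step_integral W g \<omega>))\<^sup>2) \<partial>M) = ito_sq R T (step_function g)"
proof -
  let ?f = "\<lambda>s. trace (step_function g s ** R s ** transpose (step_function g s))"
  obtain v where v: "has_bochner_integral M (\<lambda>\<omega>. (norm (step_integral W g \<omega>))\<^sup>2) v"
    "has_bochner_integral lborel (\<lambda>s. indicat_real {0..T} s * ?f s) v"
    using step_isometric [OF g g] unfolding isometric_def by (auto simp: power2_norm_eq_inner)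
  then show i: "integrable M (\<lambda>\<omega>. (norm (step_integral W g \<omega>))\<^sup>2)" by (auto simp: has_bochner_integral_iff)
  have "ito_sq R T (step_function g) = (\<integral>\<^sup>+s. ennreal (indicat_real {0..T} s * ?f s) \<partial>lborel)"
    unfolding ito_sq_def by (intro nn_integral_cong) (auto simp: indicator_def)
  also have "\<dots> = ennreal v"
    using v(2) ito_integrand_nonneg
    by (subst nn_integral_eq_integral) (auto simp: has_bochner_integral_iff indicator_def)
  finally show 1: "ito_sq R T (step_function g) = ennreal (\<integral>\<omega>. (norm (step_integral W g \<omega>))\<^sup>2 \<partial>M)"
    using v(1) by (simp add: has_bochner_integral_iff)
  show "(\<integral>\<^sup>+\<omega>. ennreal ((norm (step_integral W g \<omega>))\<^sup>2) \<partial>M) = ito_sq R T (step_function g)"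
    unfolding 1 by (rule nn_integral_eq_integral [OF i]) auto
qed

lemma step_integral_square_integrable:
  assumes "step_list T g"
  shows "integrable M (\<lambda>\<omega>. (step_integral W g \<omega> $ i)\<^sup>2)"
proof (rule Bochner_Integration.integrable_bound [OF step_ito_isometry(1) [OF assms]])
  have [measurable]: "step_integral W g \<in> borel_measurable M" by (rule step_integral_measurable [OF assms])
  show "(\<lambda>\<omega>. (step_integral W g \<omega> $ i)\<^sup>2) \<in> borel_measurable M" by measurable
  show "AE \<omega> in M. norm ((step_integral W g \<omega> $ i)\<^sup>2) \<le> norm ((norm (step_integral W g \<omega>))\<^sup>2)"
    using component_le_norm_cart by (auto intro!: AE_I2 simp: abs_le_square_iff [symmetric])
qed

end

lemma wienerI:
  assumes "prob_space M" "wiener_process M R W" "\<And>t. 0 \<le> t \<Longrightarrow> pos_def (R t)"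
  shows "wiener M R W"
proof -
  have "set_integrable lborel {0..t} R" for t
    using assms(2) by (cases "0 \<le> t") (auto simp: wiener_process_def set_integrable_def)
  then show ?thesis
    using assms unfolding wiener_def wiener_axioms_def intensity_def by auto
qed

section \<open>A maximal inequality for step integrals\<close>

text \<open>Stops the step integral at time \<open>t\<close>: its intervals are cut off at \<open>t\<close>, so that \<open>t \<mapsto> step_integral W (cut_list t g)\<close>
  is the integral as a process.\<close>

definition cut_list :: "real \<Rightarrow> ('c \<times> real \<times> real) list \<Rightarrow> ('c \<times> real \<times> real) list" where
  "cut_list t g = map (\<lambda>(c, a, b). (c, min a t, min b t)) g"

definition map_list :: "('c \<Rightarrow> 'd) \<Rightarrow> ('c \<times> real \<times> real) list \<Rightarrow> ('d \<times> real \<times> real) list" where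
  "map_list F g = map (\<lambda>(c, a, b). (F c, a, b)) g"

lemma cut_list_simps [simp]:
  "cut_list t [] = []" "cut_list t ((c, a, b) # g) = (c, min a t, min b t) # cut_list t g"
  "cut_list t (g @ g') = cut_list t g @ cut_list t g'"
  by (auto simp: cut_list_def)

lemma map_list_simps [simp]:
  "map_list F [] = []" "map_list F ((c, a, b) # g) = (F c, a, b) # map_list F g"
  "map_list F (g @ g') = map_list F g @ map_list F g'"
  by (auto simp: map_list_def)

lemma step_list_induct [consumes 1, case_names Nil Cons]:
  assumes "step_list T g" "P []"
    "\<And>c a b g. 0 \<le> a \<Longrightarrow> a \<le> b \<Longrightarrow> b \<le> T \<Longrightarrow> step_list T g \<Longrightarrow> P g \<Longrightarrow> P ((c, a, b) # g)"
  shows "P g"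
  using assms(1)
proof (induction g)
  case (Cons p g)
  then show ?case using assms(3) by (cases p) auto
qed (rule assms(2))

lemma step_list_cut: "step_list T g \<Longrightarrow> 0 \<le> t \<Longrightarrow> step_list t (cut_list t g)"
  by (induction rule: step_list_induct) auto

lemma step_list_mono: "step_list u g \<Longrightarrow> u \<le> T \<Longrightarrow> step_list T g"
  by (induction rule: step_list_induct) auto

lemma step_list_map [simp]: "step_list T (map_list F g) \<longleftrightarrow> step_list T g"
  by (induction g) auto

lemma step_function_cut: "step_function (cut_list t g) s = indicat_real {..t} s *\<^sub>R step_function g s"
  by (induction g) (auto simp: indicator_def)

lemma cut_cut: "s \<le> t \<Longrightarrow> cut_list s (cut_list t g) = cut_list s g"
  by (induction g) auto

lemma cut_map: "cut_list t (map_list F g) = map_list F (cut_list t g)"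
  by (induction g) auto

lemma step_integral_map:
  "step_integral W (map_list ((**) F) g) \<omega> = F *v step_integral W g \<omega>"
  by (induction g) (auto simp: matrix_vector_mul_assoc matrix_vector_right_distrib)

lemma step_function_map: "step_function (map_list ((**) F) g) s = F ** step_function g s"
  by (induction g) (auto simp: matrix_add_ldistrib bounded_bilinear.zero_right [OF bounded_bilinear_matmul]
      bounded_bilinear.scaleR_right [OF bounded_bilinear_matmul])

lemma step_integral_neg: "step_integral W (map_list uminus g) \<omega> = - step_integral W g \<omega>"
  by (induction g) (auto simp: bounded_bilinear.minus_left [OF bounded_bilinear_matvec])

lemma step_function_neg: "step_function (map_list uminus g) s = - step_function g s"
  by (induction g) auto

lemma step_integral_generated:
  "step_list t g \<Longrightarrow> step_integral Y g \<in> borel_measurable (generated_sigma M {0..t} Y)"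
proof (induction rule: step_list_induct)
  case Nil
  then show ?case by (simp add: step_integral_def [abs_def])
next
  case (Cons c a b g)
  have [measurable]: "Y a \<in> borel_measurable (generated_sigma M {0..t} Y)" "Y b \<in> borel_measurable (generated_sigma M {0..t} Y)"
    using Cons by (auto intro!: generated_sigma_measurable)
  have "step_integral Y ((c, a, b) # g) = (\<lambda>\<omega>. c *v (Y b \<omega> - Y a \<omega>) + step_integral Y g \<omega>)" by auto
  then show ?case using Cons by simp
qed

context wiener
begin

text \<open>After stopping at \<open>s\<close> only increments beyond \<open>s\<close> remain, and these are orthogonal to the past: the
  stopped integrals form a martingale.\<close>

lemma cut_orthogonal:
  assumes s: "0 \<le> s" and Y: "Y \<in> borel_measurable (generated_sigma M {0..s} W)" "integrable M Y"
  shows "step_list T g \<Longrightarrow>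
    has_bochner_integral M (\<lambda>\<omega>. Y \<omega> * (x \<bullet> (step_integral W g \<omega> - step_integral W (cut_list s g) \<omega>))) 0"
proof (induction rule: step_list_induct)
  case Nil
  then show ?case by (simp add: has_bochner_integral_zero)
next
  case (Cons c a b g)
  have incr: "(W b \<omega> - W a \<omega>) - (W (min b s) \<omega> - W (min a s) \<omega>) = W (max b s) \<omega> - W (max a s) \<omega>" for \<omega>
    using Cons(2) by (auto simp: min_def max_def)
  have "has_bochner_integral M (\<lambda>\<omega>. Y \<omega> * ((transpose c *v x) \<bullet> (W (max b s) \<omega> - W (max a s) \<omega>))
      + Y \<omega> * (x \<bullet> (step_integral W g \<omega> - step_integral W (cut_list s g) \<omega>))) (0 + 0)"
  proof (intro has_bochner_integral_add Cons.IH increment_indep Y(2))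
    show "Y \<in> borel_measurable (generated_sigma M {0..max a s} W)"
      by (rule measurable_generated_sigma_mono [OF Y(1)]) auto
  qed (use s Cons in auto)
  moreover have "Y \<omega> * ((transpose c *v x) \<bullet> (W (max b s) \<omega> - W (max a s) \<omega>))
      + Y \<omega> * (x \<bullet> (step_integral W g \<omega> - step_integral W (cut_list s g) \<omega>))
      = Y \<omega> * (x \<bullet> (step_integral W ((c, a, b) # g) \<omega> - step_integral W (cut_list s ((c, a, b) # g)) \<omega>))" for \<omega>
  proof -
    have "step_integral W ((c, a, b) # g) \<omega> - step_integral W (cut_list s ((c, a, b) # g)) \<omega>
      = c *v ((W b \<omega> - W a \<omega>) - (W (min b s) \<omega> - W (min a s) \<omega>)) + (step_integral W g \<omega> - step_integral W (cut_list s g) \<omega>)"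
      by (simp add: bounded_bilinear.diff_right [OF bounded_bilinear_matvec])
    then show ?thesis unfolding incr by (simp only: inner_matvec_transpose inner_add_right distrib_left)
  qed
  ultimately show ?case by simp
qed

text \<open>Kolmogorov's inequality: split according to the first grid point at which the step integral is
  large; the later increments are orthogonal to that event.\<close>

lemma maximal_inequality_grid:
  fixes g :: "((real^'m^'k) \<times> real \<times> real) list"
  assumes g: "step_list T g" and T: "0 \<le> T" and l: "0 < l"
  shows "l\<^sup>2 * prob {\<omega>\<in>space M. \<exists>i\<in>{..m}. l \<le> norm (step_integral W (cut_list (grid T m i) g) \<omega>)}
    \<le> (\<integral>\<omega>. (norm (step_integral W g \<omega>))\<^sup>2 \<partial>M)"
proof -
  let ?S = "\<lambda>i. step_integral W (cut_list (grid T m i) g)" and ?Z = "\<lambda>\<omega>. (norm (step_integral W g \<omega>))\<^sup>2"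
  define A where "A k = {\<omega>\<in>space M. l \<le> norm (?S k \<omega>) \<and> (\<forall>j\<in>{..<k}. norm (?S j \<omega>) < l)}" for k
  have t: "0 \<le> grid T m i" for i using T by simp
  have S_meas: "?S j \<in> borel_measurable (generated_sigma M {0..grid T m k} W)" if "j \<le> k" for j k
    by (rule measurable_generated_sigma_mono [OF step_integral_generated [OF step_list_cut [OF g t]]])
      (use grid_mono [OF T that, of m] in auto)
  have sub: "sets (generated_sigma M {0..grid T m k} W) \<subseteq> sets M" for k
    by (rule sets_generated_sigma_subset) auto
  have A_ad: "A k \<in> sets (generated_sigma M {0..grid T m k} W)" for k
  proof -
    let ?F = "generated_sigma M {0..grid T m k} W"
    have "{\<omega>\<in>space ?F. l \<le> norm (?S k \<omega>)} \<in> sets ?F"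
      using S_meas [of k k] by measurable
    moreover have "{\<omega>\<in>space ?F. norm (?S j \<omega>) < l} \<in> sets ?F" if "j \<in> {..<k}" for j
    proof -
      have [measurable]: "?S j \<in> borel_measurable ?F" using that by (intro S_meas) auto
      show ?thesis by measurable
    qed
    ultimately have "{\<omega>\<in>space ?F. l \<le> norm (?S k \<omega>) \<and> (\<forall>j\<in>{..<k}. norm (?S j \<omega>) < l)} \<in> sets ?F"
      by (intro sets.sets_Collect_conj sets.sets_Collect_finite_All) auto
    then show ?thesis by (simp add: A_def)
  qed
  then have A [measurable]: "A k \<in> sets M" for k using sub by blast
  have Z: "integrable M ?Z" by (rule step_ito_isometry(1) [OF g])
  have AZ: "integrable M (\<lambda>\<omega>. indicat_real (A k) \<omega> * ?Z \<omega>)" for k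
    using integrable_mult_indicator [OF A Z, of k] by simp
  have key: "l\<^sup>2 * prob (A k) \<le> (\<integral>\<omega>. indicat_real (A k) \<omega> * ?Z \<omega> \<partial>M)" for k
  proof -
    let ?Y = "\<lambda>i \<omega>. indicat_real (A k) \<omega> * ?S k \<omega> $ i"
    let ?D = "\<lambda>\<omega>. step_integral W g \<omega> - ?S k \<omega>"
    have Sk [measurable]: "?S k \<in> borel_measurable (generated_sigma M {0..grid T m k} W)" by (rule S_meas) simp
    have [measurable]: "A k \<in> sets (generated_sigma M {0..grid T m k} W)" by (rule A_ad)
    have Y: "?Y i \<in> borel_measurable (generated_sigma M {0..grid T m k} W)" for i by measurable
    have "integrable M (\<lambda>\<omega>. ?S k \<omega> $ i)" for i
      by (rule square_integrable_imp_integrable [OF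
            borel_measurable_component [OF step_integral_measurable [OF step_list_cut [OF g t]]]
            step_integral_square_integrable [OF step_list_cut [OF g t]]])
    then have Yi: "integrable M (?Y i)" for i
      using integrable_mult_indicator [OF A, of _ k] by fastforce
    have "has_bochner_integral M (\<lambda>\<omega>. \<Sum>i\<in>UNIV. ?Y i \<omega> * (axis i 1 \<bullet> ?D \<omega>)) (\<Sum>i\<in>(UNIV :: 'k set). 0)"
      by (rule has_bochner_integral_sum, rule cut_orthogonal [OF t Y Yi g])
    moreover have "has_bochner_integral M (indicat_real (A k)) (prob (A k))"
      by (rule has_bochner_integral_real_indicator [OF A]) (simp add: emeasure_eq_measure)
    ultimately have "has_bochner_integral M (\<lambda>\<omega>. l\<^sup>2 * indicat_real (A k) \<omega> + 2 * (\<Sum>i\<in>UNIV. ?Y i \<omega> * (axis i 1 \<bullet> ?D \<omega>)))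
        (l\<^sup>2 * prob (A k) + 2 * (\<Sum>i\<in>(UNIV :: 'k set). 0))"
      by (intro has_bochner_integral_add has_bochner_integral_mult_right)
    then have h: "integrable M (\<lambda>\<omega>. l\<^sup>2 * indicat_real (A k) \<omega> + 2 * (\<Sum>i\<in>UNIV. ?Y i \<omega> * (axis i 1 \<bullet> ?D \<omega>)))"
      "(\<integral>\<omega>. l\<^sup>2 * indicat_real (A k) \<omega> + 2 * (\<Sum>i\<in>UNIV. ?Y i \<omega> * (axis i 1 \<bullet> ?D \<omega>)) \<partial>M) = l\<^sup>2 * prob (A k)"
      by (auto simp: has_bochner_integral_iff)
    have "l\<^sup>2 * indicat_real (A k) \<omega> + 2 * (\<Sum>i\<in>UNIV. ?Y i \<omega> * (axis i 1 \<bullet> ?D \<omega>)) \<le> indicat_real (A k) \<omega> * ?Z \<omega>" for \<omega>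
    proof (cases "\<omega> \<in> A k")
      case True
      then have "l \<le> norm (?S k \<omega>)" by (simp add: A_def)
      then have "l\<^sup>2 \<le> (norm (?S k \<omega>))\<^sup>2" using l by (intro power_mono) auto
      moreover have "(\<Sum>i\<in>UNIV. ?Y i \<omega> * (axis i 1 \<bullet> ?D \<omega>)) = ?S k \<omega> \<bullet> ?D \<omega>"
        using True by (simp add: inner_vec_def [of "?S k \<omega>"] inner_axis')
      moreover have "?Z \<omega> = (norm (?S k \<omega> + ?D \<omega>))\<^sup>2" by simp
      then have "?Z \<omega> = (norm (?S k \<omega>))\<^sup>2 + 2 * (?S k \<omega> \<bullet> ?D \<omega>) + (norm (?D \<omega>))\<^sup>2"
        unfolding power2_norm_eq_inner by (simp only: inner_add_left inner_add_right inner_commute [of "?D \<omega>" "?S k \<omega>"])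
      ultimately show ?thesis using True by (simp add: add_increasing2)
    qed simp
    then have "(\<integral>\<omega>. l\<^sup>2 * indicat_real (A k) \<omega> + 2 * (\<Sum>i\<in>UNIV. ?Y i \<omega> * (axis i 1 \<bullet> ?D \<omega>)) \<partial>M) \<le> (\<integral>\<omega>. indicat_real (A k) \<omega> * ?Z \<omega> \<partial>M)"
      by (intro integral_mono h(1) AZ)
    then show ?thesis unfolding h(2) .
  qed
  have disj: "disjoint_family_on A {..m}"
    unfolding disjoint_family_on_def
  proof (intro ballI impI)
    have "A i \<inter> A j = {}" if "i < j" for i j
    proof (rule equals0I)
      fix \<omega> assume "\<omega> \<in> A i \<inter> A j"
      then have "l \<le> norm (?S i \<omega>)" "\<forall>i\<in>{..<j}. norm (?S i \<omega>) < l" unfolding A_def by blast+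
      then show False using that by (meson lessThan_iff not_le)
    qed
    moreover fix i j :: nat assume "i \<noteq> j"
    ultimately show "A i \<inter> A j = {}" by (metis Int_commute nat_neq_iff)
  qed
  have "{\<omega>\<in>space M. \<exists>i\<in>{..m}. l \<le> norm (?S i \<omega>)} \<subseteq> (\<Union>k\<in>{..m}. A k)"
  proof
    fix \<omega> assume "\<omega> \<in> {\<omega>\<in>space M. \<exists>i\<in>{..m}. l \<le> norm (?S i \<omega>)}"
    then obtain i where i: "\<omega> \<in> space M" "i \<le> m" "l \<le> norm (?S i \<omega>)" by auto
    define k where "k = (LEAST k. l \<le> norm (?S k \<omega>))"
    have "l \<le> norm (?S k \<omega>)" unfolding k_def using i(3) by (rule LeastI)
    moreover have "k \<le> i" unfolding k_def using i(3) by (rule Least_le)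
    moreover have "norm (?S j \<omega>) < l" if "j < k" for j
      using not_less_Least [OF that [unfolded k_def]] by simp
    ultimately show "\<omega> \<in> (\<Union>k\<in>{..m}. A k)" using i by (auto simp: A_def)
  qed
  then have "prob {\<omega>\<in>space M. \<exists>i\<in>{..m}. l \<le> norm (?S i \<omega>)} \<le> prob (\<Union>k\<in>{..m}. A k)"
    by (intro finite_measure_mono) auto
  also have "\<dots> \<le> (\<Sum>k\<in>{..m}. prob (A k))"
    by (intro finite_measure_subadditive_finite) auto
  finally have "l\<^sup>2 * prob {\<omega>\<in>space M. \<exists>i\<in>{..m}. l \<le> norm (?S i \<omega>)} \<le> (\<Sum>k\<in>{..m}. l\<^sup>2 * prob (A k))"
    unfolding sum_distrib_left [symmetric] by (rule mult_left_mono) simp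
  also have "\<dots> \<le> (\<Sum>k\<in>{..m}. \<integral>\<omega>. indicat_real (A k) \<omega> * ?Z \<omega> \<partial>M)"
    by (intro sum_mono key)
  also have "\<dots> = (\<integral>\<omega>. (\<Sum>k\<in>{..m}. indicat_real (A k) \<omega> * ?Z \<omega>) \<partial>M)"
    by (rule Bochner_Integration.integral_sum [symmetric]) (rule AZ)
  also have "\<dots> \<le> (\<integral>\<omega>. ?Z \<omega> \<partial>M)"
  proof (rule integral_mono [OF _ Z])
    show "integrable M (\<lambda>\<omega>. \<Sum>k\<in>{..m}. indicat_real (A k) \<omega> * ?Z \<omega>)" by (rule Bochner_Integration.integrable_sum) (rule AZ)
    fix \<omega>
    have "(\<Sum>k\<in>{..m}. indicat_real (A k) \<omega>) = indicat_real (\<Union>k\<in>{..m}. A k) \<omega>"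
      by (rule indicator_UN_disjoint [OF _ disj, symmetric]) simp
    also have "\<dots> \<le> 1" by (simp add: indicator_def)
    finally have "(\<Sum>k\<in>{..m}. indicat_real (A k) \<omega>) * ?Z \<omega> \<le> 1 * ?Z \<omega>" by (rule mult_right_mono) simp
    then show "(\<Sum>k\<in>{..m}. indicat_real (A k) \<omega> * ?Z \<omega>) \<le> ?Z \<omega>"
      unfolding sum_distrib_right mult_1 .
  qed
  finally show ?thesis .
qed

lemma cut_path_continuous:
  assumes W: "continuous_on {0..} (\<lambda>t. W t \<omega>)"
  shows "step_list T g \<Longrightarrow> continuous_on {0..} (\<lambda>t. step_integral W (cut_list t g) \<omega>)"
proof (induction rule: step_list_induct)
  case Nil
  then show ?case by simp
next
  case (Cons c a b g)
  have "continuous_on {0..} (\<lambda>t. W (min a t) \<omega>)" if "0 \<le> a" for a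
    using that by (intro continuous_on_compose2 [OF W, where f = "\<lambda>t. min a t"] continuous_intros) auto
  then have "continuous_on {0..} (\<lambda>t. c *v (W (min b t) \<omega> - W (min a t) \<omega>) + step_integral W (cut_list t g) \<omega>)"
    using Cons by (intro continuous_intros) auto
  then show ?case by simp
qed

text \<open>The dyadic grids increase to a dense set of times, and paths are continuous.\<close>

lemma maximal_inequality:
  assumes g: "step_list T g" and T: "0 \<le> T" and l: "0 < l"
  shows "\<exists>N\<in>sets M. l\<^sup>2 * prob N \<le> (\<integral>\<omega>. (norm (step_integral W g \<omega>))\<^sup>2 \<partial>M) \<and>
    (AE \<omega> in M. \<omega> \<notin> N \<longrightarrow> (\<forall>t\<in>{0..T}. norm (step_integral W (cut_list t g) \<omega>) \<le> l))"
proof -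
  let ?S = "\<lambda>t. step_integral W (cut_list t g)"
  define E where "E n = {\<omega>\<in>space M. \<exists>i\<in>{..2 ^ n}. l \<le> norm (?S (grid T (2 ^ n) i) \<omega>)}" for n :: nat
  have E [measurable]: "E n \<in> sets M" for n
  proof -
    have [measurable]: "?S (grid T (2 ^ n) i) \<in> borel_measurable M" for i
      using T by (intro step_integral_measurable [OF step_list_cut [OF g]]) auto
    have h: "{\<omega>\<in>space M. l \<le> norm (?S (grid T (2 ^ n) i) \<omega>)} \<in> sets M" for i by measurable
    show ?thesis unfolding E_def by (rule sets.sets_Collect_finite_Ex, rule h, rule finite_atMost)
  qed
  have inc: "incseq E"
  proof (rule incseq_SucI, rule subsetI)
    fix n \<omega> assume "\<omega> \<in> E n"
    then obtain i where i: "\<omega> \<in> space M" "i \<le> 2 ^ n" "l \<le> norm (?S (grid T (2 ^ n) i) \<omega>)" by (auto simp: E_def)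
    have "grid T (2 ^ n) i = grid T (2 ^ Suc n) (2 * i)" by simp
    then show "\<omega> \<in> E (Suc n)" using i unfolding E_def by (intro CollectI conjI bexI [of _ "2 * i"]) auto
  qed
  have "(\<lambda>n. l\<^sup>2 * prob (E n)) \<longlonglongrightarrow> l\<^sup>2 * prob (\<Union>n. E n)"
    by (intro tendsto_intros finite_Lim_measure_incseq inc) auto
  then have "l\<^sup>2 * prob (\<Union>n. E n) \<le> (\<integral>\<omega>. (norm (step_integral W g \<omega>))\<^sup>2 \<partial>M)"
    unfolding E_def by (rule LIMSEQ_le_const2) (intro exI allI impI, rule maximal_inequality_grid [OF g T l])
  moreover have "AE \<omega> in M. \<omega> \<notin> (\<Union>n. E n) \<longrightarrow> (\<forall>t\<in>{0..T}. norm (?S t \<omega>) \<le> l)"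
    using W_continuous AE_space
  proof eventually_elim
    case (elim \<omega>)
    show ?case
    proof (intro impI ballI)
      fix t assume \<omega>: "\<omega> \<notin> (\<Union>n. E n)" and t: "t \<in> {0..T}"
      define i where "i n = nat \<lfloor>t * 2 ^ n / T\<rfloor>" for n :: nat
      define s where "s n = grid T (2 ^ n) (i n)" for n :: nat
      have bd: "i n \<le> 2 ^ n \<and> \<bar>t - s n\<bar> \<le> T * (1/2) ^ n" for n
      proof (cases "T = 0")
        case True
        then show ?thesis using t by (simp add: i_def s_def)
      next
        case False
        then have T': "0 < T" using T by simp
        have p: "0 \<le> t * 2 ^ n / T" "t * 2 ^ n / T \<le> 2 ^ n" using t T' by (auto simp: field_simps)
        then have i: "real (i n) = real_of_int \<lfloor>t * 2 ^ n / T\<rfloor>" by (simp add: i_def)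
        have "real (i n) \<le> real (2 ^ n)" unfolding i by (rule order_trans [OF of_int_floor_le]) (use p in simp)
        then have 1: "i n \<le> 2 ^ n" by (simp only: of_nat_le_iff)
        have "\<bar>t * 2 ^ n / T - real (i n)\<bar> \<le> 1" unfolding i by linarith
        then have "\<bar>t * 2 ^ n / T - real (i n)\<bar> * (T * (1/2) ^ n) \<le> 1 * (T * (1/2) ^ n)"
          using T' by (intro mult_right_mono) auto
        moreover have "\<bar>t * 2 ^ n / T - real (i n)\<bar> * (T * (1/2) ^ n) = \<bar>(t * 2 ^ n / T - real (i n)) * (T * (1/2) ^ n)\<bar>"
          using T' by (simp add: abs_mult)
        moreover have "(t * 2 ^ n / T - real (i n)) * (T * (1/2) ^ n) = t - s n"
          using T' by (simp add: s_def field_simps power_divide)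
        ultimately show ?thesis using 1 by simp
      qed
      have "(\<lambda>n. T * (1/2) ^ n) \<longlonglongrightarrow> T * 0" by (intro tendsto_intros LIMSEQ_power_zero) simp
      then have "(\<lambda>n. T * (1/2) ^ n) \<longlonglongrightarrow> 0" by simp
      then have "(\<lambda>n. t - s n) \<longlonglongrightarrow> 0"
        by (rule Lim_null_comparison [rotated]) (use bd in auto)
      then have "(\<lambda>n. t - (t - s n)) \<longlonglongrightarrow> t - 0" by (intro tendsto_intros)
      then have "s \<longlonglongrightarrow> t" by simp
      moreover have s0: "0 \<le> s n" for n using T by (simp add: s_def)
      ultimately have "(\<lambda>n. ?S (s n) \<omega>) \<longlonglongrightarrow> ?S t \<omega>"
        using t by (intro continuous_on_tendsto_compose [OF cut_path_continuous [OF elim(1) g]]) auto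
      then have "(\<lambda>n. norm (?S (s n) \<omega>)) \<longlonglongrightarrow> norm (?S t \<omega>)" by (rule tendsto_norm)
      moreover have "norm (?S (s n) \<omega>) \<le> l" for n
      proof -
        have "\<omega> \<notin> E n" using \<omega> by simp
        then show ?thesis using elim(2) bd [of n] unfolding E_def s_def by force
      qed
      ultimately show "norm (?S t \<omega>) \<le> l" by (intro LIMSEQ_le_const2) auto
    qed
  qed
  ultimately show ?thesis by (intro bexI [of _ "\<Union>n. E n"]) auto
qed

end

section \<open>Wiener integrals\<close>

lemma nn_integral_fatou_le:
  fixes u :: "nat \<Rightarrow> 'a \<Rightarrow> ennreal"
  assumes u: "\<And>n. u n \<in> borel_measurable M" and lim: "AE x in M. (\<lambda>n. u n x) \<longlonglongrightarrow> v x"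
    and le: "\<forall>\<^sub>F n in sequentially. (\<integral>\<^sup>+x. u n x \<partial>M) \<le> C"
  shows "(\<integral>\<^sup>+x. v x \<partial>M) \<le> C"
proof -
  have "(\<integral>\<^sup>+x. v x \<partial>M) = (\<integral>\<^sup>+x. liminf (\<lambda>n. u n x) \<partial>M)"
    by (rule nn_integral_cong_AE, use lim in eventually_elim) (simp add: lim_imp_Liminf)
  also have "\<dots> \<le> liminf (\<lambda>n. \<integral>\<^sup>+x. u n x \<partial>M)" by (rule nn_integral_liminf [OF u])
  also have "\<dots> \<le> limsup (\<lambda>n. \<integral>\<^sup>+x. u n x \<partial>M)" by (rule Liminf_le_Limsup) simp
  also have "\<dots> \<le> C" by (rule Limsup_bounded [OF le])
  finally show ?thesis .
qed

lemma nn_integral_norm_sq_triangle: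
  fixes f g h :: "'a \<Rightarrow> 'b::euclidean_space"
  assumes "f \<in> borel_measurable M" "g \<in> borel_measurable M" "h \<in> borel_measurable M"
  shows "(\<integral>\<^sup>+x. ennreal ((norm (f x - h x))\<^sup>2) \<partial>M)
    \<le> 2 * (\<integral>\<^sup>+x. ennreal ((norm (f x - g x))\<^sup>2) \<partial>M) + 2 * (\<integral>\<^sup>+x. ennreal ((norm (g x - h x))\<^sup>2) \<partial>M)"
proof -
  have pt: "(norm (a - c))\<^sup>2 \<le> 2 * (norm (a - b))\<^sup>2 + 2 * (norm (b - c))\<^sup>2" for a b c :: 'b
  proof -
    have "norm (a - c) \<le> norm (a - b) + norm (b - c)" using norm_triangle_ineq [of "a - b" "b - c"] by simp
    then have "(norm (a - c))\<^sup>2 \<le> (norm (a - b) + norm (b - c))\<^sup>2" by (intro power_mono) auto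
    also have "\<dots> \<le> 2 * (norm (a - b))\<^sup>2 + 2 * (norm (b - c))\<^sup>2"
      using sum_squares_bound [of "norm (a - b)" "norm (b - c)"] by (simp add: power2_sum)
    finally show ?thesis .
  qed
  have "(\<integral>\<^sup>+x. ennreal ((norm (f x - h x))\<^sup>2) \<partial>M)
    \<le> (\<integral>\<^sup>+x. 2 * ennreal ((norm (f x - g x))\<^sup>2) + 2 * ennreal ((norm (g x - h x))\<^sup>2) \<partial>M)"
  proof (rule nn_integral_mono)
    fix x
    have "ennreal ((norm (f x - h x))\<^sup>2) \<le> ennreal (2 * (norm (f x - g x))\<^sup>2 + 2 * (norm (g x - h x))\<^sup>2)"
      by (intro ennreal_leI pt)
    also have "\<dots> = 2 * ennreal ((norm (f x - g x))\<^sup>2) + 2 * ennreal ((norm (g x - h x))\<^sup>2)"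
      by (simp add: ennreal_plus ennreal_mult)
    finally show "ennreal ((norm (f x - h x))\<^sup>2) \<le> 2 * ennreal ((norm (f x - g x))\<^sup>2) + 2 * ennreal ((norm (g x - h x))\<^sup>2)" .
  qed
  also have "\<dots> = 2 * (\<integral>\<^sup>+x. ennreal ((norm (f x - g x))\<^sup>2) \<partial>M) + 2 * (\<integral>\<^sup>+x. ennreal ((norm (g x - h x))\<^sup>2) \<partial>M)"
    using assms by (simp add: nn_integral_add nn_integral_cmult)
  finally show ?thesis .
qed

lemma two_ennreal: "0 \<le> a \<Longrightarrow> 0 \<le> b \<Longrightarrow> 2 * ennreal a + 2 * ennreal b = ennreal (2 * a + 2 * b)"
  by (simp add: ennreal_plus ennreal_mult)

lemma has_wiener_integral_iff:
  "has_wiener_integral M R W T f J \<longleftrightarrow> set_borel_measurable borel {0..T} f \<and> J \<in> borel_measurable M \<and>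
    (\<exists>g. (\<forall>n. step_list T (g n)) \<and> (\<lambda>n. ito_sq R T (\<lambda>s. step_function (g n) s - f s)) \<longlonglongrightarrow> 0 \<and>
      (\<lambda>n. \<integral>\<^sup>+\<omega>. ennreal ((norm (step_integral W (g n) \<omega> - J \<omega>))\<^sup>2) \<partial>M) \<longlonglongrightarrow> 0)"
  unfolding has_wiener_integral_def step_list_def ito_sq_def by simp

text \<open>With \<open>v = c\<^sup>T r\<close> the Cauchy--Schwarz inequality gives \<open>(v \<bullet> R v)\<^sup>2 \<le> |r|\<^sup>2 tr(c R c\<^sup>T) (v \<bullet> R v)\<close>; sum over the
  rows \<open>r\<close> of \<open>F\<close>.\<close>

lemma trace_form_left_mult:
  fixes F :: "real^'k^'l" and c :: "real^'m^'k"
  assumes R: "pos_def R"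
  shows "trace ((F ** c) ** R ** transpose (F ** c)) \<le> (norm F)\<^sup>2 * trace (c ** R ** transpose c)"
proof -
  let ?t = "trace (c ** R ** transpose c)"
  have t0: "0 \<le> ?t" by (rule trace_form_nonneg) (rule pos_def_nonneg [OF R])
  have row: "(transpose c *v r) \<bullet> (R *v (transpose c *v r)) \<le> (norm r)\<^sup>2 * ?t" for r
  proof -
    define v where "v = transpose c *v r"
    define q where "q = v \<bullet> (R *v v)"
    have q0: "0 \<le> q" unfolding q_def by (rule pos_def_nonneg [OF R])
    have "q = r \<bullet> (c *v (R *v v))" unfolding q_def v_def by (rule inner_matvec_transpose)
    then have "q\<^sup>2 \<le> (norm r * norm (c *v (R *v v)))\<^sup>2"
      using q0 norm_cauchy_schwarz [of r "c *v (R *v v)"] by (intro power_mono) auto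
    also have "\<dots> = (norm r)\<^sup>2 * (norm (c *v (R *v v)))\<^sup>2" by (simp add: power_mult_distrib)
    also have "\<dots> \<le> (norm r)\<^sup>2 * (?t * ((R *v v) \<bullet> (matrix_inv R *v (R *v v))))"
      by (intro mult_left_mono norm_matvec_le_trace_form [OF R]) auto
    also have "(R *v v) \<bullet> (matrix_inv R *v (R *v v)) = q"
      by (simp add: matrix_vector_mul_assoc matrix_inv_inverse(2) [OF pos_def_imp_invertible [OF R]] q_def inner_commute)
    finally have "q * q \<le> ((norm r)\<^sup>2 * ?t) * q" by (simp add: power2_eq_square mult_ac)
    then show ?thesis
      using q0 t0 unfolding v_def [symmetric] q_def [symmetric]
      by (cases "q = 0") (auto simp: mult_le_cancel_right)
  qed
  have comp: "(F ** c) $ k = transpose c *v (F $ k)" for k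
    by (simp add: vec_eq_iff matrix_matrix_mult_def matrix_vector_mult_def transpose_def mult.commute)
  have "trace ((F ** c) ** R ** transpose (F ** c)) \<le> (\<Sum>k\<in>UNIV. (norm (F $ k))\<^sup>2 * ?t)"
    unfolding trace_form [of "F ** c"] comp by (intro sum_mono row)
  also have "\<dots> = (norm F)\<^sup>2 * ?t"
    by (simp add: norm_vec_def [of F] L2_set_def sum_nonneg sum_distrib_right)
  finally show ?thesis .
qed

context intensity
begin

lemma ito_sq_left_mult:
  fixes F :: "real \<Rightarrow> real^'k^'l" and f :: "real \<Rightarrow> real^'m^'k"
  assumes f: "set_borel_measurable borel {0..T} f" and B: "\<And>s. 0 < s \<Longrightarrow> s \<le> T \<Longrightarrow> norm (F s) \<le> B"
  shows "ito_sq R T (\<lambda>s. F s ** f s) \<le> ennreal (B\<^sup>2) * ito_sq R T f"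
proof -
  have "ito_sq R T (\<lambda>s. F s ** f s)
    \<le> (\<integral>\<^sup>+s. ennreal (B\<^sup>2) * (ennreal (trace (f s ** R s ** transpose (f s))) * indicator {0..T} s) \<partial>lborel)"
    unfolding ito_sq_def
  proof (rule nn_integral_mono_AE, rule AE_mp [OF AE_lborel_singleton [of 0]], rule AE_I2, rule impI)
    fix s :: real assume "s \<noteq> 0"
    show "ennreal (trace ((F s ** f s) ** R s ** transpose (F s ** f s))) * indicator {0..T} s
      \<le> ennreal (B\<^sup>2) * (ennreal (trace (f s ** R s ** transpose (f s))) * indicator {0..T} s)"
    proof (cases "s \<in> {0..T}")
      case True
      then have "trace ((F s ** f s) ** R s ** transpose (F s ** f s)) \<le> (norm (F s))\<^sup>2 * trace (f s ** R s ** transpose (f s))"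
        by (intro trace_form_left_mult R_pos) auto
      also have "\<dots> \<le> B\<^sup>2 * trace (f s ** R s ** transpose (f s))"
        using True B [of s] \<open>s \<noteq> 0\<close> by (intro mult_right_mono power_mono ito_integrand_nonneg) auto
      finally show ?thesis
        using True ito_integrand_nonneg [of s "f s"] by (simp add: ennreal_mult [symmetric] ennreal_leI)
    qed simp
  qed
  also have "\<dots> = ennreal (B\<^sup>2) * ito_sq R T f"
    unfolding ito_sq_def using ito_integrand_measurable [OF f] by (simp add: nn_integral_cmult)
  finally show ?thesis .
qed

end

context wiener
begin

lemma nn_step_integral_diff:
  fixes g h :: "((real^'m^'k) \<times> real \<times> real) list"
  assumes "step_list T g" "step_list T h"
  shows "(\<integral>\<^sup>+\<omega>. ennreal ((norm (step_integral W g \<omega> - step_integral W h \<omega>))\<^sup>2) \<partial>M)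
    = ito_sq R T (\<lambda>s. step_function g s - step_function h s)"
  using step_ito_isometry(3) [of T "g @ map_list uminus h"] assms
  by (simp add: step_integral_neg step_function_neg ito_sq_def)

text \<open>Step functions that approximate \<open>f\<close> at a geometric rate give step integrals whose successive
  differences are summable in supremum norm: this is where the maximal inequality enters, and it
  yields one process with continuous paths that is the integral of \<open>f\<close> at every time.\<close>

lemma wiener_integral_process:
  fixes f :: "real \<Rightarrow> real^'m^'k"
  assumes f: "\<And>t. set_borel_measurable borel {0..t} f" and fin: "\<And>t. ito_sq R t f < \<infinity>"
  shows "\<exists>N. (\<forall>t\<ge>0. N t \<in> borel_measurable M) \<and> (\<forall>\<omega>\<in>space M. continuous_on {0..} (\<lambda>t. N t \<omega>)) \<and>
    (\<forall>t\<ge>0. has_wiener_integral M R W t f (N t))"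
proof -
  have "\<exists>g. step_list (real n) g \<and> ito_sq R (real n) (\<lambda>s. step_function g s - f s) \<le> ennreal ((1/8) ^ n)" for n :: nat
    by (rule step_function_dense [OF f fin]) auto
  then have "\<forall>n. \<exists>g. step_list (real n) g \<and> ito_sq R (real n) (\<lambda>s. step_function g s - f s) \<le> ennreal ((1/8) ^ n)"
    by (rule allI)
  from choice [OF this] obtain g where g: "\<And>n. step_list (real n) (g n)"
    "\<And>n. ito_sq R (real n) (\<lambda>s. step_function (g n) s - f s) \<le> ennreal ((1/8) ^ n)" by blast
  define S where "S n t = step_integral W (cut_list t (g n))" for n t
  (* the difference of two successive approximations as a single step list *)
  define D where "D n = cut_list (real n) (g (Suc n) @ map_list uminus (g n))" for n
  note ms = set_borel_measurable_step_function
  have D: "step_list (real n) (D n)" for n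
    unfolding D_def by (rule step_list_cut [of "real (Suc n)"]) (use g(1) [of "Suc n"] step_list_mono [OF g(1) [of n]] in auto)
  have DS: "step_integral W (cut_list t (D n)) \<omega> = S (Suc n) t \<omega> - S n t \<omega>" if "t \<le> real n" for n t \<omega>
    using that by (simp add: D_def S_def cut_cut cut_map step_integral_neg)
  have gn: "ito_sq R t (\<lambda>s. step_function (g n) s - f s) \<le> ennreal ((1/8) ^ n)" if "t \<le> real n" for n t
    by (rule order_trans [OF ito_sq_subinterval [OF that] g(2)])
  have "ito_sq R (real n) (step_function (D n)) \<le> ennreal (4 * (1/8) ^ n)" for n
  proof -
    have "ito_sq R (real n) (step_function (D n)) = ito_sq R (real n) (\<lambda>s. step_function (g (Suc n)) s - step_function (g n) s)"
      by (rule ito_sq_cong) (simp add: D_def step_function_cut step_function_neg algebra_simps)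
    also have "\<dots> \<le> 2 * ito_sq R (real n) (\<lambda>s. step_function (g (Suc n)) s - f s) + 2 * ito_sq R (real n) (\<lambda>s. f s - step_function (g n) s)"
      by (rule ito_sq_triangle [OF ms f ms])
    also have "\<dots> \<le> 2 * ennreal ((1/8) ^ Suc n) + 2 * ennreal ((1/8) ^ n)"
      by (intro add_mono mult_left_mono gn) (auto simp: ito_sq_minus_commute [of _ f] gn)
    also have "\<dots> = ennreal (2 * (1/8) ^ Suc n + 2 * (1/8) ^ n)"
      by (rule two_ennreal) auto
    also have "\<dots> \<le> ennreal (4 * (1/8) ^ n)" by (intro ennreal_leI) simp
    finally show ?thesis .
  qed
  then have Dsq: "(\<integral>\<omega>. (norm (step_integral W (D n) \<omega>))\<^sup>2 \<partial>M) \<le> 4 * (1/8) ^ n" for n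
    unfolding step_ito_isometry(2) [OF D] by (subst (asm) ennreal_le_iff) auto
  have "\<exists>A. A \<in> sets M \<and> ((1/2) ^ n)\<^sup>2 * prob A \<le> (\<integral>\<omega>. (norm (step_integral W (D n) \<omega>))\<^sup>2 \<partial>M) \<and>
    (AE \<omega> in M. \<omega> \<notin> A \<longrightarrow> (\<forall>t\<in>{0..real n}. norm (step_integral W (cut_list t (D n)) \<omega>) \<le> (1/2) ^ n))" for n
    using maximal_inequality [OF D, of n "(1/2) ^ n"] unfolding Bex_def by simp
  then have "\<forall>n. \<exists>A. A \<in> sets M \<and> ((1/2) ^ n)\<^sup>2 * prob A \<le> (\<integral>\<omega>. (norm (step_integral W (D n) \<omega>))\<^sup>2 \<partial>M) \<and>
    (AE \<omega> in M. \<omega> \<notin> A \<longrightarrow> (\<forall>t\<in>{0..real n}. norm (step_integral W (cut_list t (D n)) \<omega>) \<le> (1/2) ^ n))"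
    by (rule allI)
  from choice [OF this] obtain A where A: "\<And>n. A n \<in> sets M"
    "\<And>n. ((1/2) ^ n)\<^sup>2 * prob (A n) \<le> (\<integral>\<omega>. (norm (step_integral W (D n) \<omega>))\<^sup>2 \<partial>M)"
    "\<And>n. AE \<omega> in M. \<omega> \<notin> A n \<longrightarrow> (\<forall>t\<in>{0..real n}. norm (step_integral W (cut_list t (D n)) \<omega>) \<le> (1/2) ^ n)"
    by blast
  (* the rate (1/8)^n is what makes these probabilities summable for the threshold (1/2)^n *)
  have PA: "prob (A n) \<le> 4 * (1/2) ^ n" for n
  proof -
    have "(1/4) ^ n * prob (A n) \<le> 4 * (1/8 :: real) ^ n"
      using order_trans [OF A(2) [of n] Dsq] by (simp add: power2_eq_square power_mult_distrib [symmetric])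
    also have "\<dots> = (1/4) ^ n * (4 * (1/2) ^ n)" by (simp add: power_mult_distrib [symmetric])
    finally show ?thesis by (simp add: mult_le_cancel_left_pos)
  qed
  have "summable (\<lambda>n. prob (A n))"
    by (rule summable_comparison_test' [where g = "\<lambda>n. 4 * (1/2) ^ n" and N = 0])
      (auto intro!: summable_mult summable_geometric simp: PA)
  then have "AE \<omega> in M. \<forall>\<^sub>F n in sequentially. \<omega> \<in> space M - A n"
    by (intro borel_cantelli_AE1 A) (auto simp: less_top [symmetric])
  moreover have "AE \<omega> in M. \<forall>n. \<omega> \<notin> A n \<longrightarrow> (\<forall>t\<in>{0..real n}. norm (step_integral W (cut_list t (D n)) \<omega>) \<le> (1/2) ^ n)"
    using A(3) by (simp add: AE_all_countable)
  ultimately have "AE \<omega> in M. (\<forall>n. continuous_on {0..} (\<lambda>t. S n t \<omega>)) \<and>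
      (\<forall>\<^sub>F n in sequentially. \<forall>t\<in>{0..real n}. norm (S (Suc n) t \<omega> - S n t \<omega>) \<le> (1/2) ^ n)"
    using W_continuous
  proof eventually_elim
    case (elim \<omega>)
    have "\<forall>\<^sub>F n in sequentially. \<forall>t\<in>{0..real n}. norm (S (Suc n) t \<omega> - S n t \<omega>) \<le> (1/2) ^ n"
      using elim(1) by eventually_elim (use elim(2) in \<open>auto simp: DS\<close>)
    then show ?case using cut_path_continuous [OF elim(3) g(1)] by (auto simp: S_def)
  qed
  then obtain N0 where N0: "N0 \<in> null_sets M"
    and good: "\<And>\<omega>. \<omega> \<in> space M \<Longrightarrow> \<omega> \<notin> N0 \<Longrightarrow> (\<forall>n. continuous_on {0..} (\<lambda>t. S n t \<omega>)) \<and>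
      (\<forall>\<^sub>F n in sequentially. \<forall>t\<in>{0..real n}. norm (S (Suc n) t \<omega> - S n t \<omega>) \<le> (1/2) ^ n)"
    unfolding eventually_ae_filter by blast
  (* the factor makes every path continuous, not only almost every one *)
  define N where "N t \<omega> = indicat_real (space M - N0) \<omega> *\<^sub>R lim (\<lambda>n. S n t \<omega>)" for t \<omega>
  have S_meas [measurable]: "S n t \<in> borel_measurable M" if "0 \<le> t" for n t
    unfolding S_def by (rule step_integral_measurable [OF step_list_cut [OF g(1) that]])
  have N0_meas [measurable]: "N0 \<in> sets M" using N0 by auto
  have N_meas: "N t \<in> borel_measurable M" if "0 \<le> t" for t
    unfolding N_def [abs_def] using that by measurable
  have unif: "\<exists>L. uniform_limit {0..real k} (\<lambda>n t. S n t \<omega>) L sequentially" if \<omega>: "\<omega> \<in> space M" "\<omega> \<notin> N0" for k \<omega>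
  proof -
    have "\<forall>\<^sub>F n in sequentially. \<forall>t\<in>{0..real k}. norm (S (Suc n) t \<omega> - S n t \<omega>) \<le> (1/2) ^ n"
      using conjunct2 [OF good [OF \<omega>]] eventually_ge_at_top [of k] by eventually_elim auto
    then have "uniform_limit {0..real k} (\<lambda>n t. \<Sum>i<n. S (Suc i) t \<omega> - S i t \<omega>) (\<lambda>t. \<Sum>i. S (Suc i) t \<omega> - S i t \<omega>) sequentially"
      by (rule Weierstrass_m_test_ev) (auto intro: summable_geometric)
    moreover have "(\<Sum>i<n. S (Suc i) t \<omega> - S i t \<omega>) = S n t \<omega> - S 0 t \<omega>" for n t by (induction n) auto
    ultimately have "uniform_limit {0..real k} (\<lambda>n t. S n t \<omega> - S 0 t \<omega>) (\<lambda>t. \<Sum>i. S (Suc i) t \<omega> - S i t \<omega>) sequentially"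
      by (simp only:)
    moreover have "uniform_limit {0..real k} (\<lambda>n t. S 0 t \<omega>) (\<lambda>t. S 0 t \<omega>) sequentially"
      by (rule uniform_limit_const)
    ultimately have "uniform_limit {0..real k} (\<lambda>n t. S n t \<omega> - S 0 t \<omega> + S 0 t \<omega>)
        (\<lambda>t. (\<Sum>i. S (Suc i) t \<omega> - S i t \<omega>) + S 0 t \<omega>) sequentially"
      by (rule uniform_limit_add)
    then show ?thesis by auto
  qed
  have conv: "(\<lambda>n. S n t \<omega>) \<longlonglongrightarrow> N t \<omega>" if \<omega>: "\<omega> \<in> space M" "\<omega> \<notin> N0" and t: "0 \<le> t" for t \<omega>
  proof -
    obtain k :: nat where "t \<le> real k" using real_arch_simple by blast
    moreover obtain L where "uniform_limit {0..real k} (\<lambda>n t. S n t \<omega>) L sequentially"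
      using unif [OF \<omega>, of k] by blast
    ultimately have "(\<lambda>n. S n t \<omega>) \<longlonglongrightarrow> L t"
      using t by (intro tendsto_uniform_limitI [where S = "{0..real k}"]) auto
    then have "convergent (\<lambda>n. S n t \<omega>)" by (rule convergentI)
    then show ?thesis using \<omega> by (simp add: N_def convergent_LIMSEQ_iff)
  qed
  have N_cont: "continuous_on {0..} (\<lambda>t. N t \<omega>)" if \<omega>: "\<omega> \<in> space M" for \<omega>
  proof (cases "\<omega> \<in> N0")
    case True
    then show ?thesis by (simp add: N_def)
  next
    case False
    show ?thesis
    proof (rule continuous_on_atLeast0I)
      fix k :: nat
      obtain L where L: "uniform_limit {0..real k} (\<lambda>n t. S n t \<omega>) L sequentially" using unif [OF \<omega> False] by blast
      have "continuous_on {0..real k} L"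
      proof (rule uniform_limit_theorem [OF always_eventually L])
        show "\<forall>n. continuous_on {0..real k} (\<lambda>t. S n t \<omega>)"
          using continuous_on_subset [OF spec [OF conjunct1 [OF good [OF \<omega> False]]], of "{0..real k}"] by simp
      qed simp
      moreover have "L t = N t \<omega>" if "t \<in> {0..real k}" for t
        using LIMSEQ_unique [OF tendsto_uniform_limitI [OF L that] conv [OF \<omega> False]] that by simp
      ultimately show "continuous_on {0..real k} (\<lambda>t. N t \<omega>)" by (metis (no_types, lifting) continuous_on_eq)
    qed
  qed
  have notN0: "AE \<omega> in M. \<omega> \<notin> N0" by (rule AE_not_in [OF N0])
  have has: "has_wiener_integral M R W t f (N t)" if t: "0 \<le> t" for t
  proof -
    obtain k :: nat where k: "t \<le> real k" using real_arch_simple by blast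
    define G where "G n = cut_list t (g (n + k))" for n
    have G: "step_list t (G n)" for n unfolding G_def by (rule step_list_cut [OF g(1) t])
    have Gf: "ito_sq R t (\<lambda>s. step_function (G n) s - f s) \<le> ennreal ((1/8) ^ n)" for n
    proof -
      have "ito_sq R t (\<lambda>s. step_function (G n) s - f s) = ito_sq R t (\<lambda>s. step_function (g (n + k)) s - f s)"
        by (rule ito_sq_cong) (simp add: G_def step_function_cut)
      also have "\<dots> \<le> ennreal ((1/8) ^ (n + k))" using k by (intro gn) auto
      also have "\<dots> \<le> ennreal ((1/8) ^ n)" by (intro ennreal_leI power_decreasing) auto
      finally show ?thesis .
    qed
    have GN: "(\<integral>\<^sup>+\<omega>. ennreal ((norm (step_integral W (G n) \<omega> - N t \<omega>))\<^sup>2) \<partial>M) \<le> ennreal (4 * (1/8) ^ n)" for n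
    proof (rule nn_integral_fatou_le)
      show "(\<lambda>\<omega>. ennreal ((norm (step_integral W (G n) \<omega> - step_integral W (G m) \<omega>))\<^sup>2)) \<in> borel_measurable M" for m
        using step_integral_measurable [OF G] by measurable
      show "AE \<omega> in M. (\<lambda>m. ennreal ((norm (step_integral W (G n) \<omega> - step_integral W (G m) \<omega>))\<^sup>2))
          \<longlonglongrightarrow> ennreal ((norm (step_integral W (G n) \<omega> - N t \<omega>))\<^sup>2)"
        using notN0 AE_space
      proof eventually_elim
        case (elim \<omega>)
        have "(\<lambda>m. step_integral W (G m) \<omega>) \<longlonglongrightarrow> N t \<omega>"
          using LIMSEQ_ignore_initial_segment [OF conv [OF elim(2,1) t], of k] by (simp add: G_def S_def)
        then show ?case by (intro tendsto_intros)
      qed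
      show "\<forall>\<^sub>F m in sequentially. (\<integral>\<^sup>+\<omega>. ennreal ((norm (step_integral W (G n) \<omega> - step_integral W (G m) \<omega>))\<^sup>2) \<partial>M) \<le> ennreal (4 * (1/8) ^ n)"
        using eventually_ge_at_top [of n]
      proof eventually_elim
        case (elim m)
        have "ito_sq R t (\<lambda>s. step_function (G n) s - step_function (G m) s)
          \<le> 2 * ito_sq R t (\<lambda>s. step_function (G n) s - f s) + 2 * ito_sq R t (\<lambda>s. f s - step_function (G m) s)"
          by (rule ito_sq_triangle [OF ms f ms])
        also have "\<dots> \<le> 2 * ennreal ((1/8) ^ n) + 2 * ennreal ((1/8) ^ m)"
          by (intro add_mono mult_left_mono Gf) (auto simp: ito_sq_minus_commute [of _ f] Gf)
        also have "\<dots> \<le> 2 * ennreal ((1/8) ^ n) + 2 * ennreal ((1/8) ^ n)"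
          using elim by (intro add_mono mult_left_mono ennreal_leI power_decreasing) auto
        also have "\<dots> = ennreal (2 * (1/8) ^ n + 2 * (1/8) ^ n)"
          by (rule two_ennreal) auto
        finally show ?case unfolding nn_step_integral_diff [OF G G] by simp
      qed
    qed
    have z: "(\<lambda>n. ennreal (c * (1/8) ^ n)) \<longlonglongrightarrow> 0" for c :: real
    proof -
      have "(\<lambda>n. c * (1/8) ^ n) \<longlonglongrightarrow> c * 0" by (intro tendsto_intros LIMSEQ_power_zero) simp
      then show ?thesis using tendsto_ennrealI by fastforce
    qed
    show ?thesis
      unfolding has_wiener_integral_iff
    proof (intro conjI exI [of _ G] allI f N_meas t G)
      show "(\<lambda>n. ito_sq R t (\<lambda>s. step_function (G n) s - f s)) \<longlonglongrightarrow> 0"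
        by (rule tendsto_sandwich [OF _ _ tendsto_const z [of 1]]) (use Gf in auto)
      show "(\<lambda>n. \<integral>\<^sup>+\<omega>. ennreal ((norm (step_integral W (G n) \<omega> - N t \<omega>))\<^sup>2) \<partial>M) \<longlonglongrightarrow> 0"
        by (rule tendsto_sandwich [OF _ _ tendsto_const z [of 4]]) (use GN in auto)
    qed
  qed
  show ?thesis using N_meas N_cont has by blast
qed

lemma has_wiener_integral_measurable:
  "has_wiener_integral M R W T f J \<Longrightarrow> J \<in> borel_measurable M"
  "has_wiener_integral M R W T f J \<Longrightarrow> set_borel_measurable borel {0..T} f"
  unfolding has_wiener_integral_iff by auto

text \<open>The isometry survives in the limit.  The factor 16 stems from the four uses of
  \<open>|x + y|\<^sup>2 \<le> 2 |x|\<^sup>2 + 2 |y|\<^sup>2\<close>; any constant serves for uniqueness and for limits.\<close>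

lemma has_wiener_integral_diff_le:
  fixes f f' :: "real \<Rightarrow> real^'m^'k"
  assumes J: "has_wiener_integral M R W T f J" and J': "has_wiener_integral M R W T f' J'"
  shows "(\<integral>\<^sup>+\<omega>. ennreal ((norm (J \<omega> - J' \<omega>))\<^sup>2) \<partial>M) \<le> 16 * ito_sq R T (\<lambda>s. f s - f' s)"
proof -
  obtain g where g: "\<And>n. step_list T (g n)" "(\<lambda>n. ito_sq R T (\<lambda>s. step_function (g n) s - f s)) \<longlonglongrightarrow> 0"
    "(\<lambda>n. \<integral>\<^sup>+\<omega>. ennreal ((norm (step_integral W (g n) \<omega> - J \<omega>))\<^sup>2) \<partial>M) \<longlonglongrightarrow> 0"
    using J unfolding has_wiener_integral_iff by blast
  obtain g' where g': "\<And>n. step_list T (g' n)" "(\<lambda>n. ito_sq R T (\<lambda>s. step_function (g' n) s - f' s)) \<longlonglongrightarrow> 0"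
    "(\<lambda>n. \<integral>\<^sup>+\<omega>. ennreal ((norm (step_integral W (g' n) \<omega> - J' \<omega>))\<^sup>2) \<partial>M) \<longlonglongrightarrow> 0"
    using J' unfolding has_wiener_integral_iff by blast
  let ?a = "\<lambda>n. \<integral>\<^sup>+\<omega>. ennreal ((norm (step_integral W (g n) \<omega> - J \<omega>))\<^sup>2) \<partial>M"
  let ?a' = "\<lambda>n. \<integral>\<^sup>+\<omega>. ennreal ((norm (step_integral W (g' n) \<omega> - J' \<omega>))\<^sup>2) \<partial>M"
  let ?q = "\<lambda>n. ito_sq R T (\<lambda>s. step_function (g n) s - f s)"
  let ?q' = "\<lambda>n. ito_sq R T (\<lambda>s. step_function (g' n) s - f' s)"
  let ?d = "ito_sq R T (\<lambda>s. f s - f' s)"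
  note ms = set_borel_measurable_step_function
  note mf = has_wiener_integral_measurable(2) [OF J] and mf' = has_wiener_integral_measurable(2) [OF J']
  note mJ = has_wiener_integral_measurable(1) [OF J] and mJ' = has_wiener_integral_measurable(1) [OF J']
  note mg = step_integral_measurable [OF g(1)] and mg' = step_integral_measurable [OF g'(1)]
  have le: "(\<integral>\<^sup>+\<omega>. ennreal ((norm (J \<omega> - J' \<omega>))\<^sup>2) \<partial>M)
    \<le> 2 * ?a n + 2 * (2 * (2 * ?q n + 2 * (2 * ?d + 2 * ?q' n)) + 2 * ?a' n)" for n
  proof -
    have "(\<integral>\<^sup>+\<omega>. ennreal ((norm (J \<omega> - J' \<omega>))\<^sup>2) \<partial>M)
      \<le> 2 * (\<integral>\<^sup>+\<omega>. ennreal ((norm (J \<omega> - step_integral W (g n) \<omega>))\<^sup>2) \<partial>M)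
        + 2 * (\<integral>\<^sup>+\<omega>. ennreal ((norm (step_integral W (g n) \<omega> - J' \<omega>))\<^sup>2) \<partial>M)"
      by (rule nn_integral_norm_sq_triangle [OF mJ mg mJ'])
    also have "(\<integral>\<^sup>+\<omega>. ennreal ((norm (J \<omega> - step_integral W (g n) \<omega>))\<^sup>2) \<partial>M) = ?a n"
      by (simp add: norm_minus_commute)
    also have "(\<integral>\<^sup>+\<omega>. ennreal ((norm (step_integral W (g n) \<omega> - J' \<omega>))\<^sup>2) \<partial>M)
      \<le> 2 * (\<integral>\<^sup>+\<omega>. ennreal ((norm (step_integral W (g n) \<omega> - step_integral W (g' n) \<omega>))\<^sup>2) \<partial>M) + 2 * ?a' n"
      by (rule nn_integral_norm_sq_triangle [OF mg mg' mJ'])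
    also have "(\<integral>\<^sup>+\<omega>. ennreal ((norm (step_integral W (g n) \<omega> - step_integral W (g' n) \<omega>))\<^sup>2) \<partial>M)
      = ito_sq R T (\<lambda>s. step_function (g n) s - step_function (g' n) s)"
      by (rule nn_step_integral_diff [OF g(1) g'(1)])
    also have "\<dots> \<le> 2 * ?q n + 2 * ito_sq R T (\<lambda>s. f s - step_function (g' n) s)"
      by (rule ito_sq_triangle [OF ms mf ms])
    also have "ito_sq R T (\<lambda>s. f s - step_function (g' n) s)
      \<le> 2 * ?d + 2 * ito_sq R T (\<lambda>s. f' s - step_function (g' n) s)"
      by (rule ito_sq_triangle [OF mf mf' ms])
    also have "ito_sq R T (\<lambda>s. f' s - step_function (g' n) s) = ?q' n" by (rule ito_sq_minus_commute)
    finally show ?thesis by (simp add: mult_left_mono add_mono)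
  qed
  have "(\<lambda>n. 2 * ?a n + 2 * (2 * (2 * ?q n + 2 * (2 * ?d + 2 * ?q' n)) + 2 * ?a' n))
    \<longlonglongrightarrow> 2 * 0 + 2 * (2 * (2 * 0 + 2 * (2 * ?d + 2 * 0)) + 2 * 0)"
    by (intro tendsto_add ennreal_tendsto_cmult tendsto_const g g') auto
  moreover have "2 * 0 + 2 * (2 * (2 * 0 + 2 * (2 * ?d + 2 * 0)) + 2 * 0) = 16 * ?d"
    by (simp add: mult.assoc [symmetric])
  ultimately show ?thesis using le by (intro LIMSEQ_le_const) auto
qed

lemma has_wiener_integral_AE_unique:
  fixes f f' :: "real \<Rightarrow> real^'m^'k"
  assumes J: "has_wiener_integral M R W T f J" and J': "has_wiener_integral M R W T f' J'"
    and eq: "\<And>s. 0 < s \<Longrightarrow> s \<le> T \<Longrightarrow> f s = f' s"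
  shows "AE \<omega> in M. J \<omega> = J' \<omega>"
proof -
  have "ito_sq R T (\<lambda>s. f s - f' s) = ito_sq R T (\<lambda>s. 0 :: real^'m^'k)" by (rule ito_sq_cong) (simp add: eq)
  also have "\<dots> = 0" by (simp add: ito_sq_def bounded_bilinear.zero_left [OF bounded_bilinear_matmul] trace_def)
  finally have "(\<integral>\<^sup>+\<omega>. ennreal ((norm (J \<omega> - J' \<omega>))\<^sup>2) \<partial>M) = 0"
    using has_wiener_integral_diff_le [OF J J'] by simp
  then have "AE \<omega> in M. ennreal ((norm (J \<omega> - J' \<omega>))\<^sup>2) = 0"
    using has_wiener_integral_measurable(1) [OF J] has_wiener_integral_measurable(1) [OF J']
    by (subst (asm) nn_integral_0_iff_AE) auto
  then show ?thesis by eventually_elim simp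
qed

end

lemma (in prob_space) integrable_norm_sqD:
  fixes f :: "'a \<Rightarrow> 'b::euclidean_space"
  assumes f: "f \<in> borel_measurable M" and i: "integrable M (\<lambda>x. (norm (f x))\<^sup>2)"
  shows "integrable M f" "(\<integral>x. norm (f x) \<partial>M) \<le> sqrt (\<integral>x. (norm (f x))\<^sup>2 \<partial>M)"
proof -
  have n: "integrable M (\<lambda>x. norm (f x))"
    by (rule square_integrable_imp_integrable [OF measurable_compose [OF f borel_measurable_norm] i])
  then show "integrable M f" by (rule integrable_norm_cancel [OF _ f])
  have "0 \<le> variance (\<lambda>x. norm (f x))" by (rule variance_positive)
  then have "(\<integral>x. norm (f x) \<partial>M)\<^sup>2 \<le> (\<integral>x. (norm (f x))\<^sup>2 \<partial>M)"
    using variance_eq [OF n i] by simp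
  then show "(\<integral>x. norm (f x) \<partial>M) \<le> sqrt (\<integral>x. (norm (f x))\<^sup>2 \<partial>M)"
    by (rule real_le_rsqrt)
qed

lemma step_function_beyond: "step_list u g \<Longrightarrow> u < s \<Longrightarrow> step_function g s = 0"
  by (induction rule: step_list_induct) auto

context wiener
begin

lemma has_wiener_integral_extend:
  fixes f :: "real \<Rightarrow> real^'m^'k"
  assumes J: "has_wiener_integral M R W u f J" and u: "u \<le> T"
  shows "has_wiener_integral M R W T (\<lambda>s. indicat_real {..u} s *\<^sub>R f s) J"
proof -
  obtain g where g: "\<And>n. step_list u (g n)" "(\<lambda>n. ito_sq R u (\<lambda>s. step_function (g n) s - f s)) \<longlonglongrightarrow> 0"
    "(\<lambda>n. \<integral>\<^sup>+\<omega>. ennreal ((norm (step_integral W (g n) \<omega> - J \<omega>))\<^sup>2) \<partial>M) \<longlonglongrightarrow> 0"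
    using J unfolding has_wiener_integral_iff by blast
  have eq: "indicat_real {0..T} s *\<^sub>R (indicat_real {..u} s *\<^sub>R f s) = indicat_real {0..u} s *\<^sub>R f s" for s
    using u by (auto simp: indicator_def)
  have m: "set_borel_measurable borel {0..T} (\<lambda>s. indicat_real {..u} s *\<^sub>R f s)"
    using has_wiener_integral_measurable(2) [OF J] unfolding set_borel_measurable_def eq .
  have "ito_sq R T (\<lambda>s. step_function (g n) s - indicat_real {..u} s *\<^sub>R f s) = ito_sq R u (\<lambda>s. step_function (g n) s - f s)" for n
    unfolding ito_sq_def
  proof (rule nn_integral_cong)
    fix s
    consider "s \<le> u" | "u < s" by linarith
    then show "ennreal (trace ((step_function (g n) s - indicat_real {..u} s *\<^sub>R f s) ** R s ** transpose (step_function (g n) s - indicat_real {..u} s *\<^sub>R f s))) * indicator {0..T} s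
      = ennreal (trace ((step_function (g n) s - f s) ** R s ** transpose (step_function (g n) s - f s))) * indicator {0..u} s"
    proof cases
      case 1
      then have "indicat_real {..u} s = 1" "indicator {0..T} s = (indicator {0..u} s :: ennreal)"
        using u by (auto simp: indicator_def)
      then show ?thesis by simp
    next
      case 2
      then have z: "step_function (g n) s - indicat_real {..u} s *\<^sub>R f s = 0" "indicator {0..u} s = (0 :: ennreal)"
        using step_function_beyond [OF g(1)] by auto
      show ?thesis unfolding z by (simp add: bounded_bilinear.zero_left [OF bounded_bilinear_matmul] trace_def)
    qed
  qed
  then show ?thesis
    unfolding has_wiener_integral_iff
    using m has_wiener_integral_measurable(1) [OF J] g step_list_mono [OF g(1) u] by (intro conjI exI [of _ g]) auto
qed

lemma has_wiener_integral_0: "has_wiener_integral M R W T (\<lambda>s. 0) (\<lambda>\<omega>. 0)"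
  unfolding has_wiener_integral_iff
  by (intro conjI exI [of _ "\<lambda>_. []"])
    (auto simp: set_borel_measurable_def ito_sq_def bounded_bilinear.zero_left [OF bounded_bilinear_matmul] trace_def)

text \<open>Left multiplication and sums act on the approximating step lists entry by entry and by
  concatenation.\<close>

lemma has_wiener_integral_linear:
  fixes f f' :: "real \<Rightarrow> real^'m^'k" and F F' :: "real^'k^'l"
  assumes J: "has_wiener_integral M R W T f J" and J': "has_wiener_integral M R W T f' J'"
  shows "has_wiener_integral M R W T (\<lambda>s. F ** f s + F' ** f' s) (\<lambda>\<omega>. F *v J \<omega> + F' *v J' \<omega>)"
proof -
  obtain g where g: "\<And>n. step_list T (g n)" "(\<lambda>n. ito_sq R T (\<lambda>s. step_function (g n) s - f s)) \<longlonglongrightarrow> 0"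
    "(\<lambda>n. \<integral>\<^sup>+\<omega>. ennreal ((norm (step_integral W (g n) \<omega> - J \<omega>))\<^sup>2) \<partial>M) \<longlonglongrightarrow> 0"
    using J unfolding has_wiener_integral_iff by blast
  obtain g' where g': "\<And>n. step_list T (g' n)" "(\<lambda>n. ito_sq R T (\<lambda>s. step_function (g' n) s - f' s)) \<longlonglongrightarrow> 0"
    "(\<lambda>n. \<integral>\<^sup>+\<omega>. ennreal ((norm (step_integral W (g' n) \<omega> - J' \<omega>))\<^sup>2) \<partial>M) \<longlonglongrightarrow> 0"
    using J' unfolding has_wiener_integral_iff by blast
  note ms = set_borel_measurable_step_function
  note mf = has_wiener_integral_measurable(2) [OF J] and mf' = has_wiener_integral_measurable(2) [OF J']
  note mJ [measurable] = has_wiener_integral_measurable(1) [OF J] and mJ' [measurable] = has_wiener_integral_measurable(1) [OF J']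
  have mg [measurable]: "step_integral W (g n) \<in> borel_measurable M" for n by (rule step_integral_measurable [OF g(1)])
  have mg' [measurable]: "step_integral W (g' n) \<in> borel_measurable M" for n by (rule step_integral_measurable [OF g'(1)])
  have const: "set_borel_measurable borel {0..T} (\<lambda>s. F)" for F :: "real^'k^'l"
    by (intro set_borel_measurable_continuous_on continuous_intros)
  define G where "G n = map_list ((**) F) (g n) @ map_list ((**) F') (g' n)" for n
  have m: "set_borel_measurable borel {0..T} (\<lambda>s. F ** f s + F' ** f' s)"
    by (intro set_borel_measurable_add set_borel_measurable_bilinear [OF bounded_bilinear_matmul const] mf mf')
  have q: "ito_sq R T (\<lambda>s. step_function (G n) s - (F ** f s + F' ** f' s))
    \<le> 2 * (ennreal ((norm F)\<^sup>2) * ito_sq R T (\<lambda>s. step_function (g n) s - f s))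
      + 2 * (ennreal ((norm F')\<^sup>2) * ito_sq R T (\<lambda>s. step_function (g' n) s - f' s))" for n
  proof -
    have "(\<lambda>s. step_function (G n) s - (F ** f s + F' ** f' s))
      = (\<lambda>s. F ** (step_function (g n) s - f s) + F' ** (step_function (g' n) s - f' s))"
      by (simp add: fun_eq_iff G_def step_function_map bounded_bilinear.diff_right [OF bounded_bilinear_matmul])
    then have "ito_sq R T (\<lambda>s. step_function (G n) s - (F ** f s + F' ** f' s))
      = ito_sq R T (\<lambda>s. F ** (step_function (g n) s - f s) + F' ** (step_function (g' n) s - f' s))" by simp
    also have "\<dots> \<le> 2 * ito_sq R T (\<lambda>s. F ** (step_function (g n) s - f s)) + 2 * ito_sq R T (\<lambda>s. F' ** (step_function (g' n) s - f' s))"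
      by (intro ito_sq_add set_borel_measurable_bilinear [OF bounded_bilinear_matmul const] set_borel_measurable_diff ms mf mf')
    also have "\<dots> \<le> 2 * (ennreal ((norm F)\<^sup>2) * ito_sq R T (\<lambda>s. step_function (g n) s - f s))
      + 2 * (ennreal ((norm F')\<^sup>2) * ito_sq R T (\<lambda>s. step_function (g' n) s - f' s))"
      by (intro add_mono mult_left_mono ito_sq_left_mult set_borel_measurable_diff ms mf mf') auto
    finally show ?thesis .
  qed
  have pull: "(\<integral>\<^sup>+\<omega>. ennreal ((norm (F *v X \<omega>))\<^sup>2) \<partial>M) \<le> ennreal ((norm F)\<^sup>2) * (\<integral>\<^sup>+\<omega>. ennreal ((norm (X \<omega>))\<^sup>2) \<partial>M)"
    if [measurable]: "X \<in> borel_measurable M" for F :: "real^'k^'l" and X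
  proof -
    have "(\<integral>\<^sup>+\<omega>. ennreal ((norm (F *v X \<omega>))\<^sup>2) \<partial>M) \<le> (\<integral>\<^sup>+\<omega>. ennreal ((norm F)\<^sup>2) * ennreal ((norm (X \<omega>))\<^sup>2) \<partial>M)"
    proof (rule nn_integral_mono)
      fix \<omega>
      have "(norm (F *v X \<omega>))\<^sup>2 \<le> (norm F * norm (X \<omega>))\<^sup>2" by (intro power_mono norm_matvec_le) auto
      then show "ennreal ((norm (F *v X \<omega>))\<^sup>2) \<le> ennreal ((norm F)\<^sup>2) * ennreal ((norm (X \<omega>))\<^sup>2)"
        by (simp add: ennreal_mult [symmetric] power_mult_distrib ennreal_leI)
    qed
    also have "\<dots> = ennreal ((norm F)\<^sup>2) * (\<integral>\<^sup>+\<omega>. ennreal ((norm (X \<omega>))\<^sup>2) \<partial>M)"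
      by (rule nn_integral_cmult) measurable
    finally show ?thesis .
  qed
  have l: "(\<integral>\<^sup>+\<omega>. ennreal ((norm (step_integral W (G n) \<omega> - (F *v J \<omega> + F' *v J' \<omega>)))\<^sup>2) \<partial>M)
    \<le> 2 * (ennreal ((norm F)\<^sup>2) * (\<integral>\<^sup>+\<omega>. ennreal ((norm (step_integral W (g n) \<omega> - J \<omega>))\<^sup>2) \<partial>M))
      + 2 * (ennreal ((norm F')\<^sup>2) * (\<integral>\<^sup>+\<omega>. ennreal ((norm (step_integral W (g' n) \<omega> - J' \<omega>))\<^sup>2) \<partial>M))" for n
  proof -
    let ?a = "\<lambda>\<omega>. F *v step_integral W (g n) \<omega>" and ?b = "\<lambda>\<omega>. F' *v step_integral W (g' n) \<omega>"
    have "(\<integral>\<^sup>+\<omega>. ennreal ((norm ((?a \<omega> + ?b \<omega>) - (F *v J \<omega> + F' *v J' \<omega>)))\<^sup>2) \<partial>M)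
      \<le> 2 * (\<integral>\<^sup>+\<omega>. ennreal ((norm ((?a \<omega> + ?b \<omega>) - (F *v J \<omega> + ?b \<omega>)))\<^sup>2) \<partial>M)
        + 2 * (\<integral>\<^sup>+\<omega>. ennreal ((norm ((F *v J \<omega> + ?b \<omega>) - (F *v J \<omega> + F' *v J' \<omega>)))\<^sup>2) \<partial>M)"
      by (rule nn_integral_norm_sq_triangle) measurable
    also have "\<dots> = 2 * (\<integral>\<^sup>+\<omega>. ennreal ((norm (F *v (step_integral W (g n) \<omega> - J \<omega>)))\<^sup>2) \<partial>M)
        + 2 * (\<integral>\<^sup>+\<omega>. ennreal ((norm (F' *v (step_integral W (g' n) \<omega> - J' \<omega>)))\<^sup>2) \<partial>M)"
      by (simp add: bounded_bilinear.diff_right [OF bounded_bilinear_matvec])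
    also have "\<dots> \<le> 2 * (ennreal ((norm F)\<^sup>2) * (\<integral>\<^sup>+\<omega>. ennreal ((norm (step_integral W (g n) \<omega> - J \<omega>))\<^sup>2) \<partial>M))
      + 2 * (ennreal ((norm F')\<^sup>2) * (\<integral>\<^sup>+\<omega>. ennreal ((norm (step_integral W (g' n) \<omega> - J' \<omega>))\<^sup>2) \<partial>M))"
      by (intro add_mono mult_left_mono pull) auto
    finally show ?thesis by (simp add: G_def step_integral_map)
  qed
  have lim0: "(\<lambda>n. 2 * (ennreal a * x n) + 2 * (ennreal b * y n)) \<longlonglongrightarrow> 0"
    if "x \<longlonglongrightarrow> 0" "y \<longlonglongrightarrow> 0" for a b and x y :: "nat \<Rightarrow> ennreal"
  proof -
    have "(\<lambda>n. 2 * (ennreal a * x n) + 2 * (ennreal b * y n)) \<longlonglongrightarrow> 2 * (ennreal a * 0) + 2 * (ennreal b * 0)"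
      by (intro tendsto_add ennreal_tendsto_cmult that) auto
    then show ?thesis by simp
  qed
  show ?thesis
    unfolding has_wiener_integral_iff
  proof (intro conjI exI [of _ G] allI m)
    show "(\<lambda>\<omega>. F *v J \<omega> + F' *v J' \<omega>) \<in> borel_measurable M" by measurable
    show "step_list T (G n)" for n using g(1) g'(1) by (simp add: G_def)
    show "(\<lambda>n. ito_sq R T (\<lambda>s. step_function (G n) s - (F ** f s + F' ** f' s))) \<longlonglongrightarrow> 0"
      by (rule tendsto_sandwich [OF always_eventually always_eventually tendsto_const
            lim0 [OF g(2) g'(2), of "(norm F)\<^sup>2" "(norm F')\<^sup>2"]]) (use q in auto)
    show "(\<lambda>n. \<integral>\<^sup>+\<omega>. ennreal ((norm (step_integral W (G n) \<omega> - (F *v J \<omega> + F' *v J' \<omega>)))\<^sup>2) \<partial>M) \<longlonglongrightarrow> 0"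
      by (rule tendsto_sandwich [OF always_eventually always_eventually tendsto_const
            lim0 [OF g(3) g'(3), of "(norm F)\<^sup>2" "(norm F')\<^sup>2"]]) (use l in auto)
  qed
qed

lemma has_wiener_integral_interval:
  fixes f :: "real \<Rightarrow> real^'m^'k" and F :: "real^'k^'l"
  assumes "has_wiener_integral M R W u f J" "has_wiener_integral M R W v f J'" "u \<le> v" "v \<le> T"
  shows "has_wiener_integral M R W T (\<lambda>s. indicat_real {u<..v} s *\<^sub>R (F ** f s)) (\<lambda>\<omega>. F *v (J' \<omega> - J \<omega>))"
proof -
  have "has_wiener_integral M R W T
      (\<lambda>s. F ** (indicat_real {..v} s *\<^sub>R f s) + (- F) ** (indicat_real {..u} s *\<^sub>R f s)) (\<lambda>\<omega>. F *v J' \<omega> + (- F) *v J \<omega>)"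
    using assms by (intro has_wiener_integral_linear has_wiener_integral_extend [OF assms(1)] has_wiener_integral_extend [OF assms(2)]) auto
  moreover have "F ** (indicat_real {..v} s *\<^sub>R f s) + (- F) ** (indicat_real {..u} s *\<^sub>R f s) = indicat_real {u<..v} s *\<^sub>R (F ** f s)" for s
    using assms(3) by (auto simp: indicator_def bounded_bilinear.zero_right [OF bounded_bilinear_matmul] bounded_bilinear.minus_left [OF bounded_bilinear_matmul])
  moreover have "F *v J' \<omega> + (- F) *v J \<omega> = F *v (J' \<omega> - J \<omega>)" for \<omega>
    by (simp add: bounded_bilinear.diff_right [OF bounded_bilinear_matvec] bounded_bilinear.minus_left [OF bounded_bilinear_matvec])
  ultimately show ?thesis by (simp only:)
qed

lemma has_wiener_integral_add:
  fixes f f' :: "real \<Rightarrow> real^'m^'k"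
  assumes "has_wiener_integral M R W T f J" "has_wiener_integral M R W T f' J'"
  shows "has_wiener_integral M R W T (\<lambda>s. f s + f' s) (\<lambda>\<omega>. J \<omega> + J' \<omega>)"
  using has_wiener_integral_linear [OF assms, of "mat 1" "mat 1"] by simp

lemma has_wiener_integral_left_mult:
  fixes f :: "real \<Rightarrow> real^'m^'k" and F :: "real^'k^'l"
  assumes "has_wiener_integral M R W T f J"
  shows "has_wiener_integral M R W T (\<lambda>s. F ** f s) (\<lambda>\<omega>. F *v J \<omega>)"
  using has_wiener_integral_linear [OF assms assms, of F 0]
  by (simp add: bounded_bilinear.zero_left [OF bounded_bilinear_matmul])

lemma has_wiener_integral_approx:
  fixes f :: "real \<Rightarrow> real^'m^'k"
  assumes J: "has_wiener_integral M R W T f J"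
  shows "\<exists>g. (\<forall>n. step_list T (g n)) \<and> (\<lambda>n. ito_sq R T (\<lambda>s. step_function (g n) s - f s)) \<longlonglongrightarrow> 0 \<and>
    (\<forall>n. integrable M (\<lambda>\<omega>. step_integral W (g n) \<omega> - J \<omega>)) \<and>
    (\<lambda>n. \<integral>\<omega>. norm (step_integral W (g n) \<omega> - J \<omega>) \<partial>M) \<longlonglongrightarrow> 0 \<and>
    (AE \<omega> in M. (\<lambda>n. step_integral W (g n) \<omega>) \<longlonglongrightarrow> J \<omega>)"
proof -
  obtain g0 where g0: "\<And>n. step_list T (g0 n)" "(\<lambda>n. ito_sq R T (\<lambda>s. step_function (g0 n) s - f s)) \<longlonglongrightarrow> 0"
    "(\<lambda>n. \<integral>\<^sup>+\<omega>. ennreal ((norm (step_integral W (g0 n) \<omega> - J \<omega>))\<^sup>2) \<partial>M) \<longlonglongrightarrow> 0"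
    using J unfolding has_wiener_integral_iff by blast
  have "\<forall>\<^sub>F n in sequentially. (\<integral>\<^sup>+\<omega>. ennreal ((norm (step_integral W (g0 n) \<omega> - J \<omega>))\<^sup>2) \<partial>M) < 1"
    by (rule order_tendstoD [OF g0(3)]) simp
  then obtain k where k: "\<And>n. n \<ge> k \<Longrightarrow> (\<integral>\<^sup>+\<omega>. ennreal ((norm (step_integral W (g0 n) \<omega> - J \<omega>))\<^sup>2) \<partial>M) < 1"
    unfolding eventually_sequentially by blast
  define g where "g n = g0 (n + k)" for n
  define D where "D n \<omega> = step_integral W (g n) \<omega> - J \<omega>" for n \<omega>
  have [measurable]: "J \<in> borel_measurable M" by (rule has_wiener_integral_measurable(1) [OF J])
  have g: "step_list T (g n)" for n by (simp add: g_def g0)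
  have [measurable]: "step_integral W (g n) \<in> borel_measurable M" for n by (rule step_integral_measurable [OF g])
  have Dm [measurable]: "D n \<in> borel_measurable M" for n unfolding D_def [abs_def] by measurable
  have fin: "(\<integral>\<^sup>+\<omega>. ennreal ((norm (D n \<omega>))\<^sup>2) \<partial>M) < \<infinity>" for n
    using less_trans [OF k [of "n + k"], of \<infinity>] by (simp add: D_def g_def)
  have D2: "integrable M (\<lambda>\<omega>. (norm (D n \<omega>))\<^sup>2)" for n
    by (rule integrableI_bounded) (use fin [of n] in auto)
  have "(\<lambda>n. \<integral>\<^sup>+\<omega>. ennreal ((norm (D n \<omega>))\<^sup>2) \<partial>M) \<longlonglongrightarrow> 0"
    using LIMSEQ_ignore_initial_segment [OF g0(3), of k] by (simp add: D_def g_def)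
  moreover have "(\<integral>\<^sup>+\<omega>. ennreal ((norm (D n \<omega>))\<^sup>2) \<partial>M) = ennreal (\<integral>\<omega>. (norm (D n \<omega>))\<^sup>2 \<partial>M)" for n
    by (rule nn_integral_eq_integral [OF D2]) simp
  ultimately have "(\<lambda>n. ennreal (\<integral>\<omega>. (norm (D n \<omega>))\<^sup>2 \<partial>M)) \<longlonglongrightarrow> ennreal 0" by simp
  then have "(\<lambda>n. \<integral>\<omega>. (norm (D n \<omega>))\<^sup>2 \<partial>M) \<longlonglongrightarrow> 0"
    by (subst (asm) tendsto_ennreal_iff) (auto intro!: always_eventually Bochner_Integration.integral_nonneg)
  then have "(\<lambda>n. sqrt (\<integral>\<omega>. (norm (D n \<omega>))\<^sup>2 \<partial>M)) \<longlonglongrightarrow> sqrt 0" by (rule tendsto_real_sqrt)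
  then have sq: "(\<lambda>n. sqrt (\<integral>\<omega>. (norm (D n \<omega>))\<^sup>2 \<partial>M)) \<longlonglongrightarrow> 0" by simp
  have L1: "(\<lambda>n. \<integral>\<omega>. norm (D n \<omega>) \<partial>M) \<longlonglongrightarrow> 0"
  proof (rule tendsto_sandwich [OF _ _ tendsto_const sq])
    show "\<forall>\<^sub>F n in sequentially. 0 \<le> (\<integral>\<omega>. norm (D n \<omega>) \<partial>M)"
      by (intro always_eventually allI Bochner_Integration.integral_nonneg) simp
    show "\<forall>\<^sub>F n in sequentially. (\<integral>\<omega>. norm (D n \<omega>) \<partial>M) \<le> sqrt (\<integral>\<omega>. (norm (D n \<omega>))\<^sup>2 \<partial>M)"
      by (intro always_eventually allI integrable_norm_sqD(2) [OF Dm D2])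
  qed
  have Di: "integrable M (D n)" for n by (rule integrable_norm_sqD(1) [OF Dm D2])
  obtain r where r: "strict_mono r" "AE \<omega> in M. (\<lambda>n. D (r n) \<omega>) \<longlonglongrightarrow> 0"
    using tendsto_L1_AE_subseq [OF Di L1] by blast
  show ?thesis
  proof (intro exI [of _ "\<lambda>n. g (r n)"] conjI allI g)
    have "(\<lambda>n. ito_sq R T (\<lambda>s. step_function (g n) s - f s)) \<longlonglongrightarrow> 0"
      using LIMSEQ_ignore_initial_segment [OF g0(2), of k] by (simp add: g_def)
    then show "(\<lambda>n. ito_sq R T (\<lambda>s. step_function (g (r n)) s - f s)) \<longlonglongrightarrow> 0"
      using LIMSEQ_subseq_LIMSEQ [OF _ r(1)] unfolding o_def by blast
    show "integrable M (\<lambda>\<omega>. step_integral W (g (r n)) \<omega> - J \<omega>)" for n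
      using Di [of "r n"] unfolding D_def [abs_def] .
    show "(\<lambda>n. \<integral>\<omega>. norm (step_integral W (g (r n)) \<omega> - J \<omega>) \<partial>M) \<longlonglongrightarrow> 0"
      using LIMSEQ_subseq_LIMSEQ [OF L1 r(1)] unfolding o_def D_def .
    show "AE \<omega> in M. (\<lambda>n. step_integral W (g (r n)) \<omega>) \<longlonglongrightarrow> J \<omega>"
      using r(2) by eventually_elim (simp add: D_def LIM_zero_iff)
  qed
qed

lemma step_integral_integrable: "step_list T g \<Longrightarrow> integrable M (step_integral W g)"
  by (rule integrable_norm_sqD(1) [OF step_integral_measurable step_ito_isometry(1)])

lemma has_wiener_integral_integrable:
  fixes f :: "real \<Rightarrow> real^'m^'k"
  assumes J: "has_wiener_integral M R W T f J" shows "integrable M J"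
proof -
  obtain g where g: "step_list T (g (0::nat))" "integrable M (\<lambda>\<omega>. step_integral W (g 0) \<omega> - J \<omega>)"
    using has_wiener_integral_approx [OF J] by blast
  have "integrable M (\<lambda>\<omega>. step_integral W (g 0) \<omega> - (step_integral W (g 0) \<omega> - J \<omega>))"
    by (rule Bochner_Integration.integrable_diff [OF step_integral_integrable [OF g(1)] g(2)])
  then show ?thesis by simp
qed

lemma has_wiener_integral_adapted:
  fixes f :: "real \<Rightarrow> real^'m^'k"
  assumes J: "has_wiener_integral M R W T f J"
  shows "\<exists>J'\<in>borel_measurable (generated_sigma M {0..T} W). AE \<omega> in M. J \<omega> = J' \<omega>"
proof -
  obtain g where "\<forall>n. step_list T (g n)" and lim: "AE \<omega> in M. (\<lambda>n. step_integral W (g n) \<omega>) \<longlonglongrightarrow> J \<omega>"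
    using has_wiener_integral_approx [OF J] by (elim exE conjE) (rule that)
  then have g: "step_list T (g n)" for n by blast
  have "(\<lambda>\<omega>. lim (\<lambda>n. step_integral W (g n) \<omega>)) \<in> borel_measurable (generated_sigma M {0..T} W)"
    by (intro borel_measurable_lim_metric step_integral_generated g)
  moreover have "AE \<omega> in M. J \<omega> = lim (\<lambda>n. step_integral W (g n) \<omega>)"
    using lim by eventually_elim (simp add: limI)
  ultimately show ?thesis by (intro bexI [where x = "\<lambda>\<omega>. lim (\<lambda>n. step_integral W (g n) \<omega>)"])
qed

text \<open>Step integrals are linear in the increments, and integrals over an event pass to limits in \<open>L\<^sup>1\<close>.\<close>

lemma has_wiener_integral_mean_on:
  fixes f :: "real \<Rightarrow> real^'m^'k"
  assumes J: "has_wiener_integral M R W T f J" and A [measurable]: "A \<in> sets M"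
    and incr: "\<And>s t x. 0 \<le> s \<Longrightarrow> s \<le> t \<Longrightarrow> (\<integral>\<omega>. indicat_real A \<omega> * (x \<bullet> (W t \<omega> - W s \<omega>)) \<partial>M) = 0"
  shows "(\<integral>\<omega>. indicat_real A \<omega> * (x \<bullet> J \<omega>) \<partial>M) = 0"
proof -
  have step: "has_bochner_integral M (\<lambda>\<omega>. indicat_real A \<omega> * (x \<bullet> step_integral W g \<omega>)) 0"
    if "step_list T g" for x :: "real^'k" and g
    using that
  proof (induction rule: step_list_induct)
    case Nil
    then show ?case by (simp add: has_bochner_integral_zero)
  next
    case (Cons c a b g)
    have "integrable M (\<lambda>\<omega>. indicat_real A \<omega> * ((transpose c *v x) \<bullet> (W b \<omega> - W a \<omega>)))"
      using integrable_mult_indicator [OF A increment_integrable(1) [OF Cons(1,2), of "transpose c *v x"]] by simp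
    then have "has_bochner_integral M (\<lambda>\<omega>. indicat_real A \<omega> * ((transpose c *v x) \<bullet> (W b \<omega> - W a \<omega>))) 0"
      using incr [OF Cons(1,2), of "transpose c *v x"] by (simp add: has_bochner_integral_iff)
    from has_bochner_integral_add [OF this Cons.IH] show ?case
      by (simp add: inner_matvec_transpose inner_add_right distrib_left del: transpose_matrix_vector)
  qed
  obtain g where g: "\<And>n. step_list T (g n)" "\<And>n. integrable M (\<lambda>\<omega>. step_integral W (g n) \<omega> - J \<omega>)"
    "(\<lambda>n. \<integral>\<omega>. norm (step_integral W (g n) \<omega> - J \<omega>) \<partial>M) \<longlonglongrightarrow> 0"
    using has_wiener_integral_approx [OF J] by blast
  have Ji: "integrable M (\<lambda>\<omega>. indicat_real A \<omega> * (x \<bullet> J \<omega>))"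
    using integrable_mult_indicator [OF A integrable_inner_right [OF has_wiener_integral_integrable [OF J], of x]] by simp
  have le: "\<bar>\<integral>\<omega>. indicat_real A \<omega> * (x \<bullet> J \<omega>) \<partial>M\<bar> \<le> norm x * (\<integral>\<omega>. norm (step_integral W (g n) \<omega> - J \<omega>) \<partial>M)" for n
  proof -
    have s: "integrable M (\<lambda>\<omega>. indicat_real A \<omega> * (x \<bullet> step_integral W (g n) \<omega>))"
      "(\<integral>\<omega>. indicat_real A \<omega> * (x \<bullet> step_integral W (g n) \<omega>) \<partial>M) = 0"
      using step [OF g(1) [of n], of x] by (auto simp: has_bochner_integral_iff)
    have "\<bar>\<integral>\<omega>. indicat_real A \<omega> * (x \<bullet> J \<omega>) \<partial>M\<bar>
      = \<bar>(\<integral>\<omega>. indicat_real A \<omega> * (x \<bullet> step_integral W (g n) \<omega>) - indicat_real A \<omega> * (x \<bullet> J \<omega>) \<partial>M)\<bar>"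
      using s Ji by (simp add: Bochner_Integration.integral_diff)
    also have "\<dots> \<le> (\<integral>\<omega>. norm x * norm (step_integral W (g n) \<omega> - J \<omega>) \<partial>M)"
    proof (rule order_trans [OF integral_abs_bound], rule integral_mono)
      show "integrable M (\<lambda>\<omega>. \<bar>indicat_real A \<omega> * (x \<bullet> step_integral W (g n) \<omega>) - indicat_real A \<omega> * (x \<bullet> J \<omega>)\<bar>)"
        by (intro integrable_abs Bochner_Integration.integrable_diff s Ji)
      show "integrable M (\<lambda>\<omega>. norm x * norm (step_integral W (g n) \<omega> - J \<omega>))"
        by (intro integrable_mult_right integrable_norm g)
      fix \<omega>
      have "\<bar>x \<bullet> (step_integral W (g n) \<omega> - J \<omega>)\<bar> \<le> norm x * norm (step_integral W (g n) \<omega> - J \<omega>)"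
        by (rule Cauchy_Schwarz_ineq2)
      then show "\<bar>indicat_real A \<omega> * (x \<bullet> step_integral W (g n) \<omega>) - indicat_real A \<omega> * (x \<bullet> J \<omega>)\<bar>
        \<le> norm x * norm (step_integral W (g n) \<omega> - J \<omega>)"
        by (auto simp: indicator_def inner_diff_right)
    qed
    finally show ?thesis by simp
  qed
  have "(\<lambda>n. norm x * (\<integral>\<omega>. norm (step_integral W (g n) \<omega> - J \<omega>) \<partial>M)) \<longlonglongrightarrow> norm x * 0"
    by (intro tendsto_intros g)
  then have "\<bar>\<integral>\<omega>. indicat_real A \<omega> * (x \<bullet> J \<omega>) \<partial>M\<bar> \<le> norm x * 0"
    by (rule LIMSEQ_le_const) (use le in auto)
  then show ?thesis by simp
qed

lemma has_wiener_integral_AE_limit: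
  fixes f :: "real \<Rightarrow> real^'m^'k"
  assumes J: "has_wiener_integral M R W T f J" and Jn: "\<And>n. has_wiener_integral M R W T (fn n) (Jn n)"
    and lim: "(\<lambda>n. ito_sq R T (\<lambda>s. fn n s - f s)) \<longlonglongrightarrow> 0" and AE: "AE \<omega> in M. (\<lambda>n. Jn n \<omega>) \<longlonglongrightarrow> L \<omega>"
  shows "AE \<omega> in M. J \<omega> = L \<omega>"
proof -
  have [measurable]: "J \<in> borel_measurable M" "Jn n \<in> borel_measurable M" for n
    using has_wiener_integral_measurable(1) [OF J] has_wiener_integral_measurable(1) [OF Jn] by auto
  define L' where "L' \<omega> = lim (\<lambda>n. Jn n \<omega>)" for \<omega>
  have [measurable]: "L' \<in> borel_measurable M" unfolding L'_def [abs_def] by measurable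
  have "(\<lambda>n. 16 * ito_sq R T (\<lambda>s. fn n s - f s)) \<longlonglongrightarrow> 16 * 0"
    by (intro ennreal_tendsto_cmult lim) auto
  then have lim16: "(\<lambda>n. 16 * ito_sq R T (\<lambda>s. fn n s - f s)) \<longlonglongrightarrow> 0" by simp
  have "(\<integral>\<^sup>+\<omega>. ennreal ((norm (L' \<omega> - J \<omega>))\<^sup>2) \<partial>M) \<le> 0 + ennreal e" if e: "0 < e" for e
  proof (rule nn_integral_fatou_le)
    show "(\<lambda>\<omega>. ennreal ((norm (Jn n \<omega> - J \<omega>))\<^sup>2)) \<in> borel_measurable M" for n by measurable
    show "AE \<omega> in M. (\<lambda>n. ennreal ((norm (Jn n \<omega> - J \<omega>))\<^sup>2)) \<longlonglongrightarrow> ennreal ((norm (L' \<omega> - J \<omega>))\<^sup>2)"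
      using AE by eventually_elim (auto simp: L'_def limI intro!: tendsto_intros)
    have "\<forall>\<^sub>F n in sequentially. 16 * ito_sq R T (\<lambda>s. fn n s - f s) < ennreal e"
      using e by (intro order_tendstoD(2) [OF lim16]) simp
    then show "\<forall>\<^sub>F n in sequentially. (\<integral>\<^sup>+\<omega>. ennreal ((norm (Jn n \<omega> - J \<omega>))\<^sup>2) \<partial>M) \<le> 0 + ennreal e"
      by eventually_elim (rule order_trans [OF has_wiener_integral_diff_le [OF Jn J]], simp)
  qed
  then have "(\<integral>\<^sup>+\<omega>. ennreal ((norm (L' \<omega> - J \<omega>))\<^sup>2) \<partial>M) \<le> 0"
    by (rule ennreal_le_epsilon)
  then have "AE \<omega> in M. ennreal ((norm (L' \<omega> - J \<omega>))\<^sup>2) = 0"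
    by (subst (asm) le_zero_eq, subst (asm) nn_integral_0_iff_AE) auto
  then show ?thesis using AE by eventually_elim (auto simp: L'_def limI)
qed

lemma has_wiener_integral_wiener_integral:
  assumes "has_wiener_integral M R W T f J"
  shows "has_wiener_integral M R W T f (wiener_integral M R W T f)"
  unfolding wiener_integral_def by (rule someI [where P = "has_wiener_integral M R W T f", OF assms])

lemma wiener_integral_AE_eq:
  fixes f :: "real \<Rightarrow> real^'m^'k"
  assumes "has_wiener_integral M R W T f J"
  shows "AE \<omega> in M. wiener_integral M R W T f \<omega> = J \<omega>"
  by (rule has_wiener_integral_AE_unique [OF has_wiener_integral_wiener_integral [OF assms] assms]) simp

text \<open>Integration by parts reduces the integral of \<open>U K\<close> to an ordinary integral of the path
  of \<open>N = \<integral> K dW\<close>: replace \<open>U\<close> by its value at the left end of each grid cell, for which the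
  integral is an elementary sum of increments of \<open>N\<close>.\<close>

lemma wiener_integral_by_parts:
  fixes U U' :: "real \<Rightarrow> real^'k^'l" and K :: "real \<Rightarrow> real^'m^'k" and N :: "real \<Rightarrow> 'w \<Rightarrow> real^'k"
  assumes T: "0 \<le> T" and U': "set_integrable lborel {0..T} U'"
    and U: "\<And>s t. 0 \<le> s \<Longrightarrow> s \<le> t \<Longrightarrow> t \<le> T \<Longrightarrow> U t - U s = integral {s..t} U'"
    and cont: "AE \<omega> in M. continuous_on {0..T} (\<lambda>t. N t \<omega>)"
    and N: "\<And>t. 0 \<le> t \<Longrightarrow> t \<le> T \<Longrightarrow> has_wiener_integral M R W t K (N t)"
    and fin: "ito_sq R T K < \<infinity>" and J: "has_wiener_integral M R W T (\<lambda>s. U s ** K s) J"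
  shows "AE \<omega> in M. J \<omega> = U T *v N T \<omega> - U 0 *v N 0 \<omega> - integral {0..T} (\<lambda>s. U' s *v N s \<omega>)"
proof -
  define c where "c n s = (\<Sum>i<n. indicat_real {grid T n i<..grid T n (Suc i)} s *\<^sub>R U (grid T n i))" for n s
  define fn where "fn n s = (\<Sum>i<n. indicat_real {grid T n i<..grid T n (Suc i)} s *\<^sub>R (U (grid T n i) ** K s))" for n s
  define Jn where "Jn n \<omega> = (\<Sum>i<n. U (grid T n i) *v (N (grid T n (Suc i)) \<omega> - N (grid T n i) \<omega>))" for n \<omega>
  have mK: "set_borel_measurable borel {0..T} K" by (rule has_wiener_integral_measurable(2) [OF N [OF T order_refl]])
  have has: "has_wiener_integral M R W T (fn n) (Jn n)" for n
  proof -
    have "has_wiener_integral M R W T (\<lambda>s. \<Sum>i<m. indicat_real {grid T n i<..grid T n (Suc i)} s *\<^sub>R (U (grid T n i) ** K s))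
      (\<lambda>\<omega>. \<Sum>i<m. U (grid T n i) *v (N (grid T n (Suc i)) \<omega> - N (grid T n i) \<omega>))" if "m \<le> n" for m
      using that
    proof (induction m)
      case 0
      then show ?case by (simp add: has_wiener_integral_0)
    next
      case (Suc m)
      have b: "0 \<le> grid T n m" "grid T n m \<le> T" "0 \<le> grid T n (Suc m)" "grid T n (Suc m) \<le> T" "grid T n m \<le> grid T n (Suc m)"
        using grid_bounds [OF T, of m n] grid_bounds [OF T, of "Suc m" n] grid_mono [OF T, of m "Suc m" n] Suc.prems by auto
      have "has_wiener_integral M R W T (\<lambda>s. indicat_real {grid T n m<..grid T n (Suc m)} s *\<^sub>R (U (grid T n m) ** K s))
        (\<lambda>\<omega>. U (grid T n m) *v (N (grid T n (Suc m)) \<omega> - N (grid T n m) \<omega>))"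
        by (rule has_wiener_integral_interval [OF N [OF b(1,2)] N [OF b(3,4)] b(5,4)])
      from has_wiener_integral_add [OF Suc.IH this] Suc.prems show ?case by (simp del: of_nat_Suc)
    qed
    from this [OF order_refl] show ?thesis unfolding fn_def [abs_def] Jn_def [abs_def] .
  qed
  have cU: "continuous_on {0..T} U"
  proof -
    have "continuous_on {0..T} (\<lambda>t. U 0 + integral {0..t} U')"
      by (intro continuous_intros indefinite_integral_continuous_1 set_integrable_imp_integrable_on U')
    moreover have "U 0 + integral {0..t} U' = U t" if "t \<in> {0..T}" for t
      using U [of 0 t] that by (simp add: algebra_simps)
    ultimately show ?thesis by (metis (no_types, lifting) continuous_on_eq)
  qed
  have lim: "(\<lambda>n. ito_sq R T (\<lambda>s. fn n s - U s ** K s)) \<longlonglongrightarrow> 0"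
  proof -
    have bd: "\<forall>\<^sub>F n in sequentially. ito_sq R T (\<lambda>s. fn n s - U s ** K s) \<le> ennreal (d\<^sup>2) * ito_sq R T K" if d: "0 < d" for d
    proof -
      have "uniformly_continuous_on {0..T} U" by (intro compact_uniformly_continuous cU) auto
      then obtain r where r: "r > 0" "\<And>s t. s \<in> {0..T} \<Longrightarrow> t \<in> {0..T} \<Longrightarrow> dist t s < r \<Longrightarrow> dist (U t) (U s) < d"
        unfolding uniformly_continuous_on_def using d by metis
      show ?thesis
        using grid_fine [OF T r(1)] eventually_gt_at_top [of 0]
      proof eventually_elim
        case (elim n)
        have cell: "c n s = U (grid T n i) \<and> fn n s = U (grid T n i) ** K s"
          if "0 < s" "s \<le> T" "i < n" "grid T n i < s" "s \<le> grid T n (Suc i)" for s i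
          unfolding c_def fn_def
          using sum_grid_indicator [OF T that(3-5), of "\<lambda>i. U (grid T n i)"]
            sum_grid_indicator [OF T that(3-5), of "\<lambda>i. U (grid T n i) ** K s"] by simp
        have "ito_sq R T (\<lambda>s. fn n s - U s ** K s) = ito_sq R T (\<lambda>s. (c n s - U s) ** K s)"
        proof (rule ito_sq_cong)
          fix s assume s: "0 < s" "s \<le> T"
          obtain i where "i < n" "grid T n i < s" "s \<le> grid T n (Suc i)"
            using grid_cell [OF _ elim(2) s] s by auto
          then show "fn n s - U s ** K s = (c n s - U s) ** K s"
            using cell [OF s] by (simp add: bounded_bilinear.diff_left [OF bounded_bilinear_matmul])
        qed
        also have "\<dots> \<le> ennreal (d\<^sup>2) * ito_sq R T K"
        proof (rule ito_sq_left_mult [OF mK])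
          fix s assume s: "0 < s" "s \<le> T"
          obtain i where i: "i < n" "grid T n i < s" "s \<le> grid T n (Suc i)"
            using grid_cell [OF _ elim(2) s] s by auto
          have "grid T n (Suc i) - grid T n i = T / n" by (simp add: add_divide_distrib ring_distribs)
          then have "dist (grid T n i) s < r" using i elim by (auto simp: dist_real_def)
          then have "dist (U (grid T n i)) (U s) < d"
            using s grid_bounds [OF T, of i n] i by (intro r) auto
          then show "norm (c n s - U s) \<le> d" using cell [OF s i] by (simp add: dist_norm)
        qed
        finally show ?case .
      qed
    qed
    obtain q where q: "0 \<le> q" "ito_sq R T K = ennreal q" using fin by (cases "ito_sq R T K") auto
    show ?thesis
    proof (rule order_tendstoI)
      fix y :: ennreal assume "0 < y"
      then obtain z where z: "0 < z" "z < y" using dense by blast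
      then obtain e where "z = ennreal e" by (cases z) auto
      then have e: "0 < ennreal e" "ennreal e < y" using z by auto
      define d where "d = sqrt (e / (q + 1))"
      have e0: "0 < e" using e by simp
      have d: "0 < d" "d\<^sup>2 * q \<le> e" using e0 q by (auto simp: d_def field_simps)
      show "\<forall>\<^sub>F n in sequentially. ito_sq R T (\<lambda>s. fn n s - U s ** K s) < y"
        using bd [OF d(1)]
      proof eventually_elim
        case (elim n)
        also have "ennreal (d\<^sup>2) * ito_sq R T K \<le> ennreal e" using d q by (simp add: ennreal_mult [symmetric] ennreal_leI)
        finally show ?case using e by simp
      qed
    qed simp
  qed
  show ?thesis
  proof (rule has_wiener_integral_AE_limit [OF J has lim])
    show "AE \<omega> in M. (\<lambda>n. Jn n \<omega>) \<longlonglongrightarrow> U T *v N T \<omega> - U 0 *v N 0 \<omega> - integral {0..T} (\<lambda>s. U' s *v N s \<omega>)"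
      using cont
    proof eventually_elim
      case (elim \<omega>)
      show ?case unfolding Jn_def
        by (rule stieltjes_sum_limit [OF bounded_bilinear_matvec T elim U' U])
    qed
  qed
qed

end

section \<open>The Riccati equation and its transition matrices\<close>

lemma has_vector_derivative_quotient:
  fixes f :: "real \<Rightarrow> 'a::real_normed_vector"
  shows "(f has_vector_derivative D) (at x within S) \<longleftrightarrow>
    ((\<lambda>y. (f y - f x) /\<^sub>R (y - x)) \<longlongrightarrow> D) (at x within S)"
proof -
  have eq: "norm ((f y - f x) - (y - x) *\<^sub>R D) / norm (y - x) = norm ((f y - f x) /\<^sub>R (y - x) - D)" if "y \<noteq> x" for y
  proof -
    have "(f y - f x) /\<^sub>R (y - x) - D = ((f y - f x) - (y - x) *\<^sub>R D) /\<^sub>R (y - x)"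
      using that by (simp add: scaleR_diff_right)
    then show ?thesis by (simp add: divide_inverse mult.commute)
  qed
  have "(f has_vector_derivative D) (at x within S) \<longleftrightarrow>
    ((\<lambda>y. norm ((f y - f x) - (y - x) *\<^sub>R D) / norm (y - x)) \<longlongrightarrow> 0) (at x within S)"
    unfolding has_vector_derivative_def has_derivative_iff_norm by (simp add: bounded_linear_scaleR_left)
  also have "\<dots> \<longleftrightarrow> ((\<lambda>y. norm ((f y - f x) /\<^sub>R (y - x) - D)) \<longlongrightarrow> 0) (at x within S)"
    by (rule filterlim_cong [OF refl refl]) (unfold eventually_at_filter, intro always_eventually allI impI eq)
  also have "\<dots> \<longleftrightarrow> ((\<lambda>y. (f y - f x) /\<^sub>R (y - x)) \<longlongrightarrow> D) (at x within S)"
    unfolding tendsto_norm_zero_iff by (rule LIM_zero_iff)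
  finally show ?thesis .
qed

text \<open>Pass to the limit in \<open>S\<^sub>y\<^sup>-\<^sup>1 - S\<^sub>t\<^sup>-\<^sup>1 = - S\<^sub>y\<^sup>-\<^sup>1 (S\<^sub>y - S\<^sub>t) S\<^sub>t\<^sup>-\<^sup>1\<close>.\<close>

lemma matrix_inv_has_vector_derivative:
  fixes S :: "real \<Rightarrow> real^'n^'n"
  assumes S: "(S has_vector_derivative S') (at t within X)" and t: "t \<in> X"
    and inv: "\<And>s. s \<in> X \<Longrightarrow> invertible (S s)" and cont: "continuous_on X S"
  shows "((\<lambda>s. matrix_inv (S s)) has_vector_derivative - (matrix_inv (S t) ** S' ** matrix_inv (S t))) (at t within X)"
proof -
  let ?P = "\<lambda>s. matrix_inv (S s)"
  have "continuous_on X ?P" by (rule continuous_on_matrix_inv [OF cont inv])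
  then have P: "(?P \<longlongrightarrow> ?P t) (at t within X)" using t by (simp add: continuous_on_def)
  have "((\<lambda>y. - (?P y ** ((S y - S t) /\<^sub>R (y - t)) ** ?P t)) \<longlongrightarrow> - (?P t ** S' ** ?P t)) (at t within X)"
    using S unfolding has_vector_derivative_quotient by (intro tendsto_intros P)
  moreover have "- (?P y ** ((S y - S t) /\<^sub>R (y - t)) ** ?P t) = (?P y - ?P t) /\<^sub>R (y - t)" if "y \<in> X" for y
  proof -
    have "?P y ** (S y - S t) ** ?P t = ?P y ** S y ** ?P t - ?P y ** (S t ** ?P t)"
      by (simp add: bounded_bilinear.diff_left [OF bounded_bilinear_matmul] bounded_bilinear.diff_right [OF bounded_bilinear_matmul] matrix_mul_assoc)
    also have "\<dots> = ?P t - ?P y"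
      by (simp add: matrix_inv_inverse [OF inv [OF that]] matrix_inv_inverse [OF inv [OF t]])
    finally have "?P y ** (S y - S t) ** ?P t = ?P t - ?P y" .
    then have "(?P y ** (S y - S t) ** ?P t) /\<^sub>R (y - t) = (?P t - ?P y) /\<^sub>R (y - t)" by simp
    moreover have "?P y ** ((S y - S t) /\<^sub>R (y - t)) ** ?P t = (?P y ** (S y - S t) ** ?P t) /\<^sub>R (y - t)"
      by (simp only: bounded_bilinear.scaleR_left [OF bounded_bilinear_matmul] bounded_bilinear.scaleR_right [OF bounded_bilinear_matmul])
    ultimately have "?P y ** ((S y - S t) /\<^sub>R (y - t)) ** ?P t = (?P t - ?P y) /\<^sub>R (y - t)" by (simp only:)
    then show ?thesis by (simp only: scaleR_minus_right [symmetric] minus_diff_eq)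
  qed
  then have "\<forall>\<^sub>F y in at t within X. - (?P y ** ((S y - S t) /\<^sub>R (y - t)) ** ?P t) = (?P y - ?P t) /\<^sub>R (y - t)"
    by (simp add: eventually_at_filter)
  ultimately show ?thesis
    unfolding has_vector_derivative_quotient by (rule Lim_transform_eventually)
qed

lemma transpose_add: "transpose (X + Y) = transpose X + transpose (Y :: real^'n^'m)"
  by (simp add: transpose_def vec_eq_iff)

lemma transpose_diff: "transpose (X - Y) = transpose X - transpose (Y :: real^'n^'m)"
  by (simp add: transpose_def vec_eq_iff)

lemma transpose_minus: "transpose (- X) = - transpose (X :: real^'n^'m)"
  by (simp add: transpose_def vec_eq_iff)

lemma transpose_scaleR: "transpose (r *\<^sub>R X) = r *\<^sub>R transpose (X :: real^'n^'m)"
  by (simp add: transpose_def vec_eq_iff)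

lemma bounded_linear_trace: "bounded_linear (trace :: real^'n^'n \<Rightarrow> real)"
  unfolding linear_conv_bounded_linear [symmetric] linear_iff by (simp add: trace_def sum.distrib sum_distrib_left)

text \<open>The transition matrices are given with their final time as second argument; the backward
  matrix \<open>\<Phi>(0; t)\<close> is the inverse of the forward one, which makes it differentiable in \<open>t\<close>.\<close>

lemma transition_matrix_flow:
  fixes \<Phi> :: "real \<Rightarrow> real \<Rightarrow> real^'n^'n" and G :: "real \<Rightarrow> real^'n^'n"
  assumes G: "\<And>t. set_integrable lborel {0..t} G"
    and id: "\<And>\<tau>. 0 \<le> \<tau> \<Longrightarrow> \<Phi> \<tau> \<tau> = mat 1"
    and ode: "\<And>t \<tau>. 0 \<le> t \<Longrightarrow> 0 \<le> \<tau> \<Longrightarrow> ((\<lambda>s. \<Phi> s \<tau>) has_vector_derivative G t ** \<Phi> t \<tau>) (at t within {0..})"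
  shows "\<And>s T. 0 \<le> s \<Longrightarrow> 0 \<le> T \<Longrightarrow> transpose (\<Phi> s T) = transpose (\<Phi> 0 T) ** transpose (\<Phi> s 0)"
    "\<And>t. 0 \<le> t \<Longrightarrow> transpose (\<Phi> 0 t) ** transpose (\<Phi> t 0) = mat 1"
    "continuous_on {0..} (\<lambda>t. transpose (\<Phi> 0 t))" "continuous_on {0..} (\<lambda>t. transpose (\<Phi> t 0))"
    "\<And>t. set_integrable lborel {0..t} (\<lambda>s. (- transpose (G s)) ** transpose (\<Phi> 0 s))"
    "\<And>s t. 0 \<le> s \<Longrightarrow> s \<le> t \<Longrightarrow> transpose (\<Phi> 0 t) - transpose (\<Phi> 0 s) = integral {s..t} (\<lambda>s. (- transpose (G s)) ** transpose (\<Phi> 0 s))"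
proof -
  have flow: "\<Phi> s T = \<Phi> s 0 ** \<Phi> 0 T" if s: "0 \<le> s" and T: "0 \<le> T" for s T
  proof -
    have "\<Phi> s T - \<Phi> s 0 ** \<Phi> 0 T = 0"
    proof (rule linear_ode_zero [of "\<lambda>s. \<Phi> s T - \<Phi> s 0 ** \<Phi> 0 T" "\<lambda>s. G s ** (\<Phi> s T - \<Phi> s 0 ** \<Phi> 0 T)" "\<lambda>s. norm (G s)"])
      fix t :: real assume t: "0 \<le> t"
      have "((\<lambda>s. \<Phi> s T - \<Phi> s 0 ** \<Phi> 0 T) has_vector_derivative G t ** \<Phi> t T - (G t ** \<Phi> t 0) ** \<Phi> 0 T) (at t within {0..})"
        by (intro has_vector_derivative_diff ode t T order_refl
            bounded_linear.has_vector_derivative [OF bounded_bilinear.bounded_linear_left [OF bounded_bilinear_matmul]])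
      then show "((\<lambda>s. \<Phi> s T - \<Phi> s 0 ** \<Phi> 0 T) has_vector_derivative G t ** (\<Phi> t T - \<Phi> t 0 ** \<Phi> 0 T)) (at t within {0..})"
        by (simp add: bounded_bilinear.diff_right [OF bounded_bilinear_matmul] matrix_mul_assoc)
      show "norm (G t ** (\<Phi> t T - \<Phi> t 0 ** \<Phi> 0 T)) \<le> norm (G t) * norm (\<Phi> t T - \<Phi> t 0 ** \<Phi> 0 T)"
        by (rule norm_matmul_le)
    qed (use s id set_integrable_norm [OF G] in auto)
    then show ?thesis by simp
  qed
  then show "\<And>s T. 0 \<le> s \<Longrightarrow> 0 \<le> T \<Longrightarrow> transpose (\<Phi> s T) = transpose (\<Phi> 0 T) ** transpose (\<Phi> s 0)"
    by (metis matrix_transpose_mul)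
  have r: "\<Phi> t 0 ** \<Phi> 0 t = mat 1" if "0 \<le> t" for t
    using flow [OF that that] id [OF that] by simp
  have inv: "invertible (\<Phi> t 0)" if "0 \<le> t" for t
    using r [OF that] matrix_left_right_inverse unfolding invertible_def by blast
  have V: "\<Phi> 0 t = matrix_inv (\<Phi> t 0)" if "0 \<le> t" for t by (rule matrix_inv_unique [OF r [OF that]])
  show "transpose (\<Phi> 0 t) ** transpose (\<Phi> t 0) = mat 1" if "0 \<le> t" for t
    unfolding matrix_transpose_mul [symmetric] r [OF that] by (rule transpose_mat)
  have cF: "continuous_on {0..} (\<lambda>t. \<Phi> t 0)"
    unfolding continuous_on_eq_continuous_within by (auto intro: has_vector_derivative_continuous [OF ode])
  have "continuous_on {0..} (\<lambda>t. matrix_inv (\<Phi> t 0))"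
    by (rule continuous_on_matrix_inv [OF cF]) (use inv in auto)
  then have cV: "continuous_on {0..} (\<lambda>t. \<Phi> 0 t)" by (rule continuous_on_eq) (simp add: V)
  show "continuous_on {0..} (\<lambda>t. transpose (\<Phi> 0 t))" "continuous_on {0..} (\<lambda>t. transpose (\<Phi> t 0))"
    by (intro continuous_on_transpose cV cF)+
  have cU: "continuous_on {0..t} (\<lambda>t. transpose (\<Phi> 0 t))" for t
    by (intro continuous_on_transpose continuous_on_subset [OF cV]) auto
  show "set_integrable lborel {0..t} (\<lambda>s. (- transpose (G s)) ** transpose (\<Phi> 0 s))" for t
    by (rule set_integrable_bilinear_flip [OF bounded_bilinear_matmul cU])
      (use set_integrable_linear [OF bounded_linear_compose [OF bounded_linear_minus [OF bounded_linear_ident] bounded_linear_transpose] G, of t] in simp)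
  have dU: "((\<lambda>t. transpose (\<Phi> 0 t)) has_vector_derivative (- transpose (G t)) ** transpose (\<Phi> 0 t)) (at t within {0..})"
    if t: "0 \<le> t" for t
  proof -
    have "((\<lambda>s. matrix_inv (\<Phi> s 0)) has_vector_derivative - (matrix_inv (\<Phi> t 0) ** (G t ** \<Phi> t 0) ** matrix_inv (\<Phi> t 0))) (at t within {0..})"
      by (rule matrix_inv_has_vector_derivative [OF ode [OF t order_refl] _ inv cF]) (use t in auto)
    moreover have "matrix_inv (\<Phi> t 0) ** (G t ** \<Phi> t 0) ** matrix_inv (\<Phi> t 0) = \<Phi> 0 t ** G t"
      using r [OF t] by (simp add: V [OF t] matrix_mul_assoc [symmetric])
    ultimately have "((\<lambda>s. matrix_inv (\<Phi> s 0)) has_vector_derivative - (\<Phi> 0 t ** G t)) (at t within {0..})" by simp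
    then have "((\<lambda>s. \<Phi> 0 s) has_vector_derivative - (\<Phi> 0 t ** G t)) (at t within {0..})"
      by (rule has_vector_derivative_transform [rotated 2]) (use t V in auto)
    from bounded_linear.has_vector_derivative [OF bounded_linear_transpose this] show ?thesis
      by (simp add: matrix_transpose_mul linear_neg [OF bounded_linear.linear [OF bounded_linear_transpose]] bounded_bilinear.minus_left [OF bounded_bilinear_matmul])
  qed
  show "transpose (\<Phi> 0 t) - transpose (\<Phi> 0 s) = integral {s..t} (\<lambda>s. (- transpose (G s)) ** transpose (\<Phi> 0 s))"
    if "0 \<le> s" "s \<le> t" for s t
  proof (rule integral_unique [symmetric], rule fundamental_theorem_of_calculus [OF that(2)])
    fix x assume "x \<in> {s..t}"
    then show "((\<lambda>t. transpose (\<Phi> 0 t)) has_vector_derivative (- transpose (G x)) ** transpose (\<Phi> 0 x)) (at x within {s..t})"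
      by (intro has_vector_derivative_within_subset [OF dU]) (use that in auto)
  qed
qed

locale riccati =
  fixes A Q Sig :: "real \<Rightarrow> real^'d^'d" and C :: "real \<Rightarrow> real^'d^'m" and R :: "real \<Rightarrow> real^'m^'m"
    and \<Phi> :: "real \<Rightarrow> real \<Rightarrow> real^'d^'d"
  assumes A: "continuous_on {0..} A" and C: "continuous_on {0..} C"
    and Q_int: "\<And>t. set_integrable lborel {0..t} Q" and Q_pos: "\<And>t. 0 \<le> t \<Longrightarrow> pos_def (Q t)"
    and R_int: "\<And>t. set_integrable lborel {0..t} R" and R_pos: "\<And>t. 0 \<le> t \<Longrightarrow> pos_def (R t)"
    and Sig0: "pos_def (Sig 0)"
    and riccati: "\<And>t. 0 \<le> t \<Longrightarrow>
           (Sig has_vector_derivative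
              A t ** Sig t + Sig t ** transpose (A t) + Q t
              - Sig t ** transpose (C t) ** matrix_inv (R t) ** C t ** Sig t) (at t within {0..})"
    and \<Phi>_id: "\<And>\<tau>. 0 \<le> \<tau> \<Longrightarrow> \<Phi> \<tau> \<tau> = mat 1"
    and \<Phi>_ode: "\<And>t \<tau>. 0 \<le> t \<Longrightarrow> 0 \<le> \<tau> \<Longrightarrow>
           ((\<lambda>s. \<Phi> s \<tau>) has_vector_derivative
              (- transpose (A t) + transpose (C t) ** transpose (kalman_gain C R Sig t)) ** \<Phi> t \<tau>) (at t within {0..})"
begin

definition H :: "real \<Rightarrow> real^'d^'d" where
  "H t = transpose (C t) ** matrix_inv (R t) ** C t"

abbreviation K :: "real \<Rightarrow> real^'m^'d" where "K t \<equiv> kalman_gain C R Sig t"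

lemma KC: "K t ** C t = Sig t ** H t"
  by (simp add: kalman_gain_def H_def matrix_mul_assoc)

lemma R_inv_sym: "0 \<le> t \<Longrightarrow> transpose (matrix_inv (R t)) = matrix_inv (R t)"
  by (rule pos_def_symmetric [OF pos_def_matrix_inv [OF R_pos]])

lemma H_sym: "0 \<le> t \<Longrightarrow> transpose (H t) = H t"
  by (simp add: H_def matrix_transpose_mul R_inv_sym matrix_mul_assoc)

lemma H_nonneg: "0 \<le> t \<Longrightarrow> 0 \<le> x \<bullet> (H t *v x)"
proof -
  assume t: "0 \<le> t"
  have "x \<bullet> (H t *v x) = (C t *v x) \<bullet> (matrix_inv (R t) *v (C t *v x))"
    using inner_matvec_transpose [of "C t" "matrix_inv (R t) *v (C t *v x)" x]
    by (simp add: H_def matrix_vector_mul_assoc [symmetric] inner_commute del: transpose_matrix_vector)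
  then show ?thesis using pos_def_nonneg [OF pos_def_matrix_inv [OF R_pos [OF t]]] by simp
qed

lemma CK: "0 \<le> t \<Longrightarrow> transpose (C t) ** transpose (K t) = H t ** transpose (Sig t)"
  using H_sym [of t] by (simp add: matrix_transpose_mul [symmetric] KC) (simp add: matrix_transpose_mul)

lemma riccati': "0 \<le> t \<Longrightarrow>
  (Sig has_vector_derivative A t ** Sig t + Sig t ** transpose (A t) + Q t - Sig t ** H t ** Sig t) (at t within {0..})"
  using riccati [of t] by (simp add: H_def matrix_mul_assoc)

lemma Sig_cont: "continuous_on {0..} Sig"
  unfolding continuous_on_eq_continuous_within by (auto intro: has_vector_derivative_continuous [OF riccati])

text \<open>Along \<open>y\<^sub>t = \<Phi>(t; T) v\<close> the quadratic form \<open>y\<^sup>T \<Sigma> y\<close> has derivative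
  \<open>y\<^sup>T (Q + \<Sigma> H \<Sigma>\<^sup>T) y > 0\<close>.  Symmetry of \<open>\<Sigma>\<close> is itself a consequence of this positivity, by way of
  the integrability of \<open>H\<close>; therefore \<open>\<Sigma>\<^sup>T\<close> is kept apart from \<open>\<Sigma>\<close> here.\<close>

lemma Sig_positive:
  assumes T: "0 \<le> T" and v: "v \<noteq> 0"
  shows "0 < v \<bullet> (Sig T *v v)"
proof (cases "T = 0")
  case True
  then show ?thesis using Sig0 v by (auto simp: pos_def_def)
next
  case False
  then have T': "0 < T" using T by simp
  define y where "y s = \<Phi> s T *v v" for s
  define \<phi> where "\<phi> s = y s \<bullet> (Sig s *v y s)" for s
  define \<phi>' where "\<phi>' s = y s \<bullet> (Q s *v y s) + (transpose (Sig s) *v y s) \<bullet> (H s *v (transpose (Sig s) *v y s))" for s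
  have yT: "y T = v" by (simp add: y_def \<Phi>_id [OF T])
  have dy: "(y has_vector_derivative (- transpose (A s) + H s ** transpose (Sig s)) *v y s) (at s within {0..})" if s: "0 \<le> s" for s
    using bounded_linear.has_vector_derivative [OF bounded_bilinear.bounded_linear_left [OF bounded_bilinear_matvec, of v] \<Phi>_ode [OF s T]]
    by (simp add: y_def [abs_def] CK [OF s] matrix_vector_mul_assoc)
  have d\<phi>: "(\<phi> has_vector_derivative \<phi>' s) (at s within {0..})" if s: "0 \<le> s" for s
  proof -
    let ?y = "y s" and ?S = "Sig s" and ?dy = "(- transpose (A s) + H s ** transpose (Sig s)) *v y s"
    let ?dS = "A s ** ?S + ?S ** transpose (A s) + Q s - ?S ** H s ** ?S"
    have "(\<phi> has_vector_derivative (?y \<bullet> (?S *v ?dy + ?dS *v ?y) + ?dy \<bullet> (?S *v ?y))) (at s within {0..})"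
      unfolding \<phi>_def [abs_def]
      by (intro bounded_bilinear.has_vector_derivative [OF bounded_bilinear_inner]
          bounded_bilinear.has_vector_derivative [OF bounded_bilinear_matvec] dy riccati' s)
    moreover have "?y \<bullet> (?S *v ?dy + ?dS *v ?y) + ?dy \<bullet> (?S *v ?y) = \<phi>' s"
    proof -
      have 1: "?dy = - (transpose (A s) *v ?y) + H s *v (transpose ?S *v ?y)"
        by (simp only: matrix_vector_mult_add_rdistrib matrix_vector_mul_assoc bounded_bilinear.minus_left [OF bounded_bilinear_matvec])
      have 2: "(transpose (A s) *v ?y) \<bullet> (?S *v ?y) = ?y \<bullet> (A s *v (?S *v ?y))"
        by (rule inner_matvec_transpose)
      have 3: "(H s *v (transpose ?S *v ?y)) \<bullet> (?S *v ?y) = ?y \<bullet> (?S *v (H s *v (?S *v ?y)))"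
        using inner_matvec_transpose [of "H s" "transpose ?S *v ?y" "?S *v ?y"] inner_matvec_transpose [of ?S ?y "H s *v (?S *v ?y)"]
        by (simp only: H_sym [OF s])
      have 4: "?y \<bullet> (?S *v (H s *v (transpose ?S *v ?y))) = (transpose ?S *v ?y) \<bullet> (H s *v (transpose ?S *v ?y))"
        by (rule inner_matvec_transpose [symmetric])
      have 5: "?dS *v ?y = A s *v (?S *v ?y) + ?S *v (transpose (A s) *v ?y) + Q s *v ?y - ?S *v (H s *v (?S *v ?y))"
        by (simp only: matrix_vector_mult_add_rdistrib bounded_bilinear.diff_left [OF bounded_bilinear_matvec] matrix_vector_mul_assoc matrix_mul_assoc)
      have 6: "?S *v ?dy = - (?S *v (transpose (A s) *v ?y)) + ?S *v (H s *v (transpose ?S *v ?y))"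
        unfolding 1 by (simp only: matrix_vector_right_distrib bounded_bilinear.minus_right [OF bounded_bilinear_matvec])
      show ?thesis
        unfolding 5 6 unfolding 1 \<phi>'_def by (simp only: inner_add_left inner_add_right inner_diff_right inner_minus_left inner_minus_right 2 3 4)
    qed
    ultimately show ?thesis by simp
  qed
  have \<phi>'0: "0 \<le> \<phi>' s" if "0 \<le> s" for s
    unfolding \<phi>'_def using H_nonneg [OF that] pos_def_nonneg [OF Q_pos [OF that]] by (intro add_nonneg_nonneg) auto
  have mono: "\<phi> s \<le> \<phi> t" if "0 \<le> s" "s \<le> t" for s t
  proof -
    have "(\<phi>' has_integral (\<phi> t - \<phi> s)) {s..t}"
      by (rule fundamental_theorem_of_calculus [OF that(2)])
        (use that in \<open>auto intro: has_vector_derivative_within_subset [OF d\<phi>]\<close>)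
    then have "0 \<le> \<phi> t - \<phi> s" by (rule has_integral_nonneg) (use that \<phi>'0 in auto)
    then show ?thesis by simp
  qed
  have cont_y: "continuous_on {0..} y" and cont_\<phi>: "continuous_on {0..} \<phi>"
    unfolding continuous_on_eq_continuous_within
    by (auto intro: has_vector_derivative_continuous [OF dy] has_vector_derivative_continuous [OF d\<phi>])
  have "continuous (at T within {0..}) y" using cont_y T unfolding continuous_on_eq_continuous_within by auto
  then obtain e where e: "e > 0" "\<And>s. s \<in> {0..} \<Longrightarrow> dist T s < e \<Longrightarrow> y s \<noteq> 0"
    using continuous_within_avoid [of T "{0..}" y 0] yT v by auto
  define s0 where "s0 = max 0 (T - e / 2)"
  have s0: "0 \<le> s0" "s0 < T" "T - e < s0" using T' e by (auto simp: s0_def)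
  have "\<phi> s0 < \<phi> T"
  proof (rule DERIV_pos_imp_increasing_open [OF s0(2)])
    fix s assume s: "s0 < s" "s < T"
    then have sp: "0 < s" using s0 by simp
    have "(\<phi> has_vector_derivative \<phi>' s) (at s)"
      using d\<phi> [of s] sp by (simp add: at_within_interior [of s "{0..}"])
    then have "DERIV \<phi> s :> \<phi>' s" by (simp add: has_real_derivative_iff_has_vector_derivative)
    moreover have "y s \<noteq> 0" using s s0 e(2) [of s] by (auto simp: dist_real_def)
    then have "0 < y s \<bullet> (Q s *v y s)" using Q_pos [of s] sp by (auto simp: pos_def_def)
    then have "0 < \<phi>' s" using H_nonneg [of s] sp by (simp add: \<phi>'_def add_pos_nonneg del: transpose_matrix_vector)
    ultimately show "\<exists>z. DERIV \<phi> s :> z \<and> 0 < z" by blast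
  qed (use s0 in \<open>auto intro: continuous_on_subset [OF cont_\<phi>]\<close>)
  moreover have "\<phi> 0 \<le> \<phi> s0" by (rule mono) (use s0 in auto)
  moreover have "0 \<le> \<phi> 0" unfolding \<phi>_def by (rule pos_def_nonneg [OF Sig0])
  ultimately show ?thesis by (simp add: \<phi>_def yT)
qed

lemma Sig_invertible: "0 \<le> t \<Longrightarrow> invertible (Sig t)"
  by (rule invertible_if_positive) (rule Sig_positive)

abbreviation P :: "real \<Rightarrow> real^'d^'d" where "P t \<equiv> matrix_inv (Sig t)"

lemma P_cont: "continuous_on {0..} P"
  by (rule continuous_on_matrix_inv [OF Sig_cont]) (auto intro: Sig_invertible)

lemma H_measurable: "set_borel_measurable borel {0..t} H"
proof -
  have [measurable]: "(\<lambda>s. indicat_real {0..t} s *\<^sub>R R s) \<in> borel_measurable borel"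
    using R_int [of t] unfolding set_integrable_def by (simp add: borel_measurable_integrable)
  have "(\<lambda>s. indicat_real {0..t} s *\<^sub>R matrix_inv (indicat_real {0..t} s *\<^sub>R R s)) \<in> borel_measurable borel"
    by measurable
  moreover have "indicat_real {0..t} s *\<^sub>R matrix_inv (indicat_real {0..t} s *\<^sub>R R s) = indicat_real {0..t} s *\<^sub>R matrix_inv (R s)" for s
    by (simp add: indicator_def)
  ultimately have Ri: "set_borel_measurable borel {0..t} (\<lambda>s. matrix_inv (R s))"
    unfolding set_borel_measurable_def by simp
  note mC = set_borel_measurable_continuous_on [OF cont_Icc_of_atLeast [OF C]]
    and mCt = set_borel_measurable_continuous_on [OF cont_Icc_of_atLeast [OF continuous_on_transpose [OF C]]]
  show ?thesis
    unfolding H_def [abs_def]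
    by (intro set_borel_measurable_bilinear [OF bounded_bilinear_matmul] Ri mC mCt)
qed

text \<open>Evaluating the form on \<open>e\<^sub>i \<plusminus> e\<^sub>j\<close> bounds the entries of \<open>H\<close> by its diagonal.\<close>

lemma H_entry_le: "0 \<le> t \<Longrightarrow> norm (H t) \<le> real CARD('d) ^ 2 * trace (H t)"
proof -
  assume t: "0 \<le> t"
  have e: "axis i 1 \<bullet> (H t *v axis j 1) = H t $ i $ j" for i j
    by (simp add: inner_axis' matrix_vector_mult_basis column_def)
  have d: "0 \<le> H t $ i $ i" for i using H_nonneg [OF t, of "axis i 1"] by (simp add: e)
  have sym: "H t $ j $ i = H t $ i $ j" for i j
    using arg_cong [OF H_sym [OF t], of "\<lambda>M. M $ i $ j"] by (simp add: transpose_def)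
  have dt: "H t $ i $ i \<le> trace (H t)" for i
    unfolding trace_def by (rule member_le_sum) (use d in auto)
  have "\<bar>H t $ i $ j\<bar> \<le> trace (H t)" for i j
  proof -
    have "0 \<le> (axis i 1 + axis j 1) \<bullet> (H t *v (axis i 1 + axis j 1))" "0 \<le> (axis i 1 - axis j 1) \<bullet> (H t *v (axis i 1 - axis j 1))"
      by (rule H_nonneg [OF t])+
    then have "0 \<le> H t $ i $ i + 2 * H t $ i $ j + H t $ j $ j" "0 \<le> H t $ i $ i - 2 * H t $ i $ j + H t $ j $ j"
      by (simp_all add: matrix_vector_right_distrib bounded_bilinear.diff_right [OF bounded_bilinear_matvec] inner_add_left inner_add_right inner_diff_left inner_diff_right e sym)
    then show ?thesis using dt [of i] dt [of j] by linarith
  qed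
  then have "norm (H t $ i) \<le> (\<Sum>j\<in>(UNIV::'d set). trace (H t))" for i
    by (intro order_trans [OF norm_le_l1_cart] sum_mono)
  then have "(\<Sum>i\<in>(UNIV::'d set). norm (H t $ i)) \<le> (\<Sum>i\<in>(UNIV::'d set). \<Sum>j\<in>(UNIV::'d set). trace (H t))"
    by (intro sum_mono)
  moreover have "norm (H t) \<le> (\<Sum>i\<in>UNIV. norm (H t $ i))"
    unfolding norm_vec_def [of "H t"] by (rule L2_set_le_sum) auto
  ultimately show ?thesis by (simp add: power2_eq_square mult.assoc)
qed

text \<open>\<open>H = P' + P A + A\<^sup>T P + P Q P\<close> with \<open>P = \<Sigma>\<^sup>-\<^sup>1\<close> is Henstock--Kurzweil integrable because \<open>P\<close> is
  differentiable everywhere, and positivity upgrades this to absolute integrability.\<close>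

lemma H_integrable: "set_integrable lborel {0..t} H"
proof (cases "0 \<le> t")
  case True
  define P' where "P' s = - (P s ** (A s ** Sig s + Sig s ** transpose (A s) + Q s - Sig s ** H s ** Sig s) ** P s)" for s
  have dP: "(P has_vector_derivative P' s) (at s within {0..})" if "0 \<le> s" for s
    unfolding P'_def by (rule matrix_inv_has_vector_derivative [OF riccati' [OF that] _ Sig_invertible Sig_cont]) (use that in auto)
  have P'eq: "H s = P' s + (P s ** A s + transpose (A s) ** P s + P s ** Q s ** P s)" if s: "0 \<le> s" for s
  proof -
    note i1 = matrix_inv_inverse(1) [OF Sig_invertible [OF s]] and i2 = matrix_inv_inverse(2) [OF Sig_invertible [OF s]]
    have "P s ** (A s ** Sig s) ** P s = P s ** A s ** (Sig s ** P s)" by (simp only: matrix_mul_assoc)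
    then have 1: "P s ** (A s ** Sig s) ** P s = P s ** A s" by (simp add: i1)
    have "P s ** (Sig s ** transpose (A s)) ** P s = (P s ** Sig s) ** transpose (A s) ** P s" by (simp only: matrix_mul_assoc)
    then have 2: "P s ** (Sig s ** transpose (A s)) ** P s = transpose (A s) ** P s" by (simp add: i2)
    have "P s ** (Sig s ** H s ** Sig s) ** P s = (P s ** Sig s) ** H s ** (Sig s ** P s)" by (simp only: matrix_mul_assoc)
    then have 3: "P s ** (Sig s ** H s ** Sig s) ** P s = H s" by (simp add: i1 i2)
    have "P' s = - (P s ** A s + transpose (A s) ** P s + P s ** Q s ** P s - H s)"
      unfolding P'_def by (simp only: bounded_bilinear.add_left [OF bounded_bilinear_matmul] bounded_bilinear.add_right [OF bounded_bilinear_matmul]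
          bounded_bilinear.diff_left [OF bounded_bilinear_matmul] bounded_bilinear.diff_right [OF bounded_bilinear_matmul] 1 2 3)
    then show ?thesis by simp
  qed
  (* no bound on P' is known: as a derivative it is integrable in the gauge sense *)
  have P'int: "P' integrable_on {0..t}"
    by (rule has_integral_integrable, rule fundamental_theorem_of_calculus [OF True])
      (auto intro: has_vector_derivative_within_subset [OF dP])
  note cP = cont_Icc_of_atLeast [OF P_cont] and cA = cont_Icc_of_atLeast [OF A] and cAt = cont_Icc_of_atLeast [OF continuous_on_transpose [OF A]]
  have "set_integrable lborel {0..t} (\<lambda>s. P s ** Q s ** P s)"
    by (rule set_integrable_bilinear_flip [OF bounded_bilinear_matmul cP set_integrable_bilinear [OF bounded_bilinear_matmul cP Q_int]])
  then have i1: "(\<lambda>s. P s ** Q s ** P s) integrable_on {0..t}" by (rule set_integrable_imp_integrable_on)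
  have i2: "(\<lambda>s. P s ** A s + transpose (A s) ** P s) integrable_on {0..t}"
    by (intro integrable_continuous_real continuous_intros cP cA cAt)
  have "(\<lambda>s. P' s + (P s ** A s + transpose (A s) ** P s + P s ** Q s ** P s)) integrable_on {0..t}"
    by (rule Henstock_Kurzweil_Integration.integrable_add [OF P'int Henstock_Kurzweil_Integration.integrable_add [OF i2 i1]])
  moreover have "P' s + (P s ** A s + transpose (A s) ** P s + P s ** Q s ** P s) = H s" if "s \<in> {0..t}" for s
    using P'eq [of s] that by simp
  ultimately have Hi: "H integrable_on {0..t}" by (rule integrable_eq)
  have "(\<lambda>s. real CARD('d) ^ 2 * trace (H s)) integrable_on {0..t}"
  proof -
    from integrable_linear [OF Hi bounded_linear_trace] show ?thesis by (intro integrable_on_mult_right) (simp add: o_def)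
  qed
  with Hi have "H absolutely_integrable_on {0..t}"
    by (intro absolutely_integrable_integrable_bound [where g = "\<lambda>s. real CARD('d) ^ 2 * trace (H s)"] H_entry_le) auto
  then have "integrable lebesgue (\<lambda>s. indicator {0..t} s *\<^sub>R H s)" by (simp add: set_integrable_def)
  then show ?thesis
    unfolding set_integrable_def using H_measurable [of t] unfolding set_borel_measurable_def
    by (subst (asm) integrable_completion) auto
qed (simp add: set_integrable_def)

text \<open>The antisymmetric part of \<open>\<Sigma>\<close> solves a homogeneous linear equation whose coefficients are integrable
  because \<open>H\<close> is.\<close>

lemma Sig_sym: "0 \<le> t \<Longrightarrow> transpose (Sig t) = Sig t"
proof -
  assume t: "0 \<le> t"
  let ?D = "\<lambda>t. Sig t - transpose (Sig t)"
  let ?D' = "\<lambda>t. A t ** ?D t + ?D t ** transpose (A t) - (?D t ** H t ** Sig t + transpose (Sig t) ** H t ** ?D t)"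
  let ?k = "\<lambda>t. 2 * norm (A t) + 2 * norm (Sig t) * norm (H t)"
  have "?D t = 0"
  proof (rule linear_ode_zero [of ?D ?D' ?k, OF _ _ _ _ _ t])
    fix t :: real assume t: "0 \<le> t"
    let ?S' = "A t ** Sig t + Sig t ** transpose (A t) + Q t - Sig t ** H t ** Sig t"
    have d: "(?D has_vector_derivative ?S' - transpose ?S') (at t within {0..})"
      by (intro has_vector_derivative_diff bounded_linear.has_vector_derivative [OF bounded_linear_transpose] riccati' t)
    have tS: "transpose ?S' = transpose (Sig t) ** transpose (A t) + A t ** transpose (Sig t) + Q t - transpose (Sig t) ** H t ** transpose (Sig t)"
      by (simp add: transpose_add transpose_diff matrix_transpose_mul pos_def_symmetric [OF Q_pos [OF t]] H_sym [OF t] matrix_mul_assoc)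
    have "?S' - transpose ?S' = ?D' t"
      unfolding tS
      by (simp add: bounded_bilinear.diff_left [OF bounded_bilinear_matmul] bounded_bilinear.diff_right [OF bounded_bilinear_matmul])
    with d show "(?D has_vector_derivative ?D' t) (at t within {0..})" by (simp only:)
    have m3: "norm (X ** Y ** Z) \<le> norm X * norm Y * norm Z" for X Y Z :: "real^'d^'d"
      by (rule order_trans [OF norm_matmul_le]) (intro mult_right_mono norm_matmul_le; simp)
    have "norm (?D' t) \<le> norm (A t ** ?D t) + norm (?D t ** transpose (A t)) + (norm (?D t ** H t ** Sig t) + norm (transpose (Sig t) ** H t ** ?D t))"
      by (intro order_trans [OF norm_triangle_ineq4] order_trans [OF norm_triangle_ineq] add_mono order_refl)
    also have "\<dots> \<le> norm (A t) * norm (?D t) + norm (?D t) * norm (A t) + (norm (?D t) * norm (H t) * norm (Sig t) + norm (Sig t) * norm (H t) * norm (?D t))"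
      using norm_matmul_le [of "A t" "?D t"] norm_matmul_le [of "?D t" "transpose (A t)"] m3 [of "?D t" "H t" "Sig t"] m3 [of "transpose (Sig t)" "H t" "?D t"]
      unfolding norm_transpose by linarith
    also have "\<dots> = ?k t * norm (?D t)" by (simp add: algebra_simps)
    finally show "norm (?D' t) \<le> ?k t * norm (?D t)" .
  next
    have "set_integrable lborel {0..t} (\<lambda>s. norm (A s))" for t
      using borel_integrable_atLeastAtMost' [OF continuous_on_norm [OF cont_Icc_of_atLeast [OF A]]] .
    moreover have "set_integrable lborel {0..t} (\<lambda>s. norm (Sig s) * norm (H s))" for t
      by (rule set_integrable_bilinear [OF bounded_bilinear_mult continuous_on_norm [OF cont_Icc_of_atLeast [OF Sig_cont]] set_integrable_norm [OF H_integrable]])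
    ultimately have "set_integrable lborel {0..t} (\<lambda>s. 2 * norm (A s) + 2 * (norm (Sig s) * norm (H s)))" for t
      by (intro set_integral_add set_integrable_mult_right)
    then show "set_integrable lborel {0..t} ?k" for t by (simp add: mult.assoc)
    show "?D 0 = 0" using pos_def_symmetric [OF Sig0] by simp
  qed auto
  then show ?thesis by simp
qed

lemma P_sym: "0 \<le> t \<Longrightarrow> transpose (P t) = P t"
  by (simp add: matrix_inv_transpose [OF Sig_invertible] Sig_sym)

lemma KC_integrable: "set_integrable lborel {0..t} (\<lambda>s. K s ** C s)"
  unfolding KC by (rule set_integrable_bilinear [OF bounded_bilinear_matmul cont_Icc_of_atLeast [OF Sig_cont] H_integrable])

lemma K_measurable: "set_borel_measurable borel {0..t} K"
proof -
  have [measurable]: "(\<lambda>s. indicat_real {0..t} s *\<^sub>R R s) \<in> borel_measurable borel"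
    using R_int [of t] unfolding set_integrable_def by (simp add: borel_measurable_integrable)
  have "(\<lambda>s. indicat_real {0..t} s *\<^sub>R matrix_inv (indicat_real {0..t} s *\<^sub>R R s)) \<in> borel_measurable borel"
    by measurable
  moreover have "indicat_real {0..t} s *\<^sub>R matrix_inv (indicat_real {0..t} s *\<^sub>R R s) = indicat_real {0..t} s *\<^sub>R matrix_inv (R s)" for s
    by (simp add: indicator_def)
  ultimately have Ri: "set_borel_measurable borel {0..t} (\<lambda>s. matrix_inv (R s))"
    unfolding set_borel_measurable_def by simp
  have SC: "set_borel_measurable borel {0..t} (\<lambda>s. Sig s ** transpose (C s))"
    by (intro set_borel_measurable_continuous_on continuous_intros cont_Icc_of_atLeast Sig_cont C)
  show ?thesis
    unfolding kalman_gain_def [abs_def] by (rule set_borel_measurable_bilinear [OF bounded_bilinear_matmul SC Ri])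
qed

text \<open>The trace form of \<open>K\<close> is \<open>tr(\<Sigma> H \<Sigma>)\<close>, so that integrability of \<open>H\<close> makes the gain an admissible
  integrand.\<close>

lemma ito_sq_K_finite: "ito_sq R t K < \<infinity>"
proof -
  have eq: "trace (K s ** R s ** transpose (K s)) = trace (Sig s ** H s ** Sig s)" if s: "0 \<le> s" for s
  proof -
    have "K s ** R s = Sig s ** transpose (C s)"
      unfolding kalman_gain_def using matrix_inv_inverse(2) [OF pos_def_imp_invertible [OF R_pos [OF s]]]
      by (simp add: matrix_mul_assoc [symmetric])
    moreover have "transpose (K s) = matrix_inv (R s) ** C s ** Sig s"
      by (simp add: kalman_gain_def matrix_transpose_mul R_inv_sym [OF s] Sig_sym [OF s] matrix_mul_assoc)
    ultimately show ?thesis by (simp add: H_def matrix_mul_assoc)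
  qed
  have "set_integrable lborel {0..t} (\<lambda>s. Sig s ** H s ** Sig s)"
    by (rule set_integrable_bilinear_flip [OF bounded_bilinear_matmul cont_Icc_of_atLeast [OF Sig_cont] set_integrable_bilinear [OF bounded_bilinear_matmul cont_Icc_of_atLeast [OF Sig_cont] H_integrable]])
  then have i: "set_integrable lborel {0..t} (\<lambda>s. trace (Sig s ** H s ** Sig s))"
    by (rule set_integrable_linear [OF bounded_linear_trace])
  have "ito_sq R t K = (\<integral>\<^sup>+s\<in>{0..t}. ennreal (trace (Sig s ** H s ** Sig s)) \<partial>lborel)"
    unfolding ito_sq_def by (rule nn_integral_cong) (auto simp: indicator_def eq)
  also have "\<dots> = ennreal (LINT s:{0..t}|lborel. trace (Sig s ** H s ** Sig s))"
  proof (rule nn_set_integral_to_LINT [OF i])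
    fix s assume "s \<in> {0..t}"
    then have s: "0 \<le> s" by simp
    have "0 \<le> trace (K s ** R s ** transpose (K s))"
      by (rule trace_form_nonneg) (rule pos_def_nonneg [OF R_pos [OF s]])
    then show "0 \<le> trace (Sig s ** H s ** Sig s)" unfolding eq [OF s] .
  qed
  finally show ?thesis by simp
qed

lemma H_form: "x \<bullet> (H t *v x) = (C t *v x) \<bullet> (matrix_inv (R t) *v (C t *v x))"
  using inner_matvec_transpose [of "C t" "matrix_inv (R t) *v (C t *v x)" x]
  by (simp add: H_def matrix_vector_mul_assoc [symmetric] inner_commute del: transpose_matrix_vector)

end

section \<open>Adaptedness and independence modulo null sets\<close>

text \<open>Sampling on grids of mesh \<open>1/(n+1)\<close>.  The maximum with \<open>0\<close> extends the process to negative times.\<close>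

lemma measurable_pair_continuous:
  fixes Y :: "real \<Rightarrow> 'w \<Rightarrow> 'b::euclidean_space"
  assumes Y: "\<And>t. 0 \<le> t \<Longrightarrow> Y t \<in> borel_measurable N"
    and cont: "\<And>\<omega>. \<omega> \<in> space N \<Longrightarrow> continuous_on {0..} (\<lambda>t. Y t \<omega>)"
  shows "(\<lambda>p. Y (max 0 (snd p)) (fst p)) \<in> borel_measurable (N \<Otimes>\<^sub>M borel)"
proof (rule borel_measurable_LIMSEQ_metric)
  let ?k = "\<lambda>n t. nat \<lfloor>max 0 t * (real n + 1)\<rfloor>"
  fix n :: nat
  have "(\<lambda>p. Y (real k / (real n + 1)) (fst p)) \<in> borel_measurable (N \<Otimes>\<^sub>M borel)" for k :: nat
    by (rule measurable_compose [OF measurable_fst Y]) simp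
  moreover have "(\<lambda>p. ?k n (snd p)) \<in> measurable (N \<Otimes>\<^sub>M borel) (count_space UNIV)"
    by measurable
  ultimately show "(\<lambda>p. Y (real (?k n (snd p)) / (real n + 1)) (fst p)) \<in> borel_measurable (N \<Otimes>\<^sub>M borel)"
    by (rule measurable_compose_countable)
next
  let ?k = "\<lambda>n t. nat \<lfloor>max 0 t * (real n + 1)\<rfloor>"
  fix p assume "p \<in> space (N \<Otimes>\<^sub>M (borel :: real measure))"
  then have \<omega>: "fst p \<in> space N" by (auto simp: space_pair_measure)
  define s where "s = max 0 (snd p)"
  have s0: "0 \<le> s" by (simp add: s_def)
  have "(\<lambda>n. real (?k n (snd p)) / (real n + 1)) \<longlonglongrightarrow> s"
    using floor_grid_tendsto [OF s0] by (simp add: s_def)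
  then show "(\<lambda>n. Y (real (?k n (snd p)) / (real n + 1)) (fst p)) \<longlonglongrightarrow> Y (max 0 (snd p)) (fst p)"
    unfolding s_def [symmetric]
    by (intro continuous_on_tendsto_compose [OF cont [OF \<omega>]]) (use s0 in auto)
qed

lemma measurable_time_integral:
  fixes Y :: "real \<Rightarrow> 'w \<Rightarrow> 'b::euclidean_space" and h :: "'a::euclidean_space \<Rightarrow> 'b \<Rightarrow> 'c::euclidean_space"
  assumes h: "bounded_bilinear h" and c: "set_borel_measurable borel {0..t} c"
    and Y: "\<And>t. 0 \<le> t \<Longrightarrow> Y t \<in> borel_measurable N"
    and cont: "\<And>\<omega>. \<omega> \<in> space N \<Longrightarrow> continuous_on {0..} (\<lambda>t. Y t \<omega>)"
  shows "(\<lambda>\<omega>. LINT s:{0..t}|lborel. h (c s) (Y s \<omega>)) \<in> borel_measurable N"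
proof -
  interpret h: bounded_bilinear h by fact
  have eq: "(LINT s:{0..t}|lborel. h (c s) (Y s \<omega>)) = (\<integral>s. h (indicat_real {0..t} s *\<^sub>R c s) (Y (max 0 s) \<omega>) \<partial>lborel)" for \<omega>
    unfolding set_lebesgue_integral_def
    by (rule Bochner_Integration.integral_cong [OF refl]) (auto simp: indicator_def h.zero_left max_def)
  have "(\<lambda>p. indicat_real {0..t} (snd p) *\<^sub>R c (snd p)) \<in> borel_measurable (N \<Otimes>\<^sub>M borel)"
    by (rule measurable_compose [OF measurable_snd c [unfolded set_borel_measurable_def]])
  then have "(\<lambda>p. h (indicat_real {0..t} (snd p) *\<^sub>R c (snd p)) (Y (max 0 (snd p)) (fst p))) \<in> borel_measurable (N \<Otimes>\<^sub>M borel)"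
    by (rule borel_measurable_bilinear [OF h _ measurable_pair_continuous [OF Y cont]])
  then have "(\<lambda>p. h (indicat_real {0..t} (snd p) *\<^sub>R c (snd p)) (Y (max 0 (snd p)) (fst p))) \<in> borel_measurable (N \<Otimes>\<^sub>M lborel)"
    by (simp cong: measurable_cong_sets sets_pair_measure_cong)
  then show ?thesis
    unfolding eq by (intro lborel.borel_measurable_lebesgue_integral) (simp add: case_prod_beta')
qed

lemma measurable_augmented:
  fixes f g :: "'a \<Rightarrow> 'b::euclidean_space"
  assumes F: "space F = space M" "null_sets M \<subseteq> sets F" "sets F \<subseteq> sets M"
    and f: "f \<in> borel_measurable M" and g: "g \<in> borel_measurable F" and AE: "AE x in M. f x = g x"
  shows "f \<in> borel_measurable F"
proof (rule measurableI)
  fix U :: "'b set" assume U: "U \<in> sets borel"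
  have gM [measurable]: "g \<in> borel_measurable M" by (rule measurable_finer [OF g F(1,3)])
  note f [measurable]
  define E where "E = {x \<in> space M. f x \<noteq> g x}"
  have Em: "E \<in> sets M" unfolding E_def by measurable
  have En: "E \<in> null_sets M"
    using AE_iff_null_sets [OF Em] AE by (auto simp: E_def elim: eventually_mono)
  have "f -` U \<inter> space M \<in> sets M" using measurable_sets [OF f U] .
  then have "f -` U \<inter> space M \<inter> E \<in> null_sets M"
    using En by (intro null_set_Int1) auto
  then have "f -` U \<inter> space M \<inter> E \<in> sets F" using F(2) by blast
  moreover have "(g -` U \<inter> space F) - E \<in> sets F"
    using measurable_sets [OF g U] En F(2) by blast
  moreover have "f -` U \<inter> space F = ((g -` U \<inter> space F) - E) \<union> (f -` U \<inter> space M \<inter> E)"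
    by (auto simp: E_def F)
  ultimately show "f -` U \<inter> space F \<in> sets F" by simp
qed simp

lemma sigma_sets_augmented_AE:
  assumes "A \<in> sigma_sets (space M) (E \<union> null_sets M)"
  shows "\<exists>A'\<in>sigma_sets (space M) E. AE x in M. x \<in> A \<longleftrightarrow> x \<in> A'"
  using assms
proof induction
  case (Basic a)
  show ?case
  proof (cases "a \<in> E")
    case True
    then show ?thesis by (intro bexI [of _ a]) (auto intro: sigma_sets.Basic)
  next
    case False
    then have "a \<in> null_sets M" using Basic by auto
    then show ?thesis by (intro bexI [of _ "{}"]) (auto intro: sigma_sets.Empty dest: AE_not_in)
  qed
next
  case Empty
  then show ?case by (intro bexI [of _ "{}"]) (auto intro: sigma_sets.Empty)
next
  case (Compl a)
  then obtain a' where a': "a' \<in> sigma_sets (space M) E" "AE x in M. x \<in> a \<longleftrightarrow> x \<in> a'" by blast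
  have "AE x in M. x \<in> space M - a \<longleftrightarrow> x \<in> space M - a'" using a'(2) by eventually_elim auto
  then show ?case using sigma_sets.Compl [OF a'(1)] by blast
next
  case (Union a)
  then have "\<forall>i::nat. \<exists>a'. a' \<in> sigma_sets (space M) E \<and> (AE x in M. x \<in> a i \<longleftrightarrow> x \<in> a')" by blast
  from choice [OF this] obtain a' where a': "\<And>i. a' i \<in> sigma_sets (space M) E" "\<And>i. AE x in M. x \<in> a i \<longleftrightarrow> x \<in> a' i"
    by blast
  have "AE x in M. \<forall>i. x \<in> a i \<longleftrightarrow> x \<in> a' i" using a'(2) by (simp add: AE_all_countable)
  then have "AE x in M. x \<in> (\<Union>i. a i) \<longleftrightarrow> x \<in> (\<Union>i. a' i)" by eventually_elim auto
  then show ?case using sigma_sets.Union [of a', OF a'(1)] by blast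
qed

lemma continuous_modification:
  fixes Y :: "real \<Rightarrow> 'w \<Rightarrow> 'b::euclidean_space"
  assumes Y: "\<And>t. 0 \<le> t \<Longrightarrow> Y t \<in> borel_measurable M" and cont: "AE \<omega> in M. continuous_on {0..} (\<lambda>t. Y t \<omega>)"
  shows "\<exists>Y'. (\<forall>t\<ge>0. Y' t \<in> borel_measurable M) \<and> (\<forall>\<omega>. continuous_on {0..} (\<lambda>t. Y' t \<omega>)) \<and>
    (AE \<omega> in M. \<forall>t. Y' t \<omega> = Y t \<omega>)"
proof -
  obtain N where N: "N \<in> null_sets M" "\<And>\<omega>. \<omega> \<in> space M \<Longrightarrow> \<omega> \<notin> N \<Longrightarrow> continuous_on {0..} (\<lambda>t. Y t \<omega>)"
    using cont unfolding eventually_ae_filter by blast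
  have [measurable]: "N \<in> sets M" using N by auto
  define Y' where "Y' t \<omega> = indicat_real (space M - N) \<omega> *\<^sub>R Y t \<omega>" for t \<omega>
  have "Y' t \<in> borel_measurable M" if "0 \<le> t" for t
    unfolding Y'_def [abs_def] using Y [OF that] by measurable
  moreover have "continuous_on {0..} (\<lambda>t. Y' t \<omega>)" for \<omega>
    using N(2) [of \<omega>] by (cases "\<omega> \<in> space M - N") (auto simp: Y'_def)
  moreover have "AE \<omega> in M. \<forall>t. Y' t \<omega> = Y t \<omega>"
    using AE_not_in [OF N(1)] AE_space by eventually_elim (auto simp: Y'_def)
  ultimately show ?thesis by blast
qed

text \<open>The exceptional null sets of the \<open>F\<close>-measurable versions depend on time, and there are uncountably many
  times, so these versions cannot simply be integrated.  Instead, for bounded \<open>b\<close> Fubini gives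
  \<open>E[b I] = \<integral> E[b g\<^sub>s] ds = \<integral> E[E[b|F] g\<^sub>s] ds = E[E[b|F] I] = E[b E[I|F]]\<close>, so that \<open>I = E[I|F]\<close>.\<close>

lemma (in prob_space) bounded_time_integral_adapted:
  fixes g :: "real \<Rightarrow> 'a \<Rightarrow> real"
  assumes F: "subalgebra M F" and g: "(\<lambda>p. g (snd p) (fst p)) \<in> borel_measurable (M \<Otimes>\<^sub>M lborel)"
    and c: "\<And>s \<omega>. \<bar>g s \<omega>\<bar> \<le> c"
    and ad: "\<And>s. s \<in> {0..t} \<Longrightarrow> \<exists>g'\<in>borel_measurable F. AE \<omega> in M. g s \<omega> = g' \<omega>"
  shows "\<exists>I\<in>borel_measurable F. AE \<omega> in M. (LINT s:{0..t}|lborel. g s \<omega>) = I \<omega>"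
proof -
  interpret F: sigma_finite_subalgebra M F
    by (rule finite_measure_subalgebra_is_sigma_finite) (unfold_locales, rule F)
  interpret P: pair_sigma_finite M lborel by unfold_locales
  let ?h = "\<lambda>s \<omega>. indicat_real {0..t} s * g s \<omega>"
  let ?E = "real_cond_exp M F"
  define I where "I \<omega> = (\<integral>s. ?h s \<omega> \<partial>lborel)" for \<omega>
  have c0: "0 \<le> c" using c [of 0 undefined] by linarith
  note g [measurable]
  have gs [measurable]: "g s \<in> borel_measurable M" for s
  proof -
    have "(\<lambda>\<omega>. (\<omega>, s)) \<in> measurable M (M \<Otimes>\<^sub>M lborel)" by simp
    from measurable_compose [OF this g] show ?thesis by simp
  qed
  have gi: "integrable M (\<lambda>\<omega>. w \<omega> * g s \<omega>)" if w: "integrable M w" for w s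
  proof (rule Bochner_Integration.integrable_bound)
    show "integrable M (\<lambda>\<omega>. w \<omega> * c)" using w by simp
    show "(\<lambda>\<omega>. w \<omega> * g s \<omega>) \<in> borel_measurable M" using w by measurable
    show "AE \<omega> in M. norm (w \<omega> * g s \<omega>) \<le> norm (w \<omega> * c)"
      using c c0 by (intro AE_I2) (auto simp: abs_mult intro!: mult_left_mono)
  qed
  have prod: "integrable (M \<Otimes>\<^sub>M lborel) (\<lambda>(\<omega>, s). w \<omega> * ?h s \<omega>)" if w: "integrable M w" for w
  proof (rule Bochner_Integration.integrable_bound)
    have wm [measurable]: "w \<in> borel_measurable M" using w by simp
    have ind: "integrable lborel (indicat_real {0..t})"
      by (rule integrable_real_indicator) (auto simp: emeasure_lborel_Icc_eq)
    show "integrable (M \<Otimes>\<^sub>M lborel) (\<lambda>p. w (fst p) * (indicat_real {0..t} (snd p) * c))"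
    proof (rule P.Fubini_integrable)
      show "(\<lambda>p. w (fst p) * (indicat_real {0..t} (snd p) * c)) \<in> borel_measurable (M \<Otimes>\<^sub>M lborel)" by measurable
      show "integrable M (\<lambda>x. \<integral>y. norm (w (fst (x, y)) * (indicat_real {0..t} (snd (x, y)) * c)) \<partial>lborel)"
        using w by (simp add: abs_mult)
      show "AE x in M. integrable lborel (\<lambda>y. w (fst (x, y)) * (indicat_real {0..t} (snd (x, y)) * c))"
        using ind by simp
    qed
    have "(\<lambda>p. w (fst p) * (indicat_real {0..t} (snd p) * g (snd p) (fst p))) \<in> borel_measurable (M \<Otimes>\<^sub>M lborel)"
      by measurable
    then show "(\<lambda>(\<omega>, s). w \<omega> * ?h s \<omega>) \<in> borel_measurable (M \<Otimes>\<^sub>M lborel)" by (simp add: case_prod_beta')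
    show "AE p in M \<Otimes>\<^sub>M lborel. norm (case p of (\<omega>, s) \<Rightarrow> w \<omega> * ?h s \<omega>) \<le> norm (w (fst p) * (indicat_real {0..t} (snd p) * c))"
      using c c0 by (intro AE_I2) (auto simp: abs_mult intro!: mult_left_mono)
  qed
  have I_int: "integrable M (\<lambda>\<omega>. w \<omega> * I \<omega>)" if "integrable M w" for w
    using P.integrable_fst [OF prod [OF that]] by (simp add: I_def)
  have swap: "(\<integral>\<omega>. w \<omega> * I \<omega> \<partial>M) = (\<integral>s. indicat_real {0..t} s * (\<integral>\<omega>. w \<omega> * g s \<omega> \<partial>M) \<partial>lborel)" if "integrable M w" for w
  proof -
    have "(\<integral>\<omega>. w \<omega> * ?h s \<omega> \<partial>M) = indicat_real {0..t} s * (\<integral>\<omega>. w \<omega> * g s \<omega> \<partial>M)" for s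
      by (subst mult.left_commute) (rule integral_mult_right_zero)
    then show ?thesis using P.Fubini_integral [OF prod [OF that]] by (simp add: I_def)
  qed
  have I1: "integrable M I" using I_int [of "\<lambda>_. 1"] by simp
  then have Im [measurable]: "I \<in> borel_measurable M" by simp
  have "AE \<omega> in M. I \<omega> = ?E I \<omega>"
  proof (rule density_unique_real)
    show "integrable M I" "integrable M (?E I)" using I1 F.real_cond_exp_int(1) by auto
    fix S assume S [measurable]: "S \<in> sets M"
    let ?b = "indicat_real S"
    have b: "integrable M ?b" by (simp add: emeasure_eq_measure)
    have Eb: "integrable M (?E ?b)" by (rule F.real_cond_exp_int(1) [OF b])
    have "(\<integral>\<omega>. ?b \<omega> * g s \<omega> \<partial>M) = (\<integral>\<omega>. ?E ?b \<omega> * g s \<omega> \<partial>M)" if s: "s \<in> {0..t}" for s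
    proof -
      obtain g' where g'F: "g' \<in> borel_measurable F" and g': "AE \<omega> in M. g s \<omega> = g' \<omega>" using ad [OF s] by blast
      have [measurable]: "g' \<in> borel_measurable M" by (rule measurable_from_subalg [OF F g'F])
      have sw: "(\<integral>\<omega>. w \<omega> * g s \<omega> \<partial>M) = (\<integral>\<omega>. g' \<omega> * w \<omega> \<partial>M)" if "integrable M w" for w
        by (rule integral_cong_AE) (use that g' in \<open>auto elim: eventually_mono\<close>)
      have "integrable M (\<lambda>\<omega>. ?b \<omega> * g s \<omega>) = integrable M (\<lambda>\<omega>. g' \<omega> * ?b \<omega>)"
        by (rule integrable_cong_AE) (use g' in \<open>auto elim: eventually_mono\<close>)
      then have "integrable M (\<lambda>\<omega>. g' \<omega> * ?b \<omega>)" using gi [OF b] by simp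
      from F.real_cond_exp_intg(2) [OF this g'F] show ?thesis
        unfolding sw [OF b] sw [OF Eb] by simp
    qed
    then have "(\<integral>\<omega>. ?b \<omega> * I \<omega> \<partial>M) = (\<integral>\<omega>. ?E ?b \<omega> * I \<omega> \<partial>M)"
      unfolding swap [OF b] swap [OF Eb]
      by (intro Bochner_Integration.integral_cong refl) (simp add: indicator_def)
    also have "\<dots> = (\<integral>\<omega>. ?E ?b \<omega> * ?E I \<omega> \<partial>M)"
      by (rule F.real_cond_exp_intg(2) [symmetric, OF I_int [OF Eb]]) auto
    also have "\<dots> = (\<integral>\<omega>. ?E I \<omega> * ?E ?b \<omega> \<partial>M)" by (simp add: mult.commute)
    also have "\<dots> = (\<integral>\<omega>. ?E I \<omega> * ?b \<omega> \<partial>M)"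
    proof (rule F.real_cond_exp_intg(2))
      show "integrable M (\<lambda>\<omega>. ?E I \<omega> * ?b \<omega>)"
        using integrable_mult_indicator [OF S F.real_cond_exp_int(1) [OF I1]] by (simp add: mult.commute)
    qed auto
    finally show "(\<integral>\<omega>\<in>S. I \<omega> \<partial>M) = (\<integral>\<omega>\<in>S. ?E I \<omega> \<partial>M)"
      unfolding set_lebesgue_integral_def by (simp add: mult.commute)
  qed
  then show ?thesis
    by (intro bexI [of _ "?E I"]) (auto simp: I_def set_lebesgue_integral_def)
qed

text \<open>Truncation of the values preserves adaptedness, and the truncated integrals converge along each path
  by dominated convergence.\<close>

lemma (in prob_space) real_time_integral_adapted:
  fixes g :: "real \<Rightarrow> 'a \<Rightarrow> real"
  assumes F: "subalgebra M F" and g: "(\<lambda>p. g (snd p) (fst p)) \<in> borel_measurable (M \<Otimes>\<^sub>M lborel)"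
    and ad: "\<And>s. s \<in> {0..t} \<Longrightarrow> \<exists>g'\<in>borel_measurable F. AE \<omega> in M. g s \<omega> = g' \<omega>"
    and i: "AE \<omega> in M. set_integrable lborel {0..t} (\<lambda>s. g s \<omega>)"
  shows "\<exists>I\<in>borel_measurable F. AE \<omega> in M. (LINT s:{0..t}|lborel. g s \<omega>) = I \<omega>"
proof -
  let ?c = "\<lambda>n x. max (- real n) (min (real n) x)"
  note g [measurable]
  have "\<forall>n. \<exists>I. I \<in> borel_measurable F \<and> (AE \<omega> in M. (LINT s:{0..t}|lborel. ?c n (g s \<omega>)) = I \<omega>)"
  proof
    fix n
    have "\<exists>I\<in>borel_measurable F. AE \<omega> in M. (LINT s:{0..t}|lborel. ?c n (g s \<omega>)) = I \<omega>"
    proof (rule bounded_time_integral_adapted [OF F, where c = "real n"])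
      show "(\<lambda>p. ?c n (g (snd p) (fst p))) \<in> borel_measurable (M \<Otimes>\<^sub>M lborel)" by measurable
      fix s assume "s \<in> {0..t}"
      then obtain g' where [measurable]: "g' \<in> borel_measurable F" and g': "AE \<omega> in M. g s \<omega> = g' \<omega>" using ad by blast
      have "(\<lambda>\<omega>. ?c n (g' \<omega>)) \<in> borel_measurable F" by measurable
      moreover have "AE \<omega> in M. ?c n (g s \<omega>) = ?c n (g' \<omega>)" using g' by eventually_elim simp
      ultimately show "\<exists>g'\<in>borel_measurable F. AE \<omega> in M. ?c n (g s \<omega>) = g' \<omega>"
        by (intro bexI [of _ "\<lambda>\<omega>. ?c n (g' \<omega>)"])
    qed auto
    then show "\<exists>I. I \<in> borel_measurable F \<and> (AE \<omega> in M. (LINT s:{0..t}|lborel. ?c n (g s \<omega>)) = I \<omega>)" by blast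
  qed
  from choice [OF this] obtain I where I: "\<And>n. I n \<in> borel_measurable F"
    and eq: "\<And>n. AE \<omega> in M. (LINT s:{0..t}|lborel. ?c n (g s \<omega>)) = I n \<omega>" by blast
  have "AE \<omega> in M. \<forall>n. (LINT s:{0..t}|lborel. ?c n (g s \<omega>)) = I n \<omega>" using eq by (simp add: AE_all_countable)
  with i have "AE \<omega> in M. (LINT s:{0..t}|lborel. g s \<omega>) = lim (\<lambda>n. I n \<omega>)"
  proof eventually_elim
    case (elim \<omega>)
    let ?g = "\<lambda>s. indicat_real {0..t} s *\<^sub>R g s \<omega>"
    have gi: "integrable lborel ?g" using elim(1) unfolding set_integrable_def .
    have cg: "indicat_real {0..t} s *\<^sub>R ?c n (g s \<omega>) = ?c n (?g s)" for n s by (simp add: indicator_def)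
    have "(\<lambda>n. \<integral>s. ?c n (?g s) \<partial>lborel) \<longlonglongrightarrow> (\<integral>s. ?g s \<partial>lborel)"
    proof (rule integral_dominated_convergence [where w = "\<lambda>s. \<bar>?g s\<bar>"])
      have gm: "?g \<in> borel_measurable lborel" using gi by (rule borel_measurable_integrable)
      show "?g \<in> borel_measurable lborel" by (rule gm)
      show "(\<lambda>s. ?c n (?g s)) \<in> borel_measurable lborel" for n
        by (intro borel_measurable_max borel_measurable_min borel_measurable_const gm)
      show "integrable lborel (\<lambda>s. \<bar>?g s\<bar>)" using gi by (rule integrable_abs)
      show "AE s in lborel. (\<lambda>n. ?c n (?g s)) \<longlonglongrightarrow> ?g s"
      proof (rule AE_I2)
        fix s
        obtain n0 where n0: "\<bar>?g s\<bar> \<le> real n0" using real_arch_simple by blast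
        have clip: "?c n (?g s) = ?g s" if "n0 \<le> n" for n
        proof -
          have "\<bar>?g s\<bar> \<le> real n" using n0 that by (meson of_nat_le_iff order_trans)
          then show ?thesis by linarith
        qed
        have "\<forall>\<^sub>F n in sequentially. ?g s = ?c n (?g s)"
          by (rule eventually_mono [OF eventually_ge_at_top [of n0]]) (rule clip [symmetric])
        then show "(\<lambda>n. ?c n (?g s)) \<longlonglongrightarrow> ?g s" by (rule Lim_transform_eventually [OF tendsto_const])
      qed
      show "AE s in lborel. norm (?c n (?g s)) \<le> \<bar>?g s\<bar>" for n
        unfolding real_norm_def by (rule AE_I2) linarith
    qed
    then have "(\<lambda>n. LINT s:{0..t}|lborel. ?c n (g s \<omega>)) \<longlonglongrightarrow> (LINT s:{0..t}|lborel. g s \<omega>)"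
      unfolding set_lebesgue_integral_def cg .
    then show ?case unfolding elim(2) [rule_format] by (rule limI [symmetric])
  qed
  moreover have "(\<lambda>\<omega>. lim (\<lambda>n. I n \<omega>)) \<in> borel_measurable F" by (intro borel_measurable_lim_metric I)
  ultimately show ?thesis by (intro bexI [of _ "\<lambda>\<omega>. lim (\<lambda>n. I n \<omega>)"])
qed

lemma (in prob_space) time_integral_adapted:
  fixes g :: "real \<Rightarrow> 'a \<Rightarrow> real^'k"
  assumes F: "subalgebra M F" and g: "(\<lambda>p. g (snd p) (fst p)) \<in> borel_measurable (M \<Otimes>\<^sub>M lborel)"
    and ad: "\<And>s. s \<in> {0..t} \<Longrightarrow> \<exists>g'\<in>borel_measurable F. AE \<omega> in M. g s \<omega> = g' \<omega>"
    and i: "AE \<omega> in M. set_integrable lborel {0..t} (\<lambda>s. g s \<omega>)"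
  shows "\<exists>I\<in>borel_measurable F. AE \<omega> in M. (LINT s:{0..t}|lborel. g s \<omega>) = I \<omega>"
proof -
  have "\<forall>k. \<exists>I. I \<in> borel_measurable F \<and> (AE \<omega> in M. (LINT s:{0..t}|lborel. g s \<omega> $ k) = I \<omega>)"
  proof
    fix k
    have "\<exists>I\<in>borel_measurable F. AE \<omega> in M. (LINT s:{0..t}|lborel. g s \<omega> $ k) = I \<omega>"
    proof (rule real_time_integral_adapted [OF F])
      show "(\<lambda>p. g (snd p) (fst p) $ k) \<in> borel_measurable (M \<Otimes>\<^sub>M lborel)"
        using g by (rule borel_measurable_component)
      show "AE \<omega> in M. set_integrable lborel {0..t} (\<lambda>s. g s \<omega> $ k)"
        using i by eventually_elim (rule set_integrable_linear [OF bounded_linear_vec_nth])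
      fix s assume "s \<in> {0..t}"
      then obtain g' where g': "g' \<in> borel_measurable F" "AE \<omega> in M. g s \<omega> = g' \<omega>" using ad by blast
      have "(\<lambda>\<omega>. g' \<omega> $ k) \<in> borel_measurable F" using g'(1) by (rule borel_measurable_component)
      moreover have "AE \<omega> in M. g s \<omega> $ k = g' \<omega> $ k" using g'(2) by eventually_elim simp
      ultimately show "\<exists>g'\<in>borel_measurable F. AE \<omega> in M. g s \<omega> $ k = g' \<omega>"
        by (intro bexI [of _ "\<lambda>\<omega>. g' \<omega> $ k"])
    qed
    then show "\<exists>I. I \<in> borel_measurable F \<and> (AE \<omega> in M. (LINT s:{0..t}|lborel. g s \<omega> $ k) = I \<omega>)" by blast
  qed
  from choice [OF this] obtain I where I: "\<And>k. I k \<in> borel_measurable F"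
    and eq: "\<And>k. AE \<omega> in M. (LINT s:{0..t}|lborel. g s \<omega> $ k) = I k \<omega>" by blast
  have "AE \<omega> in M. \<forall>k\<in>UNIV. (LINT s:{0..t}|lborel. g s \<omega> $ k) = I k \<omega>"
    by (intro AE_finite_allI eq) simp
  with i have "AE \<omega> in M. (LINT s:{0..t}|lborel. g s \<omega>) = (\<chi> k. I k \<omega>)"
  proof eventually_elim
    case (elim \<omega>)
    have "(LINT s:{0..t}|lborel. g s \<omega>) $ k = (LINT s:{0..t}|lborel. g s \<omega> $ k)" for k
      using integral_bounded_linear [OF bounded_linear_vec_nth elim(1) [unfolded set_integrable_def], of k]
      unfolding set_lebesgue_integral_def by simp
    then show ?case using elim(2) by (simp add: vec_eq_iff)
  qed
  moreover have "(\<lambda>\<omega>. \<chi> k. I k \<omega>) \<in> borel_measurable F"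
    by (rule borel_measurable_vecI) (simp add: I)
  ultimately show ?thesis by (intro bexI [of _ "\<lambda>\<omega>. \<chi> k. I k \<omega>"])
qed

text \<open>Picard iteration shows that the state is, up to null sets, a measurable functional of its initial value
  and its noise, and it bounds the first moment of the state by those of the data.\<close>

fun picard :: "(real \<Rightarrow> real^'d^'d) \<Rightarrow> (real \<Rightarrow> 'w \<Rightarrow> real^'d) \<Rightarrow> nat \<Rightarrow> real \<Rightarrow> 'w \<Rightarrow> real^'d" where
  "picard A Y 0 = (\<lambda>t \<omega>. 0)"
| "picard A Y (Suc n) = (\<lambda>t \<omega>. Y t \<omega> + (LINT s:{0..t}|lborel. A s *v picard A Y n s \<omega>))"

lemma picard_continuous:
  assumes A: "continuous_on {0..} A" and Y: "continuous_on {0..} (\<lambda>t. Y t \<omega>)"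
  shows "continuous_on {0..} (\<lambda>t. picard A Y n t \<omega>)"
proof (induction n)
  case (Suc n)
  have "set_integrable lborel {0..t} (\<lambda>s. A s *v picard A Y n s \<omega>)" for t
    by (intro borel_integrable_atLeastAtMost' cont_Icc_of_atLeast continuous_intros A Suc)
  then show ?case by (simp add: continuous_on_add Y continuous_LINT)
qed simp

lemma picard_measurable:
  assumes A: "continuous_on {0..} A" and Y: "\<And>t. 0 \<le> t \<Longrightarrow> Y t \<in> borel_measurable N"
    and cont: "\<And>\<omega>. continuous_on {0..} (\<lambda>t. Y t \<omega>)" and t: "0 \<le> t"
  shows "picard A Y n t \<in> borel_measurable N"
  using t
proof (induction n arbitrary: t)
  case (Suc n)
  have "(\<lambda>\<omega>. LINT s:{0..t}|lborel. A s *v picard A Y n s \<omega>) \<in> borel_measurable N"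
    by (rule measurable_time_integral [OF bounded_bilinear_matvec set_borel_measurable_continuous_on [OF cont_Icc_of_atLeast [OF A]] Suc.IH picard_continuous [OF A cont]])
  then show ?case using Y [OF Suc.prems] by simp
qed simp

lemma picard_tendsto:
  assumes A: "continuous_on {0..} A" and X: "continuous_on {0..} X" and Y: "continuous_on {0..} (\<lambda>t. Y t \<omega>)"
    and eq: "\<And>t. 0 \<le> t \<Longrightarrow> X t = Y t \<omega> + (LINT s:{0..t}|lborel. A s *v X s)" and t: "0 \<le> t"
  shows "(\<lambda>n. picard A Y n t \<omega>) \<longlonglongrightarrow> X t"
proof -
  have bounded: "\<exists>B\<ge>0. \<forall>s\<in>{0..t}. norm (f s) \<le> B" if "continuous_on {0..} f" for f :: "real \<Rightarrow> 'z::real_normed_vector"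
  proof -
    have "bounded (f ` {0..t})"
      by (intro compact_imp_bounded compact_continuous_image cont_Icc_of_atLeast that) simp
    then obtain B where "\<forall>s\<in>{0..t}. norm (f s) \<le> B" unfolding bounded_iff by auto
    then show ?thesis by (intro exI [of _ "max 0 B"]) auto
  qed
  obtain a where a: "0 \<le> a" "\<And>s. s \<in> {0..t} \<Longrightarrow> norm (A s) \<le> a" using bounded [OF A] by blast
  obtain B where B: "0 \<le> B" "\<And>s. s \<in> {0..t} \<Longrightarrow> norm (X s) \<le> B" using bounded [OF X] by blast
  have le: "norm (X s - picard A Y n s \<omega>) \<le> B * (a * s) ^ n / fact n" if "s \<in> {0..t}" for n s
    using that
  proof (induction n arbitrary: s)
    case 0
    then show ?case using B by simp
  next
    case (Suc n)
    have i1: "set_integrable lborel {0..s} (\<lambda>r. A r *v X r)"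
      by (intro borel_integrable_atLeastAtMost' cont_Icc_of_atLeast continuous_intros A X)
    have i2: "set_integrable lborel {0..s} (\<lambda>r. A r *v picard A Y n r \<omega>)"
      by (intro borel_integrable_atLeastAtMost' cont_Icc_of_atLeast continuous_intros A picard_continuous Y)
    have "X s - picard A Y (Suc n) s \<omega> = (LINT r:{0..s}|lborel. A r *v X r) - (LINT r:{0..s}|lborel. A r *v picard A Y n r \<omega>)"
      using eq [of s] Suc.prems by simp
    also have "\<dots> = (LINT r:{0..s}|lborel. A r *v X r - A r *v picard A Y n r \<omega>)"
      by (rule set_integral_diff(2) [OF i1 i2, symmetric])
    also have "\<dots> = integral {0..s} (\<lambda>r. A r *v X r - A r *v picard A Y n r \<omega>)"
      by (rule set_integrable_imp_integrable_on(2) [OF set_integral_diff(1) [OF i1 i2]])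
    also have "norm \<dots> \<le> integral {0..s} (\<lambda>r. (B * a ^ Suc n / fact n) * r ^ n)"
    proof (rule integral_norm_bound_integral)
      show "(\<lambda>r. A r *v X r - A r *v picard A Y n r \<omega>) integrable_on {0..s}"
        by (rule set_integrable_imp_integrable_on(1) [OF set_integral_diff(1) [OF i1 i2]])
      show "(\<lambda>r. (B * a ^ Suc n / fact n) * r ^ n) integrable_on {0..s}"
        by (intro integrable_continuous_real continuous_intros)
      fix r assume r: "r \<in> {0..s}"
      have "norm (A r *v X r - A r *v picard A Y n r \<omega>) = norm (A r *v (X r - picard A Y n r \<omega>))"
        by (simp add: bounded_bilinear.diff_right [OF bounded_bilinear_matvec])
      also have "\<dots> \<le> norm (A r) * norm (X r - picard A Y n r \<omega>)" by (rule norm_matvec_le)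
      also have "\<dots> \<le> a * (B * (a * r) ^ n / fact n)"
        using r Suc.prems a by (intro mult_mono a Suc.IH) auto
      also have "\<dots> = (B * a ^ Suc n / fact n) * r ^ n" by (simp add: power_mult_distrib)
      finally show "norm (A r *v X r - A r *v picard A Y n r \<omega>) \<le> (B * a ^ Suc n / fact n) * r ^ n" .
    qed
    also have "integral {0..s} (\<lambda>r. (B * a ^ Suc n / fact n) * r ^ n) = B * (a * s) ^ Suc n / fact (Suc n)"
    proof (rule integral_unique)
      have "((\<lambda>r. (B * a ^ Suc n / fact n) * r ^ n) has_integral (B * a ^ Suc n / fact (Suc n)) * s ^ Suc n - (B * a ^ Suc n / fact (Suc n)) * 0 ^ Suc n) {0..s}"
      proof (rule fundamental_theorem_of_calculus)
        show "0 \<le> s" using Suc.prems by simp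
        fix x assume "x \<in> {0..s}"
        have "((\<lambda>r. (B * a ^ Suc n / fact (Suc n)) * r ^ Suc n) has_real_derivative (B * a ^ Suc n / fact (Suc n)) * (real (Suc n) * x ^ n)) (at x within {0..s})"
          using DERIV_cmult [OF DERIV_pow [of "Suc n" x "{0..s}"], of "B * a ^ Suc n / fact (Suc n)"] by simp
        moreover have "(z / (k * f)) * (k * y) = (z / f) * y" if "0 < k" for z k f y :: real
          using that by simp
        then have "(B * a ^ Suc n / fact (Suc n)) * (real (Suc n) * x ^ n) = (B * a ^ Suc n / fact n) * x ^ n"
          unfolding fact_Suc by simp
        ultimately show "((\<lambda>r. (B * a ^ Suc n / fact (Suc n)) * r ^ Suc n) has_vector_derivative (B * a ^ Suc n / fact n) * x ^ n) (at x within {0..s})"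
          by (simp only: has_real_derivative_iff_has_vector_derivative)
      qed
      moreover have "(B * a ^ Suc n / fact (Suc n)) * s ^ Suc n - (B * a ^ Suc n / fact (Suc n)) * 0 ^ Suc n = B * (a * s) ^ Suc n / fact (Suc n)"
        by (simp add: power_mult_distrib mult_ac)
      ultimately show "((\<lambda>r. (B * a ^ Suc n / fact n) * r ^ n) has_integral B * (a * s) ^ Suc n / fact (Suc n)) {0..s}"
        by (simp only:)
    qed
    finally show ?case .
  qed
  have "(\<lambda>n. B * (inverse (fact n) * (a * t) ^ n)) \<longlonglongrightarrow> B * 0"
    by (intro tendsto_mult tendsto_const summable_LIMSEQ_zero summable_exp)
  then have "(\<lambda>n. B * (a * t) ^ n / fact n) \<longlonglongrightarrow> 0" by (simp add: divide_inverse mult_ac)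
  then have "(\<lambda>n. picard A Y n t \<omega> - X t) \<longlonglongrightarrow> 0"
    by (rule Lim_null_comparison [rotated]) (use le [of t] t in \<open>simp add: norm_minus_commute\<close>)
  then show ?thesis by (simp add: LIM_zero_iff)
qed

lemma (in prob_space) picard_moment:
  assumes A: "continuous_on {0..} A" and Y: "\<And>t. 0 \<le> t \<Longrightarrow> Y t \<in> borel_measurable M"
    and cont: "\<And>\<omega>. continuous_on {0..} (\<lambda>t. Y t \<omega>)"
    and a: "0 < a" "\<And>s. s \<in> {0..T} \<Longrightarrow> norm (A s) \<le> a" and c: "0 \<le> c"
    and mom: "\<And>t. t \<in> {0..T} \<Longrightarrow> (\<integral>\<^sup>+\<omega>. ennreal (norm (Y t \<omega>)) \<partial>M) \<le> ennreal c" and t: "t \<in> {0..T}"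
  shows "(\<integral>\<^sup>+\<omega>. ennreal (norm (picard A Y n t \<omega>)) \<partial>M) \<le> ennreal (c * exp (a * t))"
  using t
proof (induction n arbitrary: t)
  case (Suc n)
  interpret pair_sigma_finite M lborel by unfold_locales
  have t: "0 \<le> t" "t \<le> T" using Suc.prems by auto
  note pm = picard_measurable [OF A Y cont]
  let ?p = "\<lambda>s \<omega>. picard A Y n (max 0 s) \<omega>"
  have j: "(\<lambda>p. picard A Y n (max 0 (snd p)) (fst p)) \<in> borel_measurable (M \<Otimes>\<^sub>M borel)"
    by (rule measurable_pair_continuous [OF pm picard_continuous [OF A cont]])
  then have "(\<lambda>p. ennreal (a * norm (picard A Y n (max 0 (snd p)) (fst p))) * indicator {0..t} (snd p)) \<in> borel_measurable (M \<Otimes>\<^sub>M borel)"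
    by measurable
  then have jm: "(\<lambda>(\<omega>, s). ennreal (a * norm (?p s \<omega>)) * indicator {0..t} s) \<in> borel_measurable (M \<Otimes>\<^sub>M lborel)"
    by (simp add: case_prod_beta' cong: measurable_cong_sets sets_pair_measure_cong)
  have le: "ennreal (norm (picard A Y (Suc n) t \<omega>)) \<le> ennreal (norm (Y t \<omega>)) + (\<integral>\<^sup>+s. ennreal (a * norm (?p s \<omega>)) * indicator {0..t} s \<partial>lborel)" for \<omega>
  proof -
    have i: "set_integrable lborel {0..t} (\<lambda>s. A s *v picard A Y n s \<omega>)"
      by (intro borel_integrable_atLeastAtMost' cont_Icc_of_atLeast continuous_intros A picard_continuous cont)
    have "ennreal (norm (LINT s:{0..t}|lborel. A s *v picard A Y n s \<omega>)) \<le> (\<integral>\<^sup>+s. ennreal (norm (indicat_real {0..t} s *\<^sub>R (A s *v picard A Y n s \<omega>))) \<partial>lborel)"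
      unfolding set_lebesgue_integral_def using i unfolding set_integrable_def by (rule integral_norm_bound_ennreal)
    also have "\<dots> \<le> (\<integral>\<^sup>+s. ennreal (a * norm (?p s \<omega>)) * indicator {0..t} s \<partial>lborel)"
    proof (rule nn_integral_mono)
      fix s
      show "ennreal (norm (indicat_real {0..t} s *\<^sub>R (A s *v picard A Y n s \<omega>))) \<le> ennreal (a * norm (?p s \<omega>)) * indicator {0..t} s"
      proof (cases "s \<in> {0..t}")
        case True
        then have "norm (A s *v picard A Y n s \<omega>) \<le> a * norm (picard A Y n s \<omega>)"
          using t by (intro order_trans [OF norm_matvec_le] mult_right_mono a) auto
        then show ?thesis using True by (simp add: ennreal_leI)
      qed simp
    qed
    finally have "ennreal (norm (LINT s:{0..t}|lborel. A s *v picard A Y n s \<omega>)) \<le> (\<integral>\<^sup>+s. ennreal (a * norm (?p s \<omega>)) * indicator {0..t} s \<partial>lborel)" .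
    moreover have "ennreal (norm (picard A Y (Suc n) t \<omega>)) \<le> ennreal (norm (Y t \<omega>) + norm (LINT s:{0..t}|lborel. A s *v picard A Y n s \<omega>))"
      by (intro ennreal_leI) (simp add: norm_triangle_ineq)
    ultimately show ?thesis by (simp add: ennreal_plus) (meson add_left_mono order_trans)
  qed
  have "(\<integral>\<^sup>+\<omega>. ennreal (norm (picard A Y (Suc n) t \<omega>)) \<partial>M)
    \<le> (\<integral>\<^sup>+\<omega>. ennreal (norm (Y t \<omega>)) + (\<integral>\<^sup>+s. ennreal (a * norm (?p s \<omega>)) * indicator {0..t} s \<partial>lborel) \<partial>M)"
    by (intro nn_integral_mono le)
  also have "\<dots> = (\<integral>\<^sup>+\<omega>. ennreal (norm (Y t \<omega>)) \<partial>M) + (\<integral>\<^sup>+\<omega>. (\<integral>\<^sup>+s. ennreal (a * norm (?p s \<omega>)) * indicator {0..t} s \<partial>lborel) \<partial>M)"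
    by (rule nn_integral_add) (use Y [OF t(1)] lborel.borel_measurable_nn_integral [OF jm] in auto)
  also have "(\<integral>\<^sup>+\<omega>. (\<integral>\<^sup>+s. ennreal (a * norm (?p s \<omega>)) * indicator {0..t} s \<partial>lborel) \<partial>M)
     = (\<integral>\<^sup>+s. (\<integral>\<^sup>+\<omega>. ennreal (a * norm (?p s \<omega>)) * indicator {0..t} s \<partial>M) \<partial>lborel)"
    by (rule Fubini' [OF jm, symmetric])
  also have "\<dots> \<le> (\<integral>\<^sup>+s. ennreal (a * c * exp (a * s)) * indicator {0..t} s \<partial>lborel)"
  proof (rule nn_integral_mono)
    fix s
    show "(\<integral>\<^sup>+\<omega>. ennreal (a * norm (?p s \<omega>)) * indicator {0..t} s \<partial>M) \<le> ennreal (a * c * exp (a * s)) * indicator {0..t} s"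
    proof (cases "s \<in> {0..t}")
      case True
      have [measurable]: "picard A Y n s \<in> borel_measurable M" using True by (intro pm) auto
      have "(\<integral>\<^sup>+\<omega>. ennreal (a * norm (?p s \<omega>)) * indicator {0..t} s \<partial>M) = ennreal a * (\<integral>\<^sup>+\<omega>. ennreal (norm (picard A Y n s \<omega>)) \<partial>M)"
        using True a by (simp add: ennreal_mult nn_integral_cmult max_def)
      also have "\<dots> \<le> ennreal a * ennreal (c * exp (a * s))"
        using True t by (intro mult_left_mono Suc.IH) auto
      finally show ?thesis using True a c by (simp add: ennreal_mult [symmetric] mult.assoc)
    qed simp
  qed
  also have "\<dots> = ennreal (c * exp (a * t) - c * exp (a * 0))"
  proof -
    have "((\<lambda>s. a * c * exp (a * s)) has_integral c * exp (a * t) - c * exp (a * 0)) {0..t}"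
      by (rule fundamental_theorem_of_calculus [OF t(1)])
        (auto intro!: derivative_eq_intros simp: has_real_derivative_iff_has_vector_derivative [symmetric])
    then show ?thesis
      using a c by (intro nn_integral_has_integral_lebesgue') auto
  qed
  finally have "(\<integral>\<^sup>+\<omega>. ennreal (norm (picard A Y (Suc n) t \<omega>)) \<partial>M)
    \<le> (\<integral>\<^sup>+\<omega>. ennreal (norm (Y t \<omega>)) \<partial>M) + ennreal (c * exp (a * t) - c)" by (simp add: add_left_mono)
  also have "\<dots> \<le> ennreal c + ennreal (c * exp (a * t) - c)" by (intro add_right_mono mom Suc.prems)
  also have "\<dots> = ennreal (c * exp (a * t))"
  proof -
    have "c * 1 \<le> c * exp (a * t)" using c a t by (intro mult_left_mono) auto
    then show ?thesis using c by (simp add: ennreal_plus [symmetric])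
  qed
  finally show ?case .
qed simp

section \<open>The solution of the mean-field equation\<close>

lemma (in wiener) has_wiener_integral_cong:
  fixes f f' :: "real \<Rightarrow> real^'m^'k"
  assumes J: "has_wiener_integral M R W T f J" and eq: "\<And>s. 0 \<le> s \<Longrightarrow> s \<le> T \<Longrightarrow> f s = f' s"
  shows "has_wiener_integral M R W T f' J"
proof -
  have "(\<lambda>s. indicat_real {0..T} s *\<^sub>R f' s) = (\<lambda>s. indicat_real {0..T} s *\<^sub>R f s)"
    using eq by (auto simp: fun_eq_iff indicator_def)
  moreover have "ito_sq R T (\<lambda>s. g s - f' s) = ito_sq R T (\<lambda>s. g s - f s)" for g
    by (rule ito_sq_cong) (simp add: eq)
  ultimately show ?thesis
    using J unfolding has_wiener_integral_iff set_borel_measurable_def by simp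
qed

lemma (in wiener) has_wiener_integral_at_0:
  fixes f :: "real \<Rightarrow> real^'m^'k"
  assumes "has_wiener_integral M R W 0 f J" shows "AE \<omega> in M. J \<omega> = 0"
  by (rule has_wiener_integral_AE_unique [OF assms has_wiener_integral_0]) simp

lemma (in intensity) ito_sq_continuous_mult_finite:
  fixes G :: "real \<Rightarrow> real^'k^'l" and f :: "real \<Rightarrow> real^'m^'k"
  assumes G: "continuous_on {0..} G" and f: "set_borel_measurable borel {0..t} f" and fin: "ito_sq R t f < \<infinity>"
  shows "set_borel_measurable borel {0..t} (\<lambda>s. G s ** f s)" "ito_sq R t (\<lambda>s. G s ** f s) < \<infinity>"
proof -
  show "set_borel_measurable borel {0..t} (\<lambda>s. G s ** f s)"
    by (rule set_borel_measurable_bilinear [OF bounded_bilinear_matmul set_borel_measurable_continuous_on [OF cont_Icc_of_atLeast [OF G]] f])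
  have "bounded (G ` {0..t})"
    by (intro compact_imp_bounded compact_continuous_image cont_Icc_of_atLeast G) simp
  then obtain b where b: "\<forall>s\<in>{0..t}. norm (G s) \<le> b" unfolding bounded_iff by auto
  have "ito_sq R t (\<lambda>s. G s ** f s) \<le> ennreal (b\<^sup>2) * ito_sq R t f"
    by (rule ito_sq_left_mult [OF f]) (use b in auto)
  also have "\<dots> < \<infinity>" using fin by (simp add: ennreal_mult_less_top)
  finally show "ito_sq R t (\<lambda>s. G s ** f s) < \<infinity>" .
qed

lemma (in intensity) ito_sq_const_finite: "ito_sq R t (\<lambda>s. c :: real^'m^'k) < \<infinity>"
  using order_le_less_trans [OF ito_sq_le_bound [of t "\<lambda>s. c" "norm c"]] by simp

locale mean_field =
  fixes M :: "'w measure"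
    and A Q Sig :: "real \<Rightarrow> real^'d^'d"
    and C :: "real \<Rightarrow> real^'d^'m"
    and R :: "real \<Rightarrow> real^'m^'m"
    and m0 :: "real^'d" and Sig0 :: "real^'d^'d"
    and B Bb X :: "real \<Rightarrow> 'w \<Rightarrow> real^'d"
    and W Wb Z :: "real \<Rightarrow> 'w \<Rightarrow> real^'m"
    and Xb0 :: "'w \<Rightarrow> real^'d"
    and \<Phi> \<Psi> :: "real \<Rightarrow> real \<Rightarrow> real^'d^'d"
    and \<gamma>1 \<gamma>2 :: real
  assumes prob: "prob_space M"
    and A: "continuous_on {0..} A" and C: "continuous_on {0..} C"
    and Q_pos: "\<And>t. 0 \<le> t \<Longrightarrow> pos_def (Q t)" and R_pos: "\<And>t. 0 \<le> t \<Longrightarrow> pos_def (R t)" and Sig0_pos: "pos_def Sig0"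
    and B: "wiener_process M Q B" and W: "wiener_process M R W"
    and Bb: "wiener_process M Q Bb" and Wb: "wiener_process M R Wb"
    and X0: "gaussian M (X 0) m0 Sig0" and Xb0: "gaussian M Xb0 m0 Sig0"
    and indep: "prob_space.indep_sets M
           (\<lambda>k. [sets (generated_sigma M {0..} B), sets (generated_sigma M {0..} W),
                 sets (generated_sigma M {()} (\<lambda>_. X 0)), sets (generated_sigma M {()} (\<lambda>_. Xb0)),
                 sets (generated_sigma M {0..} Bb), sets (generated_sigma M {0..} Wb)] ! k)
           {..<6::nat}"
    and X_meas: "\<And>t. 0 \<le> t \<Longrightarrow> X t \<in> borel_measurable M"
    and X_cont: "AE \<omega> in M. continuous_on {0..} (\<lambda>t. X t \<omega>)"
    and X_eq: "AE \<omega> in M. \<forall>t\<ge>0. X t \<omega> = X 0 \<omega> + (LINT s:{0..t}|lborel. A s *v X s \<omega>) + B t \<omega>"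
    and Z_meas: "\<And>t. 0 \<le> t \<Longrightarrow> Z t \<in> borel_measurable M"
    and Z_eq: "AE \<omega> in M. \<forall>t\<ge>0. Z t \<omega> = (LINT s:{0..t}|lborel. C s *v X s \<omega>) + W t \<omega>"
    and Sig_0: "Sig 0 = Sig0"
    and riccati_eq: "\<And>t. 0 \<le> t \<Longrightarrow>
           (Sig has_vector_derivative
              A t ** Sig t + Sig t ** transpose (A t) + Q t
              - Sig t ** transpose (C t) ** matrix_inv (R t) ** C t ** Sig t) (at t within {0..})"
    and \<Phi>_id: "\<And>\<tau>. 0 \<le> \<tau> \<Longrightarrow> \<Phi> \<tau> \<tau> = mat 1"
    and \<Phi>_ode: "\<And>t \<tau>. 0 \<le> t \<Longrightarrow> 0 \<le> \<tau> \<Longrightarrow>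
           ((\<lambda>s. \<Phi> s \<tau>) has_vector_derivative
              (- transpose (A t) + transpose (C t) ** transpose (kalman_gain C R Sig t)) ** \<Phi> t \<tau>) (at t within {0..})"
    and \<Psi>_id: "\<And>\<tau>. 0 \<le> \<tau> \<Longrightarrow> \<Psi> \<tau> \<tau> = mat 1"
    and \<Psi>_ode: "\<And>t \<tau>. 0 \<le> t \<Longrightarrow> 0 \<le> \<tau> \<Longrightarrow>
           ((\<lambda>s. \<Psi> s \<tau>) has_vector_derivative
              (- transpose (A t)
               + ((1 + \<gamma>2\<^sup>2) / 2) *\<^sub>R (transpose (C t) ** transpose (kalman_gain C R Sig t))
               - ((1 - \<gamma>1\<^sup>2) / 2) *\<^sub>R (matrix_inv (Sig t) ** Q t)) ** \<Psi> t \<tau>) (at t within {0..})"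
begin

sublocale prob_space M by (rule prob)
sublocale wB: wiener M Q B by (rule wienerI [OF prob B Q_pos])
sublocale wW: wiener M R W by (rule wienerI [OF prob W R_pos])
sublocale wBb: wiener M Q Bb by (rule wienerI [OF prob Bb Q_pos])
sublocale wWb: wiener M R Wb by (rule wienerI [OF prob Wb R_pos])
sublocale ric: riccati A Q Sig C R \<Phi>
  by unfold_locales (use A C wB.R_int wW.R_int Q_pos R_pos Sig0_pos Sig_0 riccati_eq \<Phi>_id \<Phi>_ode in auto)

abbreviation K :: "real \<Rightarrow> real^'m^'d" where "K t \<equiv> kalman_gain C R Sig t"

text \<open>\<open>L\<close> and \<open>F\<close> are the drift matrices of the conditional mean and of the deviation from it.\<close>

definition L :: "real \<Rightarrow> real^'d^'d" where "L t = A t - K t ** C t"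

definition F :: "real \<Rightarrow> real^'d^'d" where
  "F t = A t + ((1 - \<gamma>1\<^sup>2) / 2) *\<^sub>R (Q t ** matrix_inv (Sig t)) - ((1 + \<gamma>2\<^sup>2) / 2) *\<^sub>R (K t ** C t)"

text \<open>\<open>U\<close> and \<open>V\<close> are the fundamental matrices of \<open>L\<close> and \<open>F\<close>; \<open>Ui\<close> and \<open>Vi\<close> turn out to be their inverses.\<close>

definition "U t = transpose (\<Phi> 0 t)"
definition "Ui t = transpose (\<Phi> t 0)"
definition "V t = transpose (\<Psi> 0 t)"
definition "Vi t = transpose (\<Psi> t 0)"

text \<open>The combination \<open>(1 + \<gamma>\<^sub>2\<^sup>2) x + (1 - \<gamma>\<^sub>2\<^sup>2) m = 2 m + (1 + \<gamma>\<^sub>2\<^sup>2) (x - m)\<close> is what decouples mean and deviation.\<close>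

lemma drift_eq:
  "mean_field_drift A C Q R Sig \<gamma>1 \<gamma>2 s x m = L s *v m + F s *v (x - m)"
proof -
  have 1: "K s *v (C s *v ((1 / 2) *\<^sub>R ((1 + \<gamma>2\<^sup>2) *\<^sub>R x + (1 - \<gamma>2\<^sup>2) *\<^sub>R m)))
    = (K s ** C s) *v m + ((1 + \<gamma>2\<^sup>2) / 2) *\<^sub>R ((K s ** C s) *v (x - m))"
  proof -
    have "(1 / 2) *\<^sub>R ((1 + \<gamma>2\<^sup>2) *\<^sub>R x + (1 - \<gamma>2\<^sup>2) *\<^sub>R m) = m + ((1 + \<gamma>2\<^sup>2) / 2) *\<^sub>R (x - m)"
      by (simp add: vec_eq_iff field_simps)
    then show ?thesis
      by (simp add: matrix_vector_mul_assoc matrix_vector_right_distrib matrix_vector_mult_scaleR)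
  qed
  have 2: "A s *v x = A s *v m + A s *v (x - m)"
    by (simp add: bounded_bilinear.diff_right [OF bounded_bilinear_matvec])
  show ?thesis
    unfolding mean_field_drift_def 1 2 L_def F_def
    by (simp add: matrix_vector_mult_add_rdistrib bounded_bilinear.diff_left [OF bounded_bilinear_matvec]
        bounded_bilinear.scaleR_left [OF bounded_bilinear_matvec])
qed

lemma A_int: "set_integrable lborel {0..t} A"
  by (intro borel_integrable_atLeastAtMost' cont_Icc_of_atLeast A)

lemma L_int: "set_integrable lborel {0..t} L"
  unfolding L_def [abs_def] by (intro set_integral_diff A_int ric.KC_integrable)

lemma F_int: "set_integrable lborel {0..t} F"
proof -
  have "set_integrable lborel {0..t} (\<lambda>s. Q s ** matrix_inv (Sig s))"
    by (rule set_integrable_bilinear_flip [OF bounded_bilinear_matmul cont_Icc_of_atLeast [OF ric.P_cont] wB.R_int])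
  then show ?thesis
    unfolding F_def [abs_def]
    by (intro set_integral_diff set_integral_add A_int set_integrable_scaleR_right ric.KC_integrable impI)
qed

lemma U_flow:
  "\<And>s T. 0 \<le> s \<Longrightarrow> 0 \<le> T \<Longrightarrow> transpose (\<Phi> s T) = U T ** Ui s"
  "\<And>t. 0 \<le> t \<Longrightarrow> U t ** Ui t = mat 1"
  "continuous_on {0..} U" "continuous_on {0..} Ui"
  "\<And>t. set_integrable lborel {0..t} (\<lambda>s. L s ** U s)"
  "\<And>s t. 0 \<le> s \<Longrightarrow> s \<le> t \<Longrightarrow> U t - U s = integral {s..t} (\<lambda>s. L s ** U s)"
proof -
  let ?G = "\<lambda>t. - transpose (A t) + transpose (C t) ** transpose (K t)"
  have GL: "- transpose (?G t) = L t" for t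
    by (simp add: L_def transpose_add transpose_diff matrix_transpose_mul [symmetric] transpose_minus)
  have "?G t = - transpose (L t)" for t
    by (simp add: L_def transpose_diff matrix_transpose_mul)
  then have G: "set_integrable lborel {0..t} ?G" for t
    using set_integrable_linear [OF bounded_linear_compose [OF bounded_linear_minus [OF bounded_linear_ident] bounded_linear_transpose] L_int] by simp
  note fl = transition_matrix_flow [OF G \<Phi>_id \<Phi>_ode, unfolded GL]
  show "transpose (\<Phi> s T) = U T ** Ui s" if "0 \<le> s" "0 \<le> T" for s T
    unfolding U_def Ui_def using that by - (rule transition_matrix_flow(1) [OF G \<Phi>_id \<Phi>_ode]; assumption)
  show "U t ** Ui t = mat 1" if "0 \<le> t" for t
    unfolding U_def Ui_def using that by - (rule fl(2); assumption)
  show "continuous_on {0..} U" unfolding U_def [abs_def] by (rule fl(3); assumption)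
  show "continuous_on {0..} Ui" unfolding Ui_def [abs_def] by (rule fl(4); assumption)
  show "set_integrable lborel {0..t} (\<lambda>s. L s ** U s)" for t
    unfolding U_def by (rule fl(5); assumption)
  show "U t - U s = integral {s..t} (\<lambda>s. L s ** U s)" if "0 \<le> s" "s \<le> t" for s t
    unfolding U_def using that by - (rule fl(6); assumption)
qed

lemma V_flow:
  "\<And>s T. 0 \<le> s \<Longrightarrow> 0 \<le> T \<Longrightarrow> transpose (\<Psi> s T) = V T ** Vi s"
  "\<And>t. 0 \<le> t \<Longrightarrow> V t ** Vi t = mat 1"
  "continuous_on {0..} V" "continuous_on {0..} Vi"
  "\<And>t. set_integrable lborel {0..t} (\<lambda>s. F s ** V s)"
  "\<And>s t. 0 \<le> s \<Longrightarrow> s \<le> t \<Longrightarrow> V t - V s = integral {s..t} (\<lambda>s. F s ** V s)"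
proof -
  let ?G = "\<lambda>t. - transpose (A t)
               + ((1 + \<gamma>2\<^sup>2) / 2) *\<^sub>R (transpose (C t) ** transpose (kalman_gain C R Sig t))
               - ((1 - \<gamma>1\<^sup>2) / 2) *\<^sub>R (matrix_inv (Sig t) ** Q t)"
  have GF: "- transpose (?G t) = F t" if "0 \<le> t" for t
    by (simp add: F_def transpose_add transpose_diff matrix_transpose_mul [symmetric] transpose_minus transpose_scaleR)
      (simp add: matrix_transpose_mul ric.P_sym [OF that] pos_def_symmetric [OF Q_pos [OF that]])
  have "set_integrable lborel {0..t} (\<lambda>s. - transpose (F s))" for t
    using set_integrable_linear [OF bounded_linear_compose [OF bounded_linear_minus [OF bounded_linear_ident] bounded_linear_transpose] F_int] by simp
  moreover have "?G s = - transpose (F s)" if "0 \<le> s" for s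
    unfolding GF [OF that, symmetric] by (simp add: transpose_minus)
  then have "set_integrable lborel {0..t} (\<lambda>s. - transpose (F s)) = set_integrable lborel {0..t} ?G" for t
    by (intro set_integrable_cong) auto
  ultimately have G: "set_integrable lborel {0..t} ?G" for t by blast
  note fl = transition_matrix_flow [OF G \<Psi>_id \<Psi>_ode]
  show "transpose (\<Psi> s T) = V T ** Vi s" if "0 \<le> s" "0 \<le> T" for s T
    unfolding V_def Vi_def using that by - (rule transition_matrix_flow(1) [OF G \<Psi>_id \<Psi>_ode]; assumption)
  show "V t ** Vi t = mat 1" if "0 \<le> t" for t
    unfolding V_def Vi_def using that by - (rule fl(2); assumption)
  show "continuous_on {0..} V" unfolding V_def [abs_def] by (rule fl(3); assumption)
  show "continuous_on {0..} Vi" unfolding Vi_def [abs_def] by (rule fl(4); assumption)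
  show "set_integrable lborel {0..t} (\<lambda>s. F s ** V s)" for t
  proof -
    have "set_integrable lborel {0..t} (\<lambda>s. - transpose (?G s) ** V s) = set_integrable lborel {0..t} (\<lambda>s. F s ** V s)"
      by (intro set_integrable_cong refl) (simp only: GF atLeastAtMost_iff)
    moreover have "set_integrable lborel {0..t} (\<lambda>s. - transpose (?G s) ** V s)"
      unfolding V_def by (rule fl(5); assumption)
    ultimately show ?thesis by blast
  qed
  show "V t - V s = integral {s..t} (\<lambda>s. F s ** V s)" if "0 \<le> s" "s \<le> t" for s t
  proof -
    have "integral {s..t} (\<lambda>s. - transpose (?G s) ** V s) = integral {s..t} (\<lambda>s. F s ** V s)"
      by (intro integral_cong) (use that GF in auto)
    moreover have "V t - V s = integral {s..t} (\<lambda>s. - transpose (?G s) ** V s)"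
      unfolding V_def using that by - (rule fl(6); assumption)
    ultimately show ?thesis by (simp only:)
  qed
qed

lemma U_0 [simp]: "U 0 = mat 1" and V_0 [simp]: "V 0 = mat 1"
  using \<Phi>_id [of 0] \<Psi>_id [of 0] by (simp_all add: U_def V_def)

lemma kernel_W:
  "set_borel_measurable borel {0..t} (\<lambda>s. Ui s ** K s)" "ito_sq R t (\<lambda>s. Ui s ** K s) < \<infinity>"
  by (rule wW.ito_sq_continuous_mult_finite [OF U_flow(4) ric.K_measurable ric.ito_sq_K_finite])+

lemma kernel_Wb:
  "set_borel_measurable borel {0..t} (\<lambda>s. Vi s ** K s)" "ito_sq R t (\<lambda>s. Vi s ** K s) < \<infinity>"
  by (rule wW.ito_sq_continuous_mult_finite [OF V_flow(4) ric.K_measurable ric.ito_sq_K_finite])+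

lemma kernel_Bb:
  "set_borel_measurable borel {0..t} Vi" "ito_sq Q t Vi < \<infinity>"
  using wB.ito_sq_continuous_mult_finite [OF V_flow(4) set_borel_measurable_continuous_on [OF continuous_on_const] wB.ito_sq_const_finite, of t "mat 1"]
  by simp_all

lemma K_integrable_W: "0 \<le> t \<Longrightarrow> \<exists>J. has_wiener_integral M R W t K J"
  using wW.wiener_integral_process [OF ric.K_measurable ric.ito_sq_K_finite] by blast

lemma K_integrable_Wb: "0 \<le> t \<Longrightarrow> \<exists>J. has_wiener_integral M R Wb t K J"
  using wWb.wiener_integral_process [OF ric.K_measurable ric.ito_sq_K_finite] by blast

lemma Bb_integral: "0 \<le> t \<Longrightarrow> has_wiener_integral M Q Bb t (\<lambda>s. mat 1) (Bb t)"
proof -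
  assume t: "0 \<le> t"
  have [measurable]: "Bb t \<in> borel_measurable M" "Bb 0 \<in> borel_measurable M" using t by auto
  have "ito_sq Q t (\<lambda>s. step_function [(mat 1, 0, t)] s - mat 1) = ito_sq Q t (\<lambda>s. 0 :: real^'d^'d)"
    by (rule wB.ito_sq_cong) (simp add: indicator_def)
  also have "\<dots> = 0" by (simp add: ito_sq_def bounded_bilinear.zero_left [OF bounded_bilinear_matmul] trace_def)
  finally have z: "ito_sq Q t (\<lambda>s. step_function [(mat 1 :: real^'d^'d, 0, t)] s - mat 1) = 0" .
  have "(\<integral>\<^sup>+\<omega>. ennreal ((norm (step_integral Bb [(mat 1 :: real^'d^'d, 0, t)] \<omega> - Bb t \<omega>))\<^sup>2) \<partial>M) = (\<integral>\<^sup>+\<omega>. 0 \<partial>M)"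
    by (rule nn_integral_cong_AE, use wBb.W_0 in eventually_elim) simp
  then show ?thesis
    unfolding has_wiener_integral_iff using t z
    by (intro conjI exI [of _ "\<lambda>_. [(mat 1, 0, t)]"]) (auto intro: set_borel_measurable_continuous_on)
qed

end

text \<open>The hypotheses determine the stochastic integrals only up to a null set at each time and give continuity
  of paths only almost surely.  Here versions are fixed once and for all: \<open>N1\<close>, \<open>N2\<close>, \<open>N3\<close> of the integrals of
  the kernels against \<open>W\<close>, \<open>Bb\<close>, \<open>Wb\<close>, and \<open>Xc\<close>, \<open>Bc\<close> of \<open>X\<close>, \<open>B\<close> with all paths continuous.\<close>

locale mean_field_processes = mean_field M A Q Sig C R m0 Sig0 B Bb X W Wb Z Xb0 \<Phi> \<Psi> \<gamma>1 \<gamma>2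
  for M :: "'w measure"
    and A Q Sig :: "real \<Rightarrow> real^'d^'d"
    and C :: "real \<Rightarrow> real^'d^'m"
    and R :: "real \<Rightarrow> real^'m^'m"
    and m0 :: "real^'d" and Sig0 :: "real^'d^'d"
    and B Bb X :: "real \<Rightarrow> 'w \<Rightarrow> real^'d"
    and W Wb Z :: "real \<Rightarrow> 'w \<Rightarrow> real^'m"
    and Xb0 :: "'w \<Rightarrow> real^'d"
    and \<Phi> \<Psi> :: "real \<Rightarrow> real \<Rightarrow> real^'d^'d"
    and \<gamma>1 \<gamma>2 :: real +
  fixes N1 N2 N3 Xc Bc :: "real \<Rightarrow> 'w \<Rightarrow> real^'d"
  assumes N1_cont: "\<And>\<omega>. \<omega> \<in> space M \<Longrightarrow> continuous_on {0..} (\<lambda>t. N1 t \<omega>)"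
    and N1: "\<And>t. 0 \<le> t \<Longrightarrow> has_wiener_integral M R W t (\<lambda>s. Ui s ** K s) (N1 t)"
    and N2_cont: "\<And>\<omega>. \<omega> \<in> space M \<Longrightarrow> continuous_on {0..} (\<lambda>t. N2 t \<omega>)"
    and N2: "\<And>t. 0 \<le> t \<Longrightarrow> has_wiener_integral M Q Bb t Vi (N2 t)"
    and N3_cont: "\<And>\<omega>. \<omega> \<in> space M \<Longrightarrow> continuous_on {0..} (\<lambda>t. N3 t \<omega>)"
    and N3: "\<And>t. 0 \<le> t \<Longrightarrow> has_wiener_integral M R Wb t (\<lambda>s. Vi s ** K s) (N3 t)"
    and Xc_meas: "\<And>t. 0 \<le> t \<Longrightarrow> Xc t \<in> borel_measurable M"
    and Xc_cont: "\<And>\<omega>. continuous_on {0..} (\<lambda>t. Xc t \<omega>)"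
    and Xc_eq: "AE \<omega> in M. \<forall>t. Xc t \<omega> = X t \<omega>"
    and Bc_meas: "\<And>t. 0 \<le> t \<Longrightarrow> Bc t \<in> borel_measurable M"
    and Bc_cont: "\<And>\<omega>. continuous_on {0..} (\<lambda>t. Bc t \<omega>)"
    and Bc_eq: "AE \<omega> in M. \<forall>t. Bc t \<omega> = B t \<omega>"
begin

definition D :: "real \<Rightarrow> 'w \<Rightarrow> real^'d" where
  "D t \<omega> = (LINT s:{0..t}|lborel. (Ui s ** (K s ** C s)) *v Xc s \<omega>)"

text \<open>\<open>D\<close> is the drift part of \<open>Pr = \<integral> U\<^sup>-\<^sup>1 K dZ\<close>, and \<open>m\<close> is the Kalman filter; \<open>\<eta>\<close> is the deviation \<open>\<xi>\<close> transported
  back to time \<open>0\<close> by the flow \<open>V\<close>.\<close>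

definition Pr :: "real \<Rightarrow> 'w \<Rightarrow> real^'d" where "Pr t \<omega> = N1 t \<omega> + D t \<omega>"

definition m :: "real \<Rightarrow> 'w \<Rightarrow> real^'d" where "m t \<omega> = U t *v (m0 + Pr t \<omega>)"

definition \<eta> :: "real \<Rightarrow> 'w \<Rightarrow> real^'d" where
  "\<eta> t \<omega> = (Xb0 \<omega> - m0) + \<gamma>1 *\<^sub>R N2 t \<omega> + \<gamma>2 *\<^sub>R N3 t \<omega>"

definition \<xi> :: "real \<Rightarrow> 'w \<Rightarrow> real^'d" where "\<xi> t \<omega> = V t *v \<eta> t \<omega>"

definition Xs :: "real \<Rightarrow> 'w \<Rightarrow> real^'d" where "Xs t \<omega> = m t \<omega> + \<xi> t \<omega>"

lemma UiKC_int: "set_integrable lborel {0..t} (\<lambda>s. Ui s ** (K s ** C s))"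
  by (rule set_integrable_bilinear [OF bounded_bilinear_matmul cont_Icc_of_atLeast [OF U_flow(4)] ric.KC_integrable])

lemma UiKCX_int: "set_integrable lborel {0..t} (\<lambda>s. (Ui s ** (K s ** C s)) *v Xc s \<omega>)"
  by (rule set_integrable_bilinear_flip [OF bounded_bilinear_matvec cont_Icc_of_atLeast [OF Xc_cont] UiKC_int])

lemma D_cont: "continuous_on {0..} (\<lambda>t. D t \<omega>)"
  unfolding D_def by (rule continuous_LINT [OF UiKCX_int])

lemma D_meas: "D t \<in> borel_measurable M"
proof -
  have "set_borel_measurable borel {0..t} (\<lambda>s. Ui s ** (K s ** C s))"
    using UiKC_int [of t] unfolding set_integrable_def set_borel_measurable_def by (simp add: borel_measurable_integrable)
  then show ?thesis
    unfolding D_def [abs_def] by (rule measurable_time_integral [OF bounded_bilinear_matvec _ Xc_meas Xc_cont])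
qed

lemma N_meas:
  assumes "0 \<le> t"
  shows "N1 t \<in> borel_measurable M" "N2 t \<in> borel_measurable M" "N3 t \<in> borel_measurable M"
  using wW.has_wiener_integral_measurable(1) [OF N1 [OF assms]] wBb.has_wiener_integral_measurable(1) [OF N2 [OF assms]]
    wWb.has_wiener_integral_measurable(1) [OF N3 [OF assms]] by auto

lemma Xb0_meas [measurable]: "Xb0 \<in> borel_measurable M"
  by (rule gaussian_measurable [OF Xb0])

lemma m_meas: "0 \<le> t \<Longrightarrow> m t \<in> borel_measurable M"
  unfolding m_def [abs_def] Pr_def using N_meas(1) [of t] D_meas [of t] by measurable

lemma \<xi>_meas: "0 \<le> t \<Longrightarrow> \<xi> t \<in> borel_measurable M"
  unfolding \<xi>_def [abs_def] \<eta>_def using N_meas(2,3) [of t] by measurable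

lemma Xs_meas: "0 \<le> t \<Longrightarrow> Xs t \<in> borel_measurable M"
  unfolding Xs_def [abs_def] using m_meas [of t] \<xi>_meas [of t] by measurable

lemma m_cont: "\<omega> \<in> space M \<Longrightarrow> continuous_on {0..} (\<lambda>t. m t \<omega>)"
  unfolding m_def Pr_def by (intro continuous_intros U_flow(3) N1_cont D_cont)

lemma \<xi>_cont: "\<omega> \<in> space M \<Longrightarrow> continuous_on {0..} (\<lambda>t. \<xi> t \<omega>)"
  unfolding \<xi>_def \<eta>_def by (intro continuous_intros V_flow(3) N2_cont N3_cont)

lemma Xs_cont: "\<omega> \<in> space M \<Longrightarrow> continuous_on {0..} (\<lambda>t. Xs t \<omega>)"
  unfolding Xs_def by (intro continuous_intros m_cont \<xi>_cont)

lemma ito_integral_kernel: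
  assumes T: "0 \<le> T"
  shows "AE \<omega> in M. ito_process_integral M R (\<lambda>s \<omega>. C s *v X s \<omega>) W T (\<lambda>t. transpose (\<Phi> t T) ** K t) \<omega> = U T *v Pr T \<omega>"
proof -
  have "has_wiener_integral M R W T (\<lambda>s. U T ** (Ui s ** K s)) (\<lambda>\<omega>. U T *v N1 T \<omega>)"
    by (rule wW.has_wiener_integral_left_mult [OF N1 [OF T]])
  then have "has_wiener_integral M R W T (\<lambda>t. transpose (\<Phi> t T) ** K t) (\<lambda>\<omega>. U T *v N1 T \<omega>)"
    by (rule wW.has_wiener_integral_cong) (simp add: U_flow(1) T matrix_mul_assoc)
  from wW.wiener_integral_AE_eq [OF this] Xc_eq show ?thesis
  proof eventually_elim
    case (elim \<omega>)
    have "(LINT t:{0..T}|lborel. (transpose (\<Phi> t T) ** K t) *v (C t *v X t \<omega>))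
      = (LINT t:{0..T}|lborel. U T *v ((Ui t ** (K t ** C t)) *v Xc t \<omega>))"
      by (rule set_lebesgue_integral_cong) (use elim(2) in \<open>auto simp: U_flow(1) T matrix_mul_assoc matrix_vector_mul_assoc\<close>)
    also have "\<dots> = U T *v D T \<omega>"
      using integral_bounded_linear [OF bounded_bilinear.bounded_linear_right [OF bounded_bilinear_matvec] UiKCX_int [of T \<omega>, unfolded set_integrable_def], of "U T"]
      unfolding D_def set_lebesgue_integral_def by (simp add: matrix_vector_mult_scaleR)
    finally show ?case
      unfolding ito_process_integral_def elim(1) by (simp add: Pr_def matrix_vector_right_distrib add.commute)
  qed
qed

text \<open>The estimator is the candidate solution, because \<open>\<Phi>(t; T)\<close> and \<open>\<Psi>(t; T)\<close> factor through time \<open>0\<close>.\<close>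

lemma estimator_eq_Xs:
  assumes T: "0 \<le> T"
  shows "AE \<omega> in M. transpose (\<Phi> 0 T) *v m0
             + transpose (\<Psi> 0 T) *v (Xb0 \<omega> - m0)
             + ito_process_integral M R (\<lambda>s \<omega>. C s *v X s \<omega>) W T (\<lambda>t. transpose (\<Phi> t T) ** K t) \<omega>
             + \<gamma>1 *\<^sub>R wiener_integral M Q Bb T (\<lambda>t. transpose (\<Psi> t T)) \<omega>
             + \<gamma>2 *\<^sub>R wiener_integral M R Wb T (\<lambda>t. transpose (\<Psi> t T) ** K t) \<omega> = Xs T \<omega>"
proof -
  have "has_wiener_integral M Q Bb T (\<lambda>s. V T ** Vi s) (\<lambda>\<omega>. V T *v N2 T \<omega>)"
    by (rule wBb.has_wiener_integral_left_mult [OF N2 [OF T]])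
  then have 2: "has_wiener_integral M Q Bb T (\<lambda>t. transpose (\<Psi> t T)) (\<lambda>\<omega>. V T *v N2 T \<omega>)"
    by (rule wBb.has_wiener_integral_cong) (simp add: V_flow(1) T)
  have "has_wiener_integral M R Wb T (\<lambda>s. V T ** (Vi s ** K s)) (\<lambda>\<omega>. V T *v N3 T \<omega>)"
    by (rule wWb.has_wiener_integral_left_mult [OF N3 [OF T]])
  then have 3: "has_wiener_integral M R Wb T (\<lambda>t. transpose (\<Psi> t T) ** K t) (\<lambda>\<omega>. V T *v N3 T \<omega>)"
    by (rule wWb.has_wiener_integral_cong) (simp add: V_flow(1) T matrix_mul_assoc)
  show ?thesis
    using ito_integral_kernel [OF T] wBb.wiener_integral_AE_eq [OF 2] wWb.wiener_integral_AE_eq [OF 3]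
  proof eventually_elim
    case (elim \<omega>)
    show ?case
      unfolding elim
      by (simp add: Xs_def m_def \<xi>_def \<eta>_def U_def [symmetric] V_def [symmetric] matrix_vector_right_distrib matrix_vector_mult_scaleR)
  qed
qed

end

context mean_field_processes
begin

lemma N_0: "AE \<omega> in M. N1 0 \<omega> = 0" "AE \<omega> in M. N2 0 \<omega> = 0" "AE \<omega> in M. N3 0 \<omega> = 0"
  using wW.has_wiener_integral_at_0 [OF N1 [OF order_refl]] wBb.has_wiener_integral_at_0 [OF N2 [OF order_refl]]
    wWb.has_wiener_integral_at_0 [OF N3 [OF order_refl]] by auto

lemma LU_int: "continuous_on {0..} f \<Longrightarrow> (\<lambda>s. (L s ** U s) *v f s) integrable_on {0..T}"
  by (rule set_integrable_imp_integrable_on(1) [OF set_integrable_bilinear_flip [OF bounded_bilinear_matvec cont_Icc_of_atLeast U_flow(5)]])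

lemma FV_int: "continuous_on {0..} f \<Longrightarrow> (\<lambda>s. (F s ** V s) *v f s) integrable_on {0..T}"
  by (rule set_integrable_imp_integrable_on(1) [OF set_integrable_bilinear_flip [OF bounded_bilinear_matvec cont_Icc_of_atLeast V_flow(5)]])

lemma bounded_linear_matvec_left: "bounded_linear (\<lambda>M. M *v (y :: real^'d) :: real^'d)"
  by (rule bounded_bilinear.bounded_linear_left [OF bounded_bilinear_matvec])

lemma U_const: "0 \<le> T \<Longrightarrow> U T *v y = y + integral {0..T} (\<lambda>s. (L s ** U s) *v y)"
  using arg_cong [OF U_flow(6) [of 0 T], of "\<lambda>M. M *v y"]
    integral_linear [OF set_integrable_imp_integrable_on(1) [OF U_flow(5) [of T]] bounded_linear_matvec_left, of y]
  by (simp add: bounded_bilinear.diff_left [OF bounded_bilinear_matvec] o_def diff_eq_eq add.commute)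

lemma V_const: "0 \<le> T \<Longrightarrow> V T *v y = y + integral {0..T} (\<lambda>s. (F s ** V s) *v y)"
  using arg_cong [OF V_flow(6) [of 0 T], of "\<lambda>M. M *v y"]
    integral_linear [OF set_integrable_imp_integrable_on(1) [OF V_flow(5) [of T]] bounded_linear_matvec_left, of y]
  by (simp add: bounded_bilinear.diff_left [OF bounded_bilinear_matvec] o_def diff_eq_eq add.commute)

lemma AE_cont_N:
  "AE \<omega> in M. continuous_on {0..T} (\<lambda>t. N1 t \<omega>)" "AE \<omega> in M. continuous_on {0..T} (\<lambda>t. N2 t \<omega>)"
  "AE \<omega> in M. continuous_on {0..T} (\<lambda>t. N3 t \<omega>)"
  by (auto intro!: AE_I2 cont_Icc_of_atLeast N1_cont N2_cont N3_cont)

text \<open>Since \<open>U U\<^sup>-\<^sup>1 K = K\<close>, integration by parts of \<open>U\<close> against \<open>N1\<close> produces \<open>\<integral> K dW\<close> up to the term with \<open>L\<close>, and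
  the same formula for \<open>D\<close> supplies the drift part of \<open>dZ\<close>.\<close>

lemma m_equation:
  assumes T: "0 \<le> T"
  shows "AE \<omega> in M. m T \<omega> = m0 + integral {0..T} (\<lambda>s. L s *v m s \<omega>)
    + ito_process_integral M R (\<lambda>s \<omega>. C s *v X s \<omega>) W T K \<omega>"
proof -
  let ?J = "wiener_integral M R W T K"
  have "has_wiener_integral M R W T K ?J"
    using K_integrable_W [OF T] wW.has_wiener_integral_wiener_integral by blast
  then have J: "has_wiener_integral M R W T (\<lambda>s. U s ** (Ui s ** K s)) ?J"
    by (rule wW.has_wiener_integral_cong) (simp add: matrix_mul_assoc U_flow(2))
  have "AE \<omega> in M. ?J \<omega> = U T *v N1 T \<omega> - U 0 *v N1 0 \<omega> - integral {0..T} (\<lambda>s. (L s ** U s) *v N1 s \<omega>)"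
    by (rule wW.wiener_integral_by_parts [OF T U_flow(5) U_flow(6) AE_cont_N(1) N1 kernel_W(2) J])
  with N_0(1) Xc_eq AE_space show ?thesis
  proof eventually_elim
    case (elim \<omega>)
    let ?g = "\<lambda>s. (Ui s ** (K s ** C s)) *v Xc s \<omega>"
    have D: "D s \<omega> = integral {0..s} ?g" for s
      unfolding D_def by (rule set_integrable_imp_integrable_on(2) [OF UiKCX_int])
    have "U T *v integral {0..T} ?g = integral {0..T} (\<lambda>s. U s *v ?g s) + integral {0..T} (\<lambda>s. (L s ** U s) *v integral {0..s} ?g)"
      by (rule integration_by_parts_ac [OF bounded_bilinear_matvec T UiKCX_int U_flow(5) U_flow(6)])
    then have UD: "U T *v D T \<omega> = integral {0..T} (\<lambda>s. U s *v ?g s) + integral {0..T} (\<lambda>s. (L s ** U s) *v D s \<omega>)"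
      unfolding D .
    have KCX: "set_integrable lborel {0..T} (\<lambda>s. (K s ** C s) *v Xc s \<omega>)"
      by (rule set_integrable_bilinear_flip [OF bounded_bilinear_matvec cont_Icc_of_atLeast [OF Xc_cont] ric.KC_integrable])
    have "integral {0..T} (\<lambda>s. U s *v ?g s) = integral {0..T} (\<lambda>s. (K s ** C s) *v Xc s \<omega>)"
      by (rule integral_cong) (simp add: matrix_vector_mul_assoc matrix_mul_assoc U_flow(2))
    also have "\<dots> = (LINT s:{0..T}|lborel. (K s ** C s) *v Xc s \<omega>)"
      by (rule set_integrable_imp_integrable_on(2) [OF KCX, symmetric])
    also have "\<dots> = (LINT s:{0..T}|lborel. K s *v (C s *v X s \<omega>))"
      by (rule set_lebesgue_integral_cong) (use elim in \<open>auto simp: matrix_vector_mul_assoc\<close>)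
    finally have ito: "ito_process_integral M R (\<lambda>s \<omega>. C s *v X s \<omega>) W T K \<omega>
      = integral {0..T} (\<lambda>s. U s *v ?g s) + (U T *v N1 T \<omega> - integral {0..T} (\<lambda>s. (L s ** U s) *v N1 s \<omega>))"
      unfolding ito_process_integral_def using elim by simp
    have "L s *v m s \<omega> = (L s ** U s) *v m0 + ((L s ** U s) *v N1 s \<omega> + (L s ** U s) *v D s \<omega>)" for s
      by (simp add: m_def Pr_def matrix_vector_right_distrib matrix_vector_mul_assoc)
    then have "integral {0..T} (\<lambda>s. L s *v m s \<omega>) = integral {0..T} (\<lambda>s. (L s ** U s) *v m0)
      + (integral {0..T} (\<lambda>s. (L s ** U s) *v N1 s \<omega>) + integral {0..T} (\<lambda>s. (L s ** U s) *v D s \<omega>))"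
      using elim by (simp add: Henstock_Kurzweil_Integration.integral_add Henstock_Kurzweil_Integration.integrable_add LU_int N1_cont D_cont continuous_on_const)
    moreover have "m T \<omega> = U T *v m0 + (U T *v N1 T \<omega> + U T *v D T \<omega>)"
      by (simp add: m_def Pr_def matrix_vector_right_distrib)
    ultimately show ?case
      unfolding ito UD using U_const [OF T, of m0] by simp
  qed
qed

lemma \<xi>_equation:
  assumes T: "0 \<le> T"
  shows "AE \<omega> in M. \<xi> T \<omega> = (Xb0 \<omega> - m0) + integral {0..T} (\<lambda>s. F s *v \<xi> s \<omega>)
    + \<gamma>1 *\<^sub>R Bb T \<omega> + \<gamma>2 *\<^sub>R wiener_integral M R Wb T K \<omega>"
proof -
  let ?J = "wiener_integral M R Wb T K"
  have "has_wiener_integral M R Wb T K ?J"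
    using K_integrable_Wb [OF T] wWb.has_wiener_integral_wiener_integral by blast
  then have J: "has_wiener_integral M R Wb T (\<lambda>s. V s ** (Vi s ** K s)) ?J"
    by (rule wWb.has_wiener_integral_cong) (simp add: matrix_mul_assoc V_flow(2))
  have B: "has_wiener_integral M Q Bb T (\<lambda>s. V s ** Vi s) (Bb T)"
    by (rule wBb.has_wiener_integral_cong [OF Bb_integral [OF T]]) (simp add: V_flow(2))
  have "AE \<omega> in M. Bb T \<omega> = V T *v N2 T \<omega> - V 0 *v N2 0 \<omega> - integral {0..T} (\<lambda>s. (F s ** V s) *v N2 s \<omega>)"
    by (rule wBb.wiener_integral_by_parts [OF T V_flow(5) V_flow(6) AE_cont_N(2) N2 kernel_Bb(2) B])
  moreover have "AE \<omega> in M. ?J \<omega> = V T *v N3 T \<omega> - V 0 *v N3 0 \<omega> - integral {0..T} (\<lambda>s. (F s ** V s) *v N3 s \<omega>)"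
    by (rule wWb.wiener_integral_by_parts [OF T V_flow(5) V_flow(6) AE_cont_N(3) N3 kernel_Wb(2) J])
  ultimately show ?thesis
    using N_0(2,3) AE_space
  proof eventually_elim
    case (elim \<omega>)
    let ?y = "Xb0 \<omega> - m0"
    have "F s *v \<xi> s \<omega> = (F s ** V s) *v ?y + (\<gamma>1 *\<^sub>R ((F s ** V s) *v N2 s \<omega>) + \<gamma>2 *\<^sub>R ((F s ** V s) *v N3 s \<omega>))" for s
      by (simp add: \<xi>_def \<eta>_def matrix_vector_right_distrib matrix_vector_mul_assoc matrix_vector_mult_scaleR)
    moreover have "integral {0..T} (\<lambda>s. (F s ** V s) *v ?y + (\<gamma>1 *\<^sub>R ((F s ** V s) *v N2 s \<omega>) + \<gamma>2 *\<^sub>R ((F s ** V s) *v N3 s \<omega>)))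
      = integral {0..T} (\<lambda>s. (F s ** V s) *v ?y)
      + (integral {0..T} (\<lambda>s. \<gamma>1 *\<^sub>R ((F s ** V s) *v N2 s \<omega>)) + integral {0..T} (\<lambda>s. \<gamma>2 *\<^sub>R ((F s ** V s) *v N3 s \<omega>)))"
    proof -
      have 1: "(\<lambda>s. (F s ** V s) *v ?y) integrable_on {0..T}" by (rule FV_int [OF continuous_on_const])
      have 2: "(\<lambda>s. \<gamma>1 *\<^sub>R ((F s ** V s) *v N2 s \<omega>)) integrable_on {0..T}"
        by (rule integrable_cmul [OF FV_int [OF N2_cont [OF elim(5)]]])
      have 3: "(\<lambda>s. \<gamma>2 *\<^sub>R ((F s ** V s) *v N3 s \<omega>)) integrable_on {0..T}"
        by (rule integrable_cmul [OF FV_int [OF N3_cont [OF elim(5)]]])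
      show ?thesis
        by (simp only: Henstock_Kurzweil_Integration.integral_add [OF 1 Henstock_Kurzweil_Integration.integrable_add [OF 2 3]]
            Henstock_Kurzweil_Integration.integral_add [OF 2 3])
    qed
    ultimately have "integral {0..T} (\<lambda>s. F s *v \<xi> s \<omega>) = integral {0..T} (\<lambda>s. (F s ** V s) *v ?y)
      + (\<gamma>1 *\<^sub>R integral {0..T} (\<lambda>s. (F s ** V s) *v N2 s \<omega>) + \<gamma>2 *\<^sub>R integral {0..T} (\<lambda>s. (F s ** V s) *v N3 s \<omega>))"
      by simp
    moreover have "\<xi> T \<omega> = V T *v ?y + (\<gamma>1 *\<^sub>R (V T *v N2 T \<omega>) + \<gamma>2 *\<^sub>R (V T *v N3 T \<omega>))"
      by (simp add: \<xi>_def \<eta>_def matrix_vector_right_distrib matrix_vector_mult_scaleR)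
    ultimately show ?case
      using V_const [OF T, of ?y] elim by (simp add: scaleR_diff_right)
  qed
qed

lemma drift_integrable:
  assumes "continuous_on {0..} x" "continuous_on {0..} y"
  shows "set_integrable lborel {0..t} (\<lambda>s. L s *v y s + F s *v (x s - y s))"
  by (intro set_integral_add set_integrable_bilinear_flip [OF bounded_bilinear_matvec _ L_int]
      set_integrable_bilinear_flip [OF bounded_bilinear_matvec _ F_int] cont_Icc_of_atLeast continuous_intros assms)

lemma Xs_equation:
  assumes T: "0 \<le> T"
  shows "AE \<omega> in M. Xs T \<omega> = Xb0 \<omega>
             + (LINT s:{0..T}|lborel. mean_field_drift A C Q R Sig \<gamma>1 \<gamma>2 s (Xs s \<omega>) (m s \<omega>))
             + \<gamma>1 *\<^sub>R Bb T \<omega>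
             + ito_process_integral M R (\<lambda>s \<omega>. C s *v X s \<omega>) W T K \<omega>
             + \<gamma>2 *\<^sub>R wiener_integral M R Wb T K \<omega>"
  using m_equation [OF T] \<xi>_equation [OF T] AE_space
proof eventually_elim
  case (elim \<omega>)
  have i: "set_integrable lborel {0..T} (\<lambda>s. L s *v m s \<omega>)" "set_integrable lborel {0..T} (\<lambda>s. F s *v \<xi> s \<omega>)"
    by (intro set_integrable_bilinear_flip [OF bounded_bilinear_matvec _ L_int]
      set_integrable_bilinear_flip [OF bounded_bilinear_matvec _ F_int] cont_Icc_of_atLeast m_cont \<xi>_cont elim)+
  have "(LINT s:{0..T}|lborel. mean_field_drift A C Q R Sig \<gamma>1 \<gamma>2 s (Xs s \<omega>) (m s \<omega>))
    = (LINT s:{0..T}|lborel. L s *v m s \<omega> + F s *v \<xi> s \<omega>)"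
    by (simp add: drift_eq Xs_def)
  also have "\<dots> = (LINT s:{0..T}|lborel. L s *v m s \<omega>) + (LINT s:{0..T}|lborel. F s *v \<xi> s \<omega>)"
    by (rule set_integral_add(2) [OF i])
  also have "\<dots> = integral {0..T} (\<lambda>s. L s *v m s \<omega>) + integral {0..T} (\<lambda>s. F s *v \<xi> s \<omega>)"
    by (simp only: set_integrable_imp_integrable_on(2) [OF i(1)] set_integrable_imp_integrable_on(2) [OF i(2)])
  finally have eq: "(LINT s:{0..T}|lborel. mean_field_drift A C Q R Sig \<gamma>1 \<gamma>2 s (Xs s \<omega>) (m s \<omega>))
    = integral {0..T} (\<lambda>s. L s *v m s \<omega>) + integral {0..T} (\<lambda>s. F s *v \<xi> s \<omega>)" .
  show ?case unfolding eq unfolding Xs_def elim(1,2) by simp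
qed

lemma D_0: "D 0 \<omega> = 0"
  unfolding D_def set_integrable_imp_integrable_on(2) [OF UiKCX_int] by simp

lemma Xs_0: "AE \<omega> in M. Xs 0 \<omega> = Xb0 \<omega>"
  using N_0 by eventually_elim
    (simp add: Xs_def m_def \<xi>_def Pr_def D_0 \<eta>_def)

end

section \<open>The conditional mean\<close>

lemma step_drift:
  fixes y :: "real \<Rightarrow> real^'m"
  assumes y: "\<And>t. set_integrable lborel {0..t} y" and g: "step_list T g"
  shows "has_bochner_integral lborel (\<lambda>s. indicat_real {0..T} s *\<^sub>R (step_function g s *v y s))
    (step_integral (\<lambda>t _. LINT s:{0..t}|lborel. y s) g \<omega> :: real^'k)"
  using g
proof (induction rule: step_list_induct)
  case Nil
  then show ?case by (simp add: has_bochner_integral_zero)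
next
  case (Cons c a b g)
  have hb: "has_bochner_integral lborel (\<lambda>s. indicat_real {0..t} s *\<^sub>R y s) (LINT s:{0..t}|lborel. y s)" for t
    using y [of t] unfolding set_integrable_def set_lebesgue_integral_def by (simp add: has_bochner_integral_iff)
  have "has_bochner_integral lborel (\<lambda>s. c *v (indicat_real {0..b} s *\<^sub>R y s - indicat_real {0..a} s *\<^sub>R y s))
    (c *v ((LINT s:{0..b}|lborel. y s) - (LINT s:{0..a}|lborel. y s)))"
    by (rule has_bochner_integral_bounded_linear [OF bounded_bilinear.bounded_linear_right [OF bounded_bilinear_matvec] has_bochner_integral_diff [OF hb hb]])
  from has_bochner_integral_add [OF this Cons.IH]
  have "has_bochner_integral lborel (\<lambda>s. c *v (indicat_real {0..b} s *\<^sub>R y s - indicat_real {0..a} s *\<^sub>R y s) + indicat_real {0..T} s *\<^sub>R (step_function g s *v y s))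
    (step_integral (\<lambda>t _. LINT s:{0..t}|lborel. y s) ((c, a, b) # g) \<omega>)"
    by simp
  moreover have "c *v (indicat_real {0..b} s *\<^sub>R y s - indicat_real {0..a} s *\<^sub>R y s) + indicat_real {0..T} s *\<^sub>R (step_function g s *v y s)
    = indicat_real {0..T} s *\<^sub>R (step_function ((c, a, b) # g) s *v y s)" for s
  proof -
    have "indicat_real {0..b} s *\<^sub>R y s - indicat_real {0..a} s *\<^sub>R y s = indicat_real {a<..b} s *\<^sub>R y s"
      using Cons(1,2) by (auto simp: indicator_def)
    moreover have "indicat_real {0..T} s * indicat_real {a<..b} s = indicat_real {a<..b} s"
      using Cons(1-3) by (auto simp: indicator_def)
    ultimately show ?thesis
      by (simp add: matrix_vector_mult_add_rdistrib scaleR_add_right bounded_bilinear.scaleR_left [OF bounded_bilinear_matvec]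
          matrix_vector_mult_scaleR)
  qed
  ultimately show ?case by (simp only:)
qed

text \<open>Young's inequality applied to \<open>norm_matvec_le_trace_form\<close>.\<close>

lemma (in intensity) ito_sq_dual_bound:
  fixes f :: "real \<Rightarrow> real^'m^'k" and v :: "real \<Rightarrow> real^'m"
  assumes f: "set_borel_measurable borel {0..T} f" and w: "set_integrable lborel {0..T} w"
    and wv: "\<And>s. s \<in> {0..T} \<Longrightarrow> w s = v s \<bullet> (matrix_inv (R s) *v v s)" and e: "0 < e"
  shows "(\<integral>\<^sup>+s\<in>{0..T}. ennreal (norm (f s *v v s)) \<partial>lborel)
    \<le> ennreal (1 / (2 * e)) * ito_sq R T f + ennreal (e / 2 * (LINT s:{0..T}|lborel. w s))"
proof -
  have w0: "0 \<le> w s" if "s \<in> {0..T}" for s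
    unfolding wv [OF that] using that by (intro pos_def_nonneg pos_def_matrix_inv R_pos) auto
  have amgm: "4 * (p * q) \<le> (p + q)\<^sup>2" for p q :: real
    using sum_squares_bound [of p q] by (simp add: power2_sum)
  have pt: "norm (f s *v v s) \<le> 1 / (2 * e) * trace (f s ** R s ** transpose (f s)) + e / 2 * w s" if s: "s \<in> {0..T}" for s
  proof (rule power2_le_imp_le)
    let ?a = "trace (f s ** R s ** transpose (f s))"
    have a0: "0 \<le> ?a" using s by (intro ito_integrand_nonneg) auto
    have "(norm (f s *v v s))\<^sup>2 \<le> ?a * w s"
      unfolding wv [OF s] using s by (intro norm_matvec_le_trace_form R_pos) auto
    also have "\<dots> = 4 * ((1 / (2 * e) * ?a) * (e / 2 * w s))" using e by simp
    also have "\<dots> \<le> (1 / (2 * e) * ?a + e / 2 * w s)\<^sup>2"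
      by (rule amgm)
    finally show "(norm (f s *v v s))\<^sup>2 \<le> (1 / (2 * e) * ?a + e / 2 * w s)\<^sup>2" .
    show "0 \<le> 1 / (2 * e) * ?a + e / 2 * w s" using a0 w0 [OF s] e by (intro add_nonneg_nonneg mult_nonneg_nonneg) auto
  qed
  have wm: "(\<lambda>s. ennreal (e / 2 * w s) * indicator {0..T} s) \<in> borel_measurable lborel"
  proof -
    have "(\<lambda>s. indicat_real {0..T} s *\<^sub>R w s) \<in> borel_measurable lborel"
      using w unfolding set_integrable_def by (rule borel_measurable_integrable)
    then have "(\<lambda>s. ennreal (e / 2 * (indicat_real {0..T} s *\<^sub>R w s))) \<in> borel_measurable lborel" by measurable
    moreover have "(\<lambda>s. ennreal (e / 2 * (indicat_real {0..T} s *\<^sub>R w s))) = (\<lambda>s. ennreal (e / 2 * w s) * indicator {0..T} s)"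
      by (auto simp: fun_eq_iff indicator_def)
    ultimately show ?thesis by (simp only:)
  qed
  have "(\<integral>\<^sup>+s\<in>{0..T}. ennreal (norm (f s *v v s)) \<partial>lborel)
    \<le> (\<integral>\<^sup>+s. ennreal (1 / (2 * e)) * (ennreal (trace (f s ** R s ** transpose (f s))) * indicator {0..T} s)
      + ennreal (e / 2 * w s) * indicator {0..T} s \<partial>lborel)"
  proof (rule nn_integral_mono)
    fix s
    show "ennreal (norm (f s *v v s)) * indicator {0..T} s
      \<le> ennreal (1 / (2 * e)) * (ennreal (trace (f s ** R s ** transpose (f s))) * indicator {0..T} s) + ennreal (e / 2 * w s) * indicator {0..T} s"
    proof (cases "s \<in> {0..T}")
      case True
      have "ennreal (norm (f s *v v s)) \<le> ennreal (1 / (2 * e) * trace (f s ** R s ** transpose (f s)) + e / 2 * w s)"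
        by (rule ennreal_leI [OF pt [OF True]])
      also have "\<dots> = ennreal (1 / (2 * e)) * ennreal (trace (f s ** R s ** transpose (f s))) + ennreal (e / 2 * w s)"
        using True e w0 [OF True] ito_integrand_nonneg [of s "f s"]
        by (subst ennreal_plus) (auto simp: ennreal_mult [symmetric])
      finally show ?thesis using True by simp
    qed simp
  qed
  also have "\<dots> = ennreal (1 / (2 * e)) * ito_sq R T f + (\<integral>\<^sup>+s\<in>{0..T}. ennreal (e / 2 * w s) \<partial>lborel)"
    unfolding ito_sq_def using ito_integrand_measurable [OF f] wm by (simp add: nn_integral_add nn_integral_cmult)
  also have "(\<integral>\<^sup>+s\<in>{0..T}. ennreal (e / 2 * w s) \<partial>lborel) = ennreal (LINT s:{0..T}|lborel. e / 2 * w s)"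
    by (rule nn_set_integral_to_LINT) (use w w0 e in \<open>auto intro!: set_integrable_mult_right\<close>)
  finally show ?thesis by simp
qed

lemma (in intensity) ito_sq_dual_limit:
  fixes f :: "nat \<Rightarrow> real \<Rightarrow> real^'m^'k" and v :: "real \<Rightarrow> real^'m"
  assumes f: "\<And>n. set_borel_measurable borel {0..T} (f n)" and w: "set_integrable lborel {0..T} w"
    and wv: "\<And>s. s \<in> {0..T} \<Longrightarrow> w s = v s \<bullet> (matrix_inv (R s) *v v s)"
    and lim: "(\<lambda>n. ito_sq R T (f n)) \<longlonglongrightarrow> 0" and i: "\<And>n. set_integrable lborel {0..T} (\<lambda>s. f n s *v v s)"
  shows "(\<lambda>n. LINT s:{0..T}|lborel. f n s *v v s) \<longlonglongrightarrow> 0"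
proof (rule tendsto_norm_zero_cancel, rule order_tendstoI)
  fix y :: real assume y: "0 < y"
  let ?S = "LINT s:{0..T}|lborel. w s"
  have "0 \<le> ?S"
    unfolding set_lebesgue_integral_def
  proof (rule Bochner_Integration.integral_nonneg)
    fix s
    have "s \<in> {0..T} \<Longrightarrow> 0 \<le> w s" using wv [of s] by (simp add: pos_def_nonneg pos_def_matrix_inv R_pos)
    then show "0 \<le> indicat_real {0..T} s *\<^sub>R w s" by (simp add: indicator_def)
  qed
  define e where "e = y / (?S + 1)"
  have e: "0 < e" using y \<open>0 \<le> ?S\<close> by (simp add: e_def)
  have "e * ?S \<le> y" using y \<open>0 \<le> ?S\<close> by (simp add: e_def field_simps)
  then have e2: "e / 2 * ?S \<le> y / 2" by simp
  have "(\<lambda>n. ennreal (1 / (2 * e)) * ito_sq R T (f n)) \<longlonglongrightarrow> ennreal (1 / (2 * e)) * 0"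
    by (intro ennreal_tendsto_cmult lim) simp
  then have "\<forall>\<^sub>F n in sequentially. ennreal (1 / (2 * e)) * ito_sq R T (f n) < ennreal (y / 4)"
    using y by (intro order_tendstoD(2)) auto
  then show "\<forall>\<^sub>F n in sequentially. norm (LINT s:{0..T}|lborel. f n s *v v s) < y"
  proof eventually_elim
    case (elim n)
    have "ennreal (norm (LINT s:{0..T}|lborel. f n s *v v s)) \<le> (\<integral>\<^sup>+s. ennreal (norm (indicat_real {0..T} s *\<^sub>R (f n s *v v s))) \<partial>lborel)"
      unfolding set_lebesgue_integral_def by (rule integral_norm_bound_ennreal [OF i [unfolded set_integrable_def]])
    also have "\<dots> = (\<integral>\<^sup>+s\<in>{0..T}. ennreal (norm (f n s *v v s)) \<partial>lborel)"
      by (rule nn_integral_cong) (auto simp: indicator_def)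
    also have "\<dots> \<le> ennreal (1 / (2 * e)) * ito_sq R T (f n) + ennreal (e / 2 * ?S)"
      by (rule ito_sq_dual_bound [OF f w wv e])
    also have "\<dots> \<le> ennreal (y / 4) + ennreal (y / 2)"
      using elim e2 by (intro add_mono ennreal_leI) auto
    also have "\<dots> = ennreal (y / 4 + y / 2)" using y by (intro ennreal_plus [symmetric]) auto
    finally have "norm (LINT s:{0..T}|lborel. f n s *v v s) \<le> y / 4 + y / 2"
      using y by (subst (asm) ennreal_le_iff) auto
    then show ?case using y by simp
  qed
next
  fix y :: real assume "y < 0"
  then show "\<forall>\<^sub>F n in sequentially. y < norm (LINT s:{0..T}|lborel. f n s *v v s)"
    by (intro always_eventually allI) (smt (verit) norm_ge_zero)
qed

context mean_field_processes
begin

abbreviation FZ :: "real \<Rightarrow> 'w measure" where "FZ t \<equiv> generated_sigma M {0..t} Z"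

lemma FZ_sub: "subalgebra M (FZ t)"
  unfolding subalgebra_def using sets_generated_sigma_subset [of "{0..t}" Z M M] Z_meas by auto

lemma CX_int: "set_integrable lborel {0..t} (\<lambda>s. C s *v Xc s \<omega>)"
  by (intro borel_integrable_atLeastAtMost' cont_Icc_of_atLeast continuous_intros C Xc_cont)

lemma Z_eq': "AE \<omega> in M. \<forall>t\<ge>0. Z t \<omega> = (LINT s:{0..t}|lborel. C s *v Xc s \<omega>) + W t \<omega>"
  using Z_eq Xc_eq by eventually_elim simp

lemma step_integral_Z:
  fixes g :: "((real^'m^'d) \<times> real \<times> real) list"
  assumes "step_list t g"
  shows "AE \<omega> in M. step_integral Z g \<omega> = step_integral W g \<omega>
    + (LINT s:{0..t}|lborel. step_function g s *v (C s *v Xc s \<omega>))"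
  using Z_eq'
proof eventually_elim
  case (elim \<omega>)
  let ?I = "\<lambda>t _. LINT s:{0..t}|lborel. C s *v Xc s \<omega>"
  have "step_integral Z g \<omega> = step_integral W g \<omega> + step_integral ?I g \<omega>"
    using assms
  proof (induction rule: step_list_induct)
    case Nil
    then show ?case by simp
  next
    case (Cons c a b g)
    have "Z b \<omega> - Z a \<omega> = (W b \<omega> - W a \<omega>) + (?I b \<omega> - ?I a \<omega>)" using Cons elim by simp
    then show ?case using Cons.IH by (simp add: matrix_vector_right_distrib del: diff_add_eq)
  qed
  moreover have "step_integral ?I g \<omega> = (LINT s:{0..t}|lborel. step_function g s *v (C s *v Xc s \<omega>))"
    unfolding set_lebesgue_integral_def [of _ "{0..t}"]
    by (rule has_bochner_integral_integral_eq [OF step_drift [OF CX_int assms], symmetric])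
  ultimately show ?case by simp
qed

text \<open>Step integrals of \<open>Z\<close> converge to \<open>\<integral> U\<^sup>-\<^sup>1 K dZ\<close>: the martingale part by the choice of the step
  functions, the drift part by \<open>ito_sq_dual_limit\<close>, since \<open>(C X) \<bullet> R\<^sup>-\<^sup>1 (C X) = X \<bullet> H X\<close> is integrable in time.\<close>

lemma Pr_adapted:
  assumes t: "0 \<le> t"
  shows "\<exists>P'\<in>borel_measurable (FZ t). AE \<omega> in M. Pr t \<omega> = P' \<omega>"
proof -
  obtain g where "\<forall>n. step_list t (g n)" and q: "(\<lambda>n. ito_sq R t (\<lambda>s. step_function (g n) s - Ui s ** K s)) \<longlonglongrightarrow> 0"
    and lim: "AE \<omega> in M. (\<lambda>n. step_integral W (g n) \<omega>) \<longlonglongrightarrow> N1 t \<omega>"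
    using wW.has_wiener_integral_approx [OF N1 [OF t]] by (elim exE conjE) (rule that)
  then have g: "step_list t (g n)" for n by blast
  let ?P = "\<lambda>\<omega>. lim (\<lambda>n. step_integral Z (g n) \<omega>)"
  have "?P \<in> borel_measurable (FZ t)"
    by (intro borel_measurable_lim_metric step_integral_generated g)
  moreover have "AE \<omega> in M. \<forall>n. step_integral Z (g n) \<omega> = step_integral W (g n) \<omega>
    + (LINT s:{0..t}|lborel. step_function (g n) s *v (C s *v Xc s \<omega>))"
    using step_integral_Z [OF g] by (simp add: AE_all_countable)
  with lim have "AE \<omega> in M. Pr t \<omega> = ?P \<omega>"
  proof eventually_elim
    case (elim \<omega>)
    let ?v = "\<lambda>s. C s *v Xc s \<omega>"
    let ?f = "\<lambda>n s. step_function (g n) s - Ui s ** K s"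
    have si: "set_integrable lborel {0..t} (\<lambda>s. step_function (g n) s *v ?v s)" for n
      unfolding set_integrable_def by (rule integrable.intros [OF step_drift [OF CX_int g]])
    have ui: "set_integrable lborel {0..t} (\<lambda>s. (Ui s ** K s) *v ?v s)"
      using UiKCX_int [of t \<omega>] by (simp add: matrix_vector_mul_assoc matrix_mul_assoc)
    have fv: "?f n s *v ?v s = step_function (g n) s *v ?v s - (Ui s ** K s) *v ?v s" for n s
      by (simp add: bounded_bilinear.diff_left [OF bounded_bilinear_matvec])
    have "(\<lambda>n. LINT s:{0..t}|lborel. ?f n s *v ?v s) \<longlonglongrightarrow> 0"
    proof (rule wW.ito_sq_dual_limit [OF _ _ _ q])
      show "set_borel_measurable borel {0..t} (?f n)" for n
        by (rule set_borel_measurable_diff [OF set_borel_measurable_step_function kernel_W(1)])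
      show "set_integrable lborel {0..t} (\<lambda>s. Xc s \<omega> \<bullet> (ric.H s *v Xc s \<omega>))"
        by (rule set_integrable_bilinear [OF bounded_bilinear_inner cont_Icc_of_atLeast [OF Xc_cont]
              set_integrable_bilinear_flip [OF bounded_bilinear_matvec cont_Icc_of_atLeast [OF Xc_cont] ric.H_integrable]])
      show "Xc s \<omega> \<bullet> (ric.H s *v Xc s \<omega>) = ?v s \<bullet> (matrix_inv (R s) *v ?v s)" for s
        by (rule ric.H_form)
      show "set_integrable lborel {0..t} (\<lambda>s. ?f n s *v ?v s)" for n
        unfolding fv by (rule set_integral_diff(1) [OF si ui])
    qed
    moreover have "(LINT s:{0..t}|lborel. ?f n s *v ?v s) = (LINT s:{0..t}|lborel. step_function (g n) s *v ?v s) - D t \<omega>" for n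
      unfolding fv set_integral_diff(2) [OF si ui] by (simp add: D_def matrix_vector_mul_assoc matrix_mul_assoc)
    ultimately have "(\<lambda>n. LINT s:{0..t}|lborel. step_function (g n) s *v ?v s) \<longlonglongrightarrow> D t \<omega>"
      by (simp add: LIM_zero_iff)
    with elim(1) have "(\<lambda>n. step_integral W (g n) \<omega> + (LINT s:{0..t}|lborel. step_function (g n) s *v ?v s)) \<longlonglongrightarrow> N1 t \<omega> + D t \<omega>"
      by (rule tendsto_add)
    then show ?case using elim(2) by (simp add: Pr_def limI)
  qed
  ultimately show ?thesis by (intro bexI [where x = ?P])
qed

definition Yc :: "real \<Rightarrow> 'w \<Rightarrow> real^'d" where "Yc t \<omega> = X 0 \<omega> + Bc t \<omega>"

lemma Yc_cont: "continuous_on {0..} (\<lambda>t. Yc t \<omega>)"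
  unfolding Yc_def by (intro continuous_intros Bc_cont)

lemma X0_meas [measurable]: "X 0 \<in> borel_measurable M"
  by (rule X_meas) simp

lemma Yc_meas: "0 \<le> t \<Longrightarrow> Yc t \<in> borel_measurable M"
  unfolding Yc_def [abs_def] using Bc_meas [of t] by measurable

lemma Xc_picard: "AE \<omega> in M. \<forall>t\<ge>0. (\<lambda>n. picard A Yc n t \<omega>) \<longlonglongrightarrow> Xc t \<omega>"
  using X_eq Xc_eq Bc_eq
proof eventually_elim
  case (elim \<omega>)
  have eq: "Xc t \<omega> = Yc t \<omega> + (LINT s:{0..t}|lborel. A s *v Xc s \<omega>)" if "0 \<le> t" for t
    using elim(1) [rule_format, OF that] unfolding Yc_def elim(2) [rule_format] elim(3) [rule_format]
    by (simp only: add_ac)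
  show ?case
  proof (intro allI impI)
    fix t :: real assume t: "0 \<le> t"
    show "(\<lambda>n. picard A Yc n t \<omega>) \<longlonglongrightarrow> Xc t \<omega>"
      by (rule picard_tendsto [where Y = Yc, OF A Xc_cont Yc_cont eq t])
  qed
qed

lemma Xc_moment: "\<exists>c\<ge>0. \<forall>t\<in>{0..T}. (\<integral>\<^sup>+\<omega>. ennreal (norm (Xc t \<omega>)) \<partial>M) \<le> ennreal c"
proof (cases "0 \<le> T")
  case True
  have "bounded (A ` {0..T})"
    by (intro compact_imp_bounded compact_continuous_image cont_Icc_of_atLeast A) simp
  then obtain a0 where "\<forall>s\<in>{0..T}. norm (A s) \<le> a0" unfolding bounded_iff by auto
  then have a: "norm (A s) \<le> max 1 a0" if "s \<in> {0..T}" for s using that by (simp add: max.coboundedI2)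
  define q where "q = (norm (mat 1 :: real^'d^'d))\<^sup>2 * (LINT s:{0..T}|lborel. norm (Q s))"
  have q0: "0 \<le> q" unfolding q_def set_lebesgue_integral_def
    by (intro mult_nonneg_nonneg Bochner_Integration.integral_nonneg) auto
  define x0 where "x0 = (\<integral>\<omega>. norm (X 0 \<omega>) \<partial>M)"
  have x0: "0 \<le> x0" "(\<integral>\<^sup>+\<omega>. ennreal (norm (X 0 \<omega>)) \<partial>M) = ennreal x0"
    unfolding x0_def using gaussian_integrable [OF X0]
    by (auto intro!: Bochner_Integration.integral_nonneg nn_integral_eq_integral)
  have Bm: "(\<integral>\<^sup>+\<omega>. ennreal (norm (Bc t \<omega>)) \<partial>M) \<le> ennreal (1 + q)" if t: "t \<in> {0..T}" for t
  proof -
    have [measurable]: "B t \<in> borel_measurable M" "B 0 \<in> borel_measurable M" using t by auto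
    let ?g = "[(mat 1 :: real^'d^'d, 0, t)]"
    have "(\<integral>\<^sup>+\<omega>. ennreal ((norm (B t \<omega> - B 0 \<omega>))\<^sup>2) \<partial>M) = ito_sq Q T (step_function ?g)"
      using wB.step_ito_isometry(3) [of T ?g] t by simp
    also have "\<dots> \<le> ennreal q"
      unfolding q_def by (rule wB.ito_sq_le_bound) (auto simp: indicator_def)
    finally have B2: "(\<integral>\<^sup>+\<omega>. ennreal ((norm (B t \<omega> - B 0 \<omega>))\<^sup>2) \<partial>M) \<le> ennreal q" .
    have "(\<integral>\<^sup>+\<omega>. ennreal (norm (Bc t \<omega>)) \<partial>M) \<le> (\<integral>\<^sup>+\<omega>. 1 + ennreal ((norm (B t \<omega> - B 0 \<omega>))\<^sup>2) \<partial>M)"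
    proof (rule nn_integral_mono_AE)
      show "AE \<omega> in M. ennreal (norm (Bc t \<omega>)) \<le> 1 + ennreal ((norm (B t \<omega> - B 0 \<omega>))\<^sup>2)"
        using Bc_eq wB.W_0
      proof eventually_elim
        case (elim \<omega>)
        have "x \<le> 1 + x\<^sup>2" for x :: real
          using sum_squares_bound [of x 1] zero_le_power2 [of x] by simp (smt (verit) zero_le_power2)
        then have "ennreal (norm (B t \<omega>)) \<le> ennreal (1 + (norm (B t \<omega>))\<^sup>2)" by (intro ennreal_leI)
        then show ?case using elim by (simp add: ennreal_plus)
      qed
    qed
    also have "\<dots> = 1 + (\<integral>\<^sup>+\<omega>. ennreal ((norm (B t \<omega> - B 0 \<omega>))\<^sup>2) \<partial>M)"
      by (subst nn_integral_add) (auto simp: emeasure_space_1)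
    also have "\<dots> \<le> 1 + ennreal q" by (intro add_left_mono B2)
    also have "\<dots> = ennreal (1 + q)" using q0 by (simp add: ennreal_plus)
    finally show ?thesis .
  qed
  define c where "c = x0 + (1 + q)"
  have c0: "0 \<le> c" using x0 q0 by (simp add: c_def)
  have mom: "(\<integral>\<^sup>+\<omega>. ennreal (norm (Yc t \<omega>)) \<partial>M) \<le> ennreal c" if t: "t \<in> {0..T}" for t
  proof -
    have [measurable]: "Bc t \<in> borel_measurable M" using t by (intro Bc_meas) auto
    have "(\<integral>\<^sup>+\<omega>. ennreal (norm (Yc t \<omega>)) \<partial>M) \<le> (\<integral>\<^sup>+\<omega>. ennreal (norm (X 0 \<omega>)) + ennreal (norm (Bc t \<omega>)) \<partial>M)"
      by (intro nn_integral_mono) (simp add: Yc_def ennreal_plus [symmetric] norm_triangle_ineq ennreal_leI del: ennreal_plus)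
    also have "\<dots> = ennreal x0 + (\<integral>\<^sup>+\<omega>. ennreal (norm (Bc t \<omega>)) \<partial>M)"
      by (subst nn_integral_add) (auto simp: x0)
    also have "\<dots> \<le> ennreal x0 + ennreal (1 + q)" by (intro add_left_mono Bm t)
    also have "\<dots> = ennreal c" using x0 q0 by (simp add: c_def ennreal_plus [symmetric] del: ennreal_plus)
    finally show ?thesis .
  qed
  show ?thesis
  proof (intro exI [of _ "c * exp (max 1 a0 * T)"] conjI ballI)
    show "0 \<le> c * exp (max 1 a0 * T)" using c0 by simp
    fix t assume t: "t \<in> {0..T}"
    show "(\<integral>\<^sup>+\<omega>. ennreal (norm (Xc t \<omega>)) \<partial>M) \<le> ennreal (c * exp (max 1 a0 * T))"
    proof (rule nn_integral_fatou_le)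
      show "(\<lambda>\<omega>. ennreal (norm (picard A Yc n t \<omega>))) \<in> borel_measurable M" for n
        using picard_measurable [where Y = Yc, OF A Yc_meas Yc_cont, of t n] t by simp
      show "AE \<omega> in M. (\<lambda>n. ennreal (norm (picard A Yc n t \<omega>))) \<longlonglongrightarrow> ennreal (norm (Xc t \<omega>))"
        using Xc_picard by eventually_elim (use t in \<open>auto intro!: tendsto_intros\<close>)
      have "(\<integral>\<^sup>+\<omega>. ennreal (norm (picard A Yc n t \<omega>)) \<partial>M) \<le> ennreal (c * exp (max 1 a0 * t))" for n
        by (rule picard_moment [where Y = Yc and T = T, OF A Yc_meas Yc_cont _ a c0 mom t]) auto
      also have "ennreal (c * exp (max 1 a0 * t)) \<le> ennreal (c * exp (max 1 a0 * T))"
        using t c0 by (intro ennreal_leI mult_left_mono) (auto intro!: mult_left_mono)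
      finally show "\<forall>\<^sub>F n in sequentially. (\<integral>\<^sup>+\<omega>. ennreal (norm (picard A Yc n t \<omega>)) \<partial>M) \<le> ennreal (c * exp (max 1 a0 * T))"
        by simp
    qed
  qed
qed auto

text \<open>Fubini and the moment bound for the state.\<close>

lemma D_integrable: "integrable M (D t)"
proof (rule integrableI_bounded [OF D_meas])
  interpret pair_sigma_finite M lborel by unfold_locales
  obtain c where c: "0 \<le> c" "\<And>s. s \<in> {0..t} \<Longrightarrow> (\<integral>\<^sup>+\<omega>. ennreal (norm (Xc s \<omega>)) \<partial>M) \<le> ennreal c"
    using Xc_moment [of t] by blast
  let ?k = "\<lambda>s. indicat_real {0..t} s *\<^sub>R (Ui s ** (K s ** C s))"
  have km: "?k \<in> borel_measurable borel"
    using UiKC_int [of t] unfolding set_integrable_def by (simp add: borel_measurable_integrable)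
  have j: "(\<lambda>p. Xc (max 0 (snd p)) (fst p)) \<in> borel_measurable (M \<Otimes>\<^sub>M borel)"
    by (rule measurable_pair_continuous [OF Xc_meas Xc_cont])
  have "(\<lambda>p. ?k (snd p)) \<in> borel_measurable (M \<Otimes>\<^sub>M borel)" by (rule measurable_compose [OF measurable_snd km])
  with j have "(\<lambda>p. ennreal (norm (?k (snd p))) * ennreal (norm (Xc (max 0 (snd p)) (fst p)))) \<in> borel_measurable (M \<Otimes>\<^sub>M borel)"
    by measurable
  then have jm: "(\<lambda>(\<omega>, s). ennreal (norm (?k s)) * ennreal (norm (Xc (max 0 s) \<omega>))) \<in> borel_measurable (M \<Otimes>\<^sub>M lborel)"
    by (simp add: case_prod_beta' cong: measurable_cong_sets sets_pair_measure_cong)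
  have "(\<integral>\<^sup>+\<omega>. ennreal (norm (D t \<omega>)) \<partial>M) \<le> (\<integral>\<^sup>+\<omega>. (\<integral>\<^sup>+s. ennreal (norm (?k s)) * ennreal (norm (Xc (max 0 s) \<omega>)) \<partial>lborel) \<partial>M)"
  proof (rule nn_integral_mono)
    fix \<omega>
    have "ennreal (norm (D t \<omega>)) \<le> (\<integral>\<^sup>+s. ennreal (norm (indicat_real {0..t} s *\<^sub>R ((Ui s ** (K s ** C s)) *v Xc s \<omega>))) \<partial>lborel)"
      unfolding D_def set_lebesgue_integral_def by (rule integral_norm_bound_ennreal [OF UiKCX_int [unfolded set_integrable_def]])
    also have "\<dots> \<le> (\<integral>\<^sup>+s. ennreal (norm (?k s)) * ennreal (norm (Xc (max 0 s) \<omega>)) \<partial>lborel)"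
      by (intro nn_integral_mono) (auto simp: indicator_def ennreal_mult [symmetric] norm_matvec_le ennreal_leI max_def)
    finally show "ennreal (norm (D t \<omega>)) \<le> (\<integral>\<^sup>+s. ennreal (norm (?k s)) * ennreal (norm (Xc (max 0 s) \<omega>)) \<partial>lborel)" .
  qed
  also have "\<dots> = (\<integral>\<^sup>+s. (\<integral>\<^sup>+\<omega>. ennreal (norm (?k s)) * ennreal (norm (Xc (max 0 s) \<omega>)) \<partial>M) \<partial>lborel)"
    by (rule Fubini' [OF jm, symmetric])
  also have "\<dots> \<le> (\<integral>\<^sup>+s. ennreal c * ennreal (norm (?k s)) \<partial>lborel)"
  proof (rule nn_integral_mono)
    fix s
    have [measurable]: "Xc (max 0 s) \<in> borel_measurable M" by (rule Xc_meas) simp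
    have "(\<integral>\<^sup>+\<omega>. ennreal (norm (?k s)) * ennreal (norm (Xc (max 0 s) \<omega>)) \<partial>M) = ennreal (norm (?k s)) * (\<integral>\<^sup>+\<omega>. ennreal (norm (Xc (max 0 s) \<omega>)) \<partial>M)"
      by (rule nn_integral_cmult) measurable
    also have "\<dots> \<le> ennreal (norm (?k s)) * ennreal c"
    proof (cases "s \<in> {0..t}")
      case True
      then show ?thesis using c(2) [OF True] by (intro mult_left_mono) (auto simp: max_def)
    qed simp
    finally show "(\<integral>\<^sup>+\<omega>. ennreal (norm (?k s)) * ennreal (norm (Xc (max 0 s) \<omega>)) \<partial>M) \<le> ennreal c * ennreal (norm (?k s))"
      by (simp add: mult.commute)
  qed
  also have "\<dots> = ennreal c * (\<integral>\<^sup>+s. ennreal (norm (?k s)) \<partial>lborel)"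
    by (rule nn_integral_cmult, simp only: measurable_lborel2)
      (rule measurable_compose [OF measurable_compose [OF km borel_measurable_norm] measurable_ennreal])
  also have "\<dots> < \<infinity>"
    using UiKC_int [of t] unfolding set_integrable_def integrable_iff_bounded by (simp add: ennreal_mult_less_top)
  finally show "(\<integral>\<^sup>+\<omega>. ennreal (norm (D t \<omega>)) \<partial>M) < \<infinity>" .
qed

lemma m_integrable: "0 \<le> t \<Longrightarrow> integrable M (m t)"
  unfolding m_def [abs_def] Pr_def
  by (intro integrable_bounded_linear [OF bounded_bilinear.bounded_linear_right [OF bounded_bilinear_matvec]]
      Bochner_Integration.integrable_add integrable_const D_integrable wW.has_wiener_integral_integrable [OF N1])

lemma \<eta>_integrable: "0 \<le> t \<Longrightarrow> integrable M (\<eta> t)"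
  unfolding \<eta>_def [abs_def]
  by (intro Bochner_Integration.integrable_add Bochner_Integration.integrable_diff integrable_scaleR_right integrable_const
      gaussian_integrable [OF Xb0] wBb.has_wiener_integral_integrable [OF N2] wWb.has_wiener_integral_integrable [OF N3])

lemma \<xi>_integrable: "0 \<le> t \<Longrightarrow> integrable M (\<xi> t)"
  unfolding \<xi>_def [abs_def]
  by (rule integrable_bounded_linear [OF bounded_bilinear.bounded_linear_right [OF bounded_bilinear_matvec] \<eta>_integrable])

lemma Xs_integrable: "0 \<le> t \<Longrightarrow> integrable M (Xs t)"
  unfolding Xs_def [abs_def] by (intro Bochner_Integration.integrable_add m_integrable \<xi>_integrable)

end

context mean_field_processes
begin

definition source_events :: "nat \<Rightarrow> 'w set set" where
  "source_events k = [sets (generated_sigma M {0..} B), sets (generated_sigma M {0..} W),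
     sets (generated_sigma M {()} (\<lambda>_. X 0)), sets (generated_sigma M {()} (\<lambda>_. Xb0)),
     sets (generated_sigma M {0..} Bb), sets (generated_sigma M {0..} Wb)] ! k"

definition signal_data :: "'w set set" where "signal_data = (\<Union>k\<in>{0, 1, 2}. source_events k)"

definition signal_sigma :: "'w measure" where "signal_sigma = sigma (space M) (signal_data \<union> null_sets M)"

lemma source_events_simps:
  "source_events 0 = sets (generated_sigma M {0..} B)" "source_events (Suc 0) = sets (generated_sigma M {0..} W)" "source_events 2 = sets (generated_sigma M {()} (\<lambda>_. X 0))"
  "source_events 3 = sets (generated_sigma M {()} (\<lambda>_. Xb0))" "source_events 4 = sets (generated_sigma M {0..} Bb)" "source_events 5 = sets (generated_sigma M {0..} Wb)"
  by (simp_all add: source_events_def numeral_eq_Suc)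

lemma source_events_indep: "indep_sets source_events {..<6}"
  using indep unfolding source_events_def [abs_def] .

lemma source_events_subset: "k < 6 \<Longrightarrow> source_events k \<subseteq> events"
  using source_events_indep unfolding indep_sets_def by auto

lemma signal_data_events: "signal_data \<subseteq> events"
  unfolding signal_data_def by (intro UN_least source_events_subset) auto

lemma signal_sigma:
  "space signal_sigma = space M" "sets signal_sigma = sigma_sets (space M) (signal_data \<union> null_sets M)"
  "null_sets M \<subseteq> sets signal_sigma" "sets signal_sigma \<subseteq> sets M"
proof -
  have sub: "signal_data \<union> null_sets M \<subseteq> Pow (space M)"
    using signal_data_events sets.sets_into_space by (auto dest: null_setsD2)
  show "space signal_sigma = space M" unfolding signal_sigma_def by (rule space_measure_of [OF sub])
  show s: "sets signal_sigma = sigma_sets (space M) (signal_data \<union> null_sets M)"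
    unfolding signal_sigma_def by (rule sets_measure_of [OF sub])
  show "null_sets M \<subseteq> sets signal_sigma" unfolding s by (auto intro: sigma_sets.Basic)
  show "sets signal_sigma \<subseteq> sets M"
    unfolding s by (rule sets.sigma_sets_subset) (use signal_data_events in auto)
qed

lemma signal_sigma_basic:
  assumes "f \<in> borel_measurable G" "space G = space M" "sets G \<subseteq> signal_data"
  shows "f \<in> borel_measurable signal_sigma"
  by (rule measurable_finer [OF assms(1)]) (use assms(2,3) in \<open>auto simp: signal_sigma intro: sigma_sets.Basic\<close>)

lemmas signal_augmented = measurable_augmented [OF signal_sigma(1,3,4)]

text \<open>The state is, up to null sets, a limit of Picard iterates, so that the observations only depend
  on the initial state and the noises of the signal model.\<close>

lemma Xc_signal: "0 \<le> t \<Longrightarrow> Xc t \<in> borel_measurable signal_sigma"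
proof -
  assume t: "0 \<le> t"
  have "B s \<in> borel_measurable signal_sigma" if "0 \<le> s" for s
    by (rule signal_sigma_basic [of _ "generated_sigma M {0..} B"])
      (use that in \<open>auto intro: generated_sigma_measurable simp: signal_data_def source_events_simps\<close>)
  then have [measurable]: "Bc s \<in> borel_measurable signal_sigma" if "0 \<le> s" for s
    by (rule signal_augmented [OF Bc_meas, rotated]) (use that Bc_eq in \<open>auto elim: eventually_mono\<close>)
  have [measurable]: "X 0 \<in> borel_measurable signal_sigma"
    by (rule signal_sigma_basic [of _ "generated_sigma M {()} (\<lambda>_. X 0)"])
      (auto intro: generated_sigma_measurable [of "()" "{()}" "\<lambda>_. X 0"] simp: signal_data_def source_events_simps)
  have Y: "Yc s \<in> borel_measurable signal_sigma" if "0 \<le> s" for s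
    using that unfolding Yc_def [abs_def] by measurable
  have "(\<lambda>\<omega>. lim (\<lambda>n. picard A Yc n t \<omega>)) \<in> borel_measurable signal_sigma"
    by (intro borel_measurable_lim_metric picard_measurable A Y Yc_cont t)
  then show ?thesis
  proof (rule signal_augmented [OF Xc_meas [OF t]])
    show "AE \<omega> in M. Xc t \<omega> = lim (\<lambda>n. picard A Yc n t \<omega>)"
      using Xc_picard by eventually_elim (rule limI [symmetric], use t in simp)
  qed
qed

lemma FZ_signal: "sets (FZ t) \<subseteq> sets signal_sigma"
proof (rule sets_generated_sigma_subset)
  fix s assume "s \<in> {0..t}"
  then have s: "0 \<le> s" by simp
  have [measurable]: "(\<lambda>\<omega>. LINT r:{0..s}|lborel. C r *v Xc r \<omega>) \<in> borel_measurable signal_sigma"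
    by (rule measurable_time_integral [OF bounded_bilinear_matvec set_borel_measurable_continuous_on [OF cont_Icc_of_atLeast [OF C]] Xc_signal Xc_cont])
  have [measurable]: "W s \<in> borel_measurable signal_sigma"
    by (rule signal_sigma_basic [of _ "generated_sigma M {0..} W"])
      (use s in \<open>auto intro: generated_sigma_measurable simp: signal_data_def source_events_simps\<close>)
  have "(\<lambda>\<omega>. (LINT r:{0..s}|lborel. C r *v Xc r \<omega>) + W s \<omega>) \<in> borel_measurable signal_sigma" by measurable
  then show "Z s \<in> borel_measurable signal_sigma"
    by (rule signal_augmented [OF Z_meas [OF s]]) (use Z_eq' s in \<open>auto elim: eventually_mono\<close>)
qed (simp add: signal_sigma)

text \<open>Up to a null set an event of the observations is generated by \<open>B\<close>, \<open>W\<close> and \<open>X\<^sub>0\<close>, and these are jointly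
  independent of each single source of the copy.\<close>

lemma observation_orthogonal:
  assumes S: "S \<in> sets (FZ t)" and G: "sets G = source_events k" "space G = space M" and k: "k \<in> {3, 4, 5}"
    and Y: "Y \<in> borel_measurable G" and i: "integrable M Y" "(\<integral>\<omega>. Y \<omega> \<partial>M) = (0::real)"
  shows "(\<integral>\<omega>. indicat_real S \<omega> * Y \<omega> \<partial>M) = 0"
proof -
  let ?S = "sigma (space M) signal_data"
  have sub: "signal_data \<subseteq> Pow (space M)" using signal_data_events sets.sets_into_space by auto
  have "S \<in> sigma_sets (space M) (signal_data \<union> null_sets M)" using S FZ_signal signal_sigma(2) by blast
  from sigma_sets_augmented_AE [OF this] obtain S' where
    S': "S' \<in> sets ?S" "AE x in M. x \<in> S \<longleftrightarrow> x \<in> S'" by (auto simp: sets_measure_of [OF sub])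
  let ?J = "\<lambda>b. if b then {0, 1, 2} else {k}"
  have "indep_sets (\<lambda>b. sigma_sets (space M) (\<Union>i\<in>?J b. source_events i)) UNIV"
  proof (rule indep_sets_collect_sigma)
    show "indep_sets source_events (\<Union>b\<in>UNIV. ?J b)"
      by (rule indep_sets_mono_index [OF _ source_events_indep]) (use k in auto)
    show "Int_stable (source_events i)" if "i \<in> ?J b" for i b
      using that k by (auto simp: source_events_simps Int_stable_def split: if_splits)
    show "disjoint_family_on ?J UNIV" using k by (auto simp: disjoint_family_on_def)
  qed
  moreover have "sigma_sets (space M) (\<Union>i\<in>?J b. source_events i) = case_bool (sets ?S) (sets G) b" for b
  proof (cases b)
    case True
    show ?thesis
      using True by (simp only: if_True bool.case signal_data_def [symmetric] sets_measure_of [OF sub])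
  next
    case False
    then show ?thesis using sets.sigma_sets_eq [of G] G by simp
  qed
  ultimately have "indep_set (sets ?S) (sets G)" unfolding indep_set_def by simp
  then have "indep_var borel (indicat_real S') borel Y"
    by (rule indep_var_of_sets) (use borel_measurable_indicator [OF S'(1)] G Y sub in \<open>auto simp: space_measure_of\<close>)
  moreover have S'M: "S' \<in> sets M"
    using S'(1) sets.sigma_sets_subset [OF signal_data_events] by (auto simp: sets_measure_of [OF sub])
  ultimately have "(\<integral>\<omega>. indicat_real S' \<omega> * Y \<omega> \<partial>M) = (\<integral>\<omega>. indicat_real S' \<omega> \<partial>M) * (\<integral>\<omega>. Y \<omega> \<partial>M)"
    using i(1) by (intro indep_var_lebesgue_integral) (auto simp: emeasure_eq_measure)
  also have "\<dots> = 0" using i(2) by simp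
  also have "(\<integral>\<omega>. indicat_real S' \<omega> * Y \<omega> \<partial>M) = (\<integral>\<omega>. indicat_real S \<omega> * Y \<omega> \<partial>M)"
  proof (rule integral_cong_AE)
    have "S \<in> sets M" using S FZ_sub unfolding subalgebra_def by blast
    then show "(\<lambda>\<omega>. indicat_real S' \<omega> * Y \<omega>) \<in> borel_measurable M" "(\<lambda>\<omega>. indicat_real S \<omega> * Y \<omega>) \<in> borel_measurable M"
      using S'M i(1) by auto
    show "AE \<omega> in M. indicat_real S' \<omega> * Y \<omega> = indicat_real S \<omega> * Y \<omega>"
      using S'(2) by eventually_elim (auto simp: indicator_def)
  qed
  finally show ?thesis .
qed

lemma \<eta>_orthogonal:
  assumes t: "0 \<le> t" and S: "S \<in> sets (FZ t)"
  shows "(\<integral>\<omega>. indicat_real S \<omega> * (x \<bullet> \<eta> t \<omega>) \<partial>M) = 0"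
proof -
  have AM [measurable]: "S \<in> sets M" using S FZ_sub unfolding subalgebra_def by blast
  have i0: "integrable M (\<lambda>\<omega>. x \<bullet> (Xb0 \<omega> - m0))" for x :: "real^'d"
    using gaussian_moments(1) [OF Xb0, of x] by (simp add: inner_diff_right)
  have z0: "(\<integral>\<omega>. indicat_real S \<omega> * (x \<bullet> (Xb0 \<omega> - m0)) \<partial>M) = 0" for x :: "real^'d"
  proof (rule observation_orthogonal [OF S source_events_simps(4) [symmetric]])
    have "(\<lambda>_. Xb0) () \<in> borel_measurable (generated_sigma M {()} (\<lambda>_. Xb0))" by (rule generated_sigma_measurable) simp
    then show "(\<lambda>\<omega>. x \<bullet> (Xb0 \<omega> - m0)) \<in> borel_measurable (generated_sigma M {()} (\<lambda>_. Xb0))" by simp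
    show "(\<integral>\<omega>. x \<bullet> (Xb0 \<omega> - m0) \<partial>M) = 0"
      using gaussian_moments(1,2) [OF Xb0, of x] by (simp add: inner_diff_right prob_space)
  qed (use i0 in auto)
  have z2: "(\<integral>\<omega>. indicat_real S \<omega> * (x \<bullet> N2 t \<omega>) \<partial>M) = 0" for x
  proof (rule wBb.has_wiener_integral_mean_on [OF N2 [OF t] AM])
    fix r s :: real and x assume rs: "0 \<le> r" "r \<le> s"
    show "(\<integral>\<omega>. indicat_real S \<omega> * (x \<bullet> (Bb s \<omega> - Bb r \<omega>)) \<partial>M) = 0"
    proof (rule observation_orthogonal [OF S source_events_simps(5) [symmetric]])
      have "Bb s \<in> borel_measurable (generated_sigma M {0..} Bb)" "Bb r \<in> borel_measurable (generated_sigma M {0..} Bb)"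
        by (rule generated_sigma_measurable, use rs in simp)+
      then show "(\<lambda>\<omega>. x \<bullet> (Bb s \<omega> - Bb r \<omega>)) \<in> borel_measurable (generated_sigma M {0..} Bb)" by measurable
    qed (use gaussian_moments [OF wBb.W_gaussian [OF rs], of x] in auto)
  qed
  have z3: "(\<integral>\<omega>. indicat_real S \<omega> * (x \<bullet> N3 t \<omega>) \<partial>M) = 0" for x
  proof (rule wWb.has_wiener_integral_mean_on [OF N3 [OF t] AM])
    fix r s :: real and x assume rs: "0 \<le> r" "r \<le> s"
    show "(\<integral>\<omega>. indicat_real S \<omega> * (x \<bullet> (Wb s \<omega> - Wb r \<omega>)) \<partial>M) = 0"
    proof (rule observation_orthogonal [OF S source_events_simps(6) [symmetric]])
      have "Wb s \<in> borel_measurable (generated_sigma M {0..} Wb)" "Wb r \<in> borel_measurable (generated_sigma M {0..} Wb)"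
        by (rule generated_sigma_measurable, use rs in simp)+
      then show "(\<lambda>\<omega>. x \<bullet> (Wb s \<omega> - Wb r \<omega>)) \<in> borel_measurable (generated_sigma M {0..} Wb)" by measurable
    qed (use gaussian_moments [OF wWb.W_gaussian [OF rs], of x] in auto)
  qed
  have ind: "integrable M (\<lambda>\<omega>. indicat_real S \<omega> * (x \<bullet> Y \<omega>))" if "integrable M Y" for Y :: "'w \<Rightarrow> real^'d"
    using integrable_mult_indicator [OF AM integrable_inner_right [OF that, of x]] by simp
  have "(\<integral>\<omega>. indicat_real S \<omega> * (x \<bullet> \<eta> t \<omega>) \<partial>M)
    = (\<integral>\<omega>. indicat_real S \<omega> * (x \<bullet> (Xb0 \<omega> - m0)) + \<gamma>1 * (indicat_real S \<omega> * (x \<bullet> N2 t \<omega>)) + \<gamma>2 * (indicat_real S \<omega> * (x \<bullet> N3 t \<omega>)) \<partial>M)"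
    by (rule Bochner_Integration.integral_cong) (simp_all add: \<eta>_def inner_add_right algebra_simps)
  also have "\<dots> = 0"
    using ind [of "\<lambda>\<omega>. Xb0 \<omega> - m0"] gaussian_integrable [OF Xb0]
      ind [OF wBb.has_wiener_integral_integrable [OF N2 [OF t]]] ind [OF wWb.has_wiener_integral_integrable [OF N3 [OF t]]]
    by (simp add: z0 z2 z3)
  finally show ?thesis .
qed

sublocale FZ: sigma_finite_subalgebra M "FZ t"
  by (rule finite_measure_subalgebra_is_sigma_finite) (unfold_locales, rule FZ_sub)

text \<open>Up to null sets \<open>m\<close> is a functional of the observations, and \<open>\<xi> = V \<eta>\<close> is orthogonal to their events.\<close>

lemma m_cond_exp:
  assumes t: "0 \<le> t"
  shows "AE \<omega> in M. m t \<omega> = vector_cond_exp M (FZ t) (Xs t) \<omega>"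
proof -
  obtain P' where P' [measurable]: "P' \<in> borel_measurable (FZ t)" and eq: "AE \<omega> in M. Pr t \<omega> = P' \<omega>"
    using Pr_adapted [OF t] by blast
  have "AE \<omega> in M. real_cond_exp M (FZ t) (\<lambda>\<omega>. Xs t \<omega> $ i) \<omega> = (U t *v (m0 + P' \<omega>)) $ i" for i
  proof (rule FZ.real_cond_exp_charact)
    let ?g = "\<lambda>\<omega>. (U t *v (m0 + P' \<omega>)) $ i"
    show gF [measurable]: "?g \<in> borel_measurable (FZ t)" by measurable
    have gM [measurable]: "?g \<in> borel_measurable M" by (rule measurable_from_subalg [OF FZ_sub gF])
    have mi: "integrable M (\<lambda>\<omega>. m t \<omega> $ i)" by (rule integrable_bounded_linear [OF bounded_linear_vec_nth m_integrable [OF t]])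
    have mg: "AE \<omega> in M. m t \<omega> $ i = ?g \<omega>" using eq by eventually_elim (simp add: m_def)
    show "integrable M ?g"
      using mi mg gM by (subst integrable_cong_AE [of _ _ "\<lambda>\<omega>. m t \<omega> $ i"]) (auto elim: eventually_mono)
    show "integrable M (\<lambda>\<omega>. Xs t \<omega> $ i)" by (rule integrable_bounded_linear [OF bounded_linear_vec_nth Xs_integrable [OF t]])
    fix S assume S: "S \<in> sets (FZ t)"
    have AM [measurable]: "S \<in> sets M" using S FZ_sub unfolding subalgebra_def by blast
    have xi: "\<xi> t \<omega> $ i = row i (V t) \<bullet> \<eta> t \<omega>" for \<omega>
      by (simp add: \<xi>_def matrix_vector_mult_def row_def inner_vec_def)
    have "(\<integral>x\<in>S. Xs t x $ i \<partial>M) = (\<integral>\<omega>. indicat_real S \<omega> * m t \<omega> $ i + indicat_real S \<omega> * (row i (V t) \<bullet> \<eta> t \<omega>) \<partial>M)"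
      unfolding set_lebesgue_integral_def
      by (rule Bochner_Integration.integral_cong) (simp_all add: Xs_def xi algebra_simps)
    also have "\<dots> = (\<integral>\<omega>. indicat_real S \<omega> * m t \<omega> $ i \<partial>M) + (\<integral>\<omega>. indicat_real S \<omega> * (row i (V t) \<bullet> \<eta> t \<omega>) \<partial>M)"
      using integrable_mult_indicator [OF AM mi] integrable_mult_indicator [OF AM integrable_inner_right [OF \<eta>_integrable [OF t], of "row i (V t)"]]
      by (intro Bochner_Integration.integral_add) simp_all
    also have "\<dots> = (\<integral>\<omega>. indicat_real S \<omega> * m t \<omega> $ i \<partial>M)" by (simp add: \<eta>_orthogonal [OF t S])
    also have "\<dots> = (\<integral>\<omega>. indicat_real S \<omega> * ?g \<omega> \<partial>M)"
      by (rule integral_cong_AE, use mi in measurable) (use mg in \<open>auto elim: eventually_mono\<close>)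
    finally show "(\<integral>x\<in>S. Xs t x $ i \<partial>M) = (\<integral>x\<in>S. ?g x \<partial>M)" unfolding set_lebesgue_integral_def by simp
  qed
  then have "AE \<omega> in M. \<forall>i\<in>UNIV. real_cond_exp M (FZ t) (\<lambda>\<omega>. Xs t \<omega> $ i) \<omega> = (U t *v (m0 + P' \<omega>)) $ i"
    by (intro AE_finite_allI) auto
  with eq show ?thesis
  proof eventually_elim
    case (elim \<omega>)
    show ?case unfolding vec_eq_iff by (simp add: vector_cond_exp_def m_def elim)
  qed
qed

abbreviation DS :: "real \<Rightarrow> 'w measure" where "DS t \<equiv> driving_sigma M Xb0 Z Bb Wb t"

lemma driving_sigma:
  "space (DS t) = space M" "null_sets M \<subseteq> sets (DS t)" "sets (DS t) \<subseteq> sets M"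
  "sets (generated_sigma M {()} (\<lambda>_. Xb0)) \<subseteq> sets (DS t)" "sets (FZ t) \<subseteq> sets (DS t)"
  "sets (generated_sigma M {0..t} Bb) \<subseteq> sets (DS t)" "sets (generated_sigma M {0..t} Wb) \<subseteq> sets (DS t)"
proof -
  let ?E = "sets (generated_sigma M {()} (\<lambda>_. Xb0)) \<union> sets (FZ t) \<union>
        sets (generated_sigma M {0..t} Bb) \<union> sets (generated_sigma M {0..t} Wb) \<union> null_sets M"
  have ev: "?E \<subseteq> sets M"
    by (intro Un_least sets_generated_sigma_subset) (auto intro: Z_meas)
  then have sub: "?E \<subseteq> Pow (space M)" using sets.sets_into_space by blast
  show "space (DS t) = space M" unfolding driving_sigma_def by (rule space_measure_of [OF sub])
  have s: "sets (DS t) = sigma_sets (space M) ?E" unfolding driving_sigma_def by (rule sets_measure_of [OF sub])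
  show "null_sets M \<subseteq> sets (DS t)"
    "sets (generated_sigma M {()} (\<lambda>_. Xb0)) \<subseteq> sets (DS t)" "sets (FZ t) \<subseteq> sets (DS t)"
    "sets (generated_sigma M {0..t} Bb) \<subseteq> sets (DS t)" "sets (generated_sigma M {0..t} Wb) \<subseteq> sets (DS t)"
    unfolding s by (auto intro: sigma_sets.Basic)
  show "sets (DS t) \<subseteq> sets M" unfolding s by (rule sets.sigma_sets_subset [OF ev])
qed

lemmas driving_augmented = measurable_augmented [OF driving_sigma(1-3)]

lemma Xs_adapted:
  assumes t: "0 \<le> t" shows "Xs t \<in> borel_measurable (DS t)"
proof -
  have "(\<lambda>_. Xb0) () \<in> borel_measurable (generated_sigma M {()} (\<lambda>_. Xb0))" by (rule generated_sigma_measurable) simp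
  then have X: "Xb0 \<in> borel_measurable (generated_sigma M {()} (\<lambda>_. Xb0))" by simp
  have [measurable]: "Xb0 \<in> borel_measurable (DS t)"
    by (rule measurable_finer [OF X]) (use driving_sigma in auto)
  obtain P' where P': "P' \<in> borel_measurable (FZ t)" "AE \<omega> in M. Pr t \<omega> = P' \<omega>"
    using Pr_adapted [OF t] by blast
  have [measurable]: "P' \<in> borel_measurable (DS t)"
    by (rule measurable_finer [OF P'(1)]) (use driving_sigma in auto)
  obtain J2 where J2: "J2 \<in> borel_measurable (generated_sigma M {0..t} Bb)" "AE \<omega> in M. N2 t \<omega> = J2 \<omega>"
    using wBb.has_wiener_integral_adapted [OF N2 [OF t]] by blast
  have [measurable]: "J2 \<in> borel_measurable (DS t)"
    by (rule measurable_finer [OF J2(1)]) (use driving_sigma in auto)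
  obtain J3 where J3: "J3 \<in> borel_measurable (generated_sigma M {0..t} Wb)" "AE \<omega> in M. N3 t \<omega> = J3 \<omega>"
    using wWb.has_wiener_integral_adapted [OF N3 [OF t]] by blast
  have [measurable]: "J3 \<in> borel_measurable (DS t)"
    by (rule measurable_finer [OF J3(1)]) (use driving_sigma in auto)
  have "(\<lambda>\<omega>. U t *v (m0 + P' \<omega>) + V t *v ((Xb0 \<omega> - m0) + \<gamma>1 *\<^sub>R J2 \<omega> + \<gamma>2 *\<^sub>R J3 \<omega>)) \<in> borel_measurable (DS t)"
    by measurable
  then show ?thesis
  proof (rule driving_augmented [OF Xs_meas [OF t]])
    show "AE \<omega> in M. Xs t \<omega> = U t *v (m0 + P' \<omega>) + V t *v ((Xb0 \<omega> - m0) + \<gamma>1 *\<^sub>R J2 \<omega> + \<gamma>2 *\<^sub>R J3 \<omega>)"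
      using P'(2) J2(2) J3(2) by eventually_elim (simp add: Xs_def m_def \<xi>_def \<eta>_def)
  qed
qed

lemma measurable_joint:
  fixes Y :: "real \<Rightarrow> 'w \<Rightarrow> real^'k"
  assumes "\<And>t. 0 \<le> t \<Longrightarrow> Y t \<in> borel_measurable M" "\<And>\<omega>. \<omega> \<in> space M \<Longrightarrow> continuous_on {0..} (\<lambda>t. Y t \<omega>)"
  shows "(\<lambda>(t, \<omega>). Y t \<omega>) \<in> borel_measurable (restrict_space borel {0..} \<Otimes>\<^sub>M M)"
proof -
  let ?N = "restrict_space borel {0..} \<Otimes>\<^sub>M M"
  have "snd \<in> measurable ?N M" by simp
  moreover have "fst \<in> measurable ?N borel"
    by (rule measurable_compose [OF measurable_fst measurable_restrict_space1]) simp
  ultimately have "(\<lambda>q. (snd q, fst q)) \<in> measurable ?N (M \<Otimes>\<^sub>M borel)" by (rule measurable_Pair)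
  from measurable_compose [OF this measurable_pair_continuous [OF assms]]
  have "(\<lambda>q. Y (max 0 (fst q)) (snd q)) \<in> borel_measurable ?N" by simp
  moreover have "(\<lambda>q. Y (max 0 (fst q)) (snd q)) \<in> borel_measurable ?N \<longleftrightarrow> (\<lambda>(t, \<omega>). Y t \<omega>) \<in> borel_measurable ?N"
    by (rule measurable_cong) (auto simp: space_pair_measure space_restrict_space)
  ultimately show ?thesis by simp
qed

lemma Xs_solution: "mean_field_strong_solution M A C Q R Sig \<gamma>1 \<gamma>2 X W Z Xb0 Bb Wb Xs"
  unfolding mean_field_strong_solution_def
proof (intro conjI exI [of _ m] allI impI)
  show "AE \<omega> in M. continuous_on {0..} (\<lambda>t. Xs t \<omega>)" by (rule AE_I2) (rule Xs_cont)
  show "AE \<omega> in M. \<forall>t\<ge>0. set_integrable lborel {0..t}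
           (\<lambda>s. mean_field_drift A C Q R Sig \<gamma>1 \<gamma>2 s (Xs s \<omega>) (m s \<omega>))"
    unfolding drift_eq by (intro AE_I2 allI impI drift_integrable Xs_cont m_cont)
qed (simp_all add: Xs_adapted Xs_integrable Xs_0 m_cond_exp Xs_equation measurable_joint m_meas m_cont)

end

section \<open>Uniqueness\<close>

context mean_field
begin

text \<open>In the resulting formula \<open>e\<close> depends on \<open>w\<close> alone, which transfers adaptedness from \<open>w\<close> to \<open>e\<close>.\<close>

lemma variation_of_constants:
  fixes e w :: "real \<Rightarrow> real^'d"
  assumes e: "continuous_on {0..} e" and i: "\<And>t. set_integrable lborel {0..t} (\<lambda>s. L s *v w s + F s *v (e s - w s))"
    and eq: "\<And>t. 0 \<le> t \<Longrightarrow> e t = (LINT s:{0..t}|lborel. L s *v w s + F s *v (e s - w s))"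
  shows "set_integrable lborel {0..t} (\<lambda>s. Vi s *v ((L s - F s) *v w s))"
    and "0 \<le> t \<Longrightarrow> e t = V t *v (LINT s:{0..t}|lborel. Vi s *v ((L s - F s) *v w s))"
proof -
  let ?h = "\<lambda>s. Vi s *v ((L s - F s) *v w s)"
  let ?y = "\<lambda>t. LINT s:{0..t}|lborel. ?h s"
  have Fe: "set_integrable lborel {0..t} (\<lambda>s. F s *v e s)" for t
    by (rule set_integrable_bilinear_flip [OF bounded_bilinear_matvec cont_Icc_of_atLeast [OF e] F_int])
  have "(L s *v w s + F s *v (e s - w s)) - F s *v e s = (L s - F s) *v w s" for s
    by (simp add: bounded_bilinear.diff_left [OF bounded_bilinear_matvec] bounded_bilinear.diff_right [OF bounded_bilinear_matvec])
  then have LF: "set_integrable lborel {0..t} (\<lambda>s. (L s - F s) *v w s)" for t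
    using set_integral_diff(1) [OF i Fe, of t] by simp
  show h: "set_integrable lborel {0..t} ?h" for t
    by (rule set_integrable_bilinear [OF bounded_bilinear_matvec cont_Icc_of_atLeast [OF V_flow(4)] LF])
  have y: "continuous_on {0..} ?y" by (rule continuous_LINT [OF h])
  have FVy: "set_integrable lborel {0..t} (\<lambda>s. (F s ** V s) *v ?y s)" for t
    by (rule set_integrable_bilinear_flip [OF bounded_bilinear_matvec cont_Icc_of_atLeast [OF y] V_flow(5)])
  have Vy: "V T *v ?y T = (LINT s:{0..T}|lborel. (L s - F s) *v w s) + (LINT s:{0..T}|lborel. (F s ** V s) *v ?y s)" if T: "0 \<le> T" for T
  proof -
    have "V T *v integral {0..T} ?h = integral {0..T} (\<lambda>s. V s *v ?h s) + integral {0..T} (\<lambda>s. (F s ** V s) *v integral {0..s} ?h)"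
      by (rule integration_by_parts_ac [OF bounded_bilinear_matvec T h V_flow(5) V_flow(6)])
    also have "integral {0..T} (\<lambda>s. V s *v ?h s) = integral {0..T} (\<lambda>s. (L s - F s) *v w s)"
    proof (rule integral_cong)
      fix s assume "s \<in> {0..T}"
      then have "0 \<le> s" by simp
      have "V s *v ?h s = (V s ** Vi s) *v ((L s - F s) *v w s)" by (simp only: matrix_vector_mul_assoc matrix_mul_assoc)
      then show "V s *v ?h s = (L s - F s) *v w s" using V_flow(2) [OF \<open>0 \<le> s\<close>] by simp
    qed
    finally show ?thesis
      unfolding set_integrable_imp_integrable_on(2) [OF h] set_integrable_imp_integrable_on(2) [OF LF]
      using set_integrable_imp_integrable_on(2) [OF FVy] by (simp add: set_integrable_imp_integrable_on(2) [OF h])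
  qed
  assume t: "0 \<le> t"
  have "e t - V t *v ?y t = 0"
  proof (rule linear_integral_equation_zero [OF F_int _ _ t])
    show "continuous_on {0..} (\<lambda>t. e t - V t *v ?y t)"
      by (intro continuous_intros e V_flow(3) y)
    fix T :: real assume T: "0 \<le> T"
    have "e T - V T *v ?y T = (LINT s:{0..T}|lborel. L s *v w s + F s *v (e s - w s)) - (LINT s:{0..T}|lborel. (L s - F s) *v w s) - (LINT s:{0..T}|lborel. (F s ** V s) *v ?y s)"
      unfolding eq [OF T] Vy [OF T] by simp
    also have "\<dots> = (LINT s:{0..T}|lborel. (L s *v w s + F s *v (e s - w s)) - (L s - F s) *v w s - (F s ** V s) *v ?y s)"
      by (simp add: set_integral_diff i LF FVy)
    also have "\<dots> = (LINT s:{0..T}|lborel. F s *v (e s - V s *v ?y s))"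
      by (rule set_lebesgue_integral_cong)
        (auto simp: bounded_bilinear.diff_left [OF bounded_bilinear_matvec] bounded_bilinear.diff_right [OF bounded_bilinear_matvec] matrix_vector_mul_assoc)
    finally show "e T - V T *v ?y T = (LINT s:{0..T}|lborel. F s *v (e s - V s *v ?y s))" .
  qed
  then show "e t = V t *v ?y t" by simp
qed

end

context mean_field_processes
begin

lemma vector_cond_exp_measurable: "vector_cond_exp M (FZ t) Y \<in> borel_measurable (FZ t)"
  by (rule borel_measurable_vecI) (simp add: vector_cond_exp_def)

text \<open>A difference that is almost surely measurable is its own conditional expectation.\<close>

lemma vector_cond_exp_diff:
  fixes Y Y' :: "'w \<Rightarrow> real^'k"
  assumes Y: "integrable M Y" and Y': "integrable M Y'"
    and G: "G \<in> borel_measurable (FZ t)" "AE \<omega> in M. Y \<omega> - Y' \<omega> = G \<omega>"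
  shows "AE \<omega> in M. vector_cond_exp M (FZ t) Y \<omega> - vector_cond_exp M (FZ t) Y' \<omega> = Y \<omega> - Y' \<omega>"
proof -
  have "AE \<omega> in M. real_cond_exp M (FZ t) (\<lambda>\<omega>. Y \<omega> $ i) \<omega> - real_cond_exp M (FZ t) (\<lambda>\<omega>. Y' \<omega> $ i) \<omega> = G \<omega> $ i" for i
  proof -
    have Yi: "integrable M (\<lambda>\<omega>. Y \<omega> $ i)" "integrable M (\<lambda>\<omega>. Y' \<omega> $ i)"
      by (rule integrable_bounded_linear [OF bounded_linear_vec_nth Y], rule integrable_bounded_linear [OF bounded_linear_vec_nth Y'])
    have GF: "(\<lambda>\<omega>. G \<omega> $ i) \<in> borel_measurable (FZ t)" by (rule borel_measurable_component [OF G(1)])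
    have GM [measurable]: "(\<lambda>\<omega>. G \<omega> $ i) \<in> borel_measurable M" by (rule measurable_from_subalg [OF FZ_sub GF])
    have ae: "AE \<omega> in M. Y \<omega> $ i - Y' \<omega> $ i = G \<omega> $ i" using G(2)
      by eventually_elim (drule arg_cong [where f = "\<lambda>v. v $ i"], simp)
    have D: "integrable M (\<lambda>\<omega>. Y \<omega> $ i - Y' \<omega> $ i)" using Yi by simp
    have "integrable M (\<lambda>\<omega>. Y \<omega> $ i - Y' \<omega> $ i) = integrable M (\<lambda>\<omega>. G \<omega> $ i)"
      by (rule integrable_cong_AE [OF borel_measurable_integrable [OF D] GM ae])
    then have Gi: "integrable M (\<lambda>\<omega>. G \<omega> $ i)" using D by simp
    show ?thesis
      using FZ.real_cond_exp_diff [OF Yi, of t] FZ.real_cond_exp_cong [where t = t, OF ae borel_measurable_integrable [OF D] GM] FZ.real_cond_exp_F_meas [OF Gi GF]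
      by eventually_elim simp
  qed
  then have "AE \<omega> in M. \<forall>i\<in>UNIV. real_cond_exp M (FZ t) (\<lambda>\<omega>. Y \<omega> $ i) \<omega> - real_cond_exp M (FZ t) (\<lambda>\<omega>. Y' \<omega> $ i) \<omega> = G \<omega> $ i"
    by (intro AE_finite_allI) auto
  with G(2) show ?thesis
  proof eventually_elim
    case (elim \<omega>)
    show ?case unfolding elim(1) using elim(2) by (simp add: vec_eq_iff vector_cond_exp_def)
  qed
qed

text \<open>The difference \<open>e\<close> to the constructed solution is determined by the difference \<open>w\<close> of the conditional means
  and hence measurable with respect to the observations, which forces \<open>w = e\<close> and then \<open>e = 0\<close>.\<close>

lemma solution_unique:
  assumes sol: "mean_field_strong_solution M A C Q R Sig \<gamma>1 \<gamma>2 X W Z Xb0 Bb Wb Xb" and T: "0 \<le> T"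
  shows "AE \<omega> in M. Xb T \<omega> = Xs T \<omega>"
proof -
  let ?drift = "\<lambda>s x y. L s *v y + F s *v (x - y)"
  obtain mb where "\<forall>t\<ge>0. integrable M (Xb t)"
    and Xb_cont: "AE \<omega> in M. continuous_on {0..} (\<lambda>t. Xb t \<omega>)"
    and mb_joint: "(\<lambda>(t, \<omega>). mb t \<omega>) \<in> borel_measurable (restrict_space borel {0..} \<Otimes>\<^sub>M M)"
    and "\<forall>t\<ge>0. AE \<omega> in M. mb t \<omega> = vector_cond_exp M (FZ t) (Xb t) \<omega>"
    and drift_int: "AE \<omega> in M. \<forall>t\<ge>0. set_integrable lborel {0..t} (\<lambda>s. ?drift s (Xb s \<omega>) (mb s \<omega>))"
    and "\<forall>t\<ge>0. AE \<omega> in M. Xb t \<omega> = Xb0 \<omega>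
             + (LINT s:{0..t}|lborel. ?drift s (Xb s \<omega>) (mb s \<omega>))
             + \<gamma>1 *\<^sub>R Bb t \<omega>
             + ito_process_integral M R (\<lambda>s \<omega>. C s *v X s \<omega>) W t K \<omega>
             + \<gamma>2 *\<^sub>R wiener_integral M R Wb t K \<omega>"
    using sol unfolding mean_field_strong_solution_def drift_eq by (elim conjE exE) (rule that)
  then have Xb_int: "\<And>t. 0 \<le> t \<Longrightarrow> integrable M (Xb t)"
    and mb_eq: "\<And>t. 0 \<le> t \<Longrightarrow> AE \<omega> in M. mb t \<omega> = vector_cond_exp M (FZ t) (Xb t) \<omega>"
    and Xb_eq: "\<And>t. 0 \<le> t \<Longrightarrow> AE \<omega> in M. Xb t \<omega> = Xb0 \<omega>
             + (LINT s:{0..t}|lborel. ?drift s (Xb s \<omega>) (mb s \<omega>))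
             + \<gamma>1 *\<^sub>R Bb t \<omega>
             + ito_process_integral M R (\<lambda>s \<omega>. C s *v X s \<omega>) W t K \<omega>
             + \<gamma>2 *\<^sub>R wiener_integral M R Wb t K \<omega>"
    by blast+
  have Xb_meas: "Xb t \<in> borel_measurable M" if "0 \<le> t" for t
    using Xb_int [OF that] by simp
  have "\<exists>Xd. (\<forall>t\<ge>0. Xd t \<in> borel_measurable M) \<and> (\<forall>\<omega>. continuous_on {0..} (\<lambda>t. Xd t \<omega>)) \<and>
    (AE \<omega> in M. \<forall>t. Xd t \<omega> = Xb t \<omega>)"
    by (rule continuous_modification [OF Xb_meas Xb_cont]; assumption)
  then obtain Xd where "\<forall>t\<ge>0. Xd t \<in> borel_measurable M" and "\<forall>\<omega>. continuous_on {0..} (\<lambda>t. Xd t \<omega>)"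
    and Xd: "AE \<omega> in M. \<forall>t. Xd t \<omega> = Xb t \<omega>"
    by (elim exE conjE) (rule that)
  then have Xd_meas: "\<And>t. 0 \<le> t \<Longrightarrow> Xd t \<in> borel_measurable M" and Xd_cont: "\<And>\<omega>. continuous_on {0..} (\<lambda>t. Xd t \<omega>)"
    by blast+
  (* with all paths of Xd continuous, e is jointly measurable *)
  define e where "e t \<omega> = Xd t \<omega> - Xs t \<omega>" for t \<omega>
  define w where "w t \<omega> = mb t \<omega> - m t \<omega>" for t \<omega>
  have e_meas: "e t \<in> borel_measurable M" if "0 \<le> t" for t
    unfolding e_def [abs_def] using Xd_meas [OF that] Xs_meas [OF that] by measurable
  have e_cont: "continuous_on {0..} (\<lambda>t. e t \<omega>)" if "\<omega> \<in> space M" for \<omega>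
    unfolding e_def by (intro continuous_intros Xd_cont Xs_cont that)
  have diff: "?drift s x y - ?drift s x' y' = ?drift s (x - x') (y - y')" for s x y x' y'
    by (simp add: matrix_vector_mult_diff_distrib algebra_simps)
  have path_int: "AE \<omega> in M. \<forall>t. set_integrable lborel {0..t} (\<lambda>s. ?drift s (e s \<omega>) (w s \<omega>))"
    using drift_int Xd AE_space
  proof eventually_elim
    case (elim \<omega>)
    show ?case
    proof
      fix t :: real
      show "set_integrable lborel {0..t} (\<lambda>s. ?drift s (e s \<omega>) (w s \<omega>))"
      proof (cases "0 \<le> t")
        case True
        have "set_integrable lborel {0..t} (\<lambda>s. ?drift s (Xd s \<omega>) (mb s \<omega>) - ?drift s (Xs s \<omega>) (m s \<omega>))"
          unfolding elim(2) [rule_format]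
          by (intro set_integral_diff elim(1) [rule_format] True drift_integrable Xs_cont m_cont elim)
        then show ?thesis unfolding diff e_def w_def .
      qed (simp add: set_integrable_def)
    qed
  qed
  have eq: "AE \<omega> in M. e t \<omega> = (LINT s:{0..t}|lborel. ?drift s (e s \<omega>) (w s \<omega>))" if t: "0 \<le> t" for t
    using Xb_eq [OF t] Xs_equation [OF t] drift_int Xd AE_space
  proof eventually_elim
    case (elim \<omega>)
    have i: "set_integrable lborel {0..t} (\<lambda>s. ?drift s (Xb s \<omega>) (mb s \<omega>))" using elim(3) t by blast
    have j: "set_integrable lborel {0..t} (\<lambda>s. ?drift s (Xs s \<omega>) (m s \<omega>))"
      by (intro drift_integrable Xs_cont m_cont elim)
    have "e t \<omega> = (LINT s:{0..t}|lborel. ?drift s (Xb s \<omega>) (mb s \<omega>)) - (LINT s:{0..t}|lborel. ?drift s (Xs s \<omega>) (m s \<omega>))"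
      unfolding e_def elim(4) [rule_format] using elim(1,2) unfolding drift_eq by (simp add: algebra_simps)
    also have "\<dots> = (LINT s:{0..t}|lborel. ?drift s (Xb s \<omega>) (mb s \<omega>) - ?drift s (Xs s \<omega>) (m s \<omega>))"
      by (rule set_integral_diff(2) [OF i j, symmetric])
    finally show ?case unfolding diff e_def w_def elim(4) [rule_format] .
  qed
  have "AE \<omega> in M. \<forall>k n :: nat. e (real k / (real n + 1)) \<omega> = (LINT s:{0..real k / (real n + 1)}|lborel. ?drift s (e s \<omega>) (w s \<omega>))"
    by (subst AE_all_countable, rule allI, subst AE_all_countable, rule allI, rule eq) simp
  with path_int AE_space have path_eq: "AE \<omega> in M. \<forall>t\<ge>0. e t \<omega> = (LINT s:{0..t}|lborel. ?drift s (e s \<omega>) (w s \<omega>))"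
  proof eventually_elim
    case (elim \<omega>)
    show ?case
    proof (intro allI impI)
      fix t :: real assume t: "0 \<le> t"
      show "e t \<omega> = (LINT s:{0..t}|lborel. ?drift s (e s \<omega>) (w s \<omega>))"
        by (rule continuous_eq_from_rationals [OF e_cont [OF elim(2)] continuous_LINT [OF elim(1) [rule_format]] elim(3) [rule_format] t])
    qed
  qed
  define c where "c s = Vi s ** (L s - F s)" for s
  let ?h = "\<lambda>\<omega> s. c s *v w s \<omega>"
  have path_h: "AE \<omega> in M. \<forall>t. set_integrable lborel {0..t} (?h \<omega>) \<and> (0 \<le> t \<longrightarrow> e t \<omega> = V t *v (LINT s:{0..t}|lborel. ?h \<omega> s))"
    using path_int path_eq AE_space
  proof eventually_elim
    case (elim \<omega>)
    show ?case
      using variation_of_constants [OF e_cont [OF elim(3)] elim(1) [rule_format] elim(2) [rule_format]]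
      by (simp add: c_def matrix_vector_mul_assoc)
  qed
  have joint: "(\<lambda>p. f (max 0 (snd p)) (fst p)) \<in> borel_measurable (M \<Otimes>\<^sub>M lborel)"
    if "(\<lambda>(t, \<omega>). f t \<omega>) \<in> borel_measurable (restrict_space borel {0..} \<Otimes>\<^sub>M M)" for f :: "real \<Rightarrow> 'w \<Rightarrow> real^'d"
  proof -
    have "(\<lambda>p. (max 0 (snd p), fst p)) \<in> measurable (M \<Otimes>\<^sub>M lborel) (restrict_space (borel :: real measure) {0..} \<Otimes>\<^sub>M M)"
      by (intro measurable_Pair measurable_restrict_space2) auto
    from measurable_compose [OF this that] show ?thesis by simp
  qed
  have w_joint: "(\<lambda>p. w (max 0 (snd p)) (fst p)) \<in> borel_measurable (M \<Otimes>\<^sub>M lborel)"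
    using joint [OF mb_joint] joint [OF measurable_joint [OF m_meas m_cont]] unfolding w_def by simp
  have e_joint: "(\<lambda>p. e (max 0 (snd p)) (fst p)) \<in> borel_measurable (M \<Otimes>\<^sub>M lborel)"
    by (rule joint [OF measurable_joint [OF e_meas e_cont]])
  have w_ad: "\<exists>w'\<in>borel_measurable (FZ t). AE \<omega> in M. w s \<omega> = w' \<omega>" if "s \<in> {0..t}" for s t
  proof -
    have s: "0 \<le> s" "s \<le> t" using that by auto
    let ?w = "\<lambda>\<omega>. vector_cond_exp M (FZ s) (Xb s) \<omega> - vector_cond_exp M (FZ s) (Xs s) \<omega>"
    have "?w \<in> borel_measurable (FZ s)"
      using vector_cond_exp_measurable by (intro borel_measurable_diff)
    then have "?w \<in> borel_measurable (FZ t)"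
      by (rule measurable_generated_sigma_mono) (use s in auto)
    moreover have "AE \<omega> in M. w s \<omega> = ?w \<omega>"
      using mb_eq [OF s(1)] m_cond_exp [OF s(1)] by eventually_elim (simp add: w_def)
    ultimately show ?thesis by (intro bexI [of _ ?w])
  qed
  have w_e: "AE \<omega> in M. w t \<omega> = e t \<omega>" if t: "0 \<le> t" for t
  proof -
    (* outside {0..t} the coefficients need not be measurable *)
    let ?c = "\<lambda>s. indicat_real {0..t} s *\<^sub>R c s"
    let ?g = "\<lambda>s \<omega>. ?c s *v w (max 0 s) \<omega>"
    have hg: "indicat_real {0..t} s *\<^sub>R ?g s \<omega> = indicat_real {0..t} s *\<^sub>R ?h \<omega> s" for s \<omega>
      by (simp add: indicator_def max_def)
    have cm: "?c \<in> borel_measurable borel"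
      using set_integrable_bilinear [OF bounded_bilinear_matmul cont_Icc_of_atLeast [OF V_flow(4)] set_integral_diff(1) [OF L_int F_int], of t]
      unfolding set_integrable_def c_def by (simp add: borel_measurable_integrable)
    have "\<exists>I\<in>borel_measurable (FZ t). AE \<omega> in M. (LINT s:{0..t}|lborel. ?g s \<omega>) = I \<omega>"
    proof (rule time_integral_adapted [OF FZ_sub])
      have "(\<lambda>p. ?c (snd p)) \<in> borel_measurable (M \<Otimes>\<^sub>M lborel)"
        by (rule measurable_compose [OF measurable_snd]) (simp add: cm)
      then show "(\<lambda>p. ?g (snd p) (fst p)) \<in> borel_measurable (M \<Otimes>\<^sub>M lborel)"
        by (rule borel_measurable_bilinear [OF bounded_bilinear_matvec _ w_joint])
      show "AE \<omega> in M. set_integrable lborel {0..t} (\<lambda>s. ?g s \<omega>)"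
        using path_h unfolding set_integrable_def hg by (auto elim: eventually_mono)
      fix s assume s: "s \<in> {0..t}"
      obtain w' where [measurable]: "w' \<in> borel_measurable (FZ t)" and w': "AE \<omega> in M. w s \<omega> = w' \<omega>" using w_ad [OF s] by blast
      have "(\<lambda>\<omega>. ?c s *v w' \<omega>) \<in> borel_measurable (FZ t)" by measurable
      moreover have "AE \<omega> in M. ?g s \<omega> = ?c s *v w' \<omega>" using w' by eventually_elim (use s in \<open>simp add: max_def\<close>)
      ultimately show "\<exists>g'\<in>borel_measurable (FZ t). AE \<omega> in M. ?g s \<omega> = g' \<omega>" by (intro bexI [of _ "\<lambda>\<omega>. ?c s *v w' \<omega>"])
    qed
    then obtain I where [measurable]: "I \<in> borel_measurable (FZ t)" and I: "AE \<omega> in M. (LINT s:{0..t}|lborel. ?h \<omega> s) = I \<omega>"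
      unfolding set_lebesgue_integral_def hg by blast
    have G: "(\<lambda>\<omega>. V t *v I \<omega>) \<in> borel_measurable (FZ t)" by measurable
    have "AE \<omega> in M. Xb t \<omega> - Xs t \<omega> = V t *v I \<omega>"
      using I path_h Xd
    proof eventually_elim
      case (elim \<omega>)
      then show ?case using t by (simp add: e_def)
    qed
    from vector_cond_exp_diff [OF Xb_int [OF t] Xs_integrable [OF t] G this] mb_eq [OF t] m_cond_exp [OF t] Xd
    show ?thesis by eventually_elim (simp add: w_def e_def)
  qed
  interpret P: pair_sigma_finite M lborel by unfold_locales
  have "AE s in lborel. AE \<omega> in M. w (max 0 s) \<omega> = e (max 0 s) \<omega>" by (rule AE_I2, rule w_e) simp
  moreover have "{p \<in> space (M \<Otimes>\<^sub>M lborel). w (max 0 (snd p)) (fst p) = e (max 0 (snd p)) (fst p)} \<in> sets (M \<Otimes>\<^sub>M lborel)"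
    using w_joint e_joint by measurable
  ultimately have "AE \<omega> in M. AE s in lborel. w (max 0 s) \<omega> = e (max 0 s) \<omega>"
    by (subst P.AE_commute)
  with path_int path_eq Xd AE_space show ?thesis
  proof eventually_elim
    case (elim \<omega>)
    have "e T \<omega> = 0"
    proof (rule linear_integral_equation_zero [OF L_int e_cont [OF elim(4)] _ T])
      fix t :: real assume t: "0 \<le> t"
      have Le: "set_integrable lborel {0..t} (\<lambda>s. L s *v e s \<omega>)"
        by (rule set_integrable_bilinear_flip [OF bounded_bilinear_matvec cont_Icc_of_atLeast [OF e_cont [OF elim(4)]] L_int])
      have "(LINT s:{0..t}|lborel. ?drift s (e s \<omega>) (w s \<omega>)) = (LINT s:{0..t}|lborel. L s *v e s \<omega>)"
        unfolding set_lebesgue_integral_def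
      proof (rule integral_cong_AE)
        show "(\<lambda>s. indicat_real {0..t} s *\<^sub>R ?drift s (e s \<omega>) (w s \<omega>)) \<in> borel_measurable lborel"
          using elim(1) unfolding set_integrable_def by (blast intro: borel_measurable_integrable)
        show "(\<lambda>s. indicat_real {0..t} s *\<^sub>R (L s *v e s \<omega>)) \<in> borel_measurable lborel"
          using Le unfolding set_integrable_def by (rule borel_measurable_integrable)
        show "AE s in lborel. indicat_real {0..t} s *\<^sub>R ?drift s (e s \<omega>) (w s \<omega>) = indicat_real {0..t} s *\<^sub>R (L s *v e s \<omega>)"
          using elim(5)
        proof eventually_elim
          case (elim s)
          then show ?case by (cases "0 \<le> s") auto
        qed
      qed
      then show "e t \<omega> = (LINT s:{0..t}|lborel. L s *v e s \<omega>)" using elim(2) t by simp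
    qed
    then show ?case using elim(3) by (simp add: e_def)
  qed
qed

end

theorem proposition3:
  fixes M :: "'w measure"
    and A Q Sig :: "real \<Rightarrow> real^'d^'d"
    and C :: "real \<Rightarrow> real^'d^'m"
    and R :: "real \<Rightarrow> real^'m^'m"
    and m0 :: "real^'d" and Sig0 :: "real^'d^'d"
    and B Bb X :: "real \<Rightarrow> 'w \<Rightarrow> real^'d"
    and W Wb Z :: "real \<Rightarrow> 'w \<Rightarrow> real^'m"
    and Xb0 :: "'w \<Rightarrow> real^'d"
    and \<Phi> \<Psi> :: "real \<Rightarrow> real \<Rightarrow> real^'d^'d"
    and \<gamma>1 \<gamma>2 :: real
  assumes "prob_space M"
    and "continuous_on {0..} A" and "continuous_on {0..} C"
    and "\<And>t. 0 \<le> t \<Longrightarrow> pos_def (Q t)" and "\<And>t. 0 \<le> t \<Longrightarrow> pos_def (R t)" and "pos_def Sig0"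
    and "wiener_process M Q B" and "wiener_process M R W"
    and "wiener_process M Q Bb" and "wiener_process M R Wb"
    and "gaussian M (X 0) m0 Sig0" and "gaussian M Xb0 m0 Sig0"
    and "prob_space.indep_sets M
           (\<lambda>k. [sets (generated_sigma M {0..} B), sets (generated_sigma M {0..} W),
                 sets (generated_sigma M {()} (\<lambda>_. X 0)), sets (generated_sigma M {()} (\<lambda>_. Xb0)),
                 sets (generated_sigma M {0..} Bb), sets (generated_sigma M {0..} Wb)] ! k)
           {..<6::nat}"
    and "\<And>t. 0 \<le> t \<Longrightarrow> X t \<in> borel_measurable M"
    and "AE \<omega> in M. continuous_on {0..} (\<lambda>t. X t \<omega>)"
    and "AE \<omega> in M. \<forall>t\<ge>0. X t \<omega> = X 0 \<omega> + (LINT s:{0..t}|lborel. A s *v X s \<omega>) + B t \<omega>"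
    and "\<And>t. 0 \<le> t \<Longrightarrow> Z t \<in> borel_measurable M"
    and "AE \<omega> in M. \<forall>t\<ge>0. Z t \<omega> = (LINT s:{0..t}|lborel. C s *v X s \<omega>) + W t \<omega>"
    and "Sig 0 = Sig0"
    and "\<And>t. 0 \<le> t \<Longrightarrow>
           (Sig has_vector_derivative
              A t ** Sig t + Sig t ** transpose (A t) + Q t
              - Sig t ** transpose (C t) ** matrix_inv (R t) ** C t ** Sig t) (at t within {0..})"
    and "\<And>\<tau>. 0 \<le> \<tau> \<Longrightarrow> \<Phi> \<tau> \<tau> = mat 1"
    and "\<And>t \<tau>. 0 \<le> t \<Longrightarrow> 0 \<le> \<tau> \<Longrightarrow>
           ((\<lambda>s. \<Phi> s \<tau>) has_vector_derivative
              (- transpose (A t) + transpose (C t) ** transpose (kalman_gain C R Sig t)) ** \<Phi> t \<tau>) (at t within {0..})"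
    and "\<And>\<tau>. 0 \<le> \<tau> \<Longrightarrow> \<Psi> \<tau> \<tau> = mat 1"
    and "\<And>t \<tau>. 0 \<le> t \<Longrightarrow> 0 \<le> \<tau> \<Longrightarrow>
           ((\<lambda>s. \<Psi> s \<tau>) has_vector_derivative
              (- transpose (A t)
               + ((1 + \<gamma>2\<^sup>2) / 2) *\<^sub>R (transpose (C t) ** transpose (kalman_gain C R Sig t))
               - ((1 - \<gamma>1\<^sup>2) / 2) *\<^sub>R (matrix_inv (Sig t) ** Q t)) ** \<Psi> t \<tau>) (at t within {0..})"
  shows "(\<exists>Xb. mean_field_strong_solution M A C Q R Sig \<gamma>1 \<gamma>2 X W Z Xb0 Bb Wb Xb) \<and>
    (\<forall>Xb. mean_field_strong_solution M A C Q R Sig \<gamma>1 \<gamma>2 X W Z Xb0 Bb Wb Xb \<longrightarrow>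
      (\<forall>a. \<forall>T\<ge>0. AE \<omega> in M.
        a \<bullet> (transpose (\<Phi> 0 T) *v m0
             + transpose (\<Psi> 0 T) *v (Xb0 \<omega> - m0)
             + ito_process_integral M R (\<lambda>s \<omega>. C s *v X s \<omega>) W T (\<lambda>t. transpose (\<Phi> t T) ** kalman_gain C R Sig t) \<omega>
             + \<gamma>1 *\<^sub>R wiener_integral M Q Bb T (\<lambda>t. transpose (\<Psi> t T)) \<omega>
             + \<gamma>2 *\<^sub>R wiener_integral M R Wb T (\<lambda>t. transpose (\<Psi> t T) ** kalman_gain C R Sig t) \<omega>)
        = a \<bullet> Xb T \<omega>))"
proof -
  interpret mean_field M A Q Sig C R m0 Sig0 B Bb X W Wb Z Xb0 \<Phi> \<Psi> \<gamma>1 \<gamma>2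
    using assms by (rule mean_field.intro)
  obtain N1 where "\<forall>\<omega>\<in>space M. continuous_on {0..} (\<lambda>t. N1 t \<omega>)"
    "\<forall>t\<ge>0. has_wiener_integral M R W t (\<lambda>s. Ui s ** K s) (N1 t)"
    using wW.wiener_integral_process [OF kernel_W] by (elim exE conjE) (rule that)
  moreover obtain N2 where "\<forall>\<omega>\<in>space M. continuous_on {0..} (\<lambda>t. N2 t \<omega>)"
    "\<forall>t\<ge>0. has_wiener_integral M Q Bb t Vi (N2 t)"
    using wBb.wiener_integral_process [OF kernel_Bb] by (elim exE conjE) (rule that)
  moreover obtain N3 where "\<forall>\<omega>\<in>space M. continuous_on {0..} (\<lambda>t. N3 t \<omega>)"
    "\<forall>t\<ge>0. has_wiener_integral M R Wb t (\<lambda>s. Vi s ** K s) (N3 t)"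
    using wWb.wiener_integral_process [OF kernel_Wb] by (elim exE conjE) (rule that)
  moreover have "\<exists>Xc. (\<forall>t\<ge>0. Xc t \<in> borel_measurable M) \<and> (\<forall>\<omega>. continuous_on {0..} (\<lambda>t. Xc t \<omega>)) \<and>
    (AE \<omega> in M. \<forall>t. Xc t \<omega> = X t \<omega>)"
    by (rule continuous_modification [OF X_meas X_cont]; assumption)
  then obtain Xc where "\<forall>t\<ge>0. Xc t \<in> borel_measurable M" "\<forall>\<omega>. continuous_on {0..} (\<lambda>t. Xc t \<omega>)"
    "AE \<omega> in M. \<forall>t. Xc t \<omega> = X t \<omega>"
    by (elim exE conjE) (rule that)
  moreover have "\<exists>Bc. (\<forall>t\<ge>0. Bc t \<in> borel_measurable M) \<and> (\<forall>\<omega>. continuous_on {0..} (\<lambda>t. Bc t \<omega>)) \<and>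
    (AE \<omega> in M. \<forall>t. Bc t \<omega> = B t \<omega>)"
    by (rule continuous_modification [OF wB.W_measurable wB.W_continuous]; assumption)
  then obtain Bc where "\<forall>t\<ge>0. Bc t \<in> borel_measurable M" "\<forall>\<omega>. continuous_on {0..} (\<lambda>t. Bc t \<omega>)"
    "AE \<omega> in M. \<forall>t. Bc t \<omega> = B t \<omega>"
    by (elim exE conjE) (rule that)
  ultimately interpret mean_field_processes M A Q Sig C R m0 Sig0 B Bb X W Wb Z Xb0 \<Phi> \<Psi> \<gamma>1 \<gamma>2 N1 N2 N3 Xc Bc
    by unfold_locales blast+
  show ?thesis
  proof (intro conjI exI allI impI)
    show "mean_field_strong_solution M A C Q R Sig \<gamma>1 \<gamma>2 X W Z Xb0 Bb Wb Xs" by (rule Xs_solution)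
    fix Xb a and T :: real
    assume "mean_field_strong_solution M A C Q R Sig \<gamma>1 \<gamma>2 X W Z Xb0 Bb Wb Xb" and T: "0 \<le> T"
    from estimator_eq_Xs [OF T] solution_unique [OF this]
    show "AE \<omega> in M. a \<bullet> (transpose (\<Phi> 0 T) *v m0
             + transpose (\<Psi> 0 T) *v (Xb0 \<omega> - m0)
             + ito_process_integral M R (\<lambda>s \<omega>. C s *v X s \<omega>) W T (\<lambda>t. transpose (\<Phi> t T) ** kalman_gain C R Sig t) \<omega>
             + \<gamma>1 *\<^sub>R wiener_integral M Q Bb T (\<lambda>t. transpose (\<Psi> t T)) \<omega>
             + \<gamma>2 *\<^sub>R wiener_integral M R Wb T (\<lambda>t. transpose (\<Psi> t T) ** kalman_gain C R Sig t) \<omega>)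
        = a \<bullet> Xb T \<omega>"
    proof eventually_elim
      case (elim \<omega>)
      show ?case unfolding elim by (rule refl)
    qed
  qed
qed

end
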